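(* Consider the stochastic Young differential delay equation $$dy(t) = [Ay(t)+ f(y_t)]\,dt + g(y_t)\,dZ(t),\qquad y_0=\eta\in \mathcal{C}^{0,\beta_0}([-r,0],\mathbb{R}^d),$$ in the setting described in the context. Assume: (1) all eigenvalues of $A\in\mathbb{R}^{d\times d}$ have negative real parts; $C_A,\lambda>0$ are constants with $\|e^{A\cdot}\|_{\infty,[a,b]}\le C_Ae^{-\lambda a}$ and $|||e^{A\cdot}|||_{\alpha,[a,b]}\le \|A\|C_Ae^{-\lambda a}(b-a)^{1-\alpha}$ for all $0<a<b$ and $0<\alpha\le 1$; (2) $f:\mathcal{C}_r\to\mathbb{R}^d$ satisfies $\|f(\xi)-f(\zeta)\|\le C_f\|\xi-\zeta\|_{\infty,[-r,0]}$ for all $\xi,\zeta\in\mathcal{C}_r$; (3) $g:\mathcal{C}_r\to\mathbb{R}^{d\times m}$ is a continuous linear map with operator norm at most $C_g$; (4) $C_AC_f<\lambda e^{-\lambda r}$. Then there exists $\varepsilon>0$ (not depending on $g$) such that, if $C_g<\varepsilon$, the generated random dynamical system possesses a random pullback attractor $\mathcal{A}\in\mathcal{D}$ for the universe $\mathcal{D}$, with $\mathcal{A}(x)\subset\mathcal{C}^{\beta}([-r,0],\mathbb{R}^d)$, and this attractor is a singleton, i.e. $\mathcal{A}(x)$ consists of exactly one point for $\mathbb{P}$-almost every $x$. Moreover, $\mathcal{A}$ is also a random forward attractor for $\mathcal{D}$.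
   Context: Fixed data: a delay $r>0$, $\frac12<\nu\le 1$, $\beta_0\in(1-\nu,\nu)$, $\beta\in(\beta_0,\nu)$. $\mathcal{C}_r=\mathcal{C}([-r,0],\mathbb{R}^d)$ with the sup norm $\|\cdot\|_{\infty,[-r,0]}$. For a path $y$ on $[-r,\infty)$ and $t\ge0$, $y_t\in\mathcal{C}_r$ is $y_t(s)=y(t+s)$, $s\in[-r,0]$. Hölder spaces: $|||y|||_{\alpha,[a,b]}=\sup_{a\le s<t\le b}\|y(t)-y(s)\|/(t-s)^{\alpha}$; $\mathcal{C}^{\alpha}([a,b],\mathbb{R}^d)$ is the space of $\alpha$-Hölder paths with norm $\|y\|_{\infty,[a,b]}+|||y|||_{\alpha,[a,b]}$; $\mathcal{C}^{0,\alpha}([a,b],\mathbb{R}^d)$ is the closure of the smooth paths in it (a separable Banach space). $\mathcal{C}^{0,\nu}_0(\mathbb{R},\mathbb{R}^m)$ is the space of paths $x:\mathbb{R}\to\mathbb{R}^m$ with $x(0)=0$ whose restriction to each compact interval $I$ is in $\mathcal{C}^{0,\nu}(I,\mathbb{R}^m)$, with the topology of convergence in $\nu$-Hölder norm on compact intervals. Noise: $Z$ is an $\mathbb{R}^m$-valued process with stationary increments and paths in $\mathcal{C}^{0,\nu}$, taken on its canonical space: $\Omega=\mathcal{C}^{0,\nu}_0(\mathbb{R},\mathbb{R}^m)$, $\mathcal{F}$ its Borel $\sigma$-algebra, $\mathbb{P}$ the law of $Z$, $Z(t,x)=x(t)$, $(\theta_tx)(s)=x(t+s)-x(t)$; $\mathbb{P}$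 is $\theta$-invariant. It is assumed that $(\Omega,\mathcal{F},\mathbb{P},\theta)$ is ergodic and that $E\,|||Z|||_{\nu,[-r,r]}^{1/(\nu-\beta)}<\infty$. The equation is understood pathwise: for each $x\in\Omega$, $y(t)=\eta(0)+\int_0^t[Ay(u)+f(y_u)]du+\int_0^t g(y_u)dx(u)$, $t\ge0$, $y|_{[-r,0]}=\eta$, the last integral being a Young integral. Under (2),(3) there is a unique solution $y(\cdot,x,\eta)$ on $[-r,\infty)$, lying in $\mathcal{C}^{0,\beta_0}([-r,T],\mathbb{R}^d)\cap\mathcal{C}^{\beta}([0,T],\mathbb{R}^d)$ for every $T>0$. It generates the continuous random dynamical system $\varphi:\mathbb{R}^+\times\Omega\times S\to S$, $S=\mathcal{C}^{0,\beta_0}([-r,0],\mathbb{R}^d)$, $\varphi(t,x,\eta)(s)=y(t+s,x,\eta)$, with cocycle property $\varphi(t+s,x)=\varphi(t,\theta_sx)\circ\varphi(s,x)$. A random variable $\rho:\Omega\to[0,\infty)$ is tempered if $\lim_{t\to\pm\infty}\frac1t\log^+\rho(\theta_tx)=0$ a.s. A random set is an element $\hat M=\{M(x)\}_{x\in\Omega}$ of $\mathcal{F}\times\mathcal{B}(S)$; it is compact if each $M(x)$ is compact. The universe $\mathcal{D}$ is the family of random sets $\hat D$ such that, for some tempered $\rho$, $\hat D(x)$ is a.s. contained in the ball of $S$ of center $0$ and radius $\rho(x)$. With $d(E|F)=\sup_{y\in E}\inf_{z\in F}d(y,z)$, a set $\mathcal{A}\subset\Omega\times S$ is a random pullback attractor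 for $\mathcal{D}$ if (i) it is a compact random set; (ii) $\varphi(t,x)\mathcal{A}(x)=\mathcal{A}(\theta_tx)$ $\mathbb{P}$-a.s. for every $t\ge0$; (iii) for every $\hat D\in\mathcal{D}$, $\lim_{t\to\infty}d(\varphi(t,\theta_{-t}x)\hat D(\theta_{-t}x)\,|\,\mathcal{A}(x))=0$ $\mathbb{P}$-a.s. It is a random forward attractor for $\mathcal{D}$ if (i), (ii) hold and, instead of (iii), for every $\hat D\in\mathcal{D}$, $\lim_{t\to\infty}d(\varphi(t,x)\hat D(x)\,|\,\mathcal{A}(\theta_tx))=0$ $\mathbb{P}$-a.s. A random pullback attractor for $\mathcal{D}$ that itself belongs to $\mathcal{D}$ is unique (up to null sets).
   Formalization: In the universe D, the a.s. inclusion of D(x) in the tempered ball is required along whole orbits (for a.e. x, at θ_t x for all t); with an arbitrary null set, D = N×S for a null set N visited at arbitrarily large times is admitted and attraction fails. *)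

theory Defs
  imports "HOL-Probability.Probability"
begin

section \<open>Hoelder spaces\<close>

text \<open>
  A path on an interval \<open>I\<close> is a function on the reals that is extensional on \<open>I\<close>; function
  spaces on \<open>I\<close> are sets of such functions.  Norms take values in the extended nonnegative
  reals, so that membership in a Hoelder space is finiteness of the norm.
\<close>

definition sup_norm :: "real set \<Rightarrow> (real \<Rightarrow> 'a::real_normed_vector) \<Rightarrow> ennreal" where
  "sup_norm I y = (SUP t\<in>I. ennreal (norm (y t)))"

definition holder_seminorm :: "real \<Rightarrow> real set \<Rightarrow> (real \<Rightarrow> 'a::real_normed_vector) \<Rightarrow> ennreal" where
  "holder_seminorm \<alpha> I y =
     (SUP (s, t)\<in>{(s, t). s \<in> I \<and> t \<in> I \<and> s < t}. ennreal (norm (y t - y s) / (t - s) powr \<alpha>))"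

definition holder_norm :: "real \<Rightarrow> real set \<Rightarrow> (real \<Rightarrow> 'a::real_normed_vector) \<Rightarrow> ennreal" where
  "holder_norm \<alpha> I y = sup_norm I y + holder_seminorm \<alpha> I y"

definition holder_dist ::
  "real \<Rightarrow> real set \<Rightarrow> (real \<Rightarrow> 'a::real_normed_vector) \<Rightarrow> (real \<Rightarrow> 'a) \<Rightarrow> real" where
  "holder_dist \<alpha> I y z = enn2real (holder_norm \<alpha> I (\<lambda>t. y t - z t))"

definition cont_paths :: "real set \<Rightarrow> (real \<Rightarrow> 'a::real_normed_vector) set" where
  "cont_paths I = {y \<in> extensional I. continuous_on I y}"

definition holder_space :: "real \<Rightarrow> real set \<Rightarrow> (real \<Rightarrow> 'a::real_normed_vector) set" where
  "holder_space \<alpha> I = {y \<in> extensional I. holder_norm \<alpha> I y < \<top>}"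

lemma sup_norm_triangle:
  "sup_norm I (\<lambda>t. x t + y t) \<le> sup_norm I x + sup_norm I y"
  unfolding sup_norm_def
proof (rule SUP_least)
  fix t assume t: "t \<in> I"
  have "ennreal (norm (x t + y t)) \<le> ennreal (norm (x t)) + ennreal (norm (y t))"
    by (simp flip: ennreal_plus add: norm_triangle_ineq ennreal_leI)
  also have "\<dots> \<le> (SUP t\<in>I. ennreal (norm (x t))) + (SUP t\<in>I. ennreal (norm (y t)))"
    using t by (intro add_mono SUP_upper)
  finally show "ennreal (norm (x t + y t)) \<le> \<dots>" .
qed

lemma holder_seminorm_triangle:
  "holder_seminorm \<alpha> I (\<lambda>t. x t + y t) \<le> holder_seminorm \<alpha> I x + holder_seminorm \<alpha> I y"
proof -
  have "ennreal (norm ((x t + y t) - (x s + y s)) / (t - s) powr \<alpha>)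
      \<le> holder_seminorm \<alpha> I x + holder_seminorm \<alpha> I y"
    if st: "s \<in> I" "t \<in> I" "s < t" for s t
  proof -
    let ?q = "\<lambda>z. norm (z t - z s) / (t - s) powr \<alpha>"
    have "norm ((x t + y t) - (x s + y s)) \<le> norm (x t - x s) + norm (y t - y s)"
      using norm_triangle_ineq[of "x t - x s" "y t - y s"] by (simp add: algebra_simps)
    then have "norm ((x t + y t) - (x s + y s)) / (t - s) powr \<alpha> \<le> ?q x + ?q y"
      by (simp flip: add_divide_distrib add: divide_right_mono)
    then have "ennreal (norm ((x t + y t) - (x s + y s)) / (t - s) powr \<alpha>)
        \<le> ennreal (?q x) + ennreal (?q y)"
      by (simp flip: ennreal_plus add: ennreal_leI)
    also have "ennreal (?q z) \<le> holder_seminorm \<alpha> I z" for z :: "real \<Rightarrow> 'a"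
      unfolding holder_seminorm_def using st
      by (intro SUP_upper2[of "(s, t)"]) auto
    then have "ennreal (?q x) + ennreal (?q y) \<le> holder_seminorm \<alpha> I x + holder_seminorm \<alpha> I y"
      by (intro add_mono)
    finally show ?thesis .
  qed
  then show ?thesis
    by (subst holder_seminorm_def) (auto intro!: SUP_least)
qed

lemma holder_norm_triangle:
  "holder_norm \<alpha> I (\<lambda>t. x t + y t) \<le> holder_norm \<alpha> I x + holder_norm \<alpha> I y"
  using add_mono[OF sup_norm_triangle[of I x y] holder_seminorm_triangle[of \<alpha> I x y]]
  by (simp add: holder_norm_def algebra_simps)

lemma holder_norm_minus_commute:
  "holder_norm \<alpha> I (\<lambda>t. x t - y t) = holder_norm \<alpha> I (\<lambda>t. y t - x t)"
proof -
  have "norm ((x t - y t) - (x s - y s)) = norm ((y t - x t) - (y s - x s))" for s t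
    using norm_minus_commute[of "x t - y t" "x s - y s"] by (simp add: algebra_simps)
  then show ?thesis
    by (simp add: holder_norm_def sup_norm_def holder_seminorm_def norm_minus_commute)
qed

lemma holder_norm_diff_finite:
  assumes "holder_norm \<alpha> I x < \<top>" "holder_norm \<alpha> I y < \<top>"
  shows "holder_norm \<alpha> I (\<lambda>t. x t - y t) < \<top>"
proof -
  have "holder_norm \<alpha> I (\<lambda>t. x t - y t) \<le> holder_norm \<alpha> I x + holder_norm \<alpha> I (\<lambda>t. 0 - y t)"
    using holder_norm_triangle[of \<alpha> I x "\<lambda>t. 0 - y t"] by simp
  also have "\<dots> = holder_norm \<alpha> I x + holder_norm \<alpha> I y"
    using holder_norm_minus_commute[of \<alpha> I "\<lambda>t. 0" y] by simp
  also have "\<dots> < \<top>" using assms by simp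
  finally show ?thesis .
qed

lemma Metric_space_holder: "Metric_space (holder_space \<alpha> I) (holder_dist \<alpha> I)"
proof
  fix x y z :: "real \<Rightarrow> 'a"
  show "0 \<le> holder_dist \<alpha> I x y" by (simp add: holder_dist_def)
  show "holder_dist \<alpha> I x y = holder_dist \<alpha> I y x"
    using holder_norm_minus_commute[of \<alpha> I x y] by (simp add: holder_dist_def)
  assume x: "x \<in> holder_space \<alpha> I" and y: "y \<in> holder_space \<alpha> I"
  then have fin: "holder_norm \<alpha> I (\<lambda>t. x t - y t) < \<top>"
    by (intro holder_norm_diff_finite) (auto simp: holder_space_def)
  show "holder_dist \<alpha> I x y = 0 \<longleftrightarrow> x = y"
  proof
    assume "holder_dist \<alpha> I x y = 0"
    with fin have "sup_norm I (\<lambda>t. x t - y t) = 0"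
      by (auto simp: holder_dist_def enn2real_eq_0_iff holder_norm_def)
    then have "ennreal (norm (x t - y t)) \<le> 0" if "t \<in> I" for t
      using that unfolding sup_norm_def by (metis (no_types, lifting) SUP_upper)
    then show "x = y"
      using x y by (intro extensionalityI[of x I]) (auto simp: holder_space_def)
  next
    assume "x = y"
    then show "holder_dist \<alpha> I x y = 0"
    proof -
      have "sup_norm I (\<lambda>t. 0::'a) \<le> 0" "holder_seminorm \<alpha> I (\<lambda>t. 0::'a) \<le> 0"
        unfolding sup_norm_def holder_seminorm_def by (rule SUP_least, force)+
      with \<open>x = y\<close> show ?thesis by (simp add: holder_dist_def holder_norm_def)
    qed
  qed
  assume z: "z \<in> holder_space \<alpha> I"
  have fin': "holder_norm \<alpha> I (\<lambda>t. y t - z t) < \<top>"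
    using y z by (intro holder_norm_diff_finite) (auto simp: holder_space_def)
  have "holder_norm \<alpha> I (\<lambda>t. x t - z t)
      \<le> holder_norm \<alpha> I (\<lambda>t. x t - y t) + holder_norm \<alpha> I (\<lambda>t. y t - z t)"
    using holder_norm_triangle[of \<alpha> I "\<lambda>t. x t - y t" "\<lambda>t. y t - z t"] by simp
  then have "enn2real (holder_norm \<alpha> I (\<lambda>t. x t - z t))
      \<le> enn2real (holder_norm \<alpha> I (\<lambda>t. x t - y t) + holder_norm \<alpha> I (\<lambda>t. y t - z t))"
    using fin fin' by (intro enn2real_mono) auto
  also have "\<dots> = holder_dist \<alpha> I x y + holder_dist \<alpha> I y z"
    using fin fin' by (simp add: enn2real_plus holder_dist_def)
  finally show "holder_dist \<alpha> I x z \<le> holder_dist \<alpha> I x y + holder_dist \<alpha> I y z"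
    by (simp add: holder_dist_def)
qed

definition holder_topology :: "real \<Rightarrow> real set \<Rightarrow> (real \<Rightarrow> 'a::real_normed_vector) topology" where
  "holder_topology \<alpha> I = Metric_space.mtopology (holder_space \<alpha> I) (holder_dist \<alpha> I)"

text \<open>\<open>D n\<close> is the \<open>n\<close>-th derivative, one-sided at the end points of \<open>I\<close>.\<close>

definition smooth_paths :: "real set \<Rightarrow> (real \<Rightarrow> 'a::real_normed_vector) set" where
  "smooth_paths I = {y \<in> extensional I. \<exists>D :: nat \<Rightarrow> real \<Rightarrow> 'a. D 0 = y \<and>
     (\<forall>n. \<forall>t\<in>I. (D n has_vector_derivative D (Suc n) t) (at t within I))}"

definition little_holder_space :: "real \<Rightarrow> real set \<Rightarrow> (real \<Rightarrow> 'a::real_normed_vector) set" where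
  "little_holder_space \<alpha> I = holder_topology \<alpha> I closure_of smooth_paths I"


section \<open>The canonical noise space\<close>

definition borel_of_topology :: "'a topology \<Rightarrow> 'a measure" where
  "borel_of_topology X = sigma (topspace X) {U. openin X U}"

definition noise_paths :: "real \<Rightarrow> (real \<Rightarrow> 'a::real_normed_vector) set" where
  "noise_paths \<nu> = {x. x 0 = 0 \<and> (\<forall>a b. a < b \<longrightarrow> restrict x {a..b} \<in> little_holder_space \<nu> {a..b})}"

definition noise_topology :: "real \<Rightarrow> (real \<Rightarrow> 'a::real_normed_vector) topology" where
  "noise_topology \<nu> = topology_generated_by
     {{z \<in> noise_paths \<nu>. holder_norm \<nu> {a..b} (\<lambda>t. z t - x t) < ennreal e} | x a b e.
        x \<in> noise_paths \<nu> \<and> a < b \<and> 0 < e}"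

definition wiener_shift :: "real \<Rightarrow> (real \<Rightarrow> 'a::real_normed_vector) \<Rightarrow> real \<Rightarrow> 'a" where
  "wiener_shift t x = (\<lambda>s. x (t + s) - x t)"

definition invariant_measure :: "'w measure \<Rightarrow> (real \<Rightarrow> 'w \<Rightarrow> 'w) \<Rightarrow> bool" where
  "invariant_measure P \<theta> \<longleftrightarrow> (\<forall>t. \<theta> t \<in> P \<rightarrow>\<^sub>M P \<and> distr P P (\<theta> t) = P)"

definition ergodic_flow :: "'w measure \<Rightarrow> (real \<Rightarrow> 'w \<Rightarrow> 'w) \<Rightarrow> bool" where
  "ergodic_flow P \<theta> \<longleftrightarrow>
     (\<forall>E\<in>sets P. (\<forall>t. \<theta> t -` E \<inter> space P = E) \<longrightarrow> measure P E = 0 \<or> measure P E = 1)"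


section \<open>Matrices\<close>

text \<open>The library norm on matrix types is the Frobenius norm; the operator norm of a matrix is
  the norm of the bounded linear map it represents.\<close>

definition mat_op :: "real^'m^'d \<Rightarrow> (real^'m) \<Rightarrow>\<^sub>L (real^'d)" where
  "mat_op M = Blinfun ((*v) M)"

definition mat_eigenvalue :: "real^'d^'d \<Rightarrow> complex \<Rightarrow> bool" where
  "mat_eigenvalue M c \<longleftrightarrow>
     (\<exists>v :: complex^'d. v \<noteq> 0 \<and> (\<chi> i j. complex_of_real (M $ i $ j)) *v v = c *s v)"

text \<open>Multiplication and powers on matrix types are componentwise in the library, hence the
  iteration of \<open>(**)\<close>.\<close>

definition mat_exp :: "real^'d^'d \<Rightarrow> real^'d^'d" where
  "mat_exp M = (\<Sum>k. (1 / fact k) *\<^sub>R (((**) M) ^^ k) (mat 1))"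


section \<open>The Young delay equation\<close>

text \<open>The Young integral of \<open>M\<close> against \<open>x\<close> over \<open>[a, b]\<close>, as the limit of left-point sums over
  the partitions \<open>a = p 0 < \<dots> < p n = b\<close> as the mesh tends to \<open>0\<close>.\<close>

definition has_young_integral ::
  "(real \<Rightarrow> real^'m^'d) \<Rightarrow> (real \<Rightarrow> real^'m) \<Rightarrow> real \<Rightarrow> real \<Rightarrow> real^'d \<Rightarrow> bool" where
  "has_young_integral M x a b J \<longleftrightarrow>
     (\<forall>e>0. \<exists>\<delta>>0. \<forall>n (p :: nat \<Rightarrow> real).
        p 0 = a \<and> p n = b \<and> (\<forall>i<n. p i < p (Suc i) \<and> p (Suc i) - p i < \<delta>) \<longrightarrow>
        norm ((\<Sum>i<n. M (p i) *v (x (p (Suc i)) - x (p i))) - J) < e)"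

definition segment :: "real \<Rightarrow> real \<Rightarrow> (real \<Rightarrow> 'a) \<Rightarrow> real \<Rightarrow> 'a" where
  "segment r t y = restrict (\<lambda>s. y (t + s)) {-r..0}"

definition is_solution ::
  "real \<Rightarrow> real \<Rightarrow> real \<Rightarrow> real^'d^'d \<Rightarrow> ((real \<Rightarrow> real^'d) \<Rightarrow> real^'d) \<Rightarrow>
   ((real \<Rightarrow> real^'d) \<Rightarrow> real^'m^'d) \<Rightarrow> (real \<Rightarrow> real^'m) \<Rightarrow> (real \<Rightarrow> real^'d) \<Rightarrow>
   (real \<Rightarrow> real^'d) \<Rightarrow> bool" where
  "is_solution r \<beta>\<^sub>0 \<beta> A f g x \<eta> y \<longleftrightarrow>
     y \<in> extensional {-r..} \<and>
     restrict y {-r..0} = \<eta> \<and>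
     (\<forall>T>0. restrict y {-r..T} \<in> little_holder_space \<beta>\<^sub>0 {-r..T} \<and>
            restrict y {0..T} \<in> holder_space \<beta> {0..T}) \<and>
     (\<forall>t\<ge>0. \<exists>I J.
        ((\<lambda>u. A *v y u + f (segment r u y)) has_integral I) {0..t} \<and>
        has_young_integral (\<lambda>u. g (segment r u y)) x 0 t J \<and>
        y t = \<eta> 0 + I + J)"

definition delay_rds ::
  "real \<Rightarrow> real \<Rightarrow> real \<Rightarrow> real^'d^'d \<Rightarrow> ((real \<Rightarrow> real^'d) \<Rightarrow> real^'d) \<Rightarrow>
   ((real \<Rightarrow> real^'d) \<Rightarrow> real^'m^'d) \<Rightarrow>
   real \<Rightarrow> (real \<Rightarrow> real^'m) \<Rightarrow> (real \<Rightarrow> real^'d) \<Rightarrow> (real \<Rightarrow> real^'d)" where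
  "delay_rds r \<beta>\<^sub>0 \<beta> A f g t x \<eta> = segment r t (THE y. is_solution r \<beta>\<^sub>0 \<beta> A f g x \<eta> y)"

definition state_topology :: "real \<Rightarrow> real \<Rightarrow> (real \<Rightarrow> 'a::real_normed_vector) topology" where
  "state_topology r \<beta>\<^sub>0 =
     subtopology (holder_topology \<beta>\<^sub>0 {-r..0}) (little_holder_space \<beta>\<^sub>0 {-r..0})"


section \<open>Random attractors\<close>

text \<open>A random set \<open>M\<close> is a measurable set of pairs; its fibre over \<open>x\<close> is \<open>M `` {x}\<close>.\<close>

definition random_set :: "'w measure \<Rightarrow> 's topology \<Rightarrow> ('w \<times> 's) set \<Rightarrow> bool" where
  "random_set P X M \<longleftrightarrow> M \<in> sets (P \<Otimes>\<^sub>M borel_of_topology X)"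

definition compact_random_set :: "'w measure \<Rightarrow> 's topology \<Rightarrow> ('w \<times> 's) set \<Rightarrow> bool" where
  "compact_random_set P X M \<longleftrightarrow> random_set P X M \<and> (\<forall>x\<in>space P. compactin X (M `` {x}))"

text \<open>\<open>ln (max 1 u)\<close> is the positive part of the logarithm, also at \<open>u = 0\<close>.\<close>

definition tempered :: "'w measure \<Rightarrow> (real \<Rightarrow> 'w \<Rightarrow> 'w) \<Rightarrow> ('w \<Rightarrow> real) \<Rightarrow> bool" where
  "tempered P \<theta> \<rho> \<longleftrightarrow>
     \<rho> \<in> borel_measurable P \<and> (\<forall>x\<in>space P. 0 \<le> \<rho> x) \<and>
     (AE x in P. ((\<lambda>t. 1 / t * ln (max 1 (\<rho> (\<theta> t x)))) \<longlongrightarrow> 0) at_top \<and>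
                 ((\<lambda>t. 1 / t * ln (max 1 (\<rho> (\<theta> t x)))) \<longlongrightarrow> 0) at_bot)"

text \<open>
  The almost sure inclusion of \<open>D\<close> in a tempered ball is understood along whole orbits, that is,
  off a set of orbits of measure zero.  If each fixed time had its own exceptional null set, then
  \<open>D = N \<times> S\<close> would be admissible for every measurable null set \<open>N\<close>, for instance
  \<open>N = {x. x 1 = 0}\<close> for a real fractional Brownian motion.  As \<open>t \<rightarrow> \<infinity>\<close>, \<open>\<theta> (-t) x\<close> visits this
  \<open>N\<close> at arbitrarily large times \<open>t\<close> for almost every \<open>x\<close>, and there the image of the fibre \<open>S\<close>
  under the flow is unbounded already for \<open>g = 0\<close>; so no compact set could attract \<open>D\<close>.
\<close>

definition tempered_universe ::
  "'w measure \<Rightarrow> (real \<Rightarrow> 'w \<Rightarrow> 'w) \<Rightarrow> real \<Rightarrow> real \<Rightarrow>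
   ('w \<times> (real \<Rightarrow> 'a::real_normed_vector)) set set" where
  "tempered_universe P \<theta> r \<beta>\<^sub>0 = {D. random_set P (state_topology r \<beta>\<^sub>0) D \<and>
     (\<exists>\<rho>. tempered P \<theta> \<rho> \<and>
        (AE x in P. \<forall>t. D `` {\<theta> t x} \<subseteq> {\<eta>. holder_norm \<beta>\<^sub>0 {-r..0} \<eta> \<le> ennreal (\<rho> (\<theta> t x))}))}"

definition semidist :: "('s \<Rightarrow> 's \<Rightarrow> real) \<Rightarrow> 's set \<Rightarrow> 's set \<Rightarrow> ennreal" where
  "semidist d E F = (SUP y\<in>E. INF z\<in>F. ennreal (d y z))"

definition invariant_random_set ::
  "'w measure \<Rightarrow> (real \<Rightarrow> 'w \<Rightarrow> 'w) \<Rightarrow> (real \<Rightarrow> 'w \<Rightarrow> 's \<Rightarrow> 's) \<Rightarrow> ('w \<times> 's) set \<Rightarrow> bool" where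
  "invariant_random_set P \<theta> \<phi> M \<longleftrightarrow> (\<forall>t\<ge>0. AE x in P. \<phi> t x ` (M `` {x}) = M `` {\<theta> t x})"

definition random_pullback_attractor ::
  "'w measure \<Rightarrow> (real \<Rightarrow> 'w \<Rightarrow> 'w) \<Rightarrow> 's topology \<Rightarrow> ('s \<Rightarrow> 's \<Rightarrow> real) \<Rightarrow>
   (real \<Rightarrow> 'w \<Rightarrow> 's \<Rightarrow> 's) \<Rightarrow> ('w \<times> 's) set set \<Rightarrow> ('w \<times> 's) set \<Rightarrow> bool" where
  "random_pullback_attractor P \<theta> X d \<phi> \<D> \<A> \<longleftrightarrow>
     compact_random_set P X \<A> \<and> invariant_random_set P \<theta> \<phi> \<A> \<and>
     (\<forall>D\<in>\<D>. AE x in P.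
        ((\<lambda>t. semidist d (\<phi> t (\<theta> (-t) x) ` (D `` {\<theta> (-t) x})) (\<A> `` {x})) \<longlongrightarrow> 0) at_top)"

definition random_forward_attractor ::
  "'w measure \<Rightarrow> (real \<Rightarrow> 'w \<Rightarrow> 'w) \<Rightarrow> 's topology \<Rightarrow> ('s \<Rightarrow> 's \<Rightarrow> real) \<Rightarrow>
   (real \<Rightarrow> 'w \<Rightarrow> 's \<Rightarrow> 's) \<Rightarrow> ('w \<times> 's) set set \<Rightarrow> ('w \<times> 's) set \<Rightarrow> bool" where
  "random_forward_attractor P \<theta> X d \<phi> \<D> \<A> \<longleftrightarrow>
     compact_random_set P X \<A> \<and> invariant_random_set P \<theta> \<phi> \<A> \<and>
     (\<forall>D\<in>\<D>. AE x in P.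
        ((\<lambda>t. semidist d (\<phi> t x ` (D `` {x})) (\<A> `` {\<theta> t x})) \<longlongrightarrow> 0) at_top)"

text \<open>Continuity of a linear map on the space of continuous paths is the finiteness of its
  operator norm; it is implied by the bound in the last conjunct.\<close>

definition linear_with_bound ::
  "real \<Rightarrow> ((real \<Rightarrow> real^'d) \<Rightarrow> real^'m^'d) \<Rightarrow> real \<Rightarrow> bool" where
  "linear_with_bound r g C \<longleftrightarrow>
     (\<forall>\<xi>\<in>cont_paths {-r..0}. \<forall>\<zeta>\<in>cont_paths {-r..0}.
        g (restrict (\<lambda>s. \<xi> s + \<zeta> s) {-r..0}) = g \<xi> + g \<zeta>) \<and>
     (\<forall>c. \<forall>\<xi>\<in>cont_paths {-r..0}. g (restrict (\<lambda>s. c *\<^sub>R \<xi> s) {-r..0}) = c *\<^sub>R g \<xi>) \<and>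
     (\<forall>\<xi>\<in>cont_paths {-r..0}. norm (mat_op (g \<xi>)) \<le> C * enn2real (sup_norm {-r..0} \<xi>))"

end

theory Submission
  imports Defs
begin

text \<open>
  On a time window on which the noise is small compared with \<open>1 / C\<^sub>g\<close>, the variation of constants
  formula and the gap condition make the flow a contraction by the factor \<open>1 / 4\<close>, provided the window is
  long enough.  On any other window the Lipschitz constant of the flow is at most
  \<open>exp (K * (1 + w powr (1 / (\<nu> - \<beta>))))\<close>, where \<open>w\<close> is \<open>C\<^sub>g\<close> times the Hoelder seminorm of the noise.
  The logarithmic loss on noisy windows is integrable, and its mean tends to \<open>0\<close> with \<open>C\<^sub>g\<close>, so by
  ergodicity the gain prevails along almost every orbit: the flow contracts exponentially from any
  time \<open>s\<close> to any time \<open>t\<close>, up to a factor that is subexponential in \<open>\<bar>s\<bar> + \<bar>t\<bar>\<close>.  Hence the solutions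
  started from the zero path in the remote past converge, and the limit is the only point of the
  attractor in both senses.
\<close>

section \<open>Hoelder bounds with explicit constants\<close>

text \<open>The moment exponent stems from the step length of the a priori estimate. The fixed point
  argument closes on steps of length about \<open>V powr (- (1 / (\<nu> - \<alpha>)))\<close>, with
  V linear in the noise, and each step at most doubles the norm up to a constant; so the logarithm
  of the Lipschitz constant grows with the power 1/(\<nu> - \<alpha>) of the noise, and \<alpha> <
  \<beta> makes the given moment sufficient. The time-T map of an ergodic flow need not be ergodic,
  so losses cannot be averaged along the windows themselves. The loss of each window is instead
  dominated by an orbit integral over it, and only averages along the flow are used. A window is
  credited with the gain ln 4, the mean loss is at most ln 2, and ln 2 / T remains as the rate. T
  and the threshold for quiet windows are fixed by A, f, r and the exponents; g enters only
  afterwards, through \<open>C\<^sub>g\<close>, which makes \<epsilon> independent of g. All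
  exceptional orbits are discarded through one measurable set that every shift preserves, so that
  invariance and the attraction estimates hold at each of its points and at all times.\<close>

definition hol :: "real \<Rightarrow> real \<Rightarrow> real \<Rightarrow> real \<Rightarrow> (real \<Rightarrow> 'a::real_normed_vector) \<Rightarrow> bool" where
  "hol \<alpha> K a b y \<longleftrightarrow>
     (\<forall>s t. a \<le> s \<longrightarrow> s \<le> t \<longrightarrow> t \<le> b \<longrightarrow> norm (y t - y s) \<le> K * (t - s) powr \<alpha>)"

text \<open>One constant bounds both parts of the Hoelder norm, so \<open>hb\<close> and
  \<open>holder_norm\<close> differ by a factor of at most 2. This is the source of the factors 2 in
  the distance estimates below.\<close>

definition hb :: "real \<Rightarrow> real \<Rightarrow> real \<Rightarrow> real \<Rightarrow> (real \<Rightarrow> 'a::real_normed_vector) \<Rightarrow> bool" where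
  "hb \<alpha> N a b y \<longleftrightarrow> (\<forall>t. a \<le> t \<longrightarrow> t \<le> b \<longrightarrow> norm (y t) \<le> N) \<and> hol \<alpha> N a b y"

lemma holD: "hol \<alpha> K a b y \<Longrightarrow> a \<le> s \<Longrightarrow> s \<le> t \<Longrightarrow> t \<le> b \<Longrightarrow> norm (y t - y s) \<le> K * (t - s) powr \<alpha>"
  by (simp add: hol_def)

lemma holD_abs:
  assumes "hol \<alpha> K a b y" "s \<in> {a..b}" "t \<in> {a..b}"
  shows "norm (y t - y s) \<le> K * \<bar>t - s\<bar> powr \<alpha>"
proof (cases "s \<le> t")
  case True
  then show ?thesis using holD[OF assms(1), of s t] assms by simp
next
  case False
  then have "norm (y s - y t) \<le> K * (s - t) powr \<alpha>"
    using holD[OF assms(1), of t s] assms by simp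
  then show ?thesis using False by (simp add: norm_minus_commute abs_if)
qed

lemma hol_subset: "hol \<alpha> K a b y \<Longrightarrow> a \<le> a' \<Longrightarrow> b' \<le> b \<Longrightarrow> hol \<alpha> K a' b' y"
  by (force simp: hol_def)

lemma hol_mono: "hol \<alpha> K a b y \<Longrightarrow> K \<le> K' \<Longrightarrow> hol \<alpha> K' a b y"
  unfolding hol_def by (meson mult_right_mono order_trans powr_ge_zero)

lemma hol_cong:
  assumes "\<And>t. a \<le> t \<Longrightarrow> t \<le> b \<Longrightarrow> y t = z t"
  shows "hol \<alpha> K a b y \<longleftrightarrow> hol \<alpha> K a b z"
proof -
  have "y t = z t \<and> y s = z s" if "a \<le> s" "s \<le> t" "t \<le> b" for s t
    using assms that by auto
  then show ?thesis unfolding hol_def by metis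
qed

lemma hol_add: "hol \<alpha> K a b y \<Longrightarrow> hol \<alpha> L a b z \<Longrightarrow> hol \<alpha> (K + L) a b (\<lambda>t. y t + z t)"
  unfolding hol_def
proof (intro allI impI)
  fix s t
  assume *: "\<forall>s t. a \<le> s \<longrightarrow> s \<le> t \<longrightarrow> t \<le> b \<longrightarrow> norm (y t - y s) \<le> K * (t - s) powr \<alpha>"
    "\<forall>s t. a \<le> s \<longrightarrow> s \<le> t \<longrightarrow> t \<le> b \<longrightarrow> norm (z t - z s) \<le> L * (t - s) powr \<alpha>"
    and st: "a \<le> s" "s \<le> t" "t \<le> b"
  have "norm (y t + z t - (y s + z s)) \<le> norm (y t - y s) + norm (z t - z s)"
    using norm_triangle_ineq[of "y t - y s" "z t - z s"] by (simp add: algebra_simps)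
  also have "\<dots> \<le> (K + L) * (t - s) powr \<alpha>"
    using * st by (simp add: distrib_right add_mono)
  finally show "norm (y t + z t - (y s + z s)) \<le> (K + L) * (t - s) powr \<alpha>" .
qed

lemma hol_uminus: "hol \<alpha> K a b (\<lambda>t. - y t) \<longleftrightarrow> hol \<alpha> K a b y"
  by (simp add: hol_def norm_minus_commute)

lemma hol_diff: "hol \<alpha> K a b y \<Longrightarrow> hol \<alpha> L a b z \<Longrightarrow> hol \<alpha> (K + L) a b (\<lambda>t. y t - z t)"
  using hol_add[of \<alpha> K a b y L "\<lambda>t. - z t"] by (simp add: hol_uminus)

lemma hol_shift: "hol \<alpha> K a b (\<lambda>t. y (c + t)) \<longleftrightarrow> hol \<alpha> K (c + a) (c + b) y"
proof -
  have "norm (y t - y s) \<le> K * (t - s) powr \<alpha>"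
    if "\<forall>s t. a \<le> s \<longrightarrow> s \<le> t \<longrightarrow> t \<le> b \<longrightarrow> norm (y (c + t) - y (c + s)) \<le> K * (t - s) powr \<alpha>"
      "c + a \<le> s" "s \<le> t" "t \<le> c + b" for s t
    using that(1)[rule_format, of "s - c" "t - c"] that by simp
  moreover have "norm (y (c + t) - y (c + s)) \<le> K * (t - s) powr \<alpha>"
    if "\<forall>s t. c + a \<le> s \<longrightarrow> s \<le> t \<longrightarrow> t \<le> c + b \<longrightarrow> norm (y t - y s) \<le> K * (t - s) powr \<alpha>"
      "a \<le> s" "s \<le> t" "t \<le> b" for s t
    using that(1)[rule_format, of "c + s" "c + t"] that by simp
  ultimately show ?thesis unfolding hol_def by blast
qed

text \<open>An increment across \<open>b\<close> is split at \<open>b\<close>, and each part is no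
  longer than the whole. Adding the constants is crude, but it suffices for joining a past segment
  to a future one and for covering long intervals by short ones.\<close>

lemma hol_glue:
  assumes "hol \<alpha> K a b y" "hol \<alpha> L b c y" "0 \<le> K" "0 \<le> L" "0 < \<alpha>"
  shows "hol \<alpha> (K + L) a c y"
  unfolding hol_def
proof (intro allI impI)
  fix s t assume st: "a \<le> s" "s \<le> t" "t \<le> c"
  consider "t \<le> b" | "b \<le> s" | "s \<le> b" "b \<le> t" by linarith
  then show "norm (y t - y s) \<le> (K + L) * (t - s) powr \<alpha>"
  proof cases
    case 1
    then show ?thesis using hol_mono[OF assms(1), of "K + L"] assms st by (simp add: holD)
  next
    case 2
    then show ?thesis using hol_mono[OF assms(2), of "K + L"] assms st by (simp add: holD)
  next
    case 3
    have "norm (y t - y s) \<le> norm (y b - y s) + norm (y t - y b)"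
      using norm_triangle_ineq[of "y b - y s" "y t - y b"] by simp
    also have "\<dots> \<le> K * (b - s) powr \<alpha> + L * (t - b) powr \<alpha>"
      using 3 st assms by (intro add_mono) (auto intro: holD)
    also have "\<dots> \<le> K * (t - s) powr \<alpha> + L * (t - s) powr \<alpha>"
      using 3 st assms by (intro add_mono mult_left_mono powr_mono2) auto
    finally show ?thesis by (simp add: distrib_right)
  qed
qed

lemma hol_imp_continuous_on:
  assumes "hol \<alpha> K a b y" "0 < \<alpha>"
  shows "continuous_on {a..b} y"
  unfolding continuous_on_def
proof
  fix s assume s: "s \<in> {a..b}"
  have "((\<lambda>t. K * \<bar>t - s\<bar> powr \<alpha>) \<longlongrightarrow> K * \<bar>s - s\<bar> powr \<alpha>) (at s within {a..b})"
    using assms(2) by (intro tendsto_intros) (auto simp: eventually_at_filter)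
  then have 0: "((\<lambda>t. K * \<bar>t - s\<bar> powr \<alpha>) \<longlongrightarrow> 0) (at s within {a..b})"
    by simp
  have "eventually (\<lambda>t. norm (y t - y s) \<le> K * \<bar>t - s\<bar> powr \<alpha>) (at s within {a..b})"
    unfolding eventually_at_filter using holD_abs[OF assms(1) s] by (auto intro: always_eventually)
  then have "((\<lambda>t. y t - y s) \<longlongrightarrow> 0) (at s within {a..b})"
    by (rule Lim_null_comparison[OF _ 0])
  then show "(y \<longlongrightarrow> y s) (at s within {a..b})"
    by (simp add: LIM_zero_iff)
qed

lemma hol_exponent_mono:
  assumes "hol \<beta> K a b y" "\<alpha> \<le> \<beta>" "0 \<le> K"
  shows "hol \<alpha> (K * (b - a) powr (\<beta> - \<alpha>)) a b y"
  unfolding hol_def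
proof (intro allI impI)
  fix s t assume st: "a \<le> s" "s \<le> t" "t \<le> b"
  have "norm (y t - y s) \<le> K * (t - s) powr \<beta>"
    using holD[OF assms(1) st] .
  also have "(t - s) powr \<beta> = (t - s) powr (\<beta> - \<alpha>) * (t - s) powr \<alpha>"
    by (simp flip: powr_add)
  also have "K * \<dots> \<le> K * ((b - a) powr (\<beta> - \<alpha>) * (t - s) powr \<alpha>)"
    using st assms by (intro mult_left_mono mult_right_mono powr_mono2) auto
  finally show "norm (y t - y s) \<le> K * (b - a) powr (\<beta> - \<alpha>) * (t - s) powr \<alpha>"
    by (simp add: mult.assoc)
qed

lemma hbD: "hb \<alpha> N a b y \<Longrightarrow> a \<le> t \<Longrightarrow> t \<le> b \<Longrightarrow> norm (y t) \<le> N"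
  by (simp add: hb_def)

lemma hb_hol: "hb \<alpha> N a b y \<Longrightarrow> hol \<alpha> N a b y"
  by (simp add: hb_def)

lemma hb_subset: "hb \<alpha> N a b y \<Longrightarrow> a \<le> a' \<Longrightarrow> b' \<le> b \<Longrightarrow> hb \<alpha> N a' b' y"
  by (auto simp: hb_def intro: hol_subset)

lemma hb_mono: "hb \<alpha> N a b y \<Longrightarrow> N \<le> N' \<Longrightarrow> hb \<alpha> N' a b y"
  by (auto simp: hb_def intro: hol_mono order_trans)

lemma hb_nonneg: "hb \<alpha> N a b y \<Longrightarrow> a \<le> b \<Longrightarrow> 0 \<le> N"
  by (meson hbD norm_ge_zero order_refl order_trans)

lemma hb_cong:
  assumes "\<And>t. a \<le> t \<Longrightarrow> t \<le> b \<Longrightarrow> y t = z t"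
  shows "hb \<alpha> N a b y \<longleftrightarrow> hb \<alpha> N a b z"
  using hol_cong[OF assms] assms by (auto simp: hb_def)

lemma hb_diff: "hb \<alpha> K a b y \<Longrightarrow> hb \<alpha> L a b z \<Longrightarrow> hb \<alpha> (K + L) a b (\<lambda>t. y t - z t)"
  unfolding hb_def using hol_diff[of \<alpha> K a b y L z]
  by (blast intro: order_trans[OF norm_triangle_ineq4] add_mono)

lemma hb_shift: "hb \<alpha> K a b (\<lambda>t. y (c + t)) \<longleftrightarrow> hb \<alpha> K (c + a) (c + b) y"
proof -
  have "norm (y t) \<le> K" if "\<forall>t. a \<le> t \<longrightarrow> t \<le> b \<longrightarrow> norm (y (c + t)) \<le> K" "c + a \<le> t" "t \<le> c + b" for t
    using that(1)[rule_format, of "t - c"] that by simp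
  moreover have "norm (y (c + t)) \<le> K"
    if "\<forall>t. c + a \<le> t \<longrightarrow> t \<le> c + b \<longrightarrow> norm (y t) \<le> K" "a \<le> t" "t \<le> b" for t
    using that(1)[rule_format, of "c + t"] that by simp
  ultimately show ?thesis unfolding hb_def hol_shift by blast
qed

lemma hol_imp_hb:
  assumes "hol \<alpha> K a b y" "0 \<le> K" "0 < \<alpha>" "a \<le> b"
  shows "\<exists>N\<ge>0. hb \<alpha> N a b y"
proof -
  let ?N = "norm (y a) + K * (b - a) powr \<alpha> + K"
  have "norm (y t) \<le> ?N" if "a \<le> t" "t \<le> b" for t
  proof -
    have "norm (y t) \<le> norm (y a) + norm (y t - y a)"
      using norm_triangle_ineq[of "y a" "y t - y a"] by simp
    also have "norm (y t - y a) \<le> K * (t - a) powr \<alpha>"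
      using that assms by (intro holD) auto
    also have "\<dots> \<le> K * (b - a) powr \<alpha>"
      using that assms by (intro mult_left_mono powr_mono2) auto
    finally show ?thesis using assms by simp
  qed
  moreover have "hol \<alpha> ?N a b y"
    by (rule hol_mono[OF assms(1)]) (use assms in simp)
  ultimately have "hb \<alpha> ?N a b y" by (simp add: hb_def)
  moreover have "0 \<le> ?N" using assms by simp
  ultimately show ?thesis by blast
qed

text \<open>Turns the self-referential bounds of the fixed point estimates into genuine ones.\<close>

lemma bound_absorb:
  fixes P :: "real \<Rightarrow> bool"
  assumes "P K0" "0 \<le> K0" "0 \<le> c" "0 \<le> \<kappa>" "\<kappa> < 1"
    and step: "\<And>K. 0 \<le> K \<Longrightarrow> P K \<Longrightarrow> P (c + \<kappa> * K)"
    and closed: "\<And>X L. (\<And>n::nat. P (X n)) \<Longrightarrow> X \<longlonglongrightarrow> L \<Longrightarrow> P L"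
  shows "P (c / (1 - \<kappa>))"
proof -
  define X where "X = rec_nat K0 (\<lambda>_ K. c + \<kappa> * K)"
  have X0: "X 0 = K0" and XS: "X (Suc n) = c + \<kappa> * X n" for n by (simp_all add: X_def)
  have nn: "0 \<le> X n" for n by (induct n) (use assms in \<open>auto simp: X0 XS\<close>)
  have PX: "P (X n)" for n by (induct n) (use assms nn in \<open>auto simp: X0 XS\<close>)
  \<comment> \<open>The fixed point of the affine iteration; the iterates differ from it by a
    geometric factor.\<close>
  define B where "B = c / (1 - \<kappa>)"
  have B: "c + \<kappa> * B = B" using assms by (simp add: B_def field_simps)
  have *: "X n = c / (1 - \<kappa>) + \<kappa> ^ n * (K0 - c / (1 - \<kappa>))" for n
    unfolding B_def[symmetric]
  proof (induct n)
    case (Suc n)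
    have "X (Suc n) = (c + \<kappa> * B) + \<kappa> * \<kappa> ^ n * (K0 - B)"
      by (simp add: XS Suc algebra_simps)
    then show ?case by (simp add: B)
  qed (simp add: X0)
  have "X \<longlonglongrightarrow> c / (1 - \<kappa>) + 0 * (K0 - c / (1 - \<kappa>))"
    unfolding * using assms by (intro tendsto_intros LIMSEQ_power_zero) auto
  then show ?thesis using closed[of X, OF PX] by simp
qed

section \<open>Sewing and the Young integral\<close>

lemma sum_lessThan_plus:
  fixes f :: "nat \<Rightarrow> 'a::ab_group_add"
  shows "(\<Sum>j<a + m. f j) = (\<Sum>j<a. f j) + (\<Sum>j<m. f (a + j))"
  by (induct m) (auto simp: add.assoc)

lemma sum_lessThan_double:
  fixes f :: "nat \<Rightarrow> 'a::ab_group_add"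
  shows "(\<Sum>j<2 * m. f j) = (\<Sum>j<m. f (2 * j) + f (2 * j + 1))"
  by (induct m) (auto simp: add.assoc)

lemma step_mono_le:
  fixes p :: "nat \<Rightarrow> real"
  assumes "\<And>i. i < n \<Longrightarrow> p i \<le> p (Suc i)" "i \<le> j" "j \<le> n"
  shows "p i \<le> p j"
  using assms(2,3)
proof (induct j rule: dec_induct)
  case (step m)
  then show ?case using assms(1)[of m] by simp
qed simp

text \<open>Young's argument: in a partition of \<open>m + 1\<close> cells two adjacent cells have total length
  at most \<open>2 / m\<close> of the whole, and their common point is removed.\<close>

lemma discrete_sewing:
  fixes F :: "real \<Rightarrow> real \<Rightarrow> 'b::real_normed_vector"
  assumes "0 \<le> \<theta>" "0 \<le> K"
    and \<delta>: "\<And>s u t. a \<le> s \<Longrightarrow> s \<le> u \<Longrightarrow> u \<le> t \<Longrightarrow> t \<le> b \<Longrightarrow>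
              norm (F s t - F s u - F u t) \<le> K * (t - s) powr \<theta>"
    and "\<And>i. i < Suc m \<Longrightarrow> p i \<le> p (Suc i)" "a \<le> p 0" "p (Suc m) \<le> b"
  shows "norm ((\<Sum>i<Suc m. F (p i) (p (Suc i))) - F (p 0) (p (Suc m)))
           \<le> K * (\<Sum>k<m. (2 / Suc k) powr \<theta>) * (p (Suc m) - p 0) powr \<theta>"
  using assms(4-)
proof (induct m arbitrary: p)
  case 0
  then show ?case by simp
next
  case (Suc m)
  let ?n = "Suc m"
  define len where "len = p (Suc ?n) - p 0"
  have mono: "p i \<le> p j" if "i \<le> j" "j \<le> Suc ?n" for i j
    by (rule step_mono_le[of "Suc ?n"]) (use that Suc.prems in auto)
  have "\<exists>i<?n. p (i + 2) - p i \<le> 2 * len / ?n"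
  proof (rule ccontr)
    assume "\<not> ?thesis"
    then have "2 * len / ?n < p (i + 2) - p i" if "i < ?n" for i
      using that by force
    then have "(\<Sum>i<?n. 2 * len / ?n) < (\<Sum>i<?n. p (i + 2) - p i)"
      by (intro sum_strict_mono) auto
    moreover have "(\<Sum>i<?n. p (i + 2) - p i) = (p (Suc ?n) - p 1) + (p ?n - p 0)"
    proof -
      have "(\<Sum>i<k. p (i + 2) - p i) = (p (Suc k) - p 1) + (p k - p 0)" for k
        by (induct k) auto
      then show ?thesis .
    qed
    moreover have "\<dots> \<le> 2 * len"
      using mono[of 0 1] mono[of ?n "Suc ?n"] by (simp add: len_def)
    ultimately show False by simp
  qed
  then obtain i where i: "i < ?n" "p (i + 2) - p i \<le> 2 * len / ?n" by blast
  define p' where "p' j = (if j \<le> i then p j else p (Suc j))" for j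
  have IH: "norm ((\<Sum>j<Suc m. F (p' j) (p' (Suc j))) - F (p' 0) (p' (Suc m)))
           \<le> K * (\<Sum>k<m. (2 / Suc k) powr \<theta>) * (p' (Suc m) - p' 0) powr \<theta>"
  proof (rule Suc.hyps)
    show "p' j \<le> p' (Suc j)" if "j < Suc m" for j
      unfolding p'_def using that mono by auto
    show "a \<le> p' 0" "p' (Suc m) \<le> b"
      using Suc.prems i by (auto simp: p'_def)
  qed
  have ends: "p' 0 = p 0" "p' (Suc m) = p (Suc ?n)"
    using i by (auto simp: p'_def)
  \<comment> \<open>The cells fall into \<open>i\<close> cells on the left, the pair that is merged,
    and \<open>k\<close> cells on the right; only the pair changes the sum.\<close>
  obtain k where k: "?n = Suc i + k" using i(1) by (metis add_Suc less_iff_Suc_add)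
  have "(\<Sum>j<Suc ?n. F (p j) (p (Suc j))) - (\<Sum>j<?n. F (p' j) (p' (Suc j)))
      = F (p i) (p (Suc i)) + F (p (Suc i)) (p (i + 2)) - F (p i) (p (i + 2))"
  proof -
    have 1: "Suc ?n = Suc (Suc i) + k" using k by simp
    have "(\<Sum>j<Suc ?n. F (p j) (p (Suc j)))
        = (\<Sum>j<i. F (p j) (p (Suc j))) + F (p i) (p (Suc i)) + F (p (Suc i)) (p (i + 2))
          + (\<Sum>j<k. F (p (Suc (Suc i) + j)) (p (Suc (Suc (Suc i) + j))))"
      unfolding 1 sum_lessThan_plus[of _ "Suc (Suc i)"] by simp
    moreover have "(\<Sum>j<?n. F (p' j) (p' (Suc j)))
        = (\<Sum>j<i. F (p j) (p (Suc j))) + F (p i) (p (i + 2))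
          + (\<Sum>j<k. F (p (Suc (Suc i) + j)) (p (Suc (Suc (Suc i) + j))))"
      unfolding k sum_lessThan_plus[of _ "Suc i"] by (simp add: p'_def)
    ultimately show ?thesis by simp
  qed
  moreover have e1: "norm (F (p i) (p (i + 2)) - F (p i) (p (Suc i)) - F (p (Suc i)) (p (i + 2)))
      \<le> K * (p (i + 2) - p i) powr \<theta>"
    using mono[of 0 i] mono[of "i + 2" "Suc ?n"] mono[of i "Suc i"] mono[of "Suc i" "i + 2"] Suc.prems i
    by (intro \<delta>) auto
  moreover have e2: "K * (p (i + 2) - p i) powr \<theta> \<le> K * ((2 / ?n) powr \<theta> * len powr \<theta>)"
  proof -
    have "(p (i + 2) - p i) powr \<theta> \<le> (2 * len / ?n) powr \<theta>"
      using i mono[of i "i + 2"] assms(1) by (intro powr_mono2) auto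
    also have "\<dots> = ((2 / ?n) * len) powr \<theta>" by (simp add: field_simps)
    also have "\<dots> = (2 / ?n) powr \<theta> * len powr \<theta>"
      using mono[of 0 "Suc ?n"] by (subst powr_mult) (auto simp: len_def)
    finally show ?thesis using assms(2) by (intro mult_left_mono) auto
  qed
  moreover have "norm (F (p i) (p (Suc i)) + F (p (Suc i)) (p (i + 2)) - F (p i) (p (i + 2)))
      = norm (F (p i) (p (i + 2)) - F (p i) (p (Suc i)) - F (p (Suc i)) (p (i + 2)))"
    by (subst norm_minus_commute) (simp add: diff_diff_eq)
  ultimately have d: "norm ((\<Sum>j<Suc ?n. F (p j) (p (Suc j))) - (\<Sum>j<?n. F (p' j) (p' (Suc j))))
      \<le> K * ((2 / ?n) powr \<theta> * len powr \<theta>)"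
    using order_trans[OF e1 e2] by (simp only:)
  have "norm ((\<Sum>j<Suc ?n. F (p j) (p (Suc j))) - F (p 0) (p (Suc ?n)))
     \<le> norm ((\<Sum>j<Suc ?n. F (p j) (p (Suc j))) - (\<Sum>j<?n. F (p' j) (p' (Suc j))))
        + norm ((\<Sum>j<?n. F (p' j) (p' (Suc j))) - F (p 0) (p (Suc ?n)))"
    by (rule norm_diff_triangle_le) (rule order_refl)+
  also have "\<dots> \<le> K * ((2 / ?n) powr \<theta> * len powr \<theta>) + K * (\<Sum>k<m. (2 / Suc k) powr \<theta>) * len powr \<theta>"
    using d IH unfolding ends len_def by (rule add_mono)
  also have "\<dots> = K * (\<Sum>k<?n. (2 / Suc k) powr \<theta>) * len powr \<theta>"
    by (simp add: algebra_simps)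
  finally show ?case unfolding len_def .
qed

text \<open>This is \<open>2 powr \<theta>\<close> times the Riemann zeta function at \<theta>; the
  summands are the losses of Young's successive point removals.\<close>

definition young_const :: "real \<Rightarrow> real" where
  "young_const \<theta> = (\<Sum>k. (2 / Suc k) powr \<theta>)"

lemma summable_young:
  assumes "1 < \<theta>"
  shows "summable (\<lambda>k::nat. (2 / Suc k) powr \<theta>)"
proof -
  have "summable (\<lambda>k::nat. real k powr - \<theta>)"
    using assms by (subst summable_real_powr_iff) simp
  then have "summable (\<lambda>k::nat. real (Suc k) powr - \<theta>)"
    by (subst summable_Suc_iff)
  then have "summable (\<lambda>k::nat. 2 powr \<theta> * real (Suc k) powr - \<theta>)"
    by (rule summable_mult)
  moreover have "2 powr \<theta> * real (Suc k) powr - \<theta> = (2 / Suc k) powr \<theta>" for k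
    by (subst powr_divide) (auto simp: powr_minus divide_inverse)
  ultimately show ?thesis by (simp del: of_nat_Suc)
qed

lemma young_const_nonneg: "1 < \<theta> \<Longrightarrow> 0 \<le> young_const \<theta>"
  unfolding young_const_def by (intro suminf_nonneg summable_young) auto

text \<open>All intervals [s, t] use the same dyadic grid of [a, b], clamped to [s, t]. Refinement
  makes the sums converge, and the common grid makes the limit additive: for s \<le> u \<le> t only
  the cell around \<open>u\<close> tells the sums apart. An additive limit is the increment of a
  single function \<Phi>.\<close>

lemma sewing:
  fixes F :: "real \<Rightarrow> real \<Rightarrow> 'b::banach"
  assumes \<theta>: "1 < \<theta>" and K: "0 \<le> K"
    and \<delta>: "\<And>s u t. a \<le> s \<Longrightarrow> s \<le> u \<Longrightarrow> u \<le> t \<Longrightarrow> t \<le> b \<Longrightarrow>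
              norm (F s t - F s u - F u t) \<le> K * (t - s) powr \<theta>"
  shows "\<exists>\<Phi>. \<forall>s t. a \<le> s \<longrightarrow> s \<le> t \<longrightarrow> t \<le> b \<longrightarrow>
           norm (\<Phi> t - \<Phi> s - F s t) \<le> K * young_const \<theta> * (t - s) powr \<theta>"
proof -
  define d :: "nat \<Rightarrow> nat \<Rightarrow> real" where "d n k = a + real k * (b - a) / 2 ^ n" for n k
  \<comment> \<open>\<open>cl\<close> clamps a grid point to [s, t]. Cells outside [s, t] collapse
    to a point and contribute a value of \<open>F\<close> on the diagonal, which is 0.\<close>
  define cl :: "real \<Rightarrow> real \<Rightarrow> real \<Rightarrow> real" where "cl s t u = max s (min t u)" for s t u
  define S where "S n s t = (\<Sum>k<2^n. F (cl s t (d n k)) (cl s t (d n (Suc k))))" for n s t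
  have cl_mono: "u \<le> v \<Longrightarrow> cl s t u \<le> cl s t v" for s t u v by (auto simp: cl_def)
  have cl_in: "s \<le> t \<Longrightarrow> s \<le> cl s t u \<and> cl s t u \<le> t" for s t u by (auto simp: cl_def)
  have cl_diff: "s \<le> t \<Longrightarrow> u \<le> v \<Longrightarrow> cl s t v - cl s t u \<le> v - u" for s t u v by (auto simp: cl_def)
  have F0: "F s s = 0" if "a \<le> s" "s \<le> b" for s
    using \<delta>[of s s s] that by simp
  have near: "norm (S n s t - F s t) \<le> K * young_const \<theta> * (t - s) powr \<theta>"
    if st: "a \<le> s" "s \<le> t" "t \<le> b" for n s t
  proof -
    obtain m where m: "2 ^ n = Suc m" by (metis Suc_pred' zero_less_numeral zero_less_power)
    define p where "p k = cl s t (d n k)" for k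
    have dm: "d n k \<le> d n (Suc k)" for k
      using st by (auto simp: d_def field_simps intro!: divide_right_mono)
    have "d n (Suc m) = b"
      unfolding d_def m[symmetric] by simp
    then have ends: "p 0 = s" "p (Suc m) = t"
      using st by (auto simp: p_def cl_def d_def)
    have "norm ((\<Sum>i<Suc m. F (p i) (p (Suc i))) - F (p 0) (p (Suc m)))
           \<le> K * (\<Sum>k<m. (2 / Suc k) powr \<theta>) * (p (Suc m) - p 0) powr \<theta>"
    proof (rule discrete_sewing[where a = a and b = b])
      show "p i \<le> p (Suc i)" for i unfolding p_def by (rule cl_mono[OF dm])
    qed (use \<theta> K st ends \<delta> in auto)
    then have "norm (S n s t - F s t) \<le> K * (\<Sum>k<m. (2 / Suc k) powr \<theta>) * (t - s) powr \<theta>"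
      unfolding ends by (simp add: S_def p_def m)
    also have "\<dots> \<le> K * young_const \<theta> * (t - s) powr \<theta>"
      unfolding young_const_def using K
      by (intro mult_right_mono mult_left_mono sum_le_suminf summable_young \<theta>) auto
    finally show ?thesis .
  qed
  define h where "h n = (b - a) / 2 ^ n" for n :: nat
  have dh: "d n (Suc k) - d n k = h n" for n k
    by (simp add: d_def h_def field_simps)
  \<comment> \<open>Each of the 2^n cells is halved at the cost
    \<open>K * h n powr \<theta>\<close>; as \<theta> > 1, the total is a geometric term of ratio
    \<open>(1/2) powr (\<theta> - 1)\<close>.\<close>
  have cauchy: "norm (S (Suc n) s t - S n s t) \<le> K * (b - a) powr \<theta> * ((1/2) powr (\<theta> - 1)) ^ n"
    if st: "a \<le> s" "s \<le> t" "t \<le> b" for n s t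
  proof -
    have "2 ^ Suc n = 2 * 2 ^ n" by simp
    have dd: "d (Suc n) (2 * k) = d n k" for k by (simp add: d_def)
    let ?c = "cl s t"
    have S1: "S (Suc n) s t = (\<Sum>k<2^n. F (?c (d n k)) (?c (d (Suc n) (2 * k + 1))) +
            F (?c (d (Suc n) (2 * k + 1))) (?c (d n (Suc k))))"
      unfolding S_def power_Suc sum_lessThan_double using dd dd[of "Suc _"] by simp
    have "norm (S (Suc n) s t - S n s t) = norm (\<Sum>k<2^n. F (?c (d n k)) (?c (d (Suc n) (2 * k + 1))) +
            F (?c (d (Suc n) (2 * k + 1))) (?c (d n (Suc k))) - F (?c (d n k)) (?c (d n (Suc k))))"
      unfolding S1 by (simp add: S_def sum_subtractf)
    also have "\<dots> \<le> (\<Sum>k<(2::nat)^n. K * h n powr \<theta>)"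
    proof (rule sum_norm_le)
      fix k :: nat
      have "d n k \<le> d (Suc n) (2 * k + 1)" "d (Suc n) (2 * k + 1) \<le> d n (Suc k)"
        using st by (auto simp: d_def field_simps)
      then have "norm (F (?c (d n k)) (?c (d n (Suc k))) - F (?c (d n k)) (?c (d (Suc n) (2 * k + 1)))
          - F (?c (d (Suc n) (2 * k + 1))) (?c (d n (Suc k)))) \<le> K * (?c (d n (Suc k)) - ?c (d n k)) powr \<theta>"
        using st cl_in[of s t] by (intro \<delta> cl_mono) (auto intro: order_trans)
      also have "\<dots> \<le> K * h n powr \<theta>"
        unfolding dh[of n k, symmetric] using K st \<theta>
        by (intro mult_left_mono powr_mono2 cl_diff) (auto simp: cl_mono dh h_def d_def field_simps intro!: cl_mono)
      finally show "norm (F (?c (d n k)) (?c (d (Suc n) (2 * k + 1))) +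
            F (?c (d (Suc n) (2 * k + 1))) (?c (d n (Suc k))) - F (?c (d n k)) (?c (d n (Suc k)))) \<le> K * h n powr \<theta>"
        by (subst (asm) norm_minus_commute) (simp add: algebra_simps)
    qed
    also have "\<dots> = K * (b - a) powr \<theta> * ((1/2) powr (\<theta> - 1)) ^ n"
    proof -
      have "h n powr \<theta> = (b - a) powr \<theta> / (2 ^ n) powr \<theta>"
        using st by (simp add: h_def powr_divide)
      moreover have "(2 ^ n) / ((2::real) ^ n) powr \<theta> = ((1/2) powr (\<theta> - 1)) ^ n"
      proof -
        have "((1/2::real) powr (\<theta> - 1)) ^ n = 2 powr (real n * (1 - \<theta>))"
          by (simp add: powr_divide powr_diff powr_powr flip: powr_realpow) (simp add: powr_minus powr_diff field_simps)
        moreover have "(2 ^ n) / ((2::real) ^ n) powr \<theta> = 2 powr (real n * (1 - \<theta>))"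
          by (simp add: powr_powr powr_diff algebra_simps flip: powr_realpow)
        ultimately show ?thesis by simp
      qed
      ultimately have "2 ^ n * h n powr \<theta> = (b - a) powr \<theta> * ((1/2) powr (\<theta> - 1)) ^ n"
      proof -
        assume h: "h n powr \<theta> = (b - a) powr \<theta> / (2 ^ n) powr \<theta>"
          and e: "(2 ^ n) / ((2::real) ^ n) powr \<theta> = ((1/2) powr (\<theta> - 1)) ^ n"
        show ?thesis unfolding h e[symmetric] by simp
      qed
      then show ?thesis by (simp add: mult.left_commute)
    qed
    finally show ?thesis .
  qed
  have q: "0 \<le> (1/2::real) powr (\<theta> - 1)" "(1/2::real) powr (\<theta> - 1) < 1"
    using \<theta> gr_one_powr[of 2 "\<theta> - 1"] by (auto simp: powr_divide)
  have "convergent (\<lambda>n. S n s t)" if st: "a \<le> s" "s \<le> t" "t \<le> b" for s t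
  proof -
    have "summable (\<lambda>n. S (Suc n) s t - S n s t)"
      by (rule summable_comparison_test'[where N = 0, OF summable_mult[OF summable_geometric]])
         (use q cauchy[OF st] in auto)
    then have "convergent (\<lambda>n. \<Sum>i<n. S (Suc i) s t - S i s t)"
      by (simp add: summable_iff_convergent)
    then have "convergent (\<lambda>n. S n s t - S 0 s t)"
      by (simp add: sum_lessThan_telescope[of "\<lambda>i. S i s t"])
    then show ?thesis by (simp add: convergent_diff_const_right_iff)
  qed
  then have "\<exists>L. \<forall>s t. a \<le> s \<longrightarrow> s \<le> t \<longrightarrow> t \<le> b \<longrightarrow> (\<lambda>n. S n s t) \<longlonglongrightarrow> L s t"
    by (intro exI[of _ "\<lambda>s t. lim (\<lambda>n. S n s t)"]) (auto simp: convergent_LIMSEQ_iff)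
  then obtain L where L: "(\<lambda>n. S n s t) \<longlonglongrightarrow> L s t" if "a \<le> s" "s \<le> t" "t \<le> b" for s t
    by blast
  have add: "L s u + L u t = L s t" if st: "a \<le> s" "s \<le> u" "u \<le> t" "t \<le> b" for s u t
  proof -
    \<comment> \<open>At each level at most one cell has \<open>u\<close> in its interior; on every
      other cell the three sums cancel.\<close>
    have b: "norm (S n s t - S n s u - S n u t) \<le> K * h n powr \<theta>" for n
    proof -
      let ?P = "\<lambda>k. d n k < u \<and> u < d n (Suc k)"
      have dm: "d n k \<le> d n (Suc k)" for k
      proof -
        have "0 \<le> h n" using st by (simp add: h_def)
        then show ?thesis using dh[of n k] by linarith
      qed
      have dmono: "d n k \<le> d n l" if "k \<le> l" for k l
        using lift_Suc_mono_le[of "d n"] dm that by blast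
      have "norm (S n s t - S n s u - S n u t) \<le> (\<Sum>k<2^n. if ?P k then K * h n powr \<theta> else 0)"
        unfolding S_def sum_subtractf[symmetric]
      proof (rule sum_norm_le)
        fix k :: nat
        let ?x = "d n k" and ?y = "d n (Suc k)"
        let ?T = "F (cl s t ?x) (cl s t ?y) - F (cl s u ?x) (cl s u ?y) - F (cl u t ?x) (cl u t ?y)"
        consider "?y \<le> u" | "u \<le> ?x" | "?P k" by linarith
        then show "norm ?T \<le> (if ?P k then K * h n powr \<theta> else 0)"
        proof cases
          case 1
          then have "cl u t ?x = u" "cl u t ?y = u" "cl s t ?x = cl s u ?x" "cl s t ?y = cl s u ?y"
            using dm[of k] st by (auto simp: cl_def)
          then have "?T = 0" using F0[of u] st by simp
          then show ?thesis using K by simp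
        next
          case 2
          then have "cl s u ?x = u" "cl s u ?y = u" "cl s t ?x = cl u t ?x" "cl s t ?y = cl u t ?y"
            using dm[of k] st by (auto simp: cl_def)
          then have "?T = 0" using F0[of u] st by simp
          then show ?thesis using K by simp
        next
          case 3
          have e: "cl s u ?x = cl s t ?x" "cl s u ?y = u" "cl u t ?x = u" "cl u t ?y = cl s t ?y"
            using 3 st by (auto simp: cl_def)
          have "norm ?T \<le> K * (cl s t ?y - cl s t ?x) powr \<theta>"
            unfolding e using 3 st cl_in[of s t] by (intro \<delta>) (auto simp: cl_def)
          also have "\<dots> \<le> K * h n powr \<theta>"
            unfolding dh[of n k, symmetric] using K st \<theta> dm
            by (intro mult_left_mono powr_mono2 cl_diff) (auto intro!: cl_mono)
          finally show ?thesis using 3 by simp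
        qed
      qed
      also have "\<dots> = real (card {k \<in> {..<2^n}. ?P k}) * (K * h n powr \<theta>)"
        by (simp flip: sum.inter_filter)
      also have "card {k \<in> {..<2^n}. ?P k} \<le> 1"
      proof -
        have "k = l" if "?P k" "?P l" for k l
          using dmono[of "Suc k" l] dmono[of "Suc l" k] that by (metis Suc_leI linorder_neqE_nat not_less order.strict_trans)
        then show ?thesis by (auto simp: card_le_Suc0_iff_eq)
      qed
      then have "real (card {k \<in> {..<2^n}. ?P k}) * (K * h n powr \<theta>) \<le> 1 * (K * h n powr \<theta>)"
        using K by (intro mult_right_mono) auto
      finally show ?thesis by simp
    qed
    have "(\<lambda>n. K * h n powr \<theta>) \<longlonglongrightarrow> K * 0 powr \<theta>"
    proof (intro tendsto_intros)
      have "(\<lambda>n. (b - a) * (1/2) ^ n) \<longlonglongrightarrow> (b - a) * 0"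
        by (intro tendsto_intros LIMSEQ_power_zero) auto
      moreover have "h = (\<lambda>n. (b - a) * (1/2) ^ n)" by (auto simp: h_def power_divide)
      ultimately show "h \<longlonglongrightarrow> 0" by simp
    qed (use st \<theta> in \<open>auto simp: h_def\<close>)
    then have "(\<lambda>n. K * h n powr \<theta>) \<longlonglongrightarrow> 0" by simp
    then have "(\<lambda>n. S n s t - S n s u - S n u t) \<longlonglongrightarrow> 0"
      by (rule Lim_null_comparison[rotated]) (use b in simp)
    moreover have "(\<lambda>n. S n s t - S n s u - S n u t) \<longlonglongrightarrow> L s t - L s u - L u t"
      using st by (intro tendsto_intros L) auto
    ultimately have "L s t - L s u - L u t = 0" using LIMSEQ_unique by blast
    then show ?thesis by (simp add: algebra_simps)
  qed
  have "norm (L a t - L a s - F s t) \<le> K * young_const \<theta> * (t - s) powr \<theta>"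
    if st: "a \<le> s" "s \<le> t" "t \<le> b" for s t
  proof -
    have "norm (L s t - F s t) \<le> K * young_const \<theta> * (t - s) powr \<theta>"
      by (rule LIMSEQ_le_const2[OF tendsto_norm[OF tendsto_diff[OF L tendsto_const]]]) (use near st in auto)
    then show ?thesis using add[of a s t] st by (metis add_diff_cancel_left' order_refl)
  qed
  then show ?thesis by (intro exI[of _ "L a"]) auto
qed

lemma partition_mono:
  fixes p :: "nat \<Rightarrow> real"
  assumes "\<forall>i<n. p i < p (Suc i) \<and> Q i" "i \<le> n"
  shows "p 0 \<le> p i" "p i \<le> p n"
  using assms step_mono_le[of n p 0 i] step_mono_le[of n p i n] by (auto intro: less_imp_le)

text \<open>Over a partition of mesh below \<delta> the local errors of order \<theta> add up to at
  most \<open>C * \<delta> powr (\<theta> - 1) * (b - a)\<close>, which vanishes with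
  \<delta>.\<close>

lemma has_young_integralI:
  fixes M :: "real \<Rightarrow> real^'m^'d"
  assumes \<theta>: "1 < \<theta>" and C: "0 \<le> C" and ab: "a \<le> b"
    and \<Phi>: "\<And>s t. a \<le> s \<Longrightarrow> s \<le> t \<Longrightarrow> t \<le> b \<Longrightarrow>
              norm (\<Phi> t - \<Phi> s - M s *v (x t - x s)) \<le> C * (t - s) powr \<theta>"
  shows "has_young_integral M x a b (\<Phi> b - \<Phi> a)"
  unfolding has_young_integral_def
proof (intro allI impI)
  fix e :: real assume e: "0 < e"
  \<comment> \<open>The summand 1 in the denominator covers the case
    \<open>C * (b - a) = 0\<close>.\<close>
  define \<delta> where "\<delta> = (e / (C * (b - a) + 1)) powr (1 / (\<theta> - 1))"
  have den: "0 < C * (b - a) + 1" using C ab by (simp add: add_nonneg_pos)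
  have \<delta>0: "0 < \<delta>" using e den by (simp add: \<delta>_def)
  have \<delta>1: "\<delta> powr (\<theta> - 1) = e / (C * (b - a) + 1)"
    using \<theta> e den by (simp add: \<delta>_def powr_powr)
  have "norm ((\<Sum>i<n. M (p i) *v (x (p (Suc i)) - x (p i))) - (\<Phi> b - \<Phi> a)) < e"
    if p: "p 0 = a" "p n = b" "\<forall>i<n. p i < p (Suc i) \<and> p (Suc i) - p i < \<delta>" for n and p :: "nat \<Rightarrow> real"
  proof -
    have "(\<Sum>i<n. \<Phi> (p (Suc i)) - \<Phi> (p i)) = \<Phi> b - \<Phi> a"
      using sum_lessThan_telescope[of "\<lambda>i. \<Phi> (p i)" n] p by simp
    then have "norm ((\<Sum>i<n. M (p i) *v (x (p (Suc i)) - x (p i))) - (\<Phi> b - \<Phi> a))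
      = norm (\<Sum>i<n. M (p i) *v (x (p (Suc i)) - x (p i)) - (\<Phi> (p (Suc i)) - \<Phi> (p i)))"
      by (simp add: sum_subtractf)
    also have "\<dots> \<le> (\<Sum>i<n. C * \<delta> powr (\<theta> - 1) * (p (Suc i) - p i))"
    proof (rule sum_norm_le)
      fix i assume "i \<in> {..<n}"
      then have i: "i < n" by simp
      have "norm (M (p i) *v (x (p (Suc i)) - x (p i)) - (\<Phi> (p (Suc i)) - \<Phi> (p i)))
          \<le> C * (p (Suc i) - p i) powr \<theta>"
        using \<Phi>[of "p i" "p (Suc i)"] i p partition_mono[OF p(3), of i] partition_mono[OF p(3), of "Suc i"]
        by (subst norm_minus_commute) auto
      also have "(p (Suc i) - p i) powr \<theta> = (p (Suc i) - p i) powr (\<theta> - 1) * (p (Suc i) - p i) powr 1"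
        by (subst powr_add[symmetric]) simp
      also have "C * \<dots> \<le> C * (\<delta> powr (\<theta> - 1) * (p (Suc i) - p i))"
        using i p(3) C \<theta> by (intro mult_left_mono mult_mono powr_mono2) (auto simp: less_imp_le)
      finally show "norm (M (p i) *v (x (p (Suc i)) - x (p i)) - (\<Phi> (p (Suc i)) - \<Phi> (p i)))
        \<le> C * \<delta> powr (\<theta> - 1) * (p (Suc i) - p i)" by (simp add: mult.assoc)
    qed
    also have "\<dots> = C * \<delta> powr (\<theta> - 1) * (b - a)"
      using sum_lessThan_telescope[of p n] p by (simp flip: sum_distrib_left)
    also have "\<dots> = e * (C * (b - a)) / (C * (b - a) + 1)"
      by (simp add: \<delta>1)
    also have "\<dots> < e"
      using den e by (simp add: divide_less_eq algebra_simps)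
    finally show ?thesis .
  qed
  then show "\<exists>\<delta>>0. \<forall>n (p :: nat \<Rightarrow> real).
        p 0 = a \<and> p n = b \<and> (\<forall>i<n. p i < p (Suc i) \<and> p (Suc i) - p i < \<delta>) \<longrightarrow>
        norm ((\<Sum>i<n. M (p i) *v (x (p (Suc i)) - x (p i))) - (\<Phi> b - \<Phi> a)) < e"
    using \<delta>0 by blast
qed

text \<open>Without arbitrarily fine partitions every \<open>J\<close> would satisfy
  \<open>has_young_integral\<close>; this is what makes the value of the integral unique.\<close>

lemma fine_partition:
  fixes a b \<delta> :: real
  assumes "a \<le> b" "0 < \<delta>"
  shows "\<exists>n p. p 0 = a \<and> p n = b \<and> (\<forall>i<n. p i < p (Suc i) \<and> p (Suc i) - p i < \<delta>)"
proof (cases "a = b")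
  case True
  then show ?thesis by (intro exI[of _ 0] exI[of _ "\<lambda>_. a"]) simp
next
  case False
  then obtain n where n: "(b - a) / \<delta> < real n" using reals_Archimedean2 by blast
  have n0: "0 < real n" using n assms by (meson diff_ge_0_iff_ge divide_nonneg_pos le_less_trans)
  define p where "p i = a + real i * ((b - a) / n)" for i :: nat
  have "p (Suc i) - p i = (b - a) / n" for i
    by (simp add: p_def distrib_right del: of_nat_Suc) (simp add: algebra_simps add_divide_distrib diff_divide_distrib)
  moreover have "(b - a) / n < \<delta>" using n n0 assms by (simp add: field_simps)
  moreover have "0 < (b - a) / n" using n0 False assms by simp
  ultimately have "\<forall>i<n. p i < p (Suc i) \<and> p (Suc i) - p i < \<delta>"
    by (metis diff_gt_0_iff_gt)
  moreover have "p 0 = a" "p n = b" using n0 by (auto simp: p_def)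
  ultimately show ?thesis by blast
qed

lemma has_young_integral_unique:
  assumes "has_young_integral M x a b J" "has_young_integral M x a b J'" "a \<le> b"
  shows "J = J'"
proof (rule ccontr)
  assume "J \<noteq> J'"
  define e where "e = norm (J - J') / 2"
  have e: "0 < e" using \<open>J \<noteq> J'\<close> by (simp add: e_def)
  let ?S = "\<lambda>n p. (\<Sum>i<n. M (p i) *v (x (p (Suc i)) - x (p i)))"
  let ?fine = "\<lambda>\<delta> n p. p 0 = a \<and> p n = b \<and> (\<forall>i<n. p i < p (Suc i) \<and> p (Suc i) - p i < \<delta>)"
  obtain \<delta> where \<delta>: "\<delta> > 0" "\<And>n p. ?fine \<delta> n p \<Longrightarrow> norm (?S n p - J) < e"
    using assms(1)[unfolded has_young_integral_def, rule_format, OF e] by blast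
  obtain \<delta>' where \<delta>': "\<delta>' > 0" "\<And>n p. ?fine \<delta>' n p \<Longrightarrow> norm (?S n p - J') < e"
    using assms(2)[unfolded has_young_integral_def, rule_format, OF e] by blast
  obtain n p where np: "?fine (min \<delta> \<delta>') n p"
    using fine_partition[OF assms(3), of "min \<delta> \<delta>'"] \<delta>(1) \<delta>'(1) by auto
  have "norm (?S n p - J) < e" "norm (?S n p - J') < e"
    using np by (auto intro!: \<delta>(2) \<delta>'(2))
  then have "norm (J - J') < e + e"
    using norm_triangle_ineq4[of "?S n p - J'" "?S n p - J"] by simp
  then show False by (simp add: e_def)
qed

lemma has_young_integral_cong:
  assumes "\<And>t. a \<le> t \<Longrightarrow> t \<le> b \<Longrightarrow> M t = M' t" "\<And>t. a \<le> t \<Longrightarrow> t \<le> b \<Longrightarrow> x t = x' t"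
  shows "has_young_integral M x a b J = has_young_integral M' x' a b J"
proof -
  have sums: "(\<Sum>i<n. M (p i) *v (x (p (Suc i)) - x (p i))) = (\<Sum>i<n. M' (p i) *v (x' (p (Suc i)) - x' (p i)))"
    if "p 0 = a" "p n = b" "\<forall>i<n. p i < p (Suc i) \<and> p (Suc i) - p i < \<delta>" for n p \<delta>
  proof (rule sum.cong[OF refl])
    fix i assume "i \<in> {..<n}"
    then have "i \<le> n" "Suc i \<le> n" by auto
    then show "M (p i) *v (x (p (Suc i)) - x (p i)) = M' (p i) *v (x' (p (Suc i)) - x' (p i))"
      using partition_mono[OF that(3), of i] partition_mono[OF that(3), of "Suc i"] that assms by simp
  qed
  have *: "((p 0 = a \<and> p n = b \<and> (\<forall>i<n. p i < p (Suc i) \<and> p (Suc i) - p i < \<delta>)) \<longrightarrow>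
      norm ((\<Sum>i<n. M (p i) *v (x (p (Suc i)) - x (p i))) - J) < e) =
     ((p 0 = a \<and> p n = b \<and> (\<forall>i<n. p i < p (Suc i) \<and> p (Suc i) - p i < \<delta>)) \<longrightarrow>
      norm ((\<Sum>i<n. M' (p i) *v (x' (p (Suc i)) - x' (p i))) - J) < e)" for e n p \<delta>
    by (intro imp_cong refl) (elim conjE, subst sums, assumption+, rule refl)
  show ?thesis unfolding has_young_integral_def * ..
qed

lemma has_young_integral_diff_integrand:
  assumes "has_young_integral M x a b J" "has_young_integral M' x a b J'"
  shows "has_young_integral (\<lambda>t. M t - M' t) x a b (J - J')"
  unfolding has_young_integral_def
proof (intro allI impI)
  fix e :: real assume "0 < e"
  then have e: "0 < e / 2" by simp
  let ?S = "\<lambda>M n p. (\<Sum>i<n. M (p i) *v (x (p (Suc i)) - x (p i)))"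
  let ?fine = "\<lambda>\<delta> n p. p 0 = a \<and> p n = b \<and> (\<forall>i<n. p i < p (Suc i) \<and> p (Suc i) - p i < \<delta>)"
  obtain \<delta> where \<delta>: "\<delta> > 0" "\<And>n p. ?fine \<delta> n p \<Longrightarrow> norm (?S M n p - J) < e / 2"
    using assms(1)[unfolded has_young_integral_def, rule_format, OF e] by blast
  obtain \<delta>' where \<delta>': "\<delta>' > 0" "\<And>n p. ?fine \<delta>' n p \<Longrightarrow> norm (?S M' n p - J') < e / 2"
    using assms(2)[unfolded has_young_integral_def, rule_format, OF e] by blast
  have "norm (?S (\<lambda>t. M t - M' t) n p - (J - J')) < e" if "?fine (min \<delta> \<delta>') n p" for n p
  proof -
    have "?S (\<lambda>t. M t - M' t) n p - (J - J') = (?S M n p - J) - (?S M' n p - J')"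
      by (simp add: matrix_vector_mult_diff_rdistrib sum_subtractf)
    also have "norm \<dots> \<le> norm (?S M n p - J) + norm (?S M' n p - J')"
      by (rule norm_triangle_ineq4)
    also have "\<dots> < e / 2 + e / 2"
      using that by (intro add_strict_mono \<delta>(2) \<delta>'(2)) auto
    finally show ?thesis by simp
  qed
  then show "\<exists>\<delta>>0. \<forall>n p. ?fine \<delta> n p \<longrightarrow> norm (?S (\<lambda>t. M t - M' t) n p - (J - J')) < e"
    using \<delta>(1) \<delta>'(1) by (intro exI[of _ "min \<delta> \<delta>'"]) simp
qed

lemma has_young_integral_diff_driver:
  assumes "has_young_integral M x a b J" "has_young_integral M x' a b J'"
  shows "has_young_integral M (\<lambda>t. x t - x' t) a b (J - J')"
  unfolding has_young_integral_def
proof (intro allI impI)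
  fix e :: real assume "0 < e"
  then have e: "0 < e / 2" by simp
  let ?S = "\<lambda>x n p. (\<Sum>i<n. M (p i) *v (x (p (Suc i)) - x (p i)))"
  let ?fine = "\<lambda>\<delta> n p. p 0 = a \<and> p n = b \<and> (\<forall>i<n. p i < p (Suc i) \<and> p (Suc i) - p i < \<delta>)"
  obtain \<delta> where \<delta>: "\<delta> > 0" "\<And>n p. ?fine \<delta> n p \<Longrightarrow> norm (?S x n p - J) < e / 2"
    using assms(1)[unfolded has_young_integral_def, rule_format, OF e] by blast
  obtain \<delta>' where \<delta>': "\<delta>' > 0" "\<And>n p. ?fine \<delta>' n p \<Longrightarrow> norm (?S x' n p - J') < e / 2"
    using assms(2)[unfolded has_young_integral_def, rule_format, OF e] by blast
  have "norm (?S (\<lambda>t. x t - x' t) n p - (J - J')) < e" if "?fine (min \<delta> \<delta>') n p" for n p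
  proof -
    have "M s *v (x t - x' t - (x s - x' s)) = M s *v (x t - x s) - M s *v (x' t - x' s)" for s t
      by (simp add: matrix_vector_mult_diff_distrib)
    then have "?S (\<lambda>t. x t - x' t) n p - (J - J') = (?S x n p - J) - (?S x' n p - J')"
      by (simp add: sum_subtractf)
    also have "norm \<dots> \<le> norm (?S x n p - J) + norm (?S x' n p - J')"
      by (rule norm_triangle_ineq4)
    also have "\<dots> < e / 2 + e / 2"
      using that by (intro add_strict_mono \<delta>(2) \<delta>'(2)) auto
    finally show ?thesis by simp
  qed
  then show "\<exists>\<delta>>0. \<forall>n p. ?fine \<delta> n p \<longrightarrow> norm (?S (\<lambda>t. x t - x' t) n p - (J - J')) < e"
    using \<delta>(1) \<delta>'(1) by (intro exI[of _ "min \<delta> \<delta>'"]) simp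
qed

text \<open>Only increments of the driver enter the sums, so a constant \<open>k\<close> may be
  subtracted from it, as \<open>wiener_shift\<close> does.\<close>

lemma has_young_integral_shift_imp:
  assumes "has_young_integral M x (c + a) (c + b) J"
  shows "has_young_integral (\<lambda>t. M (c + t)) (\<lambda>t. x (c + t) - k) a b J"
  unfolding has_young_integral_def
proof (intro allI impI)
  fix e :: real assume e: "0 < e"
  let ?fine = "\<lambda>\<delta> a b n p. p 0 = a \<and> p n = b \<and> (\<forall>i<n. p i < p (Suc i) \<and> p (Suc i) - p i < \<delta>)"
  obtain \<delta> where \<delta>: "\<delta> > 0" "\<And>n p. ?fine \<delta> (c + a) (c + b) n p \<Longrightarrow>
      norm ((\<Sum>i<n. M (p i) *v (x (p (Suc i)) - x (p i))) - J) < e"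
    using assms(1)[unfolded has_young_integral_def, rule_format, OF e] by blast
  have "norm ((\<Sum>i<n. M (c + p i) *v (x (c + p (Suc i)) - k - (x (c + p i) - k))) - J) < e"
    if "?fine \<delta> a b n p" for n p
    using \<delta>(2)[of "\<lambda>i. c + p i" n] that by simp
  then show "\<exists>\<delta>>0. \<forall>n p. ?fine \<delta> a b n p \<longrightarrow>
      norm ((\<Sum>i<n. M (c + p i) *v (x (c + p (Suc i)) - k - (x (c + p i) - k))) - J) < e"
    using \<delta>(1) by blast
qed

text \<open>Hoelder continuity in the operator norm, tested on vectors; the norm of the matrix type
  itself is the Frobenius norm.\<close>

definition mhol :: "real \<Rightarrow> real \<Rightarrow> real \<Rightarrow> real \<Rightarrow> (real \<Rightarrow> real^'m^'d) \<Rightarrow> bool" where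
  "mhol \<alpha> K a b M \<longleftrightarrow> (\<forall>s t v. a \<le> s \<longrightarrow> s \<le> t \<longrightarrow> t \<le> b \<longrightarrow>
     norm ((M t - M s) *v v) \<le> K * (t - s) powr \<alpha> * norm v)"

text \<open>The defect of the germ \<open>M s *v (x t - x s)\<close> is an increment of
  \<open>M\<close> applied to an increment of \<open>x\<close>, hence of order \<alpha> + \<nu> > 1,
  and sewing applies. One primitive \<Phi> serves all subintervals, so additivity of the integral
  comes for free.\<close>

lemma young_integral_exists:
  fixes M :: "real \<Rightarrow> real^'m^'d"
  assumes M: "mhol \<alpha> K a b M" and x: "hol \<nu> w a b x" and "0 \<le> K" "0 \<le> w"
    and exps: "0 < \<alpha>" "0 < \<nu>" "1 < \<alpha> + \<nu>"
  obtains \<Phi> where "\<And>s t. a \<le> s \<Longrightarrow> s \<le> t \<Longrightarrow> t \<le> b \<Longrightarrow> has_young_integral M x s t (\<Phi> t - \<Phi> s)"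
    and "\<And>s t. a \<le> s \<Longrightarrow> s \<le> t \<Longrightarrow> t \<le> b \<Longrightarrow>
      norm (\<Phi> t - \<Phi> s - M s *v (x t - x s)) \<le> K * w * young_const (\<alpha> + \<nu>) * (t - s) powr (\<alpha> + \<nu>)"
proof -
  have "\<exists>\<Phi>. \<forall>s t. a \<le> s \<longrightarrow> s \<le> t \<longrightarrow> t \<le> b \<longrightarrow>
      norm (\<Phi> t - \<Phi> s - M s *v (x t - x s)) \<le> (K * w) * young_const (\<alpha> + \<nu>) * (t - s) powr (\<alpha> + \<nu>)"
  proof (rule sewing[OF exps(3)])
    fix s u t assume st: "a \<le> s" "s \<le> u" "u \<le> t" "t \<le> b"
    have "M s *v (x t - x s) - M s *v (x u - x s) - M u *v (x t - x u) = - ((M u - M s) *v (x t - x u))"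
      by (simp add: matrix_vector_mult_diff_distrib matrix_vector_mult_diff_rdistrib)
    then have "norm (M s *v (x t - x s) - M s *v (x u - x s) - M u *v (x t - x u))
       = norm ((M u - M s) *v (x t - x u))" by simp
    also have "\<dots> \<le> K * (u - s) powr \<alpha> * norm (x t - x u)"
      using M st by (auto simp: mhol_def)
    also have "\<dots> \<le> K * (u - s) powr \<alpha> * (w * (t - u) powr \<nu>)"
      using assms st by (intro mult_left_mono holD[OF x]) auto
    also have "\<dots> \<le> K * (t - s) powr \<alpha> * (w * (t - s) powr \<nu>)"
      using assms st by (intro mult_mono powr_mono2) auto
    also have "\<dots> = K * w * (t - s) powr (\<alpha> + \<nu>)" by (simp add: powr_add)
    finally show "norm (M s *v (x t - x s) - M s *v (x u - x s) - M u *v (x t - x u))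
        \<le> K * w * (t - s) powr (\<alpha> + \<nu>)" .
  qed (use assms in auto)
  then obtain \<Phi> where \<Phi>: "\<And>s t. a \<le> s \<Longrightarrow> s \<le> t \<Longrightarrow> t \<le> b \<Longrightarrow>
      norm (\<Phi> t - \<Phi> s - M s *v (x t - x s)) \<le> K * w * young_const (\<alpha> + \<nu>) * (t - s) powr (\<alpha> + \<nu>)"
    by blast
  have "has_young_integral M x s t (\<Phi> t - \<Phi> s)" if "a \<le> s" "s \<le> t" "t \<le> b" for s t
    by (rule has_young_integralI[OF exps(3), where C = "K * w * young_const (\<alpha> + \<nu>)"])
       (use that assms young_const_nonneg[OF exps(3)] \<Phi> in auto)
  then show thesis using \<Phi> that by blast
qed

text \<open>By uniqueness the estimate for the constructed integral holds for every value
  \<open>J\<close>. It is stated on [s, t] itself, so that constants of that interval can be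
  used.\<close>

lemma young_bound:
  fixes M :: "real \<Rightarrow> real^'m^'d"
  assumes J: "has_young_integral M x s t J" and "s \<le> t"
    and M: "mhol \<alpha> K s t M" and x: "hol \<nu> w s t x" and "0 \<le> K" "0 \<le> w"
    and exps: "0 < \<alpha>" "0 < \<nu>" "1 < \<alpha> + \<nu>"
  shows "norm (J - M s *v (x t - x s)) \<le> K * w * young_const (\<alpha> + \<nu>) * (t - s) powr (\<alpha> + \<nu>)"
proof -
  obtain \<Phi> where \<Phi>: "has_young_integral M x s t (\<Phi> t - \<Phi> s)"
    "norm (\<Phi> t - \<Phi> s - M s *v (x t - x s)) \<le> K * w * young_const (\<alpha> + \<nu>) * (t - s) powr (\<alpha> + \<nu>)"
    using young_integral_exists[OF M x assms(5,6) exps] assms(2) by (metis order_refl)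
  then show ?thesis using has_young_integral_unique[OF J \<Phi>(1) assms(2)] by simp
qed

section \<open>Hoelder norms and vanishing moduli\<close>

lemma sup_norm_le_iff:
  assumes "0 \<le> N"
  shows "sup_norm {a..b} y \<le> ennreal N \<longleftrightarrow> (\<forall>t. a \<le> t \<longrightarrow> t \<le> b \<longrightarrow> norm (y t) \<le> N)"
  using assms by (auto simp: sup_norm_def SUP_le_iff)

lemma holder_seminorm_le_iff:
  assumes "0 \<le> K"
  shows "holder_seminorm \<alpha> {a..b} y \<le> ennreal K \<longleftrightarrow> hol \<alpha> K a b y"
proof -
  have "ennreal (norm (y t - y s) / (t - s) powr \<alpha>) \<le> ennreal K \<longleftrightarrow> norm (y t - y s) \<le> K * (t - s) powr \<alpha>"
    if "s < t" for s t
    using that assms by (simp add: pos_divide_le_eq)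
  then have "holder_seminorm \<alpha> {a..b} y \<le> ennreal K \<longleftrightarrow>
      (\<forall>s t. a \<le> s \<longrightarrow> s < t \<longrightarrow> t \<le> b \<longrightarrow> norm (y t - y s) \<le> K * (t - s) powr \<alpha>)"
    unfolding holder_seminorm_def SUP_le_iff by fastforce
  also have "\<dots> \<longleftrightarrow> hol \<alpha> K a b y"
  proof -
    have "norm (y t - y s) \<le> K * (t - s) powr \<alpha>"
      if "\<forall>s t. a \<le> s \<longrightarrow> s < t \<longrightarrow> t \<le> b \<longrightarrow> norm (y t - y s) \<le> K * (t - s) powr \<alpha>"
        "a \<le> s" "s \<le> t" "t \<le> b" for s t
      using that by (cases "s = t") auto
    then show ?thesis unfolding hol_def by (meson less_imp_le)
  qed
  finally show ?thesis .
qed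

lemma holder_norm_le_imp_hb:
  assumes "holder_norm \<alpha> {a..b} y \<le> ennreal N" "0 \<le> N"
  shows "hb \<alpha> N a b y"
proof -
  have "sup_norm {a..b} y \<le> holder_norm \<alpha> {a..b} y" "holder_seminorm \<alpha> {a..b} y \<le> holder_norm \<alpha> {a..b} y"
    by (auto simp: holder_norm_def intro: add_increasing2 add_increasing)
  then have "sup_norm {a..b} y \<le> ennreal N" "holder_seminorm \<alpha> {a..b} y \<le> ennreal N"
    using assms(1) by (auto intro: order_trans)
  then show ?thesis
    using assms(2) by (simp add: sup_norm_le_iff holder_seminorm_le_iff hb_def)
qed

lemma hb_imp_holder_norm_le:
  assumes "hb \<alpha> N a b y" "0 \<le> N"
  shows "holder_norm \<alpha> {a..b} y \<le> ennreal (2 * N)"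
proof -
  have "holder_norm \<alpha> {a..b} y \<le> ennreal N + ennreal N"
    unfolding holder_norm_def using assms
    by (intro add_mono) (auto simp: sup_norm_le_iff holder_seminorm_le_iff hb_def)
  also have "ennreal N + ennreal N = ennreal (N + N)"
    by (rule ennreal_plus[symmetric]) (use assms in auto)
  finally show ?thesis unfolding mult_2 .
qed

lemma holder_norm_finite_iff: "holder_norm \<alpha> {a..b} y < \<top> \<longleftrightarrow> (\<exists>N\<ge>0. hb \<alpha> N a b y)"
proof
  assume "holder_norm \<alpha> {a..b} y < \<top>"
  then have "holder_norm \<alpha> {a..b} y \<le> ennreal (enn2real (holder_norm \<alpha> {a..b} y))" by simp
  then show "\<exists>N\<ge>0. hb \<alpha> N a b y"
    by (intro exI[of _ "enn2real (holder_norm \<alpha> {a..b} y)"] conjI holder_norm_le_imp_hb) auto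
next
  assume "\<exists>N\<ge>0. hb \<alpha> N a b y"
  then show "holder_norm \<alpha> {a..b} y < \<top>"
    by (auto dest!: hb_imp_holder_norm_le intro: order_le_less_trans)
qed

lemma holder_space_iff:
  "y \<in> holder_space \<alpha> {a..b} \<longleftrightarrow> y \<in> extensional {a..b} \<and> (\<exists>N\<ge>0. hb \<alpha> N a b y)"
  by (simp add: holder_space_def holder_norm_finite_iff)

lemma hb_holder_dist:
  assumes "x \<in> holder_space \<alpha> {a..b}" "y \<in> holder_space \<alpha> {a..b}"
  shows "hb \<alpha> (holder_dist \<alpha> {a..b} x y) a b (\<lambda>t. x t - y t)"
proof (rule holder_norm_le_imp_hb)
  have "holder_norm \<alpha> {a..b} (\<lambda>t. x t - y t) < \<top>"
    using assms by (intro holder_norm_diff_finite) (auto simp: holder_space_def)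
  then show "holder_norm \<alpha> {a..b} (\<lambda>t. x t - y t) \<le> ennreal (holder_dist \<alpha> {a..b} x y)"
    by (simp add: holder_dist_def)
qed (simp add: holder_dist_def)

lemma holder_dist_le:
  assumes "hb \<alpha> N a b (\<lambda>t. x t - y t)" "0 \<le> N"
  shows "holder_dist \<alpha> {a..b} x y \<le> 2 * N"
  unfolding holder_dist_def using hb_imp_holder_norm_le[OF assms] assms(2)
  by (intro enn2real_leI) auto

text \<open>Lower semicontinuity of the seminorm: pointwise convergence is enough to keep a Hoelder
  bound, no convergence in norm is required.\<close>

lemma hol_limit:
  assumes "\<And>n::nat. hol \<alpha> (K n) a b (z n)" "\<And>t. a \<le> t \<Longrightarrow> t \<le> b \<Longrightarrow> (\<lambda>n. z n t) \<longlonglongrightarrow> z' t" "K \<longlonglongrightarrow> L"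
  shows "hol \<alpha> L a b z'"
  unfolding hol_def
proof (intro allI impI)
  fix s t assume st: "a \<le> s" "s \<le> t" "t \<le> b"
  have "(\<lambda>n. norm (z n t - z n s)) \<longlonglongrightarrow> norm (z' t - z' s)"
    using st by (intro tendsto_intros assms(2)) auto
  moreover have "(\<lambda>n. K n * (t - s) powr \<alpha>) \<longlonglongrightarrow> L * (t - s) powr \<alpha>"
    by (intro tendsto_intros assms(3))
  ultimately show "norm (z' t - z' s) \<le> L * (t - s) powr \<alpha>"
    by (rule LIMSEQ_le) (use holD[OF assms(1)] st in auto)
qed

lemma hb_limit:
  assumes "\<And>n::nat. hb \<alpha> (K n) a b (z n)" "\<And>t. a \<le> t \<Longrightarrow> t \<le> b \<Longrightarrow> (\<lambda>n. z n t) \<longlonglongrightarrow> z' t" "K \<longlonglongrightarrow> L"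
  shows "hb \<alpha> L a b z'"
  unfolding hb_def
proof (intro conjI allI impI)
  fix t assume t: "a \<le> t" "t \<le> b"
  show "norm (z' t) \<le> L"
    by (rule LIMSEQ_le[OF tendsto_norm[OF assms(2)[OF t]] assms(3)]) (use hbD[OF assms(1)] t in auto)
qed (rule hol_limit[OF hb_hol[OF assms(1)] assms(2,3)])

text \<open>A Cauchy sequence converges pointwise; its Cauchy estimates pass to the limit in the
  second index by \<open>hb_limit\<close> and thereby become convergence in norm.\<close>

lemma mcomplete_holder:
  "Metric_space.mcomplete (holder_space \<alpha> {a..b} :: (real \<Rightarrow> 'a::banach) set) (holder_dist \<alpha> {a..b})"
proof -
  interpret Metric_space "holder_space \<alpha> {a..b} :: (real \<Rightarrow> 'a) set" "holder_dist \<alpha> {a..b}"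
    by (rule Metric_space_holder)
  have "\<exists>y. limitin mtopology \<sigma> y sequentially" if C: "MCauchy \<sigma>" for \<sigma> :: "nat \<Rightarrow> real \<Rightarrow> 'a"
  proof -
    have \<sigma>: "\<sigma> n \<in> holder_space \<alpha> {a..b}" for n using C by (auto simp: MCauchy_def)
    have C': "\<exists>N. \<forall>n m. N \<le> n \<longrightarrow> N \<le> m \<longrightarrow> hb \<alpha> e a b (\<lambda>t. \<sigma> n t - \<sigma> m t)" if "0 < e" for e
    proof -
      obtain N where "\<And>n m. N \<le> n \<Longrightarrow> N \<le> m \<Longrightarrow> holder_dist \<alpha> {a..b} (\<sigma> n) (\<sigma> m) < e"
        using C \<open>0 < e\<close> unfolding MCauchy_def by blast
      then show ?thesis using hb_mono[OF hb_holder_dist[OF \<sigma> \<sigma>]] less_imp_le by blast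
    qed
    have "convergent (\<lambda>n. \<sigma> n t)" if "a \<le> t" "t \<le> b" for t
    proof (rule Cauchy_convergent, rule CauchyI)
      fix e :: real assume "0 < e"
      then have "0 < e / 2" by simp
      from C'[OF this] obtain N where N: "\<And>n m. N \<le> n \<Longrightarrow> N \<le> m \<Longrightarrow> hb \<alpha> (e / 2) a b (\<lambda>t. \<sigma> n t - \<sigma> m t)"
        by blast
      have "norm (\<sigma> m t - \<sigma> n t) < e" if "N \<le> m" "N \<le> n" for m n
        using hbD[OF N[OF that] \<open>a \<le> t\<close> \<open>t \<le> b\<close>] \<open>0 < e\<close> by simp
      then show "\<exists>M. \<forall>m\<ge>M. \<forall>n\<ge>M. norm (\<sigma> m t - \<sigma> n t) < e" by blast
    qed
    then obtain y0 where y0: "\<And>t. a \<le> t \<Longrightarrow> t \<le> b \<Longrightarrow> (\<lambda>n. \<sigma> n t) \<longlonglongrightarrow> y0 t"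
      unfolding convergent_def by metis
    define y where "y = restrict y0 {a..b}"
    have y: "(\<lambda>n. \<sigma> n t) \<longlonglongrightarrow> y t" if "a \<le> t" "t \<le> b" for t
      using y0 that by (simp add: y_def)
    have lim: "\<exists>N. \<forall>n\<ge>N. hb \<alpha> e a b (\<lambda>t. \<sigma> n t - y t)" if e: "0 < e" for e
    proof -
      obtain N where N: "\<And>n m. N \<le> n \<Longrightarrow> N \<le> m \<Longrightarrow> hb \<alpha> e a b (\<lambda>t. \<sigma> n t - \<sigma> m t)"
        using C'[OF e] by blast
      have "hb \<alpha> e a b (\<lambda>t. \<sigma> n t - y t)" if "N \<le> n" for n
      proof (rule hb_limit[where K = "\<lambda>_. e" and z = "\<lambda>k t. \<sigma> n t - \<sigma> (k + N) t"])
        show "(\<lambda>k. \<sigma> n t - \<sigma> (k + N) t) \<longlonglongrightarrow> \<sigma> n t - y t" if "a \<le> t" "t \<le> b" for t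
          by (intro tendsto_intros LIMSEQ_ignore_initial_segment y that)
      qed (use N that in auto)
      then show ?thesis by blast
    qed
    have yin: "y \<in> holder_space \<alpha> {a..b}"
    proof -
      obtain n where n: "hb \<alpha> 1 a b (\<lambda>t. \<sigma> n t - y t)" using lim[of 1] by auto
      obtain N where N: "0 \<le> N" "hb \<alpha> N a b (\<sigma> n)" using \<sigma>[of n] by (auto simp: holder_space_iff)
      have "hb \<alpha> (N + 1) a b (\<lambda>t. \<sigma> n t - (\<sigma> n t - y t))" by (rule hb_diff[OF N(2) n])
      then have "hb \<alpha> (N + 1) a b y" by simp
      then show ?thesis using N(1) by (auto simp: holder_space_iff y_def intro!: exI[of _ "N + 1"])
    qed
    have "\<forall>\<^sub>F n in sequentially. \<sigma> n \<in> holder_space \<alpha> {a..b} \<and> holder_dist \<alpha> {a..b} (\<sigma> n) y < e" if e: "0 < e" for e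
    proof -
      obtain N where N: "\<And>n. n \<ge> N \<Longrightarrow> hb \<alpha> (e / 4) a b (\<lambda>t. \<sigma> n t - y t)" using lim[of "e / 4"] e by auto
      have "holder_dist \<alpha> {a..b} (\<sigma> n) y < e" if "N \<le> n" for n
        using holder_dist_le[OF N[OF that]] e by simp
      then show ?thesis using \<sigma> by (auto simp: eventually_sequentially)
    qed
    then show ?thesis using yin by (auto simp: limitin_metric)
  qed
  then show ?thesis by (simp add: mcomplete_def)
qed

section \<open>Vanishing Hoelder modulus as an intrinsic description of the closure of the smooth
  paths\<close>

definition vm :: "real \<Rightarrow> real \<Rightarrow> real \<Rightarrow> (real \<Rightarrow> 'a::real_normed_vector) \<Rightarrow> bool" where
  "vm \<alpha> a b y \<longleftrightarrow> (\<forall>e>0. \<exists>\<delta>>0. \<forall>s t. a \<le> s \<longrightarrow> s \<le> t \<longrightarrow> t \<le> b \<longrightarrow> t - s < \<delta> \<longrightarrow>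
     norm (y t - y s) \<le> e * (t - s) powr \<alpha>)"

lemma vm_subset: "vm \<alpha> a b y \<Longrightarrow> a \<le> a' \<Longrightarrow> b' \<le> b \<Longrightarrow> vm \<alpha> a' b' y"
  unfolding vm_def by (meson order_trans)

lemma vm_cong:
  assumes "\<And>t. a \<le> t \<Longrightarrow> t \<le> b \<Longrightarrow> y t = z t"
  shows "vm \<alpha> a b y \<longleftrightarrow> vm \<alpha> a b z"
proof -
  have "norm (y t - y s) = norm (z t - z s)" if "a \<le> s" "s \<le> t" "t \<le> b" for s t
    using assms that by simp
  then have "(a \<le> s \<longrightarrow> s \<le> t \<longrightarrow> t \<le> b \<longrightarrow> t - s < \<delta> \<longrightarrow> norm (y t - y s) \<le> e * (t - s) powr \<alpha>) \<longleftrightarrow>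
      (a \<le> s \<longrightarrow> s \<le> t \<longrightarrow> t \<le> b \<longrightarrow> t - s < \<delta> \<longrightarrow> norm (z t - z s) \<le> e * (t - s) powr \<alpha>)" for s t \<delta> e
    by auto
  then show ?thesis unfolding vm_def by simp
qed

lemma vm_shift:
  assumes "vm \<alpha> (c + a) (c + b) y"
  shows "vm \<alpha> a b (\<lambda>t. y (c + t))"
  unfolding vm_def
proof (intro allI impI)
  fix e :: real assume "0 < e"
  then obtain \<delta> where \<delta>: "0 < \<delta>" "\<And>s t. c + a \<le> s \<Longrightarrow> s \<le> t \<Longrightarrow> t \<le> c + b \<Longrightarrow> t - s < \<delta> \<Longrightarrow>
     norm (y t - y s) \<le> e * (t - s) powr \<alpha>"
    using assms unfolding vm_def by blast
  have "norm (y (c + t) - y (c + s)) \<le> e * (t - s) powr \<alpha>"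
    if "a \<le> s" "s \<le> t" "t \<le> b" "t - s < \<delta>" for s t
    using \<delta>(2)[of "c + s" "c + t"] that by simp
  then show "\<exists>\<delta>>0. \<forall>s t. a \<le> s \<longrightarrow> s \<le> t \<longrightarrow> t \<le> b \<longrightarrow> t - s < \<delta> \<longrightarrow>
     norm (y (c + t) - y (c + s)) \<le> e * (t - s) powr \<alpha>"
    using \<delta>(1) by blast
qed

lemma hol_imp_vm:
  assumes "hol \<beta> K a b y" "\<alpha> < \<beta>"
  shows "vm \<alpha> a b y"
  unfolding vm_def
proof (intro allI impI)
  fix e :: real assume e: "0 < e"
  \<comment> \<open>Increments shorter than \<delta> gain the factor
    \<open>\<delta> powr (\<beta> - \<alpha>)\<close>; \<open>\<bar>K\<bar> + 1\<close> is positive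
    for every real \<open>K\<close>.\<close>
  define \<delta> where "\<delta> = (e / (\<bar>K\<bar> + 1)) powr (1 / (\<beta> - \<alpha>))"
  have \<delta>: "0 < \<delta>" "\<delta> powr (\<beta> - \<alpha>) = e / (\<bar>K\<bar> + 1)"
    using e assms(2) by (auto simp: \<delta>_def powr_powr)
  have "norm (y t - y s) \<le> e * (t - s) powr \<alpha>"
    if st: "a \<le> s" "s \<le> t" "t \<le> b" "t - s < \<delta>" for s t
  proof -
    have "norm (y t - y s) \<le> K * (t - s) powr \<beta>" using holD[OF assms(1)] st by blast
    also have "\<dots> \<le> (\<bar>K\<bar> + 1) * (t - s) powr \<beta>" by (intro mult_right_mono) auto
    also have "(t - s) powr \<beta> = (t - s) powr (\<beta> - \<alpha>) * (t - s) powr \<alpha>" by (simp flip: powr_add)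
    also have "(\<bar>K\<bar> + 1) * \<dots> \<le> (\<bar>K\<bar> + 1) * (\<delta> powr (\<beta> - \<alpha>) * (t - s) powr \<alpha>)"
      using st assms(2) by (intro mult_left_mono mult_right_mono powr_mono2) auto
    also have "\<dots> = e * (t - s) powr \<alpha>" using \<delta>(2) by simp
    finally show ?thesis .
  qed
  then show "\<exists>\<delta>>0. \<forall>s t. a \<le> s \<longrightarrow> s \<le> t \<longrightarrow> t \<le> b \<longrightarrow> t - s < \<delta> \<longrightarrow>
     norm (y t - y s) \<le> e * (t - s) powr \<alpha>" using \<delta>(1) by blast
qed

lemma vm_glue:
  assumes "vm \<alpha> a b y" "vm \<alpha> b c y" "0 < \<alpha>"
  shows "vm \<alpha> a c y"
  unfolding vm_def
proof (intro allI impI)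
  fix e :: real assume "0 < e"
  then have e: "0 < e / 2" by simp
  obtain \<delta> where \<delta>: "0 < \<delta>" "\<And>s t. a \<le> s \<Longrightarrow> s \<le> t \<Longrightarrow> t \<le> b \<Longrightarrow> t - s < \<delta> \<Longrightarrow>
     norm (y t - y s) \<le> e / 2 * (t - s) powr \<alpha>"
    using assms(1) e unfolding vm_def by blast
  obtain \<delta>' where \<delta>': "0 < \<delta>'" "\<And>s t. b \<le> s \<Longrightarrow> s \<le> t \<Longrightarrow> t \<le> c \<Longrightarrow> t - s < \<delta>' \<Longrightarrow>
     norm (y t - y s) \<le> e / 2 * (t - s) powr \<alpha>"
    using assms(2) e unfolding vm_def by blast
  have "norm (y t - y s) \<le> e * (t - s) powr \<alpha>"
    if st: "a \<le> s" "s \<le> t" "t \<le> c" "t - s < min \<delta> \<delta>'" for s t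
  proof -
    have half: "e / 2 * (t - s) powr \<alpha> \<le> e * (t - s) powr \<alpha>" using e by (intro mult_right_mono) auto
    consider "t \<le> b" | "b \<le> s" | "s \<le> b" "b \<le> t" by linarith
    then show ?thesis
    proof cases
      case 1
      then show ?thesis using \<delta>(2)[of s t] st half by simp
    next
      case 2
      then show ?thesis using \<delta>'(2)[of s t] st half by simp
    next
      case 3
      have "norm (y t - y s) \<le> norm (y b - y s) + norm (y t - y b)"
        using norm_triangle_ineq[of "y b - y s" "y t - y b"] by simp
      also have "\<dots> \<le> e / 2 * (b - s) powr \<alpha> + e / 2 * (t - b) powr \<alpha>"
        using 3 st by (intro add_mono \<delta>(2) \<delta>'(2)) auto
      also have "\<dots> \<le> e / 2 * (t - s) powr \<alpha> + e / 2 * (t - s) powr \<alpha>"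
        using 3 st assms e by (intro add_mono mult_left_mono powr_mono2) auto
      finally show ?thesis by simp
    qed
  qed
  then show "\<exists>\<delta>>0. \<forall>s t. a \<le> s \<longrightarrow> s \<le> t \<longrightarrow> t \<le> c \<longrightarrow> t - s < \<delta> \<longrightarrow>
     norm (y t - y s) \<le> e * (t - s) powr \<alpha>"
    using \<delta>(1) \<delta>'(1) by (intro exI[of _ "min \<delta> \<delta>'"]) auto
qed

lemma vm_imp_continuous_on:
  assumes "vm \<alpha> a b y" "0 < \<alpha>"
  shows "continuous_on {a..b} y"
proof -
  obtain \<delta> where \<delta>: "0 < \<delta>" "\<And>s t. a \<le> s \<Longrightarrow> s \<le> t \<Longrightarrow> t \<le> b \<Longrightarrow> t - s < \<delta> \<Longrightarrow>
     norm (y t - y s) \<le> 1 * (t - s) powr \<alpha>"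
    using assms(1) zero_less_one unfolding vm_def by blast
  show ?thesis unfolding continuous_on_def
  proof
    fix s assume s: "s \<in> {a..b}"
    have "((\<lambda>t. \<bar>t - s\<bar> powr \<alpha>) \<longlongrightarrow> \<bar>s - s\<bar> powr \<alpha>) (at s within {a..b})"
      using assms(2) by (intro tendsto_intros) (auto simp: eventually_at_filter)
    then have 0: "((\<lambda>t. \<bar>t - s\<bar> powr \<alpha>) \<longlongrightarrow> 0) (at s within {a..b})"
      by simp
    have "eventually (\<lambda>t. norm (y t - y s) \<le> \<bar>t - s\<bar> powr \<alpha>) (at s within {a..b})"
      unfolding eventually_at
    proof (intro exI[of _ \<delta>] conjI ballI impI \<delta>(1))
      fix t assume t: "t \<in> {a..b}" "t \<noteq> s \<and> dist t s < \<delta>"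
      show "norm (y t - y s) \<le> \<bar>t - s\<bar> powr \<alpha>"
        using \<delta>(2)[of s t] \<delta>(2)[of t s] t s by (cases "s \<le> t") (auto simp: dist_real_def norm_minus_commute abs_if split: if_splits)
    qed
    then have "((\<lambda>t. y t - y s) \<longlongrightarrow> 0) (at s within {a..b})"
      by (rule Lim_null_comparison[OF _ 0])
    then show "(y \<longlongrightarrow> y s) (at s within {a..b})"
      by (simp add: LIM_zero_iff)
  qed
qed

text \<open>Short increments are controlled by the modulus at e = 1, long ones by the bound of the
  continuous path divided by \<open>\<delta> powr \<alpha>\<close>.\<close>

lemma vm_imp_hol:
  assumes "vm \<alpha> a b y" "0 < \<alpha>"
  shows "\<exists>K\<ge>0. hol \<alpha> K a b y"
proof -
  obtain \<delta> where \<delta>: "0 < \<delta>" "\<And>s t. a \<le> s \<Longrightarrow> s \<le> t \<Longrightarrow> t \<le> b \<Longrightarrow> t - s < \<delta> \<Longrightarrow>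
     norm (y t - y s) \<le> 1 * (t - s) powr \<alpha>"
    using assms(1) zero_less_one unfolding vm_def by blast
  have "compact (y ` {a..b})"
    by (intro compact_continuous_image vm_imp_continuous_on[OF assms] compact_Icc)
  then obtain B where B: "0 < B" "\<And>t. a \<le> t \<Longrightarrow> t \<le> b \<Longrightarrow> norm (y t) \<le> B"
    using compact_imp_bounded bounded_pos by (metis atLeastAtMost_iff image_eqI)
  let ?K = "1 + 2 * B / \<delta> powr \<alpha>"
  have "norm (y t - y s) \<le> ?K * (t - s) powr \<alpha>" if st: "a \<le> s" "s \<le> t" "t \<le> b" for s t
  proof (cases "t - s < \<delta>")
    case True
    have "norm (y t - y s) \<le> 1 * (t - s) powr \<alpha>" using \<delta>(2) st True by blast
    also have "\<dots> \<le> ?K * (t - s) powr \<alpha>" using B \<delta> by (intro mult_right_mono) auto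
    finally show ?thesis .
  next
    case False
    have "norm (y t - y s) \<le> norm (y t) + norm (y s)" by (rule norm_triangle_ineq4)
    also have "\<dots> \<le> B + B" using B st by (intro add_mono) auto
    also have "\<dots> = 2 * B / \<delta> powr \<alpha> * \<delta> powr \<alpha>" using \<delta> by simp
    also have "\<dots> \<le> 2 * B / \<delta> powr \<alpha> * (t - s) powr \<alpha>"
      using False B \<delta> assms(2) by (intro mult_left_mono powr_mono2) auto
    also have "\<dots> \<le> ?K * (t - s) powr \<alpha>" by (intro mult_right_mono) auto
    finally show ?thesis .
  qed
  moreover have "0 \<le> ?K" using B \<delta> by simp
  ultimately show ?thesis by (auto simp: hol_def intro!: exI[of _ ?K])
qed

lemma vector_mvt_bound:
  fixes f :: "real \<Rightarrow> 'a::banach"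
  assumes "a \<le> b" "\<And>u. u \<in> {a..b} \<Longrightarrow> (f has_vector_derivative f' u) (at u within {a..b})"
    and "\<And>u. u \<in> {a..b} \<Longrightarrow> norm (f' u) \<le> B"
  shows "norm (f b - f a) \<le> B * (b - a)"
proof -
  have "(f' has_integral (f b - f a)) {a..b}"
    by (rule fundamental_theorem_of_calculus) (use assms in auto)
  moreover have "norm (f' a) \<le> B" using assms(1) by (intro assms(3)) simp
  then have "0 \<le> B" by (rule order_trans[OF norm_ge_zero])
  ultimately show ?thesis
    using has_integral_bound_real[of B "{}" f' "f b - f a" a b] assms by simp
qed

text \<open>Steklov averages of a path with vanishing modulus converge to it in the Hoelder norm;
  their derivatives are continuous and hence uniformly approximable by polynomials.\<close>

lemma vm_approx_smooth:
  fixes y :: "real \<Rightarrow> 'a::euclidean_space"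
  assumes vm: "vm \<alpha> a b y" and \<alpha>: "0 < \<alpha>" "\<alpha> < 1" and ab: "a < b" and e: "0 < e"
  shows "\<exists>p\<in>smooth_paths {a..b}. hb \<alpha> e a b (\<lambda>t. y t - p t)"
proof -
  obtain K where K: "0 \<le> K" "hol \<alpha> K a b y" using vm_imp_hol[OF vm \<alpha>(1)] by blast
  define e1 where "e1 = e / 4"
  have e1: "0 < e1" using e by (simp add: e1_def)
  obtain \<delta> where \<delta>: "0 < \<delta>" "\<And>s t. a \<le> s \<Longrightarrow> s \<le> t \<Longrightarrow> t \<le> b \<Longrightarrow> t - s < \<delta> \<Longrightarrow>
     norm (y t - y s) \<le> e1 * (t - s) powr \<alpha>"
    using vm e1 unfolding vm_def by blast
  \<comment> \<open>Constant extension beyond [a, b], so that the averages over [t, t + h] exist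
    near \<open>b\<close>. Clamping does not increase distances, hence all increment bounds
    persist.\<close>
  define yb where "yb t = y (max a (min b t))" for t
  have cl: "max a (min b t) \<in> {a..b}" for t using ab by auto
  have yb_eq: "yb t = y t" if "a \<le> t" "t \<le> b" for t using that by (simp add: yb_def max_def min_def)
  have ybK: "norm (yb t - yb s) \<le> K * (t - s) powr \<alpha>" if "s \<le> t" for s t
  proof -
    have "norm (yb t - yb s) \<le> K * (max a (min b t) - max a (min b s)) powr \<alpha>"
      unfolding yb_def using that ab by (intro holD[OF K(2)]) auto
    also have "\<dots> \<le> K * (t - s) powr \<alpha>"
      using that ab K \<alpha> by (intro mult_left_mono powr_mono2) auto
    finally show ?thesis .
  qed
  have yb\<delta>: "norm (yb t - yb s) \<le> e1 * (t - s) powr \<alpha>" if "s \<le> t" "t - s < \<delta>" for s t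
  proof -
    have "norm (yb t - yb s) \<le> e1 * (max a (min b t) - max a (min b s)) powr \<alpha>"
      unfolding yb_def using that ab by (intro \<delta>(2)) auto
    also have "\<dots> \<le> e1 * (t - s) powr \<alpha>"
      using that ab e1 \<alpha> by (intro mult_left_mono powr_mono2) auto
    finally show ?thesis .
  qed
  have "hol \<alpha> K c d yb" for c d by (auto simp: hol_def intro: ybK)
  then have cont: "continuous_on {c..d} yb" for c d using hol_imp_continuous_on \<alpha> by blast
  \<comment> \<open>Two demands on \<open>h\<close>: the sup error
    \<open>K * h powr \<alpha>\<close> stays below \<open>e1\<close>, and twice this error stays
    below \<open>e1 * \<delta> powr \<alpha>\<close>, which settles all increments longer than
    \<delta>.\<close>
  obtain h where h: "0 < h" "h \<le> 1" "K * h powr \<alpha> \<le> e1" "2 * K * h powr \<alpha> \<le> e1 * \<delta> powr \<alpha>"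
  proof -
    define m where "m = min e1 (e1 * \<delta> powr \<alpha>) / (2 * K + 1)"
    have m: "0 < m" using e1 \<delta> K by (simp add: m_def)
    define h where "h = min 1 (m powr (1 / \<alpha>))"
    have "h powr \<alpha> \<le> (m powr (1 / \<alpha>)) powr \<alpha>" using \<alpha> by (intro powr_mono2) (auto simp: h_def)
    also have "\<dots> = m" using m \<alpha> by (simp add: powr_powr)
    finally have "h powr \<alpha> * (2 * K + 1) \<le> m * (2 * K + 1)" using K by (intro mult_right_mono) auto
    also have "\<dots> = min e1 (e1 * \<delta> powr \<alpha>)" using K by (simp add: m_def)
    finally have *: "h powr \<alpha> * (2 * K + 1) \<le> min e1 (e1 * \<delta> powr \<alpha>)" .
    have "2 * K * h powr \<alpha> \<le> h powr \<alpha> * (2 * K + 1)" by (simp add: algebra_simps)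
    moreover have "K * h powr \<alpha> \<le> h powr \<alpha> * (2 * K + 1)" using K by (simp add: algebra_simps)
    ultimately have "K * h powr \<alpha> \<le> e1" "2 * K * h powr \<alpha> \<le> e1 * \<delta> powr \<alpha>" using * by simp_all
    moreover have "0 < h" "h \<le> 1" using m by (auto simp: h_def)
    ultimately show thesis using that by blast
  qed
  obtain Y where Y0: "\<And>t. t \<in> {a - 1..b + 2} \<Longrightarrow> (Y has_vector_derivative yb t) (at t within {a - 1..b + 2})"
    using antiderivative_continuous[OF cont] by blast
  have Y: "(Y has_vector_derivative yb t) (at t)" if "a \<le> t" "t \<le> b + 1" for t
    using Y0[of t] that by (simp add: at_within_Icc_at)
  define z where "z t = (1 / h) *\<^sub>R (Y (t + h) - Y t)" for t
  \<comment> \<open>An increment of z - y is the mean over u in [0, h] of the differences in the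
    hypothesis, so a bound uniform in \<open>u\<close> carries over; \<open>D h - D 0\<close> is
    \<open>h\<close> times that increment.\<close>
  have zy: "norm (z t - y t - (z s - y s)) \<le> B"
    if st: "t \<in> {a..b}" "s \<in> {a..b}" and B: "\<And>u. 0 \<le> u \<Longrightarrow> u \<le> h \<Longrightarrow> norm (yb (t + u) - yb t - (yb (s + u) - yb s)) \<le> B" for t s B
  proof -
    define D where "D u = Y (t + u) - u *\<^sub>R y t - (Y (s + u) - u *\<^sub>R y s)" for u
    have Yd: "((\<lambda>u. Y (c + u)) has_vector_derivative yb (c + u)) (at u within {0..h})"
      if "c \<in> {a..b}" "u \<in> {0..h}" for c u
    proof -
      have "((Y \<circ> (\<lambda>u. c + u)) has_vector_derivative (1 *\<^sub>R yb (c + u))) (at u)"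
        by (rule vector_diff_chain_at) (use that h in \<open>auto intro!: derivative_eq_intros Y\<close>)
      then show ?thesis by (simp add: o_def has_vector_derivative_at_within)
    qed
    have "norm (D h - D 0) \<le> B * (h - 0)"
    proof (rule vector_mvt_bound)
      fix u assume u: "u \<in> {0..h}"
      show "(D has_vector_derivative (yb (t + u) - yb t - (yb (s + u) - yb s))) (at u within {0..h})"
        unfolding D_def using st u by (auto intro!: derivative_eq_intros Yd simp: yb_eq)
      show "norm (yb (t + u) - yb t - (yb (s + u) - yb s)) \<le> B" using B u by auto
    qed (use h in auto)
    moreover have "D h - D 0 = h *\<^sub>R (z t - y t - (z s - y s))"
      using h by (simp add: D_def z_def algebra_simps)
    ultimately show ?thesis using h by (simp add: mult.commute)
  qed
  have z0: "norm (z t - y t) \<le> K * h powr \<alpha>" if t: "t \<in> {a..b}" for t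
  proof -
    define D where "D u = Y (t + u) - u *\<^sub>R y t" for u
    have "norm (D h - D 0) \<le> (K * h powr \<alpha>) * (h - 0)"
    proof (rule vector_mvt_bound)
      fix u assume u: "u \<in> {0..h}"
      have "((Y \<circ> (\<lambda>u. t + u)) has_vector_derivative (1 *\<^sub>R yb (t + u))) (at u)"
        by (rule vector_diff_chain_at) (use u t h in \<open>auto intro!: derivative_eq_intros Y\<close>)
      then have "((\<lambda>u. Y (t + u)) has_vector_derivative yb (t + u)) (at u within {0..h})"
        by (simp add: o_def has_vector_derivative_at_within)
      then show "(D has_vector_derivative (yb (t + u) - yb t)) (at u within {0..h})"
        unfolding D_def using t by (auto intro!: derivative_eq_intros simp: yb_eq)
      have "norm (yb (t + u) - yb t) \<le> K * (t + u - t) powr \<alpha>" using u by (intro ybK) auto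
      also have "\<dots> \<le> K * h powr \<alpha>" using u K \<alpha> by (intro mult_left_mono powr_mono2) auto
      finally show "norm (yb (t + u) - yb t) \<le> K * h powr \<alpha>" .
    qed (use h in auto)
    moreover have "D h - D 0 = h *\<^sub>R (z t - y t)"
      using h by (simp add: D_def z_def algebra_simps)
    ultimately show ?thesis using h by (simp add: mult.commute)
  qed
  have zh: "norm (z t - y t - (z s - y s)) \<le> 2 * e1 * (t - s) powr \<alpha>"
    if st: "a \<le> s" "s \<le> t" "t \<le> b" for s t
  proof (cases "t - s < \<delta>")
    case True
    show ?thesis
    proof (rule zy)
      fix u :: real assume u: "0 \<le> u" "u \<le> h"
      have "norm (yb (t + u) - yb t - (yb (s + u) - yb s)) = norm ((yb (t + u) - yb (s + u)) - (yb t - yb s))"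
        by (simp add: algebra_simps)
      also have "\<dots> \<le> norm (yb (t + u) - yb (s + u)) + norm (yb t - yb s)" by (rule norm_triangle_ineq4)
      also have "\<dots> \<le> e1 * (t + u - (s + u)) powr \<alpha> + e1 * (t - s) powr \<alpha>"
        using st True by (intro add_mono yb\<delta>) auto
      finally show "norm (yb (t + u) - yb t - (yb (s + u) - yb s)) \<le> 2 * e1 * (t - s) powr \<alpha>" by simp
    qed (use st in auto)
  next
    case False
    have "norm (z t - y t - (z s - y s)) \<le> norm (z t - y t) + norm (z s - y s)" by (rule norm_triangle_ineq4)
    also have "\<dots> \<le> K * h powr \<alpha> + K * h powr \<alpha>" using st by (intro add_mono z0) auto
    also have "\<dots> \<le> e1 * \<delta> powr \<alpha>" using h(4) by simp
    also have "\<dots> \<le> e1 * (t - s) powr \<alpha>" using False e1 \<delta> \<alpha> by (intro mult_left_mono powr_mono2) auto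
    also have "\<dots> \<le> 2 * e1 * (t - s) powr \<alpha>" using e1 by (intro mult_right_mono) auto
    finally show ?thesis .
  qed
  define w where "w t = (1 / h) *\<^sub>R (yb (t + h) - yb t)" for t
  have zw: "(z has_vector_derivative w t) (at t)" if "a \<le> t" "t \<le> b" for t
  proof -
    have "((Y \<circ> (\<lambda>u. u + h)) has_vector_derivative (1 *\<^sub>R yb (t + h))) (at t)"
      by (rule vector_diff_chain_at) (use that h in \<open>auto intro!: derivative_eq_intros Y\<close>)
    then have "((\<lambda>u. Y (u + h)) has_vector_derivative yb (t + h)) (at t)" by (simp add: o_def)
    then show ?thesis unfolding z_def w_def using that h
      by (auto intro!: derivative_eq_intros Y)
  qed
  \<comment> \<open>A uniform error \<open>e2\<close> of the derivative costs at most
    \<open>e2 * (b - a)\<close> in the sup norm and \<open>e2 * (b - a) powr (1 - \<alpha>)\<close>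
    in the seminorm; both are at most \<open>e1\<close>.\<close>
  define e2 where "e2 = e1 / ((b - a) + (b - a) powr (1 - \<alpha>))"
  have den: "0 < (b - a) + (b - a) powr (1 - \<alpha>)" using ab by (simp add: add_pos_pos)
  have e2: "0 < e2" "e2 * (b - a) \<le> e1" "e2 * (b - a) powr (1 - \<alpha>) \<le> e1"
    using e1 den ab by (auto simp: e2_def field_simps)
  have "continuous_on {a..b} w"
  proof -
    have "continuous_on {a..b} (\<lambda>t. yb (t + h))"
      by (rule continuous_on_compose2[OF cont[of "a + h" "b + h"]]) (auto intro!: continuous_intros)
    then show ?thesis unfolding w_def by (intro continuous_intros cont)
  qed
  then obtain q where q: "polynomial_function q" "\<And>t. t \<in> {a..b} \<Longrightarrow> norm (w t - q t) < e2"
    using Stone_Weierstrass_polynomial_function[of "{a..b}" w e2] e2 by auto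
  obtain Q0 where Q0: "\<And>t. t \<in> {a..b} \<Longrightarrow> (Q0 has_vector_derivative q t) (at t within {a..b})"
    using antiderivative_continuous[of a b q] q(1) continuous_on_polymonial_function by blast
  \<comment> \<open>The primitive is adjusted to agree with \<open>z\<close> at \<open>a\<close>,
    which turns increment bounds for z - Q into sup bounds.\<close>
  define Q where "Q t = Q0 t + (z a - Q0 a)" for t
  have Q: "(Q has_vector_derivative q t) (at t within {a..b})" if "t \<in> {a..b}" for t
    unfolding Q_def using Q0[OF that] by (auto intro!: derivative_eq_intros)
  have QA: "Q a = z a" by (simp add: Q_def)
  have zQ: "norm (z t - Q t - (z s - Q s)) \<le> e2 * (t - s)" if st: "a \<le> s" "s \<le> t" "t \<le> b" for s t
  proof (rule vector_mvt_bound[where f = "\<lambda>t. z t - Q t" and f' = "\<lambda>t. w t - q t"])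
    fix u assume u: "u \<in> {s..t}"
    have "(Q has_vector_derivative q u) (at u within {s..t})"
      by (rule has_vector_derivative_within_subset[OF Q]) (use u st in auto)
    then show "((\<lambda>t. z t - Q t) has_vector_derivative w u - q u) (at u within {s..t})"
      using u st by (intro has_vector_derivative_diff has_vector_derivative_at_within[OF zw]) auto
    show "norm (w u - q u) \<le> e2" using q(2)[of u] u st by simp
  qed (use st in auto)
  define p where "p = restrict Q {a..b}"
  have "hb \<alpha> e a b (\<lambda>t. y t - p t)"
    unfolding hb_def hol_def
  proof (intro conjI allI impI)
    fix t assume t: "a \<le> t" "t \<le> b"
    have "y t - p t = (z t - Q t - (z a - Q a)) - (z t - y t)"
      using t QA by (simp add: p_def)
    then have "norm (y t - p t) \<le> norm (z t - Q t - (z a - Q a)) + norm (z t - y t)"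
      by (simp only: norm_triangle_ineq4)
    also have "\<dots> \<le> e2 * (t - a) + K * h powr \<alpha>" using t by (intro add_mono zQ z0) auto
    also have "\<dots> \<le> e2 * (b - a) + K * h powr \<alpha>" using t e2 by simp
    also have "\<dots> \<le> e" using e2 h e by (simp add: e1_def)
    finally show "norm (y t - p t) \<le> e" .
  next
    fix s t assume st: "a \<le> s" "s \<le> t" "t \<le> b"
    have "y t - p t - (y s - p s) = (z t - Q t - (z s - Q s)) - (z t - y t - (z s - y s))"
      using st by (simp add: p_def)
    then have "norm (y t - p t - (y s - p s)) \<le> norm (z t - Q t - (z s - Q s)) + norm (z t - y t - (z s - y s))"
      by (simp only: norm_triangle_ineq4)
    also have "\<dots> \<le> e2 * (t - s) + 2 * e1 * (t - s) powr \<alpha>" using st by (intro add_mono zQ zh) auto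
    also have "e2 * (t - s) = e2 * ((t - s) powr (1 - \<alpha>) * (t - s) powr \<alpha>)"
      using st by (simp flip: powr_add)
    also have "\<dots> \<le> e2 * ((b - a) powr (1 - \<alpha>) * (t - s) powr \<alpha>)"
      using st e2 \<alpha> by (intro mult_left_mono mult_right_mono powr_mono2) auto
    also have "\<dots> \<le> e1 * (t - s) powr \<alpha>"
      unfolding mult.assoc[symmetric] by (intro mult_right_mono e2) auto
    finally have "norm (y t - p t - (y s - p s)) \<le> 3 * e1 * (t - s) powr \<alpha>" by (simp add: algebra_simps)
    also have "\<dots> \<le> e * (t - s) powr \<alpha>" using e by (intro mult_right_mono) (auto simp: e1_def)
    finally show "norm (y t - p t - (y s - p s)) \<le> e * (t - s) powr \<alpha>" .
  qed
  moreover have "p \<in> smooth_paths {a..b}"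
  proof -
    have "\<exists>g'. polynomial_function g' \<and> (\<forall>t. (g has_vector_derivative g' t) (at t))"
      if "polynomial_function g" for g :: "real \<Rightarrow> 'a"
      using has_vector_derivative_polynomial_function[OF that] by metis
    note ex = this
    \<comment> \<open>A choice of derivative for each polynomial function yields the whole sequence
      of derivatives that \<open>smooth_paths\<close> asks for.\<close>
    define d where "d g = (SOME g'. polynomial_function g' \<and> (\<forall>t. (g has_vector_derivative g' t) (at t)))"
      for g :: "real \<Rightarrow> 'a"
    have d: "polynomial_function (d g) \<and> (\<forall>t. (g has_vector_derivative (d g) t) (at t))"
      if "polynomial_function g" for g
      unfolding d_def by (rule someI_ex[OF ex[OF that]])
    define D where "D n = (case n of 0 \<Rightarrow> p | Suc k \<Rightarrow> (d ^^ k) q)" for n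
    have poly: "polynomial_function ((d ^^ k) q)" for k by (induct k) (use q d in auto)
    have "(D n has_vector_derivative D (Suc n) t) (at t within {a..b})" if "t \<in> {a..b}" for n t
    proof (cases n)
      case 0
      have "(p has_vector_derivative q t) (at t within {a..b})"
        by (rule has_vector_derivative_transform[OF that _ Q[OF that]]) (simp add: p_def)
      then show ?thesis by (simp add: D_def 0)
    next
      case (Suc k)
      then show ?thesis using d[OF poly[of k]] by (simp add: D_def has_vector_derivative_at_within)
    qed
    moreover have "D 0 = p" by (simp add: D_def)
    ultimately show ?thesis unfolding smooth_paths_def by (auto simp: p_def)
  qed
  ultimately show ?thesis by blast
qed

lemma smooth_path_lipschitz:
  fixes p :: "real \<Rightarrow> 'a::euclidean_space"
  assumes "p \<in> smooth_paths {a..b}"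
  shows "\<exists>C\<ge>0. hol 1 C a b p"
proof -
  obtain D :: "nat \<Rightarrow> real \<Rightarrow> 'a" where D: "D 0 = p"
    "\<And>n t. t \<in> {a..b} \<Longrightarrow> (D n has_vector_derivative D (Suc n) t) (at t within {a..b})"
    using assms unfolding smooth_paths_def by blast
  have "continuous_on {a..b} (D 1)"
    by (rule continuous_on_vector_derivative[OF D(2)])
  then have "compact (D 1 ` {a..b})" by (intro compact_continuous_image compact_Icc)
  then obtain C where C: "0 < C" "\<And>t. a \<le> t \<Longrightarrow> t \<le> b \<Longrightarrow> norm (D 1 t) \<le> C"
    using compact_imp_bounded bounded_pos by (metis atLeastAtMost_iff image_eqI)
  have "norm (p t - p s) \<le> C * (t - s) powr 1" if st: "a \<le> s" "s \<le> t" "t \<le> b" for s t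
  proof -
    have "norm (p t - p s) \<le> C * (t - s)"
    proof (rule vector_mvt_bound)
      fix u assume u: "u \<in> {s..t}"
      show "(p has_vector_derivative D 1 u) (at u within {s..t})"
        using has_vector_derivative_within_subset[OF D(2)[of u 0], of "{s..t}"] u st D(1) by simp
      show "norm (D 1 u) \<le> C" using C u st by auto
    qed (use st in auto)
    then show ?thesis using st by simp
  qed
  then show ?thesis using C(1) by (auto simp: hol_def intro!: exI[of _ C])
qed

lemma smooth_paths_subset_holder:
  fixes p :: "real \<Rightarrow> 'a::euclidean_space"
  assumes "p \<in> smooth_paths {a..b}" "0 < \<alpha>" "\<alpha> \<le> 1" "a \<le> b"
  shows "p \<in> holder_space \<alpha> {a..b}"
proof -
  obtain C where C: "0 \<le> C" "hol 1 C a b p" using smooth_path_lipschitz[OF assms(1)] by blast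
  have "hol \<alpha> (C * (b - a) powr (1 - \<alpha>)) a b p"
    by (rule hol_exponent_mono[OF C(2)]) (use assms C in auto)
  from hol_imp_hb[OF this] show ?thesis
    using assms C by (auto simp: holder_space_iff smooth_paths_def)
qed

lemma closure_of_holder:
  "y \<in> holder_topology \<alpha> I closure_of S \<longleftrightarrow>
     y \<in> holder_space \<alpha> I \<and> (\<forall>e>0. \<exists>p\<in>S. p \<in> holder_space \<alpha> I \<and> holder_dist \<alpha> I y p < e)"
proof -
  interpret Metric_space "holder_space \<alpha> I" "holder_dist \<alpha> I" by (rule Metric_space_holder)
  show ?thesis unfolding holder_topology_def metric_closure_of by (auto simp: in_mball)
qed

lemma little_holder_imp_holder: "y \<in> little_holder_space \<alpha> I \<Longrightarrow> y \<in> holder_space \<alpha> I"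
  by (simp add: little_holder_space_def closure_of_holder)

text \<open>A smooth path is Lipschitz, so its increments are negligible at small scales; an
  approximation error below e/2 in the Hoelder norm then leaves a modulus of at most e. The converse
  is \<open>vm_approx_smooth\<close>. From here on membership in the state space is a condition on
  increments alone.\<close>

lemma little_holder_space_iff:
  fixes y :: "real \<Rightarrow> 'a::euclidean_space"
  assumes \<alpha>: "0 < \<alpha>" "\<alpha> < 1" and ab: "a < b"
  shows "y \<in> little_holder_space \<alpha> {a..b} \<longleftrightarrow> y \<in> extensional {a..b} \<and> vm \<alpha> a b y"
proof
  assume y: "y \<in> little_holder_space \<alpha> {a..b}"
  then have yh: "y \<in> holder_space \<alpha> {a..b}" by (rule little_holder_imp_holder)
  have "vm \<alpha> a b y"
    unfolding vm_def
  proof (intro allI impI)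
    fix e :: real assume "0 < e"
    then have e: "0 < e / 2" by simp
    obtain p where p: "p \<in> smooth_paths {a..b}" "p \<in> holder_space \<alpha> {a..b}" "holder_dist \<alpha> {a..b} y p < e / 2"
      using y e unfolding little_holder_space_def closure_of_holder by blast
    have yp: "hb \<alpha> (e / 2) a b (\<lambda>t. y t - p t)"
      by (rule hb_mono[OF hb_holder_dist[OF yh p(2)]]) (use p in simp)
    obtain C where C: "hol 1 C a b p" using smooth_path_lipschitz[OF p(1)] by blast
    obtain \<delta> where \<delta>: "0 < \<delta>" "\<And>s t. a \<le> s \<Longrightarrow> s \<le> t \<Longrightarrow> t \<le> b \<Longrightarrow> t - s < \<delta> \<Longrightarrow>
        norm (p t - p s) \<le> e / 2 * (t - s) powr \<alpha>"
      using hol_imp_vm[OF C \<alpha>(2)] e unfolding vm_def by blast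
    have "norm (y t - y s) \<le> e * (t - s) powr \<alpha>" if st: "a \<le> s" "s \<le> t" "t \<le> b" "t - s < \<delta>" for s t
    proof -
      have "norm (y t - y s) \<le> norm (y t - p t - (y s - p s)) + norm (p t - p s)"
        using norm_triangle_ineq[of "y t - p t - (y s - p s)" "p t - p s"] by simp
      also have "\<dots> \<le> e / 2 * (t - s) powr \<alpha> + e / 2 * (t - s) powr \<alpha>"
        using st by (intro add_mono \<delta>(2) holD[OF hb_hol[OF yp]]) auto
      finally show ?thesis by simp
    qed
    then show "\<exists>\<delta>>0. \<forall>s t. a \<le> s \<longrightarrow> s \<le> t \<longrightarrow> t \<le> b \<longrightarrow> t - s < \<delta> \<longrightarrow>
        norm (y t - y s) \<le> e * (t - s) powr \<alpha>" using \<delta>(1) by blast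
  qed
  then show "y \<in> extensional {a..b} \<and> vm \<alpha> a b y" using yh by (simp add: holder_space_iff)
next
  assume y: "y \<in> extensional {a..b} \<and> vm \<alpha> a b y"
  then obtain K where "0 \<le> K" "hol \<alpha> K a b y" using vm_imp_hol \<alpha> by blast
  then have yh: "y \<in> holder_space \<alpha> {a..b}"
    using hol_imp_hb[of \<alpha> K a b y] y \<alpha> ab by (simp add: holder_space_iff)
  have "\<exists>p\<in>smooth_paths {a..b}. p \<in> holder_space \<alpha> {a..b} \<and> holder_dist \<alpha> {a..b} y p < e" if e: "0 < e" for e
  proof -
    obtain p where p: "p \<in> smooth_paths {a..b}" "hb \<alpha> (e / 4) a b (\<lambda>t. y t - p t)"
      using vm_approx_smooth[of \<alpha> a b y "e / 4"] y \<alpha> ab e by auto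
    have "holder_dist \<alpha> {a..b} y p \<le> 2 * (e / 4)" by (rule holder_dist_le[OF p(2)]) (use e in simp)
    then have "holder_dist \<alpha> {a..b} y p < e" using e by simp
    then show ?thesis using p smooth_paths_subset_holder[OF p(1)] \<alpha> ab by force
  qed
  then show "y \<in> little_holder_space \<alpha> {a..b}"
    using yh unfolding little_holder_space_def closure_of_holder by blast
qed

section \<open>A priori bounds\<close>

lemma blinfun_apply_mat_op [simp]: "blinfun_apply (mat_op M) v = M *v v"
  unfolding mat_op_def by (rule bounded_linear_Blinfun_apply[THEN fun_cong]) simp

lemma norm_mat_op: "norm (M *v v) \<le> norm (mat_op M) * norm v"
  using norm_blinfun[of "mat_op M" v] by simp

lemma powr_le_powr_unit: "0 \<le> d \<Longrightarrow> d \<le> 1 \<Longrightarrow> a \<le> b \<Longrightarrow> d powr b \<le> d powr (a::real)"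
  by (cases "d = 0") (auto intro: powr_mono')

text \<open>A step length of at most 1 for which V times its power \<kappa> is at most 1/4, for
  every V \<ge> 0; the summand 1 admits V = 0 and caps the length.\<close>

definition gstep :: "real \<Rightarrow> real \<Rightarrow> real" where
  "gstep \<kappa> V = (4 * V + 1) powr (- (1 / \<kappa>))"

lemma gstep:
  assumes "0 < \<kappa>" "0 \<le> V"
  shows "0 < gstep \<kappa> V" "gstep \<kappa> V \<le> 1" "V * gstep \<kappa> V powr \<kappa> \<le> 1 / 4" "gstep \<kappa> V powr \<kappa> \<le> 1"
proof -
  show "0 < gstep \<kappa> V" using assms by (simp add: gstep_def)
  have "1 \<le> (4 * V + 1) powr (1 / \<kappa>)" using assms by (intro ge_one_powr_ge_zero) auto
  then show 1: "gstep \<kappa> V \<le> 1"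
    unfolding gstep_def powr_minus_divide by (auto simp: divide_le_eq_1)
  then show "gstep \<kappa> V powr \<kappa> \<le> 1"
    using powr_mono2[of \<kappa> "gstep \<kappa> V" 1] assms by (simp add: gstep_def)
  have "gstep \<kappa> V powr \<kappa> = 1 / (4 * V + 1)"
    using assms unfolding gstep_def powr_powr by (simp add: powr_minus_divide)
  then show "V * gstep \<kappa> V powr \<kappa> \<le> 1 / 4" using assms by (simp add: divide_le_eq)
qed

text \<open>For increments of length d \<le> \<tau> \<le> 1 every term is a multiple of
  \<open>d powr \<nu>\<close> at most, and \<open>d powr \<nu> \<le> \<tau> powr (\<nu> - \<alpha>)
  * d powr \<alpha>\<close>: the gap between the exponents provides the smallness on short
  steps.\<close>

lemma increment_le:
  assumes d: "0 \<le> d" "d \<le> \<tau>" "\<tau> \<le> 1" and e: "0 < \<alpha>" "\<alpha> < \<nu>" "\<nu> \<le> 1"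
    and nn: "0 \<le> L" "0 \<le> v" "0 \<le> Z" "0 \<le> N" "0 \<le> (e::real)"
  shows "L * N * d + v * N * (d powr \<nu> + Z * d powr (\<alpha> + \<nu>)) + e * d powr \<nu>
     \<le> ((L + v * (1 + Z)) * \<tau> powr (\<nu> - \<alpha>) * N + e * \<tau> powr (\<nu> - \<alpha>)) * d powr \<alpha>"
proof -
  have d1: "d \<le> 1" using d by simp
  have "d powr 1 \<le> d powr \<nu>" using d d1 e by (intro powr_le_powr_unit) auto
  then have a: "d \<le> d powr \<nu>" using d by simp
  have b: "d powr (\<alpha> + \<nu>) \<le> d powr \<nu>" using d d1 e by (intro powr_le_powr_unit) auto
  have c: "d powr \<nu> \<le> \<tau> powr (\<nu> - \<alpha>) * d powr \<alpha>"
  proof -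
    have "d powr \<nu> = d powr (\<nu> - \<alpha>) * d powr \<alpha>" by (simp flip: powr_add)
    also have "\<dots> \<le> \<tau> powr (\<nu> - \<alpha>) * d powr \<alpha>"
      using d e by (intro mult_right_mono powr_mono2) auto
    finally show ?thesis .
  qed
  have "L * N * d + v * N * (d powr \<nu> + Z * d powr (\<alpha> + \<nu>)) + e * d powr \<nu>
      \<le> L * N * d powr \<nu> + v * N * (d powr \<nu> + Z * d powr \<nu>) + e * d powr \<nu>"
    using a b nn by (intro add_mono mult_left_mono) auto
  also have "\<dots> = ((L + v * (1 + Z)) * N + e) * d powr \<nu>" by (simp add: algebra_simps)
  also have "\<dots> \<le> ((L + v * (1 + Z)) * N + e) * (\<tau> powr (\<nu> - \<alpha>) * d powr \<alpha>)"
    using c nn by (intro mult_left_mono) auto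
  finally show ?thesis by (simp add: algebra_simps)
qed

text \<open>The increment bound involves the norm over all of [l, b], hence the increments
  themselves. On a short step it improves a seminorm bound K on [a, b] to N0/2 + e + K/2;
  \<open>bound_absorb\<close> then yields N0 + 2e, so the norm has doubled at most, up to 2e. The
  finiteness in \<open>fin\<close> starts this iteration, and its constant disappears in the
  limit.\<close>

lemma gronwall_step:
  fixes z :: "real \<Rightarrow> 'a::real_normed_vector"
  assumes e: "0 < \<alpha>" "\<alpha> < \<nu>" "\<nu> \<le> 1"
    and nn: "0 \<le> L" "0 \<le> v" "0 \<le> Z" "0 \<le> e" and la: "l \<le> a" "a \<le> b"
    and hb0: "hb \<alpha> N0 l a z" and fin: "hb \<alpha> N' l b z"
    and inc: "\<And>N s t. hb \<alpha> N l b z \<Longrightarrow> a \<le> s \<Longrightarrow> s \<le> t \<Longrightarrow> t \<le> b \<Longrightarrow>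
       norm (z t - z s) \<le> L * N * (t - s) + v * N * ((t - s) powr \<nu> + Z * (t - s) powr (\<alpha> + \<nu>)) + e * (t - s) powr \<nu>"
    and \<tau>: "b - a \<le> gstep (\<nu> - \<alpha>) (L + v * (1 + Z))"
  shows "hb \<alpha> (2 * N0 + 2 * e) l b z"
proof -
  let ?\<tau> = "gstep (\<nu> - \<alpha>) (L + v * (1 + Z))"
  have V: "0 \<le> L + v * (1 + Z)" using nn by simp
  have gs: "0 < ?\<tau>" "?\<tau> \<le> 1" "(L + v * (1 + Z)) * ?\<tau> powr (\<nu> - \<alpha>) \<le> 1/4" "?\<tau> powr (\<nu> - \<alpha>) \<le> 1"
    using gstep[OF _ V, of "\<nu> - \<alpha>"] e by auto
  have N0: "0 \<le> N0" using hb_nonneg[OF hb0 la(1)] .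
  have N': "0 \<le> N'" using hb_nonneg[OF fin] la by simp
  \<comment> \<open>As the step is no longer than 1, a seminorm bound \<open>K\<close> on [a, b]
    also bounds the growth of the values by \<open>K\<close>.\<close>
  have ext: "hb \<alpha> (N0 + K) l b z" if K: "0 \<le> K" "hol \<alpha> K a b z" for K
  proof -
    have "norm (z t) \<le> N0 + K" if t: "l \<le> t" "t \<le> b" for t
    proof (cases "t \<le> a")
      case True
      then show ?thesis using hbD[OF hb0 t(1)] K by simp
    next
      case False
      have "norm (z t) \<le> norm (z a) + norm (z t - z a)"
        using norm_triangle_ineq[of "z a" "z t - z a"] by simp
      also have "norm (z t - z a) \<le> K * (t - a) powr \<alpha>" using False t la by (intro holD[OF K(2)]) auto
      also have "(t - a) powr \<alpha> \<le> 1 powr \<alpha>"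
        using False t la \<tau> gs e by (intro powr_mono2) auto
      finally show ?thesis using hbD[OF hb0, of a] la K by (simp add: mult_left_mono)
    qed
    then show ?thesis unfolding hb_def using hol_glue[OF hb_hol[OF hb0] K(2) N0 K(1) e(1)] by blast
  qed
  have "hol \<alpha> ((N0 / 2 + e) / (1 - 1 / 2)) a b z"
  proof (rule bound_absorb[where P = "\<lambda>K. hol \<alpha> K a b z" and ?K0.0 = N'])
    show "hol \<alpha> N' a b z" using hb_hol[OF fin] la hol_subset by blast
    fix K assume K: "0 \<le> K" "hol \<alpha> K a b z"
    show "hol \<alpha> (N0 / 2 + e + 1 / 2 * K) a b z"
      unfolding hol_def
    proof (intro allI impI)
      fix s t assume st: "a \<le> s" "s \<le> t" "t \<le> b"
      have "norm (z t - z s) \<le> L * (N0 + K) * (t - s) + v * (N0 + K) * ((t - s) powr \<nu> + Z * (t - s) powr (\<alpha> + \<nu>)) + e * (t - s) powr \<nu>"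
        by (rule inc[OF ext[OF K] st])
      also have "\<dots> \<le> ((L + v * (1 + Z)) * ?\<tau> powr (\<nu> - \<alpha>) * (N0 + K) + e * ?\<tau> powr (\<nu> - \<alpha>)) * (t - s) powr \<alpha>"
        using st \<tau> gs e nn N0 K by (intro increment_le) auto
      also have "\<dots> \<le> (1 / 4 * (N0 + K) + e * 1) * (t - s) powr \<alpha>"
        using gs nn N0 K by (intro mult_right_mono add_mono mult_left_mono) auto
      also have "\<dots> \<le> (N0 / 2 + e + 1 / 2 * K) * (t - s) powr \<alpha>"
        using N0 K by (intro mult_right_mono) auto
      finally show "norm (z t - z s) \<le> (N0 / 2 + e + 1 / 2 * K) * (t - s) powr \<alpha>" .
    qed
  next
    fix X :: "nat \<Rightarrow> real" and M assume "\<And>n. hol \<alpha> (X n) a b z" "X \<longlonglongrightarrow> M"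
    then show "hol \<alpha> M a b z" using hol_limit[of \<alpha> X a b "\<lambda>_. z" z M] by simp
  qed (use N' N0 nn in auto)
  moreover have "(N0 / 2 + e) / (1 - 1 / 2) = N0 + 2 * e" by simp
  ultimately have "hol \<alpha> (N0 + 2 * e) a b z" by metis
  then have "hb \<alpha> (N0 + (N0 + 2 * e)) l b z" using N0 nn by (intro ext) auto
  then show ?thesis by (simp add: algebra_simps)
qed

definition gsteps :: "real \<Rightarrow> real \<Rightarrow> real \<Rightarrow> nat" where
  "gsteps \<kappa> T V = nat \<lceil>T / gstep \<kappa> V\<rceil>"

text \<open>The norm doubles on each step, and the number of steps is of order T times the power
  1/(\<nu> - \<alpha>) of the noise coefficient. In \<open>inc\<close> only increments of length at
  most 1 are considered, for which powers with different exponents can be compared.\<close>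

lemma gronwall:
  fixes z :: "real \<Rightarrow> 'a::real_normed_vector"
  assumes e: "0 < \<alpha>" "\<alpha> < \<nu>" "\<nu> \<le> 1"
    and nn: "0 \<le> L" "0 \<le> v" "0 \<le> Z" "0 \<le> e" and la: "l \<le> 0" "0 \<le> T"
    and hb0: "hb \<alpha> N0 l 0 z" and fin: "hb \<alpha> N' l T z"
    and inc: "\<And>N b s t. hb \<alpha> N l b z \<Longrightarrow> 0 \<le> s \<Longrightarrow> s \<le> t \<Longrightarrow> t \<le> b \<Longrightarrow> b \<le> T \<Longrightarrow> t - s \<le> 1 \<Longrightarrow>
       norm (z t - z s) \<le> L * N * (t - s) + v * N * ((t - s) powr \<nu> + Z * (t - s) powr (\<alpha> + \<nu>)) + e * (t - s) powr \<nu>"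
  shows "hb \<alpha> (2 ^ gsteps (\<nu> - \<alpha>) T (L + v * (1 + Z)) * (N0 + 2 * e)) l T z"
proof -
  let ?\<tau> = "gstep (\<nu> - \<alpha>) (L + v * (1 + Z))"
  have V: "0 \<le> L + v * (1 + Z)" using nn by simp
  have gs: "0 < ?\<tau>" "?\<tau> \<le> 1" using gstep[OF _ V, of "\<nu> - \<alpha>"] e by auto
  have N0: "0 \<le> N0" using hb_nonneg[OF hb0 la(1)] .
  \<comment> \<open>The exact solution of the recursion N \<mapsto> 2 N + 2 e started from
    \<open>N0\<close>.\<close>
  have *: "hb \<alpha> (2 ^ k * (N0 + 2 * e) - 2 * e) l (min T (real k * ?\<tau>)) z" for k :: nat
  proof (induct k)
    case 0
    then show ?case using hb0 la by simp
  next
    case (Suc k)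
    let ?a = "min T (real k * ?\<tau>)" and ?b = "min T (real (Suc k) * ?\<tau>)"
    have "0 \<le> ?a" using gs la by simp
    have "real (Suc k) * ?\<tau> = real k * ?\<tau> + ?\<tau>" by (simp add: distrib_right)
    then have ab: "?a \<le> ?b" "?b - ?a \<le> ?\<tau>" using gs by auto
    have "hb \<alpha> (2 * (2 ^ k * (N0 + 2 * e) - 2 * e) + 2 * e) l ?b z"
    proof (rule gronwall_step[OF e nn _ ab(1) Suc _ _ ab(2)])
      show "l \<le> ?a" using \<open>0 \<le> ?a\<close> la by simp
      show "hb \<alpha> N' l ?b z" by (rule hb_subset[OF fin]) auto
    next
      fix N s t assume *: "hb \<alpha> N l ?b z" "?a \<le> s" "s \<le> t" "t \<le> ?b"
      show "norm (z t - z s) \<le> L * N * (t - s) + v * N * ((t - s) powr \<nu> + Z * (t - s) powr (\<alpha> + \<nu>)) + e * (t - s) powr \<nu>"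
        by (rule inc[OF *(1) _ *(3,4)]) (use \<open>0 \<le> ?a\<close> ab gs * in linarith)+
    qed
    then show ?case by (simp add: algebra_simps)
  qed
  let ?k = "gsteps (\<nu> - \<alpha>) T (L + v * (1 + Z))"
  have "T / ?\<tau> \<le> real ?k" unfolding gsteps_def by linarith
  then have "T \<le> real ?k * ?\<tau>" using gs by (simp add: field_simps)
  then have "hb \<alpha> (2 ^ ?k * (N0 + 2 * e) - 2 * e) l T z" using *[of ?k] by (simp add: min_def)
  then show ?thesis by (rule hb_mono) (use nn in simp)
qed

section \<open>Solutions of the Young delay equation\<close>

text \<open>\<open>\<alpha>\<close> plays the role of \<open>\<beta>\<^sub>0\<close>: paths of this
  regularity can be integrated against the noise because \<alpha> + \<nu> > 1. The larger exponent
  \<beta> is the one that solutions gain.\<close>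

locale young_delay =
  fixes r \<nu> \<alpha> \<beta> :: real and A :: "real^'d^'d" and f :: "(real \<Rightarrow> real^'d) \<Rightarrow> real^'d"
    and g :: "(real \<Rightarrow> real^'d) \<Rightarrow> real^'m^'d" and C\<^sub>f C\<^sub>g :: real
  assumes r: "0 < r" and \<nu>1: "\<nu> \<le> 1" and \<alpha>\<nu>: "1 - \<nu> < \<alpha>" and \<alpha>\<beta>: "\<alpha> < \<beta>" and \<beta>\<nu>: "\<beta> < \<nu>"
    and f_lip: "\<And>\<xi> \<zeta>. \<xi> \<in> cont_paths {-r..0} \<Longrightarrow> \<zeta> \<in> cont_paths {-r..0} \<Longrightarrow>
           norm (f \<xi> - f \<zeta>) \<le> C\<^sub>f * enn2real (sup_norm {-r..0} (\<lambda>s. \<xi> s - \<zeta> s))"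
    and g_lin: "linear_with_bound r g C\<^sub>g"
begin

lemma exps: "0 < \<alpha>" "\<alpha> < 1" "0 < \<nu>" "\<alpha> < \<nu>" "1 < \<alpha> + \<nu>" "\<beta> < 1"
  using r \<nu>1 \<alpha>\<nu> \<alpha>\<beta> \<beta>\<nu> by auto

abbreviation Z where "Z \<equiv> young_const (\<alpha> + \<nu>)"

lemma Z_nonneg: "0 \<le> Z" using young_const_nonneg exps by simp

definition cst :: "real^'d \<Rightarrow> real \<Rightarrow> real^'d" where "cst c = restrict (\<lambda>_. c) {-r..0}"

lemma cst_cont: "cst c \<in> cont_paths {-r..0}"
proof -
  have "continuous_on {-r..0} (cst c) \<longleftrightarrow> continuous_on {-r..0} (\<lambda>_. c)"
    by (rule continuous_on_cong) (auto simp: cst_def)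
  then show ?thesis by (simp add: cont_paths_def cst_def)
qed

lemma sup_norm_cst: "sup_norm {-r..0} (cst c) = ennreal (norm c)"
proof -
  have "sup_norm {-r..0} (cst c) = (SUP t\<in>{-r..0}. ennreal (norm c))"
    unfolding sup_norm_def by (rule SUP_cong) (auto simp: cst_def)
  also have "\<dots> = ennreal (norm c)" using r by (intro cSUP_const) auto
  finally show ?thesis .
qed

lemma C\<^sub>f_nonneg: "0 \<le> C\<^sub>f"
proof -
  \<comment> \<open>The Lipschitz bound, tested on the constant paths with values a unit vector and
    0, forces the constant to be nonnegative.\<close>
  let ?c = "axis undefined 1 :: real^'d"
  have "sup_norm {-r..0} (\<lambda>s. cst ?c s - cst 0 s) = sup_norm {-r..0} (cst ?c)"
    unfolding sup_norm_def by (rule SUP_cong) (auto simp: cst_def)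
  then have "norm (f (cst ?c) - f (cst 0)) \<le> C\<^sub>f * 1"
    using f_lip[OF cst_cont cst_cont, of ?c 0] by (simp add: sup_norm_cst)
  then show ?thesis using norm_ge_zero[of "f (cst ?c) - f (cst 0)"] by linarith
qed

lemma C\<^sub>g_nonneg: "0 \<le> C\<^sub>g"
proof -
  let ?c = "axis undefined 1 :: real^'d"
  have "norm (mat_op (g (cst ?c))) \<le> C\<^sub>g * 1"
    using g_lin cst_cont[of ?c] sup_norm_cst[of ?c] unfolding linear_with_bound_def by fastforce
  then show ?thesis using norm_ge_zero[of "mat_op (g (cst ?c))"] by linarith
qed

abbreviation L where "L \<equiv> norm (mat_op A) + C\<^sub>f"

lemma L_nonneg: "0 \<le> L" using C\<^sub>f_nonneg by simp

lemma enn2real_sup_norm_le: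
  assumes "\<And>s. s \<in> {-r..0} \<Longrightarrow> norm (\<xi> s) \<le> N"
  shows "enn2real (sup_norm {-r..0} \<xi>) \<le> N"
proof -
  have "norm (\<xi> 0) \<le> N" using r by (intro assms) simp
  then have N: "0 \<le> N" by (rule order_trans[OF norm_ge_zero])
  have "sup_norm {-r..0} \<xi> \<le> ennreal N" using assms by (simp add: sup_norm_le_iff[OF N])
  then show ?thesis by (rule enn2real_leI[OF N])
qed

lemma f_diff:
  assumes "\<xi> \<in> cont_paths {-r..0}" "\<zeta> \<in> cont_paths {-r..0}" "\<And>s. s \<in> {-r..0} \<Longrightarrow> norm (\<xi> s - \<zeta> s) \<le> N"
  shows "norm (f \<xi> - f \<zeta>) \<le> C\<^sub>f * N"
  by (rule order_trans[OF f_lip[OF assms(1,2)]])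
     (intro mult_left_mono enn2real_sup_norm_le assms(3) C\<^sub>f_nonneg)

lemma cont_paths_diff:
  assumes "\<xi> \<in> cont_paths {-r..0}" "\<zeta> \<in> cont_paths {-r..0}"
  shows "restrict (\<lambda>s. \<xi> s - \<zeta> s) {-r..0} \<in> cont_paths {-r..0}"
proof -
  have "continuous_on {-r..0} (restrict (\<lambda>s. \<xi> s - \<zeta> s) {-r..0}) \<longleftrightarrow> continuous_on {-r..0} (\<lambda>s. \<xi> s - \<zeta> s)"
    by (rule continuous_on_cong) auto
  then show ?thesis using assms by (auto simp: cont_paths_def intro: continuous_intros)
qed

text \<open>Additivity of \<open>g\<close> is given for sums of continuous paths; the difference is
  reached by adding \<zeta> back to it.\<close>

lemma g_diff_eq:
  assumes "\<xi> \<in> cont_paths {-r..0}" "\<zeta> \<in> cont_paths {-r..0}"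
  shows "g \<xi> - g \<zeta> = g (restrict (\<lambda>s. \<xi> s - \<zeta> s) {-r..0})"
proof -
  let ?d = "restrict (\<lambda>s. \<xi> s - \<zeta> s) {-r..0}"
  have "g (restrict (\<lambda>s. ?d s + \<zeta> s) {-r..0}) = g ?d + g \<zeta>"
    using g_lin cont_paths_diff[OF assms] assms unfolding linear_with_bound_def by blast
  moreover have "restrict (\<lambda>s. ?d s + \<zeta> s) {-r..0} = \<xi>"
    using assms(1) by (intro extensionalityI[of _ "{-r..0}"]) (auto simp: cont_paths_def)
  ultimately show ?thesis by simp
qed

lemma g_bound:
  assumes "\<xi> \<in> cont_paths {-r..0}" "\<And>s. s \<in> {-r..0} \<Longrightarrow> norm (\<xi> s) \<le> N"
  shows "norm (g \<xi> *v v) \<le> C\<^sub>g * N * norm v"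
proof -
  have "norm (mat_op (g \<xi>)) \<le> C\<^sub>g * enn2real (sup_norm {-r..0} \<xi>)"
    using g_lin assms unfolding linear_with_bound_def by blast
  also have "\<dots> \<le> C\<^sub>g * N" by (intro mult_left_mono enn2real_sup_norm_le assms C\<^sub>g_nonneg)
  finally show ?thesis by (intro order_trans[OF norm_mat_op] mult_right_mono) auto
qed

lemma g_diff:
  assumes "\<xi> \<in> cont_paths {-r..0}" "\<zeta> \<in> cont_paths {-r..0}" "\<And>s. s \<in> {-r..0} \<Longrightarrow> norm (\<xi> s - \<zeta> s) \<le> N"
  shows "norm ((g \<xi> - g \<zeta>) *v v) \<le> C\<^sub>g * N * norm v"
  unfolding g_diff_eq[OF assms(1,2)]
  by (rule g_bound[OF cont_paths_diff[OF assms(1,2)]]) (use assms(3) in simp)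

lemma segment_cont:
  assumes "continuous_on {-r..T} y" "0 \<le> u" "u \<le> T"
  shows "segment r u y \<in> cont_paths {-r..0}"
proof -
  have "continuous_on {-r..0} (segment r u y) \<longleftrightarrow> continuous_on {-r..0} (\<lambda>s. y (u + s))"
    by (rule continuous_on_cong) (auto simp: segment_def)
  moreover have "continuous_on {-r..0} (\<lambda>s. y (u + s))"
    by (rule continuous_on_compose2[OF assms(1)]) (use assms in \<open>auto intro!: continuous_intros\<close>)
  ultimately show ?thesis by (simp add: cont_paths_def segment_def)
qed

lemma segment_apply: "s \<in> {-r..0} \<Longrightarrow> segment r u y s = y (u + s)"
  by (simp add: segment_def)

lemma segment_cong: "(\<And>s. u - r \<le> s \<Longrightarrow> s \<le> u \<Longrightarrow> y s = z s) \<Longrightarrow> segment r u y = segment r u z"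
  by (auto simp: segment_def fun_eq_iff restrict_def)

definition G :: "(real \<Rightarrow> real^'d) \<Rightarrow> real \<Rightarrow> real^'m^'d" where "G y u = g (segment r u y)"
text \<open>The linear term A y is treated as an ordinary Lipschitz part of the drift, with total
  constant \<open>L\<close>. The decay of the semigroup enters in \<open>window_contraction\<close>
  for the first time.\<close>

definition F :: "(real \<Rightarrow> real^'d) \<Rightarrow> real \<Rightarrow> real^'d" where "F y u = A *v y u + f (segment r u y)"

lemma G_cong: "(\<And>s. u - r \<le> s \<Longrightarrow> s \<le> u \<Longrightarrow> y s = z s) \<Longrightarrow> G y u = G z u"
  unfolding G_def using segment_cong[of u y z] by simp

lemma F_cong: "(\<And>s. u - r \<le> s \<Longrightarrow> s \<le> u \<Longrightarrow> y s = z s) \<Longrightarrow> F y u = F z u"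
  unfolding F_def using segment_cong[of u y z] r by simp

text \<open>Two segments differ at \<open>u\<close> by an increment of \<open>y\<close> over the
  same time lag, so the Hoelder constant of \<open>y\<close> on [-r, T] serves in the sup norm of
  segments.\<close>

lemma mhol_G:
  assumes "hol \<alpha> K (-r) T y"
  shows "mhol \<alpha> (C\<^sub>g * K) 0 T (G y)"
  unfolding mhol_def
proof (intro allI impI)
  fix s t v assume st: "0 \<le> s" "s \<le> t" "t \<le> T"
  have c: "continuous_on {-r..T} y" using hol_imp_continuous_on[OF assms] exps by simp
  have "norm ((G y t - G y s) *v v) \<le> C\<^sub>g * (K * (t - s) powr \<alpha>) * norm v"
    unfolding G_def
  proof (rule g_diff)
    fix u assume u: "u \<in> {-r..0}"
    have "norm (y (t + u) - y (s + u)) \<le> K * ((t + u) - (s + u)) powr \<alpha>"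
      by (rule holD[OF assms]) (use st u in auto)
    then show "norm (segment r t y u - segment r s y u) \<le> K * (t - s) powr \<alpha>"
      using u by (simp add: segment_apply)
  qed (use segment_cont[OF c] st in auto)
  then show "norm ((G y t - G y s) *v v) \<le> C\<^sub>g * K * (t - s) powr \<alpha> * norm v" by (simp add: mult.assoc)
qed

lemma G_diff_eq:
  assumes "continuous_on {-r..T} y" "continuous_on {-r..T} z" "0 \<le> u" "u \<le> T"
  shows "G y u - G z u = G (\<lambda>t. y t - z t) u"
proof -
  have "restrict (\<lambda>s. segment r u y s - segment r u z s) {-r..0} = segment r u (\<lambda>t. y t - z t)"
    by (auto simp: segment_def fun_eq_iff restrict_def)
  then show ?thesis unfolding G_def
    using g_diff_eq[OF segment_cont[OF assms(1,3,4)] segment_cont[OF assms(2,3,4)]] by simp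
qed

lemma F_diff:
  assumes "continuous_on {-r..T} y" "continuous_on {-r..T} z" "0 \<le> u" "u \<le> T"
    and "\<And>s. u - r \<le> s \<Longrightarrow> s \<le> u \<Longrightarrow> norm (y s - z s) \<le> N"
  shows "norm (F y u - F z u) \<le> L * N"
proof -
  have 1: "norm (A *v y u - A *v z u) \<le> norm (mat_op A) * N"
  proof -
    have "A *v y u - A *v z u = A *v (y u - z u)" by (simp add: matrix_vector_mult_diff_distrib)
    then show ?thesis using norm_mat_op[of A "y u - z u"] assms(5)[of u] r
      by (simp add: mult_left_mono order_trans)
  qed
  have 2: "norm (f (segment r u y) - f (segment r u z)) \<le> C\<^sub>f * N"
    using assms by (intro f_diff segment_cont) (auto simp: segment_apply)
  have "F y u - F z u = (A *v y u - A *v z u) + (f (segment r u y) - f (segment r u z))"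
    by (simp add: F_def)
  then have "norm (F y u - F z u) \<le> norm (A *v y u - A *v z u) + norm (f (segment r u y) - f (segment r u z))"
    by (simp only: norm_triangle_ineq)
  then show ?thesis using 1 2 by (simp add: distrib_right)
qed

lemma hol_F:
  assumes "hol \<alpha> K (-r) T y"
  shows "hol \<alpha> (L * K) 0 T (F y)"
  unfolding hol_def
proof (intro allI impI)
  fix s t assume st: "0 \<le> s" "s \<le> t" "t \<le> T"
  have c: "continuous_on {-r..T} y" using hol_imp_continuous_on[OF assms] exps by simp
  have b: "norm (y (t + u) - y (s + u)) \<le> K * (t - s) powr \<alpha>" if u: "u \<in> {-r..0}" for u
  proof -
    have "norm (y (t + u) - y (s + u)) \<le> K * ((t + u) - (s + u)) powr \<alpha>"
      by (rule holD[OF assms]) (use st u in auto)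
    then show ?thesis by simp
  qed
  have 1: "norm (A *v y t - A *v y s) \<le> norm (mat_op A) * (K * (t - s) powr \<alpha>)"
  proof -
    have "A *v y t - A *v y s = A *v (y t - y s)" by (simp add: matrix_vector_mult_diff_distrib)
    then show ?thesis using norm_mat_op[of A "y t - y s"] b[of 0] r
      by (simp add: mult_left_mono order_trans)
  qed
  have 2: "norm (f (segment r t y) - f (segment r s y)) \<le> C\<^sub>f * (K * (t - s) powr \<alpha>)"
    using st b by (intro f_diff segment_cont[OF c]) (auto simp: segment_apply)
  have "F y t - F y s = (A *v y t - A *v y s) + (f (segment r t y) - f (segment r s y))"
    by (simp add: F_def)
  then have "norm (F y t - F y s) \<le> norm (A *v y t - A *v y s) + norm (f (segment r t y) - f (segment r s y))"
    by (simp only: norm_triangle_ineq)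
  then show "norm (F y t - F y s) \<le> L * K * (t - s) powr \<alpha>"
    using 1 2 by (simp add: distrib_right mult.assoc)
qed

lemma F_integrable:
  assumes "hol \<alpha> K (-r) T y" "0 \<le> s" "t \<le> T"
  shows "F y integrable_on {s..t}"
proof -
  have "continuous_on {0..T} (F y)" using hol_imp_continuous_on[OF hol_F[OF assms(1)]] exps by simp
  then show ?thesis using assms by (intro integrable_continuous_real) (auto intro: continuous_on_subset)
qed

section \<open>Increments, growth, stability and uniqueness of solutions on [0, T]\<close>

definition solves :: "(real \<Rightarrow> real^'m) \<Rightarrow> real \<Rightarrow> (real \<Rightarrow> real^'d) \<Rightarrow> bool" where
  "solves x T y \<longleftrightarrow> (\<forall>t. 0 \<le> t \<longrightarrow> t \<le> T \<longrightarrow>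
     (\<exists>J. has_young_integral (G y) x 0 t J \<and> y t = y 0 + integral {0..t} (F y) + J))"

lemma young_G:
  assumes "hol \<alpha> K (-r) T y" "0 \<le> K" "hol \<nu> w 0 T x" "0 \<le> w"
  obtains \<Phi> where "\<And>s t. 0 \<le> s \<Longrightarrow> s \<le> t \<Longrightarrow> t \<le> T \<Longrightarrow> has_young_integral (G y) x s t (\<Phi> t - \<Phi> s)"
  using young_integral_exists[OF mhol_G[OF assms(1)] assms(3)] assms C\<^sub>g_nonneg exps by (metis mult_nonneg_nonneg)

text \<open>The leading term is \<open>G y s\<close> applied to the increment of \<open>x\<close>,
  the rest is the Young remainder. Both are linear in N because g is linear; this keeps the
  Lipschitz constant of the flow independent of the size of the solutions.\<close>

lemma young_G_bound:
  assumes "hb \<alpha> N (-r) T y" "hol \<nu> w 0 T x" "0 \<le> w" "0 \<le> s" "s \<le> t" "t \<le> T"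
    and J: "has_young_integral (G y) x s t J"
  shows "norm J \<le> (C\<^sub>g * w) * N * ((t - s) powr \<nu> + Z * (t - s) powr (\<alpha> + \<nu>))"
proof -
  have N: "0 \<le> N" using hb_nonneg[OF assms(1)] assms r by simp
  have c: "continuous_on {-r..T} y" using hol_imp_continuous_on[OF hb_hol[OF assms(1)]] exps by simp
  have "norm (J - G y s *v (x t - x s)) \<le> (C\<^sub>g * N) * w * Z * (t - s) powr (\<alpha> + \<nu>)"
  proof (rule young_bound[OF J assms(5)])
    have "mhol \<alpha> (C\<^sub>g * N) 0 T (G y)" by (rule mhol_G[OF hb_hol[OF assms(1)]])
    then show "mhol \<alpha> (C\<^sub>g * N) s t (G y)" using assms unfolding mhol_def by (meson order_trans)
    show "hol \<nu> w s t x" by (rule hol_subset[OF assms(2)]) (use assms in auto)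
  qed (use N C\<^sub>g_nonneg exps assms in auto)
  moreover have "norm (G y s *v (x t - x s)) \<le> C\<^sub>g * N * (w * (t - s) powr \<nu>)"
  proof -
    have "norm (G y s *v (x t - x s)) \<le> C\<^sub>g * N * norm (x t - x s)"
      unfolding G_def using assms by (intro g_bound segment_cont[OF c]) (auto simp: segment_apply intro: hbD[OF assms(1)])
    also have "\<dots> \<le> C\<^sub>g * N * (w * (t - s) powr \<nu>)"
      using assms N C\<^sub>g_nonneg by (intro mult_left_mono holD[OF assms(2)]) auto
    finally show ?thesis .
  qed
  moreover have "norm J \<le> norm (J - G y s *v (x t - x s)) + norm (G y s *v (x t - x s))"
    using norm_triangle_ineq[of "J - G y s *v (x t - x s)" "G y s *v (x t - x s)"] by simp
  ultimately show ?thesis by (simp add: algebra_simps)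
qed

lemma solves_increment:
  assumes "solves x T y" "hol \<alpha> K (-r) T y" "0 \<le> K" "hol \<nu> w 0 T x" "0 \<le> w" "0 \<le> s" "s \<le> t" "t \<le> T"
  obtains J where "has_young_integral (G y) x s t J" "y t - y s = integral {s..t} (F y) + J"
proof -
  obtain \<Phi> where \<Phi>: "\<And>s t. 0 \<le> s \<Longrightarrow> s \<le> t \<Longrightarrow> t \<le> T \<Longrightarrow> has_young_integral (G y) x s t (\<Phi> t - \<Phi> s)"
    using young_G[OF assms(2-5)] by blast
  have y: "y t = y 0 + integral {0..t} (F y) + (\<Phi> t - \<Phi> 0)" if "0 \<le> t" "t \<le> T" for t
    using assms(1)[unfolded solves_def, rule_format, OF that] has_young_integral_unique[OF \<Phi>[of 0 t]] that by auto
  have I: "integral {0..s} (F y) + integral {s..t} (F y) = integral {0..t} (F y)"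
    using assms by (intro Henstock_Kurzweil_Integration.integral_combine F_integrable[OF assms(2)]) auto
  have yt: "y t = y 0 + integral {0..t} (F y) + (\<Phi> t - \<Phi> 0)" and ys: "y s = y 0 + integral {0..s} (F y) + (\<Phi> s - \<Phi> 0)"
    using assms by (auto intro: y)
  have "y t - y s = integral {s..t} (F y) + (\<Phi> t - \<Phi> s)"
    by (subst yt, subst ys) (simp flip: I)
  then show thesis using that[OF \<Phi>] assms by simp
qed

lemma integral_F_bound:
  assumes "hol \<alpha> K (-r) T y" "0 \<le> s" "s \<le> t" "t \<le> T" "\<And>u. s \<le> u \<Longrightarrow> u \<le> t \<Longrightarrow> norm (F y u) \<le> B"
  shows "norm (integral {s..t} (F y)) \<le> B * (t - s)"
proof -
  have "(F y has_integral integral {s..t} (F y)) {s..t}"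
    using F_integrable[OF assms(1,2,4)] by (simp add: has_integral_integral)
  moreover have "norm (F y s) \<le> B" using assms(3) by (intro assms(5)) simp_all
  then have "0 \<le> B" by (rule order_trans[OF norm_ge_zero])
  ultimately show ?thesis using has_integral_bound_real[of B "{}" "F y" _ s t] assms by simp
qed

lemma growth_increment:
  assumes "solves x T y" "hol \<nu> w 0 T x" "0 \<le> w" "hb \<alpha> N (-r) T y" "0 \<le> s" "s \<le> t" "t \<le> T"
  shows "norm (y t - y s) \<le> (L * N + norm (f (cst 0))) * (t - s)
     + (C\<^sub>g * w) * N * ((t - s) powr \<nu> + Z * (t - s) powr (\<alpha> + \<nu>))"
proof -
  have N: "0 \<le> N" using hb_nonneg[OF assms(4)] assms r by simp
  have c: "continuous_on {-r..T} y" using hol_imp_continuous_on[OF hb_hol[OF assms(4)]] exps by simp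
  obtain J where J: "has_young_integral (G y) x s t J" "y t - y s = integral {s..t} (F y) + J"
    using solves_increment[OF assms(1) hb_hol[OF assms(4)] N assms(2,3,5-7)] .
  have "norm (integral {s..t} (F y)) \<le> (L * N + norm (f (cst 0))) * (t - s)"
  proof (rule integral_F_bound[OF hb_hol[OF assms(4)]])
    fix u assume u: "s \<le> u" "u \<le> t"
    have "norm (F y u - F (\<lambda>_. 0) u) \<le> L * N"
      using u assms by (intro F_diff[OF c]) (auto intro: hbD[OF assms(4)])
    \<comment> \<open>The zero path is the reference for the drift; its value there is the only
      inhomogeneity of the equation.\<close>
    moreover have "F (\<lambda>_. 0) u = f (cst 0)"
      by (simp add: F_def segment_def cst_def)
    ultimately show "norm (F y u) \<le> L * N + norm (f (cst 0))"
      using norm_triangle_ineq[of "F y u - f (cst 0)" "f (cst 0)"] by simp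
  qed (use assms in auto)
  moreover have "norm J \<le> (C\<^sub>g * w) * N * ((t - s) powr \<nu> + Z * (t - s) powr (\<alpha> + \<nu>))"
    by (rule young_G_bound[OF assms(4,2,3,5-7) J(1)])
  ultimately show ?thesis unfolding J(2) by (intro order_trans[OF norm_triangle_ineq] add_mono)
qed

lemma solves_restrict: "solves x T y \<Longrightarrow> T' \<le> T \<Longrightarrow> solves x T' y"
  by (simp add: solves_def)

text \<open>The growth factor of the a priori estimate over [0, T], where \<open>v\<close> stands
  for \<open>C\<^sub>g\<close> times the seminorm of the noise.\<close>

definition gf :: "real \<Rightarrow> real \<Rightarrow> real" where
  "gf T v = 2 ^ gsteps (\<nu> - \<alpha>) T (L + v * (1 + Z))"

lemma growth:
  assumes "solves x T y" "hol \<nu> w 0 T x" "0 \<le> w" "hol \<alpha> K (-r) T y" "0 \<le> K" "0 \<le> T" "hb \<alpha> N0 (-r) 0 y"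
  shows "hb \<alpha> (gf T (C\<^sub>g * w) * (N0 + 2 * norm (f (cst 0)))) (-r) T y"
proof -
  obtain N' where N': "hb \<alpha> N' (-r) T y" using hol_imp_hb[OF assms(4,5)] exps r assms by auto
  show ?thesis unfolding gf_def
  proof (rule gronwall[OF exps(1,4) \<nu>1 L_nonneg _ Z_nonneg _ _ assms(6,7) N'])
    fix N b s t assume *: "hb \<alpha> N (- r) b y" "0 \<le> s" "s \<le> t" "t \<le> b" "b \<le> T" "t - s \<le> 1"
    have "norm (y t - y s) \<le> (L * N + norm (f (cst 0))) * (t - s)
         + (C\<^sub>g * w) * N * ((t - s) powr \<nu> + Z * (t - s) powr (\<alpha> + \<nu>))"
      by (rule growth_increment[OF solves_restrict[OF assms(1)] hol_subset[OF assms(2)] assms(3) *(1-4)]) (use * in auto)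
    \<comment> \<open>Increments of length at most 1 allow the inhomogeneity to be counted with the
      exponent \<nu>.\<close>
    moreover have "norm (f (cst 0)) * (t - s) powr 1 \<le> norm (f (cst 0)) * (t - s) powr \<nu>"
      using * \<nu>1 by (intro mult_left_mono powr_le_powr_unit) auto
    ultimately show "norm (y t - y s) \<le> L * N * (t - s) + (C\<^sub>g * w) * N * ((t - s) powr \<nu> + Z * (t - s) powr (\<alpha> + \<nu>))
        + norm (f (cst 0)) * (t - s) powr \<nu>"
      using * by (simp add: distrib_right)
  qed (use C\<^sub>g_nonneg assms r in auto)
qed

lemma diff_increment:
  assumes "solves x1 T y1" "solves x2 T y2" "hol \<nu> w 0 T x1" "0 \<le> w" "hol \<nu> w2 0 T x2" "0 \<le> w2"
    and "hol \<alpha> K1 (-r) T y1" "0 \<le> K1" "hb \<alpha> N2 (-r) T y2" "hol \<nu> e 0 T (\<lambda>t. x1 t - x2 t)" "0 \<le> e"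
    and N: "hb \<alpha> N (-r) T (\<lambda>t. y1 t - y2 t)" and st: "0 \<le> s" "s \<le> t" "t \<le> T"
  shows "norm ((y1 t - y2 t) - (y1 s - y2 s)) \<le> L * N * (t - s)
     + (C\<^sub>g * w) * N * ((t - s) powr \<nu> + Z * (t - s) powr (\<alpha> + \<nu>))
     + (C\<^sub>g * e) * N2 * ((t - s) powr \<nu> + Z * (t - s) powr (\<alpha> + \<nu>))"
proof -
  have N2: "0 \<le> N2" using hb_nonneg[OF assms(9)] st r by simp
  have c1: "continuous_on {-r..T} y1" using hol_imp_continuous_on[OF assms(7)] exps by simp
  have c2: "continuous_on {-r..T} y2" using hol_imp_continuous_on[OF hb_hol[OF assms(9)]] exps by simp
  obtain J1 where J1: "has_young_integral (G y1) x1 s t J1" "y1 t - y1 s = integral {s..t} (F y1) + J1"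
    using solves_increment[OF assms(1,7,8,3,4) st] .
  obtain J2 where J2: "has_young_integral (G y2) x2 s t J2" "y2 t - y2 s = integral {s..t} (F y2) + J2"
    using solves_increment[OF assms(2) hb_hol[OF assms(9)] N2 assms(5,6) st] .
  \<comment> \<open>The second integrand against the first driver: this intermediate integral
    separates the change of the integrand from the change of the driver.\<close>
  obtain J' where J': "has_young_integral (G y2) x1 s t J'"
    using young_G[OF hb_hol[OF assms(9)] N2 assms(3,4)] st by metis
  have "has_young_integral (\<lambda>u. G y1 u - G y2 u) x1 s t (J1 - J')"
    by (rule has_young_integral_diff_integrand[OF J1(1) J'])
  then have "has_young_integral (G (\<lambda>t. y1 t - y2 t)) x1 s t (J1 - J')"
    by (subst has_young_integral_cong[where M' = "\<lambda>u. G y1 u - G y2 u" and x' = x1])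
       (use G_diff_eq[OF c1 c2] st in auto)
  then have 1: "norm (J1 - J') \<le> (C\<^sub>g * w) * N * ((t - s) powr \<nu> + Z * (t - s) powr (\<alpha> + \<nu>))"
    by (rule young_G_bound[OF N assms(3,4) st])
  have 2: "norm (J' - J2) \<le> (C\<^sub>g * e) * N2 * ((t - s) powr \<nu> + Z * (t - s) powr (\<alpha> + \<nu>))"
    by (rule young_G_bound[OF assms(9,10,11) st has_young_integral_diff_driver[OF J' J2(1)]])
  have 3: "norm (integral {s..t} (F y1) - integral {s..t} (F y2)) \<le> L * N * (t - s)"
  proof -
    have i: "F y1 integrable_on {s..t}" "F y2 integrable_on {s..t}"
      using F_integrable[OF assms(7)] F_integrable[OF hb_hol[OF assms(9)]] st by auto
    then have "((\<lambda>u. F y1 u - F y2 u) has_integral (integral {s..t} (F y1) - integral {s..t} (F y2))) {s..t}"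
      by (intro has_integral_diff) (auto simp: has_integral_integral)
    moreover have "norm (F y1 u - F y2 u) \<le> L * N" if "u \<in> {s..t}" for u
      using that st by (intro F_diff[OF c1 c2]) (auto intro: hbD[OF N])
    moreover have "0 \<le> L * N" using hb_nonneg[OF N] L_nonneg st r by simp
    ultimately show ?thesis
      using has_integral_bound_real[of "L * N" "{}" "\<lambda>u. F y1 u - F y2 u" _ s t] st by simp
  qed
  have "(y1 t - y2 t) - (y1 s - y2 s) = (y1 t - y1 s) - (y2 t - y2 s)" by simp
  also have "\<dots> = (integral {s..t} (F y1) - integral {s..t} (F y2)) + (J1 - J') + (J' - J2)"
    unfolding J1(2) J2(2) by simp
  finally show ?thesis
    using 1 2 3 by (simp only:) (intro order_trans[OF norm_triangle_ineq] add_mono)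
qed

text \<open>Driver and initial path vary together. Equal drivers (e = 0) give the Lipschitz estimate
  and uniqueness; e > 0 gives continuity in the noise, from which measurability will follow.\<close>

lemma stability:
  assumes "solves x1 T y1" "solves x2 T y2" "hol \<nu> w 0 T x1" "0 \<le> w" "hol \<nu> w2 0 T x2" "0 \<le> w2"
    and "hol \<alpha> K1 (-r) T y1" "0 \<le> K1" "hb \<alpha> N2 (-r) T y2" "hol \<nu> e 0 T (\<lambda>t. x1 t - x2 t)" "0 \<le> e"
    and "0 \<le> T" "hb \<alpha> N0 (-r) 0 (\<lambda>t. y1 t - y2 t)"
  shows "hb \<alpha> (gf T (C\<^sub>g * w) * (N0 + 2 * ((C\<^sub>g * e) * N2 * (1 + Z)))) (-r) T (\<lambda>t. y1 t - y2 t)"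
proof -
  have N2: "0 \<le> N2" using hb_nonneg[OF assms(9)] assms r by simp
  obtain N1 where "hb \<alpha> N1 (-r) T y1" using hol_imp_hb[OF assms(7,8)] exps r assms by auto
  then have fin: "hb \<alpha> (N1 + N2) (-r) T (\<lambda>t. y1 t - y2 t)" by (rule hb_diff[OF _ assms(9)])
  show ?thesis unfolding gf_def
  proof (rule gronwall[OF exps(1,4) \<nu>1 L_nonneg _ Z_nonneg _ _ assms(12,13) fin])
    fix N b s t assume *: "hb \<alpha> N (- r) b (\<lambda>t. y1 t - y2 t)" "0 \<le> s" "s \<le> t" "t \<le> b" "b \<le> T" "t - s \<le> 1"
    have "norm ((y1 t - y2 t) - (y1 s - y2 s)) \<le> L * N * (t - s)
     + (C\<^sub>g * w) * N * ((t - s) powr \<nu> + Z * (t - s) powr (\<alpha> + \<nu>))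
     + (C\<^sub>g * e) * N2 * ((t - s) powr \<nu> + Z * (t - s) powr (\<alpha> + \<nu>))"
      by (rule diff_increment[OF solves_restrict[OF assms(1)] solves_restrict[OF assms(2)]
            hol_subset[OF assms(3)] assms(4) hol_subset[OF assms(5)] assms(6) hol_subset[OF assms(7)] assms(8)
            hb_subset[OF assms(9)] hol_subset[OF assms(10)] assms(11) *(1-4)]) (use * in auto)
    moreover have "(C\<^sub>g * e) * N2 * ((t - s) powr \<nu> + Z * (t - s) powr (\<alpha> + \<nu>)) \<le> (C\<^sub>g * e) * N2 * ((t - s) powr \<nu> + Z * (t - s) powr \<nu>)"
      using * N2 assms C\<^sub>g_nonneg Z_nonneg exps by (intro mult_left_mono add_mono powr_le_powr_unit) auto
    ultimately show "norm ((y1 t - y2 t) - (y1 s - y2 s)) \<le> L * N * (t - s)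
       + (C\<^sub>g * w) * N * ((t - s) powr \<nu> + Z * (t - s) powr (\<alpha> + \<nu>)) + (C\<^sub>g * e) * N2 * (1 + Z) * (t - s) powr \<nu>"
      by (simp add: algebra_simps)
  qed (use C\<^sub>g_nonneg Z_nonneg N2 assms r in auto)
qed

lemma lipschitz:
  assumes "solves x T y1" "solves x T y2" "hol \<nu> w 0 T x" "0 \<le> w"
    and "hol \<alpha> K1 (-r) T y1" "0 \<le> K1" "hol \<alpha> K2 (-r) T y2" "0 \<le> K2"
    and "0 \<le> T" "hb \<alpha> N0 (-r) 0 (\<lambda>t. y1 t - y2 t)"
  shows "hb \<alpha> (gf T (C\<^sub>g * w) * N0) (-r) T (\<lambda>t. y1 t - y2 t)"
proof -
  obtain N2 where N2: "hb \<alpha> N2 (-r) T y2" using hol_imp_hb[OF assms(7,8)] exps r assms by auto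
  have "hol \<nu> 0 0 T (\<lambda>t. x t - x t)" by (simp add: hol_def)
  from stability[OF assms(1,2,3,4,3,4,5,6) N2 this _ assms(9,10)] show ?thesis by simp
qed

lemma solution_unique:
  assumes "solves x T y1" "solves x T y2" "hol \<nu> w 0 T x" "0 \<le> w"
    and "hol \<alpha> K1 (-r) T y1" "0 \<le> K1" "hol \<alpha> K2 (-r) T y2" "0 \<le> K2"
    and "0 \<le> T" "\<And>t. -r \<le> t \<Longrightarrow> t \<le> 0 \<Longrightarrow> y1 t = y2 t" "-r \<le> t" "t \<le> T"
  shows "y1 t = y2 t"
proof -
  have "hb \<alpha> 0 (-r) 0 (\<lambda>t. y1 t - y2 t)" using assms(10) by (simp add: hb_def hol_def)
  from hbD[OF lipschitz[OF assms(1-9) this] assms(11,12)] show ?thesis by simp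
qed

end

section \<open>Existence of solutions by Picard iteration on short steps\<close>

lemma has_young_integral_refl: "has_young_integral M x a a 0"
  unfolding has_young_integral_def
proof (intro allI impI)
  fix e :: real assume "0 < e"
  have "n = 0" if "p 0 = a \<and> p n = a \<and> (\<forall>i<n. p i < p (Suc i) \<and> p (Suc i) - p i < 1)" for n and p :: "nat \<Rightarrow> real"
  proof (rule ccontr)
    assume "n \<noteq> 0"
    then show False using partition_mono(2)[of n p "\<lambda>i. p (Suc i) - p i < 1" 1] that by force
  qed
  note n0 = this
  have "norm ((\<Sum>i<n. M (p i) *v (x (p (Suc i)) - x (p i))) - 0) < e"
    if "p 0 = a \<and> p n = a \<and> (\<forall>i<n. p i < p (Suc i) \<and> p (Suc i) - p i < 1)" for n and p :: "nat \<Rightarrow> real"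
    using n0[OF that] \<open>0 < e\<close> by simp
  then show "\<exists>\<delta>>0. \<forall>n p. p 0 = a \<and> p n = a \<and> (\<forall>i<n. p i < p (Suc i) \<and> p (Suc i) - p i < \<delta>) \<longrightarrow>
      norm ((\<Sum>i<n. M (p i) *v (x (p (Suc i)) - x (p i))) - 0) < e"
    using zero_less_one by blast
qed

lemma increment_hol:
  fixes y :: "real \<Rightarrow> 'a::real_normed_vector"
  assumes "\<And>s t. a \<le> s \<Longrightarrow> s \<le> t \<Longrightarrow> t \<le> b \<Longrightarrow>
      norm (y t - y s) \<le> B * (t - s) + v * ((t - s) powr \<nu> + Z * (t - s) powr (\<alpha> + \<nu>))"
    and "0 \<le> B" "0 \<le> v" "0 \<le> Z" "\<gamma> \<le> \<nu>" "\<nu> \<le> 1" "0 < \<alpha>"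
  shows "hol \<gamma> (B * (b - a) powr (1 - \<gamma>) + v * ((b - a) powr (\<nu> - \<gamma>) + Z * (b - a) powr (\<alpha> + \<nu> - \<gamma>))) a b y"
  unfolding hol_def
proof (intro allI impI)
  fix s t assume st: "a \<le> s" "s \<le> t" "t \<le> b"
  have p: "(t - s) powr \<mu> \<le> (b - a) powr (\<mu> - \<gamma>) * (t - s) powr \<gamma>" if "\<gamma> \<le> \<mu>" for \<mu>
  proof -
    have "(t - s) powr \<mu> = (t - s) powr (\<mu> - \<gamma>) * (t - s) powr \<gamma>" by (simp flip: powr_add)
    also have "\<dots> \<le> (b - a) powr (\<mu> - \<gamma>) * (t - s) powr \<gamma>"
      using st that by (intro mult_right_mono powr_mono2) auto
    finally show ?thesis .
  qed
  have "norm (y t - y s) \<le> B * (t - s) powr 1 + v * ((t - s) powr \<nu> + Z * (t - s) powr (\<alpha> + \<nu>))"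
    using assms(1)[OF st] st by simp
  also have "\<dots> \<le> B * ((b - a) powr (1 - \<gamma>) * (t - s) powr \<gamma>)
      + v * ((b - a) powr (\<nu> - \<gamma>) * (t - s) powr \<gamma> + Z * ((b - a) powr (\<alpha> + \<nu> - \<gamma>) * (t - s) powr \<gamma>))"
    using assms(2-) by (intro add_mono mult_left_mono p) auto
  finally show "norm (y t - y s) \<le> (B * (b - a) powr (1 - \<gamma>) + v * ((b - a) powr (\<nu> - \<gamma>) + Z * (b - a) powr (\<alpha> + \<nu> - \<gamma>))) * (t - s) powr \<gamma>"
    by (simp add: algebra_simps)
qed

context young_delay
begin

text \<open>The counterpart of \<open>diff_increment\<close> for paths that need not solve the
  equation, as the Picard map requires.\<close>

lemma diff_integrals:
  assumes "hol \<nu> w 0 T x" "0 \<le> w" "hol \<alpha> K1 (-r) T y1" "hol \<alpha> K2 (-r) T y2"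
    and N: "hb \<alpha> N (-r) T (\<lambda>t. y1 t - y2 t)" and st: "0 \<le> s" "s \<le> t" "t \<le> T"
    and J: "has_young_integral (G y1) x s t J1" "has_young_integral (G y2) x s t J2"
  shows "norm ((integral {s..t} (F y1) + J1) - (integral {s..t} (F y2) + J2)) \<le> L * N * (t - s)
     + (C\<^sub>g * w) * N * ((t - s) powr \<nu> + Z * (t - s) powr (\<alpha> + \<nu>))"
proof -
  have c1: "continuous_on {-r..T} y1" using hol_imp_continuous_on[OF assms(3)] exps by simp
  have c2: "continuous_on {-r..T} y2" using hol_imp_continuous_on[OF assms(4)] exps by simp
  have "has_young_integral (\<lambda>u. G y1 u - G y2 u) x s t (J1 - J2)"
    by (rule has_young_integral_diff_integrand[OF J])
  then have "has_young_integral (G (\<lambda>t. y1 t - y2 t)) x s t (J1 - J2)"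
    by (subst has_young_integral_cong[where M' = "\<lambda>u. G y1 u - G y2 u" and x' = x])
       (use G_diff_eq[OF c1 c2] st in auto)
  then have 1: "norm (J1 - J2) \<le> (C\<^sub>g * w) * N * ((t - s) powr \<nu> + Z * (t - s) powr (\<alpha> + \<nu>))"
    by (rule young_G_bound[OF N assms(1,2) st])
  have 3: "norm (integral {s..t} (F y1) - integral {s..t} (F y2)) \<le> L * N * (t - s)"
  proof -
    have i: "F y1 integrable_on {s..t}" "F y2 integrable_on {s..t}"
      using F_integrable[OF assms(3)] F_integrable[OF assms(4)] st by auto
    then have "((\<lambda>u. F y1 u - F y2 u) has_integral (integral {s..t} (F y1) - integral {s..t} (F y2))) {s..t}"
      by (intro has_integral_diff) (auto simp: has_integral_integral)
    moreover have "norm (F y1 u - F y2 u) \<le> L * N" if "u \<in> {s..t}" for u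
      using that st by (intro F_diff[OF c1 c2]) (auto intro: hbD[OF N])
    moreover have "0 \<le> L * N" using hb_nonneg[OF N] L_nonneg st r by simp
    ultimately show ?thesis
      using has_integral_bound_real[of "L * N" "{}" "\<lambda>u. F y1 u - F y2 u" _ s t] st by simp
  qed
  have "(integral {s..t} (F y1) + J1) - (integral {s..t} (F y2) + J2)
      = (integral {s..t} (F y1) - integral {s..t} (F y2)) + (J1 - J2)" by simp
  then show ?thesis
    using 1 3 by (simp only:) (intro order_trans[OF norm_triangle_ineq] add_mono)
qed

lemma solves_cong:
  assumes "solves x T y" "\<And>t. -r \<le> t \<Longrightarrow> t \<le> T \<Longrightarrow> y t = z t" "0 \<le> T"
  shows "solves x T z"
  unfolding solves_def
proof (intro allI impI)
  fix t assume t: "0 \<le> t" "t \<le> T"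
  obtain J where J: "has_young_integral (G y) x 0 t J" "y t = y 0 + integral {0..t} (F y) + J"
    using assms(1) t unfolding solves_def by blast
  have "has_young_integral (G z) x 0 t J"
    using J(1) by (subst has_young_integral_cong[where M' = "G y" and x' = x])
       (use t assms(2) in \<open>auto intro!: G_cong\<close>)
  moreover have "integral {0..t} (F y) = integral {0..t} (F z)"
    by (rule integral_cong) (use t assms(2) in \<open>auto intro!: F_cong\<close>)
  moreover have "y t = z t" "y 0 = z 0" using assms(2)[of t] assms(2)[of 0] t r by auto
  ultimately show "\<exists>J. has_young_integral (G z) x 0 t J \<and> z t = z 0 + integral {0..t} (F z) + J"
    using J(2) by auto
qed

text \<open>The Picard map acts on the paths over [-r, b] that coincide with \<open>y0\<close> up to
  \<open>a\<close>. Differences of images vanish up to \<open>a\<close>, so the smallness of the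
  single step [a, b] makes the map a contraction on the whole interval, whatever the length of the
  past.\<close>

lemma solve_extend:
  assumes w: "hol \<nu> w 0 b x" "0 \<le> w" and ab: "0 \<le> a" "a \<le> b"
    and y0: "hol \<alpha> K0 (-r) a y0" "0 \<le> K0" "solves x a y0"
    and step: "b - a \<le> gstep (\<nu> - \<alpha>) (L + (C\<^sub>g * w) * (1 + Z))"
  shows "\<exists>y K. 0 \<le> K \<and> hol \<alpha> K (-r) b y \<and> (\<forall>t. -r \<le> t \<longrightarrow> t \<le> a \<longrightarrow> y t = y0 t) \<and> solves x b y"
proof -
  let ?H = "holder_space \<alpha> {-r..b} :: (real \<Rightarrow> real^'d) set"
  let ?d = "holder_dist \<alpha> {-r..b} :: (real \<Rightarrow> real^'d) \<Rightarrow> (real \<Rightarrow> real^'d) \<Rightarrow> real"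
  let ?V = "L + (C\<^sub>g * w) * (1 + Z)"
  let ?\<tau> = "gstep (\<nu> - \<alpha>) ?V"
  have V: "0 \<le> ?V" using L_nonneg C\<^sub>g_nonneg w Z_nonneg by simp
  have gs: "0 < ?\<tau>" "?\<tau> \<le> 1" "?V * ?\<tau> powr (\<nu> - \<alpha>) \<le> 1/4"
    using gstep[OF _ V, of "\<nu> - \<alpha>"] exps by auto
  define X where "X = {y \<in> ?H. \<forall>t. -r \<le> t \<longrightarrow> t \<le> a \<longrightarrow> y t = y0 t}"
  interpret M: Metric_space ?H ?d by (rule Metric_space_holder)
  interpret S: Submetric ?H ?d X by unfold_locales (auto simp: X_def)
  \<comment> \<open>Agreement with \<open>y0\<close> up to \<open>a\<close> is a closed condition,
    because evaluation is bounded by the distance.\<close>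
  have complete: "S.sub.mcomplete"
  proof (rule S.sequentially_closedin_mcomplete_imp_mcomplete[OF mcomplete_holder])
    fix \<sigma> l assume *: "range \<sigma> \<subseteq> X \<and> limitin M.mtopology \<sigma> l sequentially"
    then have l: "l \<in> ?H" using M.limitin_mspace by blast
    have "l t = y0 t" if t: "-r \<le> t" "t \<le> a" for t
    proof (rule ccontr)
      assume "l t \<noteq> y0 t"
      then have "0 < norm (l t - y0 t)" by simp
      then have "\<forall>\<^sub>F n in sequentially. \<sigma> n \<in> ?H \<and> ?d (\<sigma> n) l < norm (l t - y0 t)"
        using * unfolding M.limitin_metric by blast
      then obtain n where n: "\<sigma> n \<in> ?H" "?d (\<sigma> n) l < norm (l t - y0 t)"
        unfolding eventually_sequentially by blast
      have "norm (\<sigma> n t - l t) \<le> ?d (\<sigma> n) l" using hbD[OF hb_holder_dist[OF n(1) l]] t ab by simp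
      moreover have "\<sigma> n t = y0 t" using * t by (auto simp: X_def)
      ultimately show False using n(2) by (simp add: norm_minus_commute)
    qed
    then show "l \<in> X" using l by (simp add: X_def)
  qed
  define JJ where "JJ y t = (THE J. has_young_integral (G y) x 0 t J)" for y t
  define \<Gamma> where "\<Gamma> y = restrict (\<lambda>t. if t \<le> 0 then y0 t else y0 0 + integral {0..t} (F y) + JJ y t) {-r..b}" for y
  have XN: "\<exists>N\<ge>0. hb \<alpha> N (-r) b y" if "y \<in> X" for y using that by (simp add: X_def holder_space_iff)
  have JJ: "JJ y t = J" if "has_young_integral (G y) x 0 t J" "0 \<le> t" for y t J
    unfolding JJ_def using that has_young_integral_unique by (intro the_equality) auto
  have \<Gamma>inc: "\<exists>J. has_young_integral (G y) x s t J \<and> \<Gamma> y t - \<Gamma> y s = integral {s..t} (F y) + J"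
    if y: "y \<in> X" and st: "0 \<le> s" "s \<le> t" "t \<le> b" for y s t
  proof -
    obtain N where N: "0 \<le> N" "hb \<alpha> N (-r) b y" using XN[OF y] by blast
    obtain \<Phi> where \<Phi>: "\<And>s t. 0 \<le> s \<Longrightarrow> s \<le> t \<Longrightarrow> t \<le> b \<Longrightarrow> has_young_integral (G y) x s t (\<Phi> t - \<Phi> s)"
      using young_G[OF hb_hol[OF N(2)] N(1) w] by blast
    have \<Gamma>t: "\<Gamma> y t = y0 0 + integral {0..t} (F y) + (\<Phi> t - \<Phi> 0)" if "0 \<le> t" "t \<le> b" for t
      using that JJ[OF \<Phi>[of 0 t]] r by (auto simp: \<Gamma>_def)
    have I: "integral {0..s} (F y) + integral {s..t} (F y) = integral {0..t} (F y)"
      using st by (intro Henstock_Kurzweil_Integration.integral_combine F_integrable[OF hb_hol[OF N(2)]]) auto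
    have s: "s \<le> b" "0 \<le> t" using st by auto
    have "\<Gamma> y t - \<Gamma> y s = integral {s..t} (F y) + (\<Phi> t - \<Phi> s)"
      unfolding \<Gamma>t[OF s(2) st(3)] \<Gamma>t[OF st(1) s(1)] I[symmetric] by simp
    then show ?thesis using \<Phi>[OF st] by blast
  qed
  \<comment> \<open>Up to time \<open>a\<close> the map returns \<open>y0\<close>, because
    \<open>y0\<close> already solves the equation there.\<close>
  have \<Gamma>past: "\<Gamma> y t = y0 t" if y: "y \<in> X" and t: "-r \<le> t" "t \<le> a" for y t
  proof (cases "t \<le> 0")
    case True
    then show ?thesis using t ab by (simp add: \<Gamma>_def)
  next
    case False
    have eq: "y s = y0 s" if "-r \<le> s" "s \<le> t" for s using y that t by (simp add: X_def)
    obtain J where J: "has_young_integral (G y0) x 0 t J" "y0 t = y0 0 + integral {0..t} (F y0) + J"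
      using y0(3)[unfolded solves_def, rule_format, of t] t False by auto
    have "has_young_integral (G y) x 0 t J"
      using J(1) by (subst has_young_integral_cong[where M' = "G y0" and x' = x])
         (use eq in \<open>auto intro!: G_cong\<close>)
    then have "JJ y t = J" using JJ False by simp
    moreover have "integral {0..t} (F y) = integral {0..t} (F y0)"
      by (rule integral_cong) (use eq in \<open>auto intro!: F_cong\<close>)
    ultimately show ?thesis using J(2) False t ab by (simp add: \<Gamma>_def)
  qed
  have \<Gamma>X: "\<Gamma> y \<in> X" if y: "y \<in> X" for y
  proof -
    obtain N where N: "0 \<le> N" "hb \<alpha> N (-r) b y" using XN[OF y] by blast
    have "hol \<alpha> (L * N) 0 b (F y)" by (rule hol_F[OF hb_hol[OF N(2)]])
    then obtain B where B: "0 \<le> B" "hb \<alpha> B 0 b (F y)"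
      using hol_imp_hb[of \<alpha> "L * N" 0 b] L_nonneg N exps ab by auto
    have "\<exists>K\<ge>0. hol \<alpha> K 0 b (\<Gamma> y)"
    proof (intro exI conjI)
      show "hol \<alpha> (B * (b - 0) powr (1 - \<alpha>) + (C\<^sub>g * w * N) * ((b - 0) powr (\<nu> - \<alpha>) + Z * (b - 0) powr (\<alpha> + \<nu> - \<alpha>))) 0 b (\<Gamma> y)"
      proof (rule increment_hol)
        fix s t assume st: "0 \<le> s" "s \<le> t" "t \<le> b"
        obtain J where J: "has_young_integral (G y) x s t J" "\<Gamma> y t - \<Gamma> y s = integral {s..t} (F y) + J"
          using \<Gamma>inc[OF y st] by blast
        have "norm (integral {s..t} (F y)) \<le> B * (t - s)"
          by (rule integral_F_bound[OF hb_hol[OF N(2)] st]) (use st in \<open>auto intro: hbD[OF B(2)]\<close>)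
        moreover have "norm J \<le> C\<^sub>g * w * N * ((t - s) powr \<nu> + Z * (t - s) powr (\<alpha> + \<nu>))"
          by (rule young_G_bound[OF N(2) w st J(1)])
        ultimately show "norm (\<Gamma> y t - \<Gamma> y s) \<le> B * (t - s) + C\<^sub>g * w * N * ((t - s) powr \<nu> + Z * (t - s) powr (\<alpha> + \<nu>))"
          unfolding J(2) by (intro order_trans[OF norm_triangle_ineq] add_mono)
      qed (use B C\<^sub>g_nonneg w N Z_nonneg exps \<nu>1 in auto)
    qed (use B C\<^sub>g_nonneg w N Z_nonneg in auto)
    then obtain K where K: "0 \<le> K" "hol \<alpha> K 0 b (\<Gamma> y)" by blast
    have "hol \<alpha> K0 (-r) 0 (\<Gamma> y)"
      using hol_subset[OF y0(1), of "-r" 0] ab by (subst hol_cong[where z = y0]) (auto simp: \<Gamma>past[OF y])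
    then have "hol \<alpha> (K0 + K) (-r) b (\<Gamma> y)" by (rule hol_glue[OF _ K(2) y0(2) K(1) exps(1)])
    then have "\<exists>N\<ge>0. hb \<alpha> N (-r) b (\<Gamma> y)" using hol_imp_hb[of \<alpha> "K0 + K" "-r" b] y0 K exps r ab by auto
    then show ?thesis using \<Gamma>past[OF y] by (simp add: X_def holder_space_iff) (simp add: \<Gamma>_def)
  qed
  \<comment> \<open>The factor is 1/4 from the step length times 2 from the passage from
    \<open>hb\<close> to the norm.\<close>
  have contr: "?d (\<Gamma> y1) (\<Gamma> y2) \<le> 1/2 * ?d y1 y2" if y1: "y1 \<in> X" and y2: "y2 \<in> X" for y1 y2
  proof -
    let ?N = "?d y1 y2"
    have "y1 \<in> ?H" "y2 \<in> ?H" using y1 y2 by (auto simp: X_def)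
    then have N: "hb \<alpha> ?N (-r) b (\<lambda>t. y1 t - y2 t)" by (rule hb_holder_dist)
    have N0: "0 \<le> ?N" by simp
    obtain N1 where N1: "0 \<le> N1" "hb \<alpha> N1 (-r) b y1" using XN[OF y1] by blast
    obtain N2 where N2: "0 \<le> N2" "hb \<alpha> N2 (-r) b y2" using XN[OF y2] by blast
    let ?z = "\<lambda>t. \<Gamma> y1 t - \<Gamma> y2 t"
    have 0: "hol \<alpha> 0 (-r) a ?z" using \<Gamma>past[OF y1] \<Gamma>past[OF y2] by (auto simp: hol_def)
    have 1: "hol \<alpha> (?N / 4) a b ?z"
      unfolding hol_def
    proof (intro allI impI)
      fix s t assume "a \<le> s" "s \<le> t" "t \<le> b"
      then have st: "0 \<le> s" "s \<le> t" "t \<le> b" "t - s \<le> ?\<tau>" using ab step by auto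
      obtain J1 where J1: "has_young_integral (G y1) x s t J1" "\<Gamma> y1 t - \<Gamma> y1 s = integral {s..t} (F y1) + J1"
        using \<Gamma>inc[OF y1 st(1-3)] by blast
      obtain J2 where J2: "has_young_integral (G y2) x s t J2" "\<Gamma> y2 t - \<Gamma> y2 s = integral {s..t} (F y2) + J2"
        using \<Gamma>inc[OF y2 st(1-3)] by blast
      have "?z t - ?z s = (\<Gamma> y1 t - \<Gamma> y1 s) - (\<Gamma> y2 t - \<Gamma> y2 s)" by simp
      also have "norm \<dots> \<le> L * ?N * (t - s) + (C\<^sub>g * w) * ?N * ((t - s) powr \<nu> + Z * (t - s) powr (\<alpha> + \<nu>))"
        unfolding J1(2) J2(2) by (rule diff_integrals[OF w hb_hol[OF N1(2)] hb_hol[OF N2(2)] N st(1-3) J1(1) J2(1)])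
      also have "\<dots> \<le> (?V * ?\<tau> powr (\<nu> - \<alpha>) * ?N + 0 * ?\<tau> powr (\<nu> - \<alpha>)) * (t - s) powr \<alpha>"
        using increment_le[of "t - s" ?\<tau> \<alpha> \<nu> L "C\<^sub>g * w" Z ?N 0] st gs exps \<nu>1 L_nonneg C\<^sub>g_nonneg w Z_nonneg N0 by simp
      also have "\<dots> \<le> (1/4 * ?N) * (t - s) powr \<alpha>"
        using mult_right_mono[OF gs(3) N0] by (intro mult_right_mono) simp_all
      finally show "norm (?z t - ?z s) \<le> (?N / 4) * (t - s) powr \<alpha>" by simp
    qed
    have 2: "hol \<alpha> (?N / 4) (-r) b ?z" using hol_glue[OF 0 1 _ _ exps(1)] N0 by simp
    have "norm (?z t) \<le> ?N / 4" if t: "-r \<le> t" "t \<le> b" for t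
    proof (cases "t \<le> a")
      case True
      then show ?thesis using \<Gamma>past[OF y1 t(1)] \<Gamma>past[OF y2 t(1)] N0 by simp
    next
      case False
      have "\<Gamma> y1 a = y0 a" "\<Gamma> y2 a = y0 a" using \<Gamma>past y1 y2 ab r by auto
      then have "norm (?z t) = norm (?z t - ?z a)" by simp
      also have "\<dots> \<le> ?N / 4 * (t - a) powr \<alpha>" using False t by (intro holD[OF 1]) auto
      also have "\<dots> \<le> ?N / 4 * 1 powr \<alpha>"
        using False t step gs N0 exps by (intro mult_left_mono powr_mono2) auto
      finally show ?thesis by simp
    qed
    then have "hb \<alpha> (?N / 4) (-r) b ?z" using 2 by (simp add: hb_def)
    from holder_dist_le[OF this] N0 show ?thesis by simp
  qed
  \<comment> \<open>Freezing \<open>y0\<close> at its value in \<open>a\<close> gives a member of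
    \<open>X\<close>.\<close>
  have "X \<noteq> {}"
  proof -
    let ?y = "restrict (\<lambda>t. if t \<le> a then y0 t else y0 a) {-r..b}"
    have "hol \<alpha> K0 (-r) a ?y" using y0(1) ab by (subst hol_cong[where z = y0]) auto
    moreover have "hol \<alpha> 0 a b ?y" using ab r by (auto simp: hol_def)
    ultimately have "hol \<alpha> (K0 + 0) (-r) b ?y" by (rule hol_glue[OF _ _ y0(2) order_refl exps(1)])
    then have "\<exists>N\<ge>0. hb \<alpha> N (-r) b ?y" using hol_imp_hb[of \<alpha> "K0 + 0" "-r" b] y0 exps r ab by auto
    then have "?y \<in> X" using ab by (simp add: X_def holder_space_iff)
    then show ?thesis by blast
  qed
  then obtain y where y: "y \<in> X" "\<Gamma> y = y"
    using S.sub.Banach_fixedpoint_thm[OF complete, of \<Gamma> "1/2"] \<Gamma>X contr by (auto simp: Pi_def)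
  obtain N where N: "0 \<le> N" "hb \<alpha> N (-r) b y" using XN[OF y(1)] by blast
  have "solves x b y"
    unfolding solves_def
  proof (intro allI impI)
    fix t assume t: "0 \<le> t" "t \<le> b"
    obtain J where "has_young_integral (G y) x 0 t J" "\<Gamma> y t - \<Gamma> y 0 = integral {0..t} (F y) + J"
      using \<Gamma>inc[OF y(1) order_refl t] by blast
    then show "\<exists>J. has_young_integral (G y) x 0 t J \<and> y t = y 0 + integral {0..t} (F y) + J"
      unfolding y(2) by (intro exI[of _ J]) (simp add: algebra_simps)
  qed
  then show ?thesis using N hb_hol[OF N(2)] y(1) by (auto simp: X_def)
qed

text \<open>The admissible step length depends on the noise over [0, T] but neither on the initial
  path nor on the solution, so finitely many steps of that length reach T.\<close>

lemma solve_exists: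
  assumes w: "hol \<nu> w 0 T x" "0 \<le> w" and T: "0 \<le> T"
    and \<eta>: "hol \<alpha> K0 (-r) 0 \<eta>" "0 \<le> K0"
  shows "\<exists>y K. 0 \<le> K \<and> hol \<alpha> K (-r) T y \<and> (\<forall>t. -r \<le> t \<longrightarrow> t \<le> 0 \<longrightarrow> y t = \<eta> t) \<and> solves x T y"
proof -
  let ?\<tau> = "gstep (\<nu> - \<alpha>) (L + (C\<^sub>g * w) * (1 + Z))"
  have V: "0 \<le> L + (C\<^sub>g * w) * (1 + Z)" using L_nonneg C\<^sub>g_nonneg w Z_nonneg by simp
  have gs: "0 < ?\<tau>" using gstep(1)[OF _ V, of "\<nu> - \<alpha>"] exps by auto
  have *: "\<exists>y K. 0 \<le> K \<and> hol \<alpha> K (-r) (min T (real k * ?\<tau>)) y \<and> (\<forall>t. -r \<le> t \<longrightarrow> t \<le> 0 \<longrightarrow> y t = \<eta> t)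
      \<and> solves x (min T (real k * ?\<tau>)) y" for k :: nat
  proof (induct k)
    case 0
    have "solves x 0 \<eta>"
      unfolding solves_def
    proof (intro allI impI)
      fix t :: real assume "0 \<le> t" "t \<le> 0"
      then have "t = 0" by simp
      then show "\<exists>J. has_young_integral (G \<eta>) x 0 t J \<and> \<eta> t = \<eta> 0 + integral {0..t} (F \<eta>) + J"
        using has_young_integral_refl by (intro exI[of _ 0]) simp
    qed
    then show ?case using \<eta> T by auto
  next
    case (Suc k)
    let ?a = "min T (real k * ?\<tau>)" and ?b = "min T (real (Suc k) * ?\<tau>)"
    have a0: "0 \<le> ?a" using gs T by simp
    have "real (Suc k) * ?\<tau> = real k * ?\<tau> + ?\<tau>" by (simp add: distrib_right)
    then have ab: "?a \<le> ?b" "?b - ?a \<le> ?\<tau>" using gs by auto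
    obtain y0 K where y0: "0 \<le> K" "hol \<alpha> K (-r) ?a y0" "\<And>t. -r \<le> t \<Longrightarrow> t \<le> 0 \<Longrightarrow> y0 t = \<eta> t" "solves x ?a y0"
      using Suc by blast
    have "hol \<nu> w 0 ?b x" by (rule hol_subset[OF w(1)]) auto
    from solve_extend[OF this w(2) a0 ab(1) y0(2,1,4) ab(2)]
    obtain y K' where y: "0 \<le> K'" "hol \<alpha> K' (-r) ?b y" "\<And>t. -r \<le> t \<Longrightarrow> t \<le> ?a \<Longrightarrow> y t = y0 t" "solves x ?b y"
      by blast
    have "y t = \<eta> t" if "-r \<le> t" "t \<le> 0" for t
      using y(3)[of t] y0(3)[OF that] that a0 by simp
    then show ?case using y by blast
  qed
  obtain k where "T / ?\<tau> \<le> real k" using real_arch_simple by blast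
  then have "T \<le> real k * ?\<tau>" using gs by (simp add: field_simps)
  then show ?thesis using *[of k] by (simp add: min_def)
qed

section \<open>Global solutions and the cocycle they generate\<close>

definition lhol :: "(real \<Rightarrow> real^'m) \<Rightarrow> bool" where
  "lhol x \<longleftrightarrow> (\<forall>a b. \<exists>w\<ge>0. hol \<nu> w a b x)"

text \<open>Only \<alpha>-Hoelder bounds are demanded; the vanishing modulus and the
  \<beta>-regularity in \<open>is_solution\<close> follow from the equation and the initial path,
  see \<open>is_solution_iff\<close>.\<close>

definition gsol :: "(real \<Rightarrow> real^'m) \<Rightarrow> (real \<Rightarrow> real^'d) \<Rightarrow> (real \<Rightarrow> real^'d) \<Rightarrow> bool" where
  "gsol x \<eta> y \<longleftrightarrow> y \<in> extensional {-r..} \<and> (\<forall>t. -r \<le> t \<longrightarrow> t \<le> 0 \<longrightarrow> y t = \<eta> t) \<and>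
     (\<forall>T\<ge>0. (\<exists>K\<ge>0. hol \<alpha> K (-r) T y) \<and> solves x T y)"

abbreviation S where "S \<equiv> (little_holder_space \<alpha> {-r..0} :: (real \<Rightarrow> real^'d) set)"

lemma S_iff: "\<eta> \<in> S \<longleftrightarrow> \<eta> \<in> extensional {-r..0} \<and> vm \<alpha> (-r) 0 \<eta>"
  using little_holder_space_iff[of \<alpha> "-r" 0 \<eta>] exps r by simp

lemma S_hol: "\<eta> \<in> S \<Longrightarrow> \<exists>K\<ge>0. hol \<alpha> K (-r) 0 \<eta>"
  using vm_imp_hol exps by (auto simp: S_iff)

lemma gsol_exists:
  assumes x: "lhol x" and \<eta>: "\<eta> \<in> S"
  shows "\<exists>y. gsol x \<eta> y"
proof -
  obtain K0 where K0: "0 \<le> K0" "hol \<alpha> K0 (-r) 0 \<eta>" using S_hol[OF \<eta>] by blast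
  have "\<exists>y. (\<exists>K\<ge>0. hol \<alpha> K (-r) T y) \<and> (\<forall>t. -r \<le> t \<longrightarrow> t \<le> 0 \<longrightarrow> y t = \<eta> t) \<and> solves x T y"
    if T: "0 \<le> T" for T
  proof -
    obtain w where w: "0 \<le> w" "hol \<nu> w 0 T x" using x unfolding lhol_def by blast
    show ?thesis using solve_exists[OF w(2,1) T K0(2,1)] by blast
  qed
  then obtain Y where Y: "\<And>T. 0 \<le> T \<Longrightarrow> \<exists>K\<ge>0. hol \<alpha> K (-r) T (Y T)"
    "\<And>T t. 0 \<le> T \<Longrightarrow> -r \<le> t \<Longrightarrow> t \<le> 0 \<Longrightarrow> Y T t = \<eta> t" "\<And>T. 0 \<le> T \<Longrightarrow> solves x T (Y T)"
    by metis
  have agree: "Y T t = Y T' t" if T: "0 \<le> T" "T \<le> T'" "-r \<le> t" "t \<le> T" for T T' t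
  proof -
    obtain w where w: "0 \<le> w" "hol \<nu> w 0 T x" using x unfolding lhol_def by blast
    obtain K1 where K1: "0 \<le> K1" "hol \<alpha> K1 (-r) T (Y T)" using Y(1) T by blast
    have "0 \<le> T'" using T by simp
    then obtain K2 where K2: "0 \<le> K2" "hol \<alpha> K2 (-r) T' (Y T')" using Y(1) by blast
    have "hol \<alpha> K2 (-r) T (Y T')" using hol_subset[OF K2(2)] T by simp
    from solution_unique[OF Y(3)[OF T(1)] solves_restrict[OF Y(3)[OF \<open>0 \<le> T'\<close>] T(2)] w(2,1) K1(2,1) this K2(1) T(1) _ T(3,4)]
    show ?thesis using Y(2) T \<open>0 \<le> T'\<close> by simp
  qed
  \<comment> \<open>At time \<open>t\<close> the solution with horizon \<open>max 0 t\<close> is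
    used; by uniqueness every larger horizon gives the same value.\<close>
  define y where "y = restrict (\<lambda>t. Y (max 0 t) t) {-r..}"
  have y: "y t = Y T t" if "0 \<le> T" "-r \<le> t" "t \<le> T" for t T
    using agree[of "max 0 t" T t] that by (simp add: y_def)
  have "gsol x \<eta> y"
    unfolding gsol_def
  proof (intro conjI allI impI)
    show "y \<in> extensional {-r..}" by (simp add: y_def)
    show "y t = \<eta> t" if "-r \<le> t" "t \<le> 0" for t using y[of 0 t] Y(2)[of 0 t] that by simp
    fix T :: real assume T: "0 \<le> T"
    obtain K where K: "0 \<le> K" "hol \<alpha> K (-r) T (Y T)" using Y(1)[OF T] by blast
    then show "\<exists>K\<ge>0. hol \<alpha> K (-r) T y" using hol_cong[of "-r" T y "Y T" \<alpha> K] y[OF T] by auto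
    show "solves x T y" by (rule solves_cong[OF Y(3)[OF T] _ T]) (use y[OF T] in auto)
  qed
  then show ?thesis by blast
qed

lemma gsol_hol: "gsol x \<eta> y \<Longrightarrow> 0 \<le> T \<Longrightarrow> \<exists>K\<ge>0. hol \<alpha> K (-r) T y"
  by (simp add: gsol_def)

lemma gsol_solves: "gsol x \<eta> y \<Longrightarrow> 0 \<le> T \<Longrightarrow> solves x T y"
  by (simp add: gsol_def)

lemma gsol_past: "gsol x \<eta> y \<Longrightarrow> -r \<le> t \<Longrightarrow> t \<le> 0 \<Longrightarrow> y t = \<eta> t"
  by (simp add: gsol_def)

lemma gsol_unique:
  assumes x: "lhol x" and y: "gsol x \<eta> y1" "gsol x \<eta> y2"
  shows "y1 = y2"
proof (rule extensionalityI[of _ "{-r..}"])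
  fix t assume "t \<in> {-r..}"
  then have t: "-r \<le> t" by simp
  let ?T = "max 0 t"
  obtain w where w: "0 \<le> w" "hol \<nu> w 0 ?T x" using x unfolding lhol_def by blast
  obtain K1 where K1: "0 \<le> K1" "hol \<alpha> K1 (-r) ?T y1" using gsol_hol[OF y(1), of ?T] by auto
  obtain K2 where K2: "0 \<le> K2" "hol \<alpha> K2 (-r) ?T y2" using gsol_hol[OF y(2), of ?T] by auto
  show "y1 t = y2 t"
    by (rule solution_unique[OF gsol_solves[OF y(1)] gsol_solves[OF y(2)] w(2,1) K1(2,1) K2(2,1) _ _ t])
       (use gsol_past[OF y(1)] gsol_past[OF y(2)] in auto)
qed (use y in \<open>auto simp: gsol_def\<close>)

text \<open>On bounded intervals both integrals have increments of order \<nu> > \<beta>, even if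
  the initial path is merely \<alpha>-Hoelder.\<close>

lemma gsol_beta:
  assumes x: "lhol x" and y: "gsol x \<eta> y" and T: "0 \<le> T"
  shows "\<exists>K\<ge>0. hol \<beta> K 0 T y"
proof -
  obtain w where w: "0 \<le> w" "hol \<nu> w 0 T x" using x unfolding lhol_def by blast
  obtain K where K: "0 \<le> K" "hol \<alpha> K (-r) T y" using gsol_hol[OF y T] by blast
  obtain N where N: "0 \<le> N" "hb \<alpha> N (-r) T y" using hol_imp_hb[OF K(2,1)] exps r T by auto
  have "hol \<beta> ((L * N + norm (f (cst 0))) * (T - 0) powr (1 - \<beta>) + (C\<^sub>g * w * N) * ((T - 0) powr (\<nu> - \<beta>) + Z * (T - 0) powr (\<alpha> + \<nu> - \<beta>))) 0 T y"
  proof (rule increment_hol)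
    fix s t assume st: "0 \<le> s" "s \<le> t" "t \<le> T"
    show "norm (y t - y s) \<le> (L * N + norm (f (cst 0))) * (t - s) + (C\<^sub>g * w * N) * ((t - s) powr \<nu> + Z * (t - s) powr (\<alpha> + \<nu>))"
      by (rule growth_increment[OF gsol_solves[OF y T] w(2,1) N(2) st])
  qed (use L_nonneg N C\<^sub>g_nonneg w Z_nonneg \<beta>\<nu> \<nu>1 exps in auto)
  moreover have "0 \<le> (L * N + norm (f (cst 0))) * (T - 0) powr (1 - \<beta>) + (C\<^sub>g * w * N) * ((T - 0) powr (\<nu> - \<beta>) + Z * (T - 0) powr (\<alpha> + \<nu> - \<beta>))"
    using C\<^sub>f_nonneg N C\<^sub>g_nonneg w Z_nonneg by (intro add_nonneg_nonneg mult_nonneg_nonneg) auto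
  ultimately show ?thesis by blast
qed

text \<open>The past has a vanishing modulus by the choice of the state space, the future because it
  is Hoelder with the larger exponent \<beta>. Hence the flow never leaves the closure of the smooth
  paths.\<close>

lemma gsol_vm:
  assumes x: "lhol x" and \<eta>: "\<eta> \<in> S" and y: "gsol x \<eta> y" and T: "0 \<le> T"
  shows "vm \<alpha> (-r) T y"
proof (rule vm_glue[OF _ _ exps(1)])
  show "vm \<alpha> (-r) 0 y" using \<eta> vm_cong[of "-r" 0 y \<eta> \<alpha>] gsol_past[OF y] by (simp add: S_iff)
  show "vm \<alpha> 0 T y" using gsol_beta[OF x y T] hol_imp_vm \<alpha>\<beta> by blast
qed

text \<open>Together with existence and uniqueness of \<open>gsol\<close> this allows the definite
  description in \<open>delay_rds\<close> to be evaluated.\<close>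

lemma is_solution_iff:
  assumes x: "lhol x" and \<eta>: "\<eta> \<in> S"
  shows "is_solution r \<alpha> \<beta> A f g x \<eta> y \<longleftrightarrow> gsol x \<eta> y"
proof
  assume s: "is_solution r \<alpha> \<beta> A f g x \<eta> y"
  have past: "y t = \<eta> t" if "-r \<le> t" "t \<le> 0" for t
  proof -
    have "restrict y {-r..0} t = \<eta> t" using s by (simp add: is_solution_def)
    then show ?thesis using that by simp
  qed
  have hol: "\<exists>K\<ge>0. hol \<alpha> K (-r) T y" if T: "0 \<le> T" for T
  proof -
    \<comment> \<open>The definition speaks of positive horizons; T + 1 also covers T = 0.\<close>
    have "restrict y {-r..T + 1} \<in> little_holder_space \<alpha> {-r..T + 1}"
      using s T by (simp add: is_solution_def)
    then have "vm \<alpha> (-r) (T + 1) (restrict y {-r..T + 1})"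
      by (subst (asm) little_holder_space_iff) (use exps r T in auto)
    then have "vm \<alpha> (-r) (T + 1) y" using vm_cong[of "-r" "T + 1" y "restrict y {-r..T + 1}"] by simp
    then have "vm \<alpha> (-r) T y" by (rule vm_subset) auto
    then show ?thesis using vm_imp_hol exps by blast
  qed
  have "solves x T y" if T: "0 \<le> T" for T
    unfolding solves_def
  proof (intro allI impI)
    fix t assume t: "0 \<le> t" "t \<le> T"
    obtain I J where IJ: "((\<lambda>u. A *v y u + f (segment r u y)) has_integral I) {0..t}"
        "has_young_integral (\<lambda>u. g (segment r u y)) x 0 t J" "y t = \<eta> 0 + I + J"
      using s t unfolding is_solution_def by blast
    have "integral {0..t} (F y) = I" using IJ(1) unfolding F_def[abs_def] by (rule integral_unique)
    then show "\<exists>J. has_young_integral (G y) x 0 t J \<and> y t = y 0 + integral {0..t} (F y) + J"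
      using IJ(2,3) past[of 0] r unfolding G_def[abs_def] by auto
  qed
  then show "gsol x \<eta> y" using s past hol by (simp add: gsol_def is_solution_def)
next
  assume y: "gsol x \<eta> y"
  have e\<eta>: "\<eta> \<in> extensional {-r..0}" using \<eta> by (simp add: S_iff)
  show "is_solution r \<alpha> \<beta> A f g x \<eta> y"
    unfolding is_solution_def
  proof (intro conjI allI impI)
    show "y \<in> extensional {-r..}" using y by (simp add: gsol_def)
    show "restrict y {-r..0} = \<eta>"
      by (rule extensionalityI[OF restrict_extensional e\<eta>]) (use gsol_past[OF y] in simp)
    fix T :: real assume T: "0 < T"
    show "restrict y {-r..T} \<in> little_holder_space \<alpha> {-r..T}"
      using gsol_vm[OF x \<eta> y, of T] vm_cong[of "-r" T y "restrict y {-r..T}"] T r exps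
      by (simp add: little_holder_space_iff)
    obtain K where K: "0 \<le> K" "hol \<beta> K 0 T y" using gsol_beta[OF x y, of T] T by auto
    have "hol \<beta> K 0 T (restrict y {0..T})" using K(2) hol_cong[of 0 T y "restrict y {0..T}"] by simp
    then have "\<exists>N\<ge>0. hb \<beta> N 0 T (restrict y {0..T})"
      using hol_imp_hb[of \<beta> K 0 T] K(1) T exps \<alpha>\<beta> by auto
    then show "restrict y {0..T} \<in> holder_space \<beta> {0..T}" by (simp add: holder_space_iff)
  next
    fix t :: real assume t: "0 \<le> t"
    obtain K where K: "0 \<le> K" "hol \<alpha> K (-r) t y" using gsol_hol[OF y t] by blast
    have "(F y has_integral integral {0..t} (F y)) {0..t}"
      using F_integrable[OF K(2) order_refl order_refl] by (simp add: has_integral_integral)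
    moreover obtain J where J: "has_young_integral (G y) x 0 t J" "y t = y 0 + integral {0..t} (F y) + J"
      using gsol_solves[OF y t] t unfolding solves_def by blast
    moreover have "y 0 = \<eta> 0" using gsol_past[OF y, of 0] r by simp
    ultimately show "\<exists>I J. ((\<lambda>u. A *v y u + f (segment r u y)) has_integral I) {0..t} \<and>
        has_young_integral (\<lambda>u. g (segment r u y)) x 0 t J \<and> y t = \<eta> 0 + I + J"
      unfolding F_def[abs_def] G_def[abs_def] by auto
  qed
qed

definition ysol :: "(real \<Rightarrow> real^'m) \<Rightarrow> (real \<Rightarrow> real^'d) \<Rightarrow> real \<Rightarrow> real^'d" where
  "ysol x \<eta> = (THE y. is_solution r \<alpha> \<beta> A f g x \<eta> y)"

abbreviation \<phi> where "\<phi> \<equiv> delay_rds r \<alpha> \<beta> A f g"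

lemma \<phi>_eq: "\<phi> t x \<eta> = segment r t (ysol x \<eta>)"
  by (simp add: delay_rds_def ysol_def)

lemma ysol:
  assumes "lhol x" "\<eta> \<in> S"
  shows "gsol x \<eta> (ysol x \<eta>)"
proof -
  obtain y where y: "gsol x \<eta> y" using gsol_exists[OF assms] by blast
  then have sol: "is_solution r \<alpha> \<beta> A f g x \<eta> y" using is_solution_iff[OF assms] by simp
  have uniq: "z = y" if "is_solution r \<alpha> \<beta> A f g x \<eta> z" for z
    using that is_solution_iff[OF assms] gsol_unique[OF assms(1) _ y] by simp
  have "ysol x \<eta> = y" unfolding ysol_def
  proof (rule the_equality)
    show "is_solution r \<alpha> \<beta> A f g x \<eta> y" by (rule sol)
    show "z = y" if "is_solution r \<alpha> \<beta> A f g x \<eta> z" for z by (rule uniq[OF that])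
  qed
  then have "is_solution r \<alpha> \<beta> A f g x \<eta> (ysol x \<eta>)"
    using y is_solution_iff[OF assms] by simp
  then show ?thesis using is_solution_iff[OF assms] by simp
qed

lemma ysol_eq: "lhol x \<Longrightarrow> \<eta> \<in> S \<Longrightarrow> gsol x \<eta> y \<Longrightarrow> ysol x \<eta> = y"
  using ysol gsol_unique by blast

lemma \<phi>_S:
  assumes "lhol x" "\<eta> \<in> S" "0 \<le> t"
  shows "\<phi> t x \<eta> \<in> S"
proof -
  let ?y = "ysol x \<eta>"
  have "vm \<alpha> (-r) t ?y" by (rule gsol_vm[OF assms(1,2) ysol[OF assms(1,2)] assms(3)])
  then have "vm \<alpha> (t + - r) (t + 0) ?y" by (rule vm_subset) (use assms in auto)
  then have "vm \<alpha> (-r) 0 (\<lambda>s. ?y (t + s))" by (rule vm_shift)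
  then have "vm \<alpha> (-r) 0 (segment r t ?y)"
    using vm_cong[of "-r" 0 "segment r t ?y" "\<lambda>s. ?y (t + s)"] by (simp add: segment_apply)
  then show ?thesis by (simp add: S_iff \<phi>_eq) (simp add: segment_def)
qed

text \<open>From time r on the segment lies inside [0, t], where solutions are
  \<beta>-Hoelder.\<close>

lemma \<phi>_beta:
  assumes "lhol x" "\<eta> \<in> S" "r \<le> t"
  shows "\<phi> t x \<eta> \<in> holder_space \<beta> {-r..0}"
proof -
  let ?y = "ysol x \<eta>"
  obtain K where K: "0 \<le> K" "hol \<beta> K 0 t ?y" using gsol_beta[OF assms(1) ysol[OF assms(1,2)], of t] assms r by auto
  then have "hol \<beta> K (t + - r) (t + 0) ?y" using hol_subset[OF K(2), of "t + - r" "t + 0"] assms(3) by simp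
  then have "hol \<beta> K (-r) 0 (\<lambda>s. ?y (t + s))" by (simp only: hol_shift)
  then have "hol \<beta> K (-r) 0 (segment r t ?y)"
    using hol_cong[of "-r" 0 "segment r t ?y" "\<lambda>s. ?y (t + s)"] by (simp add: segment_apply)
  from hol_imp_hb[OF this K(1)] show ?thesis
    using exps \<alpha>\<beta> r by (simp add: holder_space_iff \<phi>_eq) (simp add: segment_def)
qed

lemma \<phi>_0: "lhol x \<Longrightarrow> \<eta> \<in> S \<Longrightarrow> \<phi> 0 x \<eta> = \<eta>"
  by (rule extensionalityI[of _ "{-r..0}"])
     (auto simp: \<phi>_eq segment_def S_iff gsol_past[OF ysol])

lemma lhol_shift: "lhol x \<Longrightarrow> lhol (wiener_shift s x)"
  unfolding lhol_def
proof (intro allI)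
  fix a b assume *: "\<forall>a b. \<exists>w\<ge>0. hol \<nu> w a b x"
  then obtain w where w: "0 \<le> w" "hol \<nu> w (s + a) (s + b) x" by blast
  then have "hol \<nu> (w + 0) a b (\<lambda>t. x (s + t) - x s)"
    by (intro hol_diff) (auto simp: hol_shift hol_def)
  then show "\<exists>w\<ge>0. hol \<nu> w a b (wiener_shift s x)" using w(1) by (auto simp: wiener_shift_def)
qed

text \<open>In the increment form of the equation a restart at time s is a new initial value
  problem: integrals over [s, s + t] become integrals over [0, t] of the shifted data.\<close>

lemma gsol_shift:
  assumes x: "lhol x" and y: "gsol x \<eta> y" and s: "0 \<le> s"
  shows "gsol (wiener_shift s x) (segment r s y) (restrict (\<lambda>t. y (s + t)) {-r..})"
  unfolding gsol_def
proof (intro conjI allI impI)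
  let ?y = "restrict (\<lambda>t. y (s + t)) {-r..}"
  show "?y \<in> extensional {-r..}" by simp
  show "?y t = segment r s y t" if "-r \<le> t" "t \<le> 0" for t using that by (simp add: segment_apply)
  fix T :: real assume T: "0 \<le> T"
  obtain K where K: "0 \<le> K" "hol \<alpha> K (-r) (s + T) y" using gsol_hol[OF y, of "s + T"] s T by auto
  have "hol \<alpha> K (s + - r) (s + T) y" by (rule hol_subset[OF K(2)]) (use s in auto)
  then have "hol \<alpha> K (-r) T (\<lambda>t. y (s + t))" by (simp only: hol_shift)
  then have "hol \<alpha> K (-r) T ?y" using hol_cong[of "-r" T ?y "\<lambda>t. y (s + t)"] by simp
  then show "\<exists>K\<ge>0. hol \<alpha> K (-r) T ?y" using K(1) by blast
  obtain w where w: "0 \<le> w" "hol \<nu> w 0 (s + T) x" using x unfolding lhol_def by blast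
  have seg: "segment r u ?y = segment r (s + u) y" if "0 \<le> u" for u
    using that by (auto simp: segment_def fun_eq_iff restrict_def add.assoc)
  show "solves (wiener_shift s x) T ?y"
    unfolding solves_def
  proof (intro allI impI)
    fix t assume t: "0 \<le> t" "t \<le> T"
    obtain J where J: "has_young_integral (G y) x s (s + t) J" "y (s + t) - y s = integral {s..s + t} (F y) + J"
      using solves_increment[OF gsol_solves[OF y] K(2,1) w(2,1) s] s t T by (metis add_left_mono add_nonneg_nonneg le_add_same_cancel1)
    have "has_young_integral (\<lambda>u. G y (s + u)) (\<lambda>u. x (s + u) - x s) 0 t J"
      by (rule has_young_integral_shift_imp) (use J(1) in simp)
    then have "has_young_integral (G ?y) (wiener_shift s x) 0 t J"
      by (subst has_young_integral_cong[where M' = "\<lambda>u. G y (s + u)" and x' = "\<lambda>u. x (s + u) - x s"])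
         (auto simp: G_def seg wiener_shift_def)
    moreover have "integral {s..s + t} (F y) = integral {0..t} (F ?y)"
    proof -
      have "integral {0..t} (F ?y) = integral {0..t} (F y \<circ> (+) s)"
        by (rule integral_cong) (use r in \<open>auto simp: F_def seg\<close>)
      also have "\<dots> = integral {s..s + t} (F y)" by (simp add: integral_shift_Icc_real add.commute)
      finally show ?thesis by simp
    qed
    ultimately show "\<exists>J. has_young_integral (G ?y) (wiener_shift s x) 0 t J \<and> ?y t = ?y 0 + integral {0..t} (F ?y) + J"
      using J(2) t r by (intro exI[of _ J]) (simp add: algebra_simps)
  qed
qed

text \<open>The shifted solution solves the shifted equation, and uniqueness identifies it with the
  flow restarted at time s.\<close>

lemma \<phi>_cocycle:
  assumes x: "lhol x" and \<eta>: "\<eta> \<in> S" and st: "0 \<le> s" "0 \<le> t"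
  shows "\<phi> (s + t) x \<eta> = \<phi> t (wiener_shift s x) (\<phi> s x \<eta>)"
proof -
  let ?y = "ysol x \<eta>"
  have "ysol (wiener_shift s x) (\<phi> s x \<eta>) = restrict (\<lambda>t. ?y (s + t)) {-r..}"
    by (rule ysol_eq[OF lhol_shift[OF x] \<phi>_S[OF x \<eta> st(1)]])
       (use gsol_shift[OF x ysol[OF x \<eta>] st(1)] in \<open>simp add: \<phi>_eq\<close>)
  then have "\<phi> t (wiener_shift s x) (\<phi> s x \<eta>) = segment r t (restrict (\<lambda>t. ?y (s + t)) {-r..})"
    unfolding \<phi>_eq[of t] by simp
  also have "\<dots> = segment r (s + t) ?y"
    using st by (auto simp: segment_def fun_eq_iff restrict_def add.assoc)
  finally show ?thesis by (simp add: \<phi>_eq)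
qed

lemma S_holder: "\<eta> \<in> S \<Longrightarrow> \<eta> \<in> holder_space \<alpha> {-r..0}"
  by (rule little_holder_imp_holder)

lemma cst_S: "cst c \<in> S"
proof -
  have "vm \<alpha> (-r) 0 (cst c)"
    by (rule hol_imp_vm[where \<beta> = 1 and K = 0]) (use exps in \<open>auto simp: hol_def cst_def\<close>)
  then show ?thesis by (simp add: S_iff) (simp add: cst_def)
qed

abbreviation dS where "dS \<equiv> (holder_dist \<alpha> {-r..0} :: (real \<Rightarrow> real^'d) \<Rightarrow> (real \<Rightarrow> real^'d) \<Rightarrow> real)"

lemma hb_segment:
  assumes "hb \<alpha> N (t - r) t (\<lambda>s. y1 s - y2 s)"
  shows "hb \<alpha> N (-r) 0 (\<lambda>s. segment r t y1 s - segment r t y2 s)"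
proof -
  have "hb \<alpha> N (-r) 0 (\<lambda>s. y1 (t + s) - y2 (t + s))"
    using assms hb_shift[of \<alpha> N "-r" 0 "\<lambda>s. y1 s - y2 s" t] by simp
  then show ?thesis
    by (subst hb_cong[where z = "\<lambda>s. y1 (t + s) - y2 (t + s)"]) (auto simp: segment_apply)
qed

lemma \<phi>_lipschitz:
  assumes x: "lhol x" and w: "hol \<nu> w 0 T x" "0 \<le> w" and \<eta>: "\<eta>1 \<in> S" "\<eta>2 \<in> S" and t: "0 \<le> t" "t \<le> T"
  shows "dS (\<phi> t x \<eta>1) (\<phi> t x \<eta>2) \<le> 2 * (gf T (C\<^sub>g * w) * dS \<eta>1 \<eta>2)"
proof -
  let ?y1 = "ysol x \<eta>1" and ?y2 = "ysol x \<eta>2"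
  note y1 = ysol[OF x \<eta>(1)] and y2 = ysol[OF x \<eta>(2)]
  have T: "0 \<le> T" using t by simp
  obtain K1 where K1: "0 \<le> K1" "hol \<alpha> K1 (-r) T ?y1" using gsol_hol[OF y1 T] by blast
  obtain K2 where K2: "0 \<le> K2" "hol \<alpha> K2 (-r) T ?y2" using gsol_hol[OF y2 T] by blast
  have "hb \<alpha> (dS \<eta>1 \<eta>2) (-r) 0 (\<lambda>t. \<eta>1 t - \<eta>2 t)" by (rule hb_holder_dist) (use \<eta> S_holder in auto)
  then have "hb \<alpha> (dS \<eta>1 \<eta>2) (-r) 0 (\<lambda>t. ?y1 t - ?y2 t)"
    by (subst hb_cong[where z = "\<lambda>t. \<eta>1 t - \<eta>2 t"]) (auto simp: gsol_past[OF y1] gsol_past[OF y2])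
  from lipschitz[OF gsol_solves[OF y1 T] gsol_solves[OF y2 T] w K1(2,1) K2(2,1) T this]
  have "hb \<alpha> (gf T (C\<^sub>g * w) * dS \<eta>1 \<eta>2) (-r) T (\<lambda>t. ?y1 t - ?y2 t)" .
  then have "hb \<alpha> (gf T (C\<^sub>g * w) * dS \<eta>1 \<eta>2) (t - r) t (\<lambda>t. ?y1 t - ?y2 t)"
    by (rule hb_subset) (use t in auto)
  from holder_dist_le[OF hb_segment[OF this]] show ?thesis
    by (simp add: \<phi>_eq gf_def holder_dist_def)
qed

lemma \<phi>_growth:
  assumes x: "lhol x" and w: "hol \<nu> w 0 T x" "0 \<le> w" and \<eta>: "\<eta> \<in> S" and t: "0 \<le> t" "t \<le> T"
  shows "dS (\<phi> t x \<eta>) (cst 0) \<le> 2 * (gf T (C\<^sub>g * w) * (dS \<eta> (cst 0) + 2 * norm (f (cst 0))))"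
proof -
  let ?y = "ysol x \<eta>"
  note y = ysol[OF x \<eta>]
  have T: "0 \<le> T" using t by simp
  obtain K where K: "0 \<le> K" "hol \<alpha> K (-r) T ?y" using gsol_hol[OF y T] by blast
  let ?N0 = "dS \<eta> (cst 0)"
  have "hb \<alpha> ?N0 (-r) 0 (\<lambda>t. \<eta> t - cst 0 t)" by (rule hb_holder_dist) (use \<eta> cst_S S_holder in auto)
  then have "hb \<alpha> ?N0 (-r) 0 ?y"
    by (subst hb_cong[where z = "\<lambda>t. \<eta> t - cst 0 t"]) (auto simp: gsol_past[OF y] cst_def)
  from growth[OF gsol_solves[OF y T] w K(2,1) T this]
  have "hb \<alpha> (gf T (C\<^sub>g * w) * (?N0 + 2 * norm (f (cst 0)))) (-r) T ?y" .
  then have "hb \<alpha> (gf T (C\<^sub>g * w) * (?N0 + 2 * norm (f (cst 0)))) (t - r) t (\<lambda>s. ?y s - (\<lambda>_. 0) s)"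
    using t by (auto intro: hb_subset)
  from hb_segment[OF this]
  have "hb \<alpha> (gf T (C\<^sub>g * w) * (?N0 + 2 * norm (f (cst 0)))) (-r) 0 (\<lambda>s. segment r t ?y s - cst 0 s)"
    by (subst hb_cong[where z = "\<lambda>s. segment r t ?y s - segment r t (\<lambda>_. 0) s"]) (auto simp: segment_apply cst_def)
  from holder_dist_le[OF this] show ?thesis
    by (simp add: \<phi>_eq gf_def holder_dist_def)
qed

text \<open>For measurability in the noise: at a fixed initial path the solution depends on nearby
  drivers in a Lipschitz way, at all times up to T. The restriction e \<le> 1 allows the single
  constant \<open>w + 1\<close> for all these drivers.\<close>

lemma \<phi>_driver_stability:
  assumes x: "lhol x" and \<eta>: "\<eta> \<in> S" and T: "0 \<le> T"
  shows "\<exists>C\<ge>0. \<forall>x' e. lhol x' \<longrightarrow> 0 \<le> e \<longrightarrow> e \<le> 1 \<longrightarrow> hol \<nu> e 0 T (\<lambda>t. x' t - x t) \<longrightarrow>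
     (\<forall>t. -r \<le> t \<longrightarrow> t \<le> T \<longrightarrow> norm (ysol x' \<eta> t - ysol x \<eta> t) \<le> C * e)"
proof -
  let ?y = "ysol x \<eta>"
  note y = ysol[OF x \<eta>]
  obtain w where w: "0 \<le> w" "hol \<nu> w 0 T x" using x unfolding lhol_def by blast
  obtain K where K: "0 \<le> K" "hol \<alpha> K (-r) T ?y" using gsol_hol[OF y T] by blast
  obtain N2 where N2: "0 \<le> N2" "hb \<alpha> N2 (-r) T ?y" using hol_imp_hb[OF K(2,1)] exps r T by auto
  let ?C = "gf T (C\<^sub>g * (w + 1)) * (2 * (C\<^sub>g * N2 * (1 + Z)))"
  have "norm (ysol x' \<eta> t - ?y t) \<le> ?C * e"
    if x': "lhol x'" and e: "0 \<le> e" "e \<le> 1" "hol \<nu> e 0 T (\<lambda>t. x' t - x t)" and t: "-r \<le> t" "t \<le> T" for x' e t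
  proof -
    note y' = ysol[OF x' \<eta>]
    obtain K' where K': "0 \<le> K'" "hol \<alpha> K' (-r) T (ysol x' \<eta>)" using gsol_hol[OF y' T] by blast
    have "hol \<nu> (w + e) 0 T (\<lambda>t. x t + (x' t - x t))" by (rule hol_add[OF w(2) e(3)])
    then have "hol \<nu> (w + e) 0 T x'" by simp
    then have w': "hol \<nu> (w + 1) 0 T x'" by (rule hol_mono) (use e in simp)
    have "hb \<alpha> 0 (-r) 0 (\<lambda>t. ysol x' \<eta> t - ?y t)"
      using gsol_past[OF y'] gsol_past[OF y] by (auto simp: hb_def hol_def)
    from stability[OF gsol_solves[OF y' T] gsol_solves[OF y T] w' _ w(2,1) K'(2,1) N2(2) e(3,1) T this]
    have "hb \<alpha> (gf T (C\<^sub>g * (w + 1)) * (0 + 2 * ((C\<^sub>g * e) * N2 * (1 + Z)))) (-r) T (\<lambda>t. ysol x' \<eta> t - ?y t)"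
      using w by simp
    from hbD[OF this t] show ?thesis by (simp add: algebra_simps)
  qed
  moreover have "0 \<le> ?C" using C\<^sub>g_nonneg N2 Z_nonneg by (simp add: gf_def)
  ultimately show ?thesis by blast
qed

end

section \<open>The matrix exponential\<close>

lemma has_vector_derivative_matrix:
  fixes F :: "real \<Rightarrow> real^'n^'m"
  assumes "\<And>i j. ((\<lambda>t. F t $ i $ j) has_real_derivative F' $ i $ j) (at t)"
  shows "(F has_vector_derivative F') (at t)"
  unfolding has_vector_derivative_def
proof (subst has_derivative_componentwise_within, intro ballI)
  fix b :: "real^'n^'m" assume "b \<in> Basis"
  then obtain i j where b: "b = axis i (axis j 1)" by (auto simp: Basis_vec_def)
  have "((\<lambda>t. F t $ i $ j) has_derivative (\<lambda>x. x * F' $ i $ j)) (at t)"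
    using assms[of i j] by (simp add: has_field_derivative_def mult_commute_abs)
  then show "((\<lambda>x. F x \<bullet> b) has_derivative (\<lambda>x. (x *\<^sub>R F') \<bullet> b)) (at t)"
    by (simp add: b inner_axis)
qed

lemma scaleR_matrix_mult:
  fixes A :: "real^'n^'m" and B :: "real^'p^'n"
  shows "(c *\<^sub>R A) ** B = c *\<^sub>R (A ** B)" "A ** (c *\<^sub>R B) = c *\<^sub>R (A ** B)"
  by (simp_all add: vec_eq_iff matrix_matrix_mult_def sum_distrib_left mult_ac)

lemma matrix_mult_add:
  fixes A A' :: "real^'n^'m" and B B' :: "real^'p^'n"
  shows "(A + A') ** B = A ** B + A' ** B" "A ** (B + B') = A ** B + A ** B'"
  by (simp_all add: vec_eq_iff matrix_matrix_mult_def sum.distrib distrib_left distrib_right)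

lemma matrix_pow_scaleR:
  fixes A :: "real^'n^'n"
  shows "((**) (t *\<^sub>R A) ^^ k) (mat 1) = t ^ k *\<^sub>R ((**) A ^^ k) (mat 1)"
  by (induct k) (simp_all add: scaleR_matrix_mult)

lemma matrix_pow_commute:
  fixes A :: "real^'n^'n"
  shows "A ** ((**) A ^^ k) (mat 1) = ((**) A ^^ k) (mat 1) ** A"
proof (induct k)
  case (Suc k)
  have "(A ** ((**) A ^^ k) (mat 1)) ** A = A ** (((**) A ^^ k) (mat 1) ** A)"
    by (rule matrix_mul_assoc[symmetric])
  then show ?case using Suc by simp
qed simp

lemma bounded_linear_matrix_mul_left: "bounded_linear ((**) (A :: real^'n^'n) :: real^'n^'n \<Rightarrow> _)"
  unfolding linear_conv_bounded_linear[symmetric]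
  by (rule linearI) (simp_all add: matrix_mult_add scaleR_matrix_mult)

lemma bounded_linear_matrix_mul_right: "bounded_linear (\<lambda>M :: real^'n^'n. M ** (A :: real^'n^'n))"
  unfolding linear_conv_bounded_linear[symmetric]
  by (rule linearI) (simp_all add: matrix_mult_add scaleR_matrix_mult)

lemma summable_mat_exp:
  fixes A :: "real^'n^'n"
  shows "summable (\<lambda>k. (t ^ k / fact k) *\<^sub>R ((**) A ^^ k) (mat 1))"
proof -
  obtain K where K: "0 < K" "\<And>M :: real^'n^'n. norm (A ** M) \<le> norm M * K"
    using bounded_linear.pos_bounded[OF bounded_linear_matrix_mul_left[of A]] by blast
  have b: "norm (((**) A ^^ k) (mat 1)) \<le> K ^ k * norm (mat 1 :: real^'n^'n)" for k
  proof (induct k)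
    case (Suc k)
    have "norm (((**) A ^^ Suc k) (mat 1)) \<le> norm (((**) A ^^ k) (mat 1)) * K" by (simp add: K)
    also have "\<dots> \<le> (K ^ k * norm (mat 1 :: real^'n^'n)) * K" using Suc K by (intro mult_right_mono) auto
    finally show ?case by (simp add: mult_ac)
  qed simp
  have "summable (\<lambda>k. inverse (fact k) * (\<bar>t\<bar> * K) ^ k * norm (mat 1 :: real^'n^'n))"
    by (intro summable_mult2 summable_exp)
  then show ?thesis
  proof (rule summable_comparison_test'[where N = 0])
    fix k :: nat
    have "norm ((t ^ k / fact k) *\<^sub>R ((**) A ^^ k) (mat 1)) \<le> \<bar>t\<bar> ^ k / fact k * (K ^ k * norm (mat 1 :: real^'n^'n))"
      using b[of k] by (simp add: power_abs mult_left_mono divide_right_mono)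
    then show "norm ((t ^ k / fact k) *\<^sub>R ((**) A ^^ k) (mat 1))
        \<le> inverse (fact k) * (\<bar>t\<bar> * K) ^ k * norm (mat 1 :: real^'n^'n)"
      by (simp add: power_mult_distrib field_simps)
  qed
qed

lemma mat_exp_eq: "mat_exp (t *\<^sub>R A) = (\<Sum>k. (t ^ k / fact k) *\<^sub>R ((**) A ^^ k) (mat 1))"
  unfolding mat_exp_def matrix_pow_scaleR by simp

lemma mat_exp_0 [simp]: "mat_exp (0 :: real^'n^'n) = mat 1"
proof -
  let ?A = "0 :: real^'n^'n"
  have "(\<Sum>k. (0 ^ k / fact k) *\<^sub>R ((**) ?A ^^ k) (mat 1)) = (\<Sum>k\<in>{0}. (0 ^ k / fact k) *\<^sub>R ((**) ?A ^^ k) (mat 1))"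
    by (rule suminf_finite) (auto simp: power_0_left)
  then show ?thesis using mat_exp_eq[of 0 ?A] by simp
qed

text \<open>Each entry is a power series in t, differentiated term by term. \<open>A\<close> stands
  on the right, next to the vector to which the variation of constants formula applies it.\<close>

lemma mat_exp_has_vector_derivative:
  fixes A :: "real^'n^'n"
  shows "((\<lambda>t. mat_exp (t *\<^sub>R A)) has_vector_derivative mat_exp (t *\<^sub>R A) ** A) (at t)"
proof (rule has_vector_derivative_matrix)
  fix i j :: 'n
  let ?p = "\<lambda>k. ((**) A ^^ k) (mat 1)"
  define c where "c k = (?p k $ i $ j) / fact k" for k
  have lin: "bounded_linear (\<lambda>M :: real^'n^'n. M $ i $ j)"
    using bounded_linear_compose[OF bounded_linear_vec_nth[of j] bounded_linear_vec_nth[of i]] by simp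
  have entry: "(\<lambda>k. c k * t ^ k) sums (mat_exp (t *\<^sub>R A) $ i $ j)" for t
  proof -
    have "(\<lambda>k. ((t ^ k / fact k) *\<^sub>R ?p k) $ i $ j) sums (mat_exp (t *\<^sub>R A) $ i $ j)"
      unfolding mat_exp_eq by (rule bounded_linear.sums[OF lin summable_sums[OF summable_mat_exp]])
    then show ?thesis by (simp add: c_def mult.commute)
  qed
  have "((\<lambda>t. \<Sum>k. c k * t ^ k) has_field_derivative (\<Sum>k. diffs c k * t ^ k)) (at t)"
    by (rule termdiffs_strong_converges_everywhere) (use entry in \<open>auto simp: sums_iff\<close>)
  moreover have "(\<lambda>t. \<Sum>k. c k * t ^ k) = (\<lambda>t. mat_exp (t *\<^sub>R A) $ i $ j)"
    using entry by (auto simp: sums_iff)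
  moreover have "(\<Sum>k. diffs c k * t ^ k) = (mat_exp (t *\<^sub>R A) ** A) $ i $ j"
  proof -
    have "(\<lambda>k. (((t ^ k / fact k) *\<^sub>R ?p k) ** A) $ i $ j) sums ((mat_exp (t *\<^sub>R A) ** A) $ i $ j)"
      unfolding mat_exp_eq
      by (rule bounded_linear.sums[OF lin bounded_linear.sums[OF bounded_linear_matrix_mul_right summable_sums[OF summable_mat_exp]]])
    moreover have "(((t ^ k / fact k) *\<^sub>R ?p k) ** A) $ i $ j = diffs c k * t ^ k" for k
    proof -
      have "((t ^ k / fact k) *\<^sub>R ?p k) ** A = (t ^ k / fact k) *\<^sub>R ?p (Suc k)"
        by (simp add: matrix_pow_commute scaleR_matrix_mult)
      moreover have "diffs c k = ?p (Suc k) $ i $ j / fact k"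
        by (simp add: diffs_def c_def field_simps del: of_nat_Suc)
      ultimately show ?thesis by (simp add: mult.commute)
    qed
    ultimately show ?thesis by (simp add: sums_iff)
  qed
  ultimately show "((\<lambda>t. mat_exp (t *\<^sub>R A) $ i $ j) has_real_derivative (mat_exp (t *\<^sub>R A) ** A) $ i $ j) (at t)"
    by simp
qed

lemma bounded_bilinear_matrix_vector: "bounded_bilinear ((*v) :: real^'n^'m \<Rightarrow> real^'n \<Rightarrow> real^'m)"
  unfolding bilinear_conv_bounded_bilinear[symmetric] bilinear_def
  by (auto intro!: linearI simp: matrix_vector_mult_add_rdistrib matrix_vector_right_distrib
      scaleR_matrix_vector_assoc matrix_vector_mult_scaleR)

section \<open>Contraction over a long time window\<close>

text \<open>An exponential weight of rate \<delta> costs the factor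
  \<open>exp (\<delta> * r)\<close> in the delayed term and reduces the decay rate by \<delta>. The
  gap condition gives the strict inequality at \<delta> = 0, and continuity preserves it for small
  \<delta> > 0.\<close>

lemma exponent_gap:
  fixes a lam r :: real
  assumes "a < lam * exp (- lam * r)" "0 < lam" "0 < r"
  shows "\<exists>\<delta>. 0 < \<delta> \<and> \<delta> < lam \<and> a * exp (\<delta> * r) < lam - \<delta>"
proof -
  have "lam * exp (- lam * r) \<le> lam * 1" using assms by (intro mult_left_mono) auto
  then have a: "a < lam" using assms(1) by linarith
  have "((\<lambda>\<delta>. lam - \<delta> - a * exp (\<delta> * r)) \<longlongrightarrow> lam - 0 - a * exp (0 * r)) (at_right 0)"
    by (intro tendsto_intros)
  then have "\<forall>\<^sub>F \<delta> in at_right 0. 0 < lam - \<delta> - a * exp (\<delta> * r)"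
    using a by (intro order_tendstoD(1)) auto
  moreover have "\<forall>\<^sub>F \<delta> in at_right 0. 0 < \<delta> \<and> \<delta> < lam"
    using assms(2) by (auto simp: eventually_at_right_field)
  ultimately have "\<forall>\<^sub>F \<delta> in at_right 0. 0 < \<delta> \<and> \<delta> < lam \<and> a * exp (\<delta> * r) < lam - \<delta>"
    by eventually_elim auto
  then show ?thesis using eventually_happens' trivial_limit_at_right_real by blast
qed

context young_delay
begin

lemma gsteps_mono:
  assumes "0 \<le> V" "V \<le> V'" "0 \<le> T"
  shows "gsteps (\<nu> - \<alpha>) T V \<le> gsteps (\<nu> - \<alpha>) T V'"
proof -
  have "0 < \<nu> - \<alpha>" using exps by simp
  then have g: "0 < gstep (\<nu> - \<alpha>) V'" "gstep (\<nu> - \<alpha>) V' \<le> gstep (\<nu> - \<alpha>) V"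
    using assms unfolding gstep_def by (auto intro!: powr_mono2')
  then have "T / gstep (\<nu> - \<alpha>) V \<le> T / gstep (\<nu> - \<alpha>) V'"
    using assms by (intro divide_left_mono) auto
  then show ?thesis unfolding gsteps_def by (intro nat_mono ceiling_mono)
qed

lemma gf_mono: "0 \<le> v \<Longrightarrow> v \<le> v' \<Longrightarrow> 0 \<le> T \<Longrightarrow> gf T v \<le> gf T v'"
  unfolding gf_def using L_nonneg Z_nonneg
  by (intro power_increasing gsteps_mono add_mono mult_right_mono) auto

lemma gf_nonneg: "0 \<le> gf T v" by (simp add: gf_def)

text \<open>The difference z of two solutions splits into the Young integral \<zeta>, whose bound is
  proportional to the noise, and a differentiable rest V. Variation of constants for V bounds z in
  the sup norm with weight \<open>exp (\<delta> * t)\<close>; the delayed term returns a factor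
  \<kappa> < 1 and is absorbed. Without noise the final segment is of order
  \<open>exp (- \<delta> * (T - 2 * r))\<close>, and every other term carries
  \<open>C\<^sub>g * w\<close>.\<close>

lemma window_contraction:
  assumes CA: "0 < C\<^sub>A" and lam: "0 < lam"
    and expA: "\<And>t. 0 < t \<Longrightarrow> norm (mat_op (mat_exp (t *\<^sub>R A))) \<le> C\<^sub>A * exp (- lam * t)"
    and \<delta>: "0 < \<delta>" "\<delta> < lam" "C\<^sub>A * C\<^sub>f * exp (\<delta> * r) < lam - \<delta>"
    and T: "2 * r \<le> T"
    and y: "solves x T y1" "solves x T y2" "hol \<nu> w 0 T x" "0 \<le> w"
      "hol \<alpha> K1 (-r) T y1" "0 \<le> K1" "hol \<alpha> K2 (-r) T y2" "0 \<le> K2"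
    and small: "C\<^sub>g * w \<le> 1"
    and hb0: "hb \<alpha> N (-r) 0 (\<lambda>t. y1 t - y2 t)"
  shows "hb \<alpha> (N * (exp (- \<delta> * (T - 2 * r)) * (1 + L * r powr (1 - \<alpha>)) *
     ((C\<^sub>A + 1) + (C\<^sub>A * norm (mat_op A) / lam + 1) * exp (\<delta> * T) * ((C\<^sub>g * w) * gf T 1 * (T powr \<nu> + Z * T powr (\<alpha> + \<nu>))))
        / (1 - C\<^sub>A * C\<^sub>f * exp (\<delta> * r) / (lam - \<delta>))
     + (C\<^sub>g * w) * gf T 1 * (r powr (\<nu> - \<alpha>) + Z * r powr \<nu>))) (T - r) T (\<lambda>t. y1 t - y2 t)"
proof -
  define z where "z t = y1 t - y2 t" for t
  define v where "v = C\<^sub>g * w"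
  define R where "R = gf T 1"
  define \<kappa> where "\<kappa> = C\<^sub>A * C\<^sub>f * exp (\<delta> * r) / (lam - \<delta>)"
  have v: "0 \<le> v" "v \<le> 1" using small C\<^sub>g_nonneg y by (auto simp: v_def)
  have R: "0 \<le> R" by (simp add: R_def gf_def)
  have \<kappa>: "0 \<le> \<kappa>" "\<kappa> < 1" using \<delta> CA C\<^sub>f_nonneg by (auto simp: \<kappa>_def)
  have T0: "0 < T" using T r by simp
  have N: "0 \<le> N" using hb_nonneg[OF hb0] r by simp
  \<comment> \<open>A crude bound on the whole window, with the growth factor for
    \<open>C\<^sub>g * w \<le> 1\<close>; it controls \<zeta> and starts the absorption.\<close>
  have hbz: "hb \<alpha> (R * N) (-r) T z"
  proof -
    have "hb \<alpha> (gf T v * N) (-r) T z"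
      unfolding v_def z_def using lipschitz[OF y _ hb0] T0 by simp
    then show ?thesis
      by (rule hb_mono) (use gf_mono[OF v, of T] T0 N in \<open>simp add: R_def mult_right_mono\<close>)
  qed
  have RN: "0 \<le> R * N" using R N by simp
  have c1: "continuous_on {-r..T} y1" using hol_imp_continuous_on[OF y(5)] exps by simp
  have c2: "continuous_on {-r..T} y2" using hol_imp_continuous_on[OF y(7)] exps by simp
  obtain \<Phi> where \<Phi>: "\<And>s t. 0 \<le> s \<Longrightarrow> s \<le> t \<Longrightarrow> t \<le> T \<Longrightarrow> has_young_integral (G z) x s t (\<Phi> t - \<Phi> s)"
    using young_G[OF hb_hol[OF hbz] RN y(3,4)] by blast
  define \<zeta> where "\<zeta> t = \<Phi> t - \<Phi> 0" for t
  define D where "D u = F y1 u - F y2 u" for u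
  have D_cont: "continuous_on {0..T} D"
    unfolding D_def using hol_imp_continuous_on[OF hol_F[OF y(5)]] hol_imp_continuous_on[OF hol_F[OF y(7)]] exps
    by (intro continuous_on_diff) auto
  have inc: "z t - z s = integral {s..t} D + (\<zeta> t - \<zeta> s)" if st: "0 \<le> s" "s \<le> t" "t \<le> T" for s t
  proof -
    obtain J1 where J1: "has_young_integral (G y1) x s t J1" "y1 t - y1 s = integral {s..t} (F y1) + J1"
      using solves_increment[OF y(1,5,6,3,4) st] .
    obtain J2 where J2: "has_young_integral (G y2) x s t J2" "y2 t - y2 s = integral {s..t} (F y2) + J2"
      using solves_increment[OF y(2,7,8,3,4) st] .
    have "has_young_integral (\<lambda>u. G y1 u - G y2 u) x s t (J1 - J2)"
      by (rule has_young_integral_diff_integrand[OF J1(1) J2(1)])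
    then have "has_young_integral (G z) x s t (J1 - J2)"
      by (subst has_young_integral_cong[where M' = "\<lambda>u. G y1 u - G y2 u" and x' = x])
         (use G_diff_eq[OF c1 c2] st in \<open>auto simp: z_def[abs_def]\<close>)
    then have "J1 - J2 = \<zeta> t - \<zeta> s"
      using has_young_integral_unique[OF _ \<Phi>[OF st] st(2)] by (simp add: \<zeta>_def)
    moreover have "integral {s..t} D = integral {s..t} (F y1) - integral {s..t} (F y2)"
      unfolding D_def using F_integrable[OF y(5)] F_integrable[OF y(7)] st by (intro integral_diff) auto
    moreover have "z t - z s = (y1 t - y1 s) - (y2 t - y2 s)" by (simp add: z_def)
    ultimately show ?thesis unfolding J1(2) J2(2) by simp
  qed
  have \<zeta>inc: "norm (\<zeta> t - \<zeta> s) \<le> v * (R * N) * ((t - s) powr \<nu> + Z * (t - s) powr (\<alpha> + \<nu>))"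
    if st: "0 \<le> s" "s \<le> t" "t \<le> T" for s t
  proof -
    have "\<zeta> t - \<zeta> s = \<Phi> t - \<Phi> s" by (simp add: \<zeta>_def)
    then show ?thesis unfolding v_def using young_G_bound[OF hbz y(3,4) st \<Phi>[OF st]] by simp
  qed
  define \<zeta>m where "\<zeta>m = v * (R * N) * (T powr \<nu> + Z * T powr (\<alpha> + \<nu>))"
  have \<zeta>m: "0 \<le> \<zeta>m" using v RN Z_nonneg by (simp add: \<zeta>m_def)
  have \<zeta>b: "norm (\<zeta> t) \<le> \<zeta>m" if t: "0 \<le> t" "t \<le> T" for t
  proof -
    have "norm (\<zeta> t - \<zeta> 0) \<le> v * (R * N) * ((t - 0) powr \<nu> + Z * (t - 0) powr (\<alpha> + \<nu>))"
      using t by (intro \<zeta>inc) auto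
    also have "\<dots> \<le> \<zeta>m" unfolding \<zeta>m_def
      using t v RN Z_nonneg exps by (intro mult_left_mono add_mono powr_mono2) auto
    finally show ?thesis by (simp add: \<zeta>_def)
  qed
  \<comment> \<open>Removing \<zeta> leaves the integral of a continuous function, so
    \<open>V\<close> is differentiable although \<open>z\<close> need not be.\<close>
  define V where "V t = z t - \<zeta> t" for t
  have V_eq: "V t = z 0 + integral {0..t} D" if "0 \<le> t" "t \<le> T" for t
    using inc[of 0 t] that by (simp add: V_def \<zeta>_def algebra_simps)
  have V_der: "(V has_vector_derivative D t) (at t within {0..T})" if t: "t \<in> {0..T}" for t
  proof (rule has_vector_derivative_transform[OF t])
    show "V u = z 0 + integral {0..u} D" if "u \<in> {0..T}" for u using V_eq that by simp
    show "((\<lambda>u. z 0 + integral {0..u} D) has_vector_derivative D t) (at t within {0..T})"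
      using integral_has_vector_derivative[OF D_cont t] by (auto intro!: derivative_eq_intros)
  qed
  define X where "X t = mat_exp (t *\<^sub>R A)" for t
  have X_der: "(X has_vector_derivative X t ** A) (at t)" for t
    unfolding X_def by (rule mat_exp_has_vector_derivative)
  have Xb: "norm (X t *v q) \<le> C\<^sub>A * exp (- lam * t) * norm q" if "0 < t" for t q
    using order_trans[OF norm_mat_op mult_right_mono[OF expA[OF that] norm_ge_zero]] by (simp add: X_def)
  have z0: "norm (z u) \<le> N" if "-r \<le> u" "u \<le> 0" for u
    using hbD[OF hb0 that] by (simp add: z_def)
  have step: "norm (z t) * exp (\<delta> * t) \<le>
      ((C\<^sub>A + 1) * N + (C\<^sub>A * norm (mat_op A) / lam + 1) * exp (\<delta> * T) * \<zeta>m) + \<kappa> * K"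
    if K: "0 \<le> K" "\<And>u. -r \<le> u \<Longrightarrow> u \<le> T \<Longrightarrow> norm (z u) * exp (\<delta> * u) \<le> K" and t: "-r \<le> t" "t \<le> T" for K t
  proof (cases "t \<le> 0")
    case True
    have "norm (z t) * exp (\<delta> * t) \<le> N * 1"
      using True t \<delta> z0 N by (intro mult_mono) (auto simp: mult_nonneg_nonpos)
    also have "\<dots> \<le> (C\<^sub>A + 1) * N" using CA N by (simp add: algebra_simps)
    also have "\<dots> \<le> ((C\<^sub>A + 1) * N + (C\<^sub>A * norm (mat_op A) / lam + 1) * exp (\<delta> * T) * \<zeta>m) + \<kappa> * K"
      using CA lam \<zeta>m \<kappa> K by simp
    finally show ?thesis .
  next
    case False
    then have t0: "0 < t" by simp
    have Kexp: "norm (z u) \<le> K * exp (- \<delta> * u)" if "-r \<le> u" "u \<le> T" for u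
      using K(2)[OF that] by (simp add: exp_minus field_simps)
    define E where "E u = f (segment r u y1) - f (segment r u y2)" for u
    have E: "norm (E u) \<le> C\<^sub>f * (exp (\<delta> * r) * K * exp (- \<delta> * u))" if u: "0 \<le> u" "u \<le> T" for u
      unfolding E_def
    proof (rule f_diff[OF segment_cont[OF c1 u] segment_cont[OF c2 u]])
      fix s assume s: "s \<in> {-r..0}"
      have "norm (z (u + s)) \<le> K * exp (- \<delta> * (u + s))" using s u by (intro Kexp) auto
      \<comment> \<open>Looking back by at most r costs the factor \<open>exp (\<delta> * r)\<close>
        in the weight.\<close>
      also have "exp (- \<delta> * (u + s)) \<le> exp (\<delta> * r) * exp (- \<delta> * u)"
        using s \<delta> mult_left_mono[of "-s" r \<delta>] by (simp flip: exp_add) (simp add: algebra_simps)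
      finally show "norm (segment r u y1 s - segment r u y2 s) \<le> exp (\<delta> * r) * K * exp (- \<delta> * u)"
        using s K(1) by (simp add: segment_apply z_def mult_left_mono mult.assoc mult.left_commute)
    qed
    have DA: "D u = A *v (V u + \<zeta> u) + E u" for u
      by (simp add: D_def F_def E_def V_def z_def matrix_vector_mult_diff_distrib)
    \<comment> \<open>Differentiating X (t - s) V s in s cancels A V, and only \<zeta> and the
      delayed term remain; \<open>h\<close> runs from X t z 0 to V t.\<close>
    define h where "h s = X (t - s) *v V s" for s
    \<comment> \<open>A primitive of the bound for the derivative of \<open>h\<close>; its two
      summands are the integrated effects of \<zeta> and of the delayed term.\<close>
    define \<psi> where "\<psi> s = C\<^sub>A * (norm (mat_op A) * \<zeta>m / lam * exp (- lam * (t - s))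
        + C\<^sub>f * exp (\<delta> * r) * K / (lam - \<delta>) * exp (- lam * t + (lam - \<delta>) * s))" for s
    have h_der: "(h has_vector_derivative X (t - s) *v (A *v \<zeta> s + E s)) (at s within {0..t})"
      if s: "s \<in> {0..t}" for s
    proof -
      have 1: "((\<lambda>s. X (t - s)) has_vector_derivative - (X (t - s) ** A)) (at s within {0..t})"
      proof -
        have "((X \<circ> (\<lambda>s. t - s)) has_vector_derivative (- 1) *\<^sub>R (X (t - s) ** A)) (at s)"
          by (rule vector_diff_chain_at[OF _ X_der]) (auto intro!: derivative_eq_intros)
        then show ?thesis by (simp add: o_def has_vector_derivative_at_within)
      qed
      have 2: "(V has_vector_derivative D s) (at s within {0..t})"
        by (rule has_vector_derivative_within_subset[OF V_der]) (use s t in auto)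
      have "(h has_vector_derivative X (t - s) *v D s + - (X (t - s) ** A) *v V s) (at s within {0..t})"
        unfolding h_def by (rule bounded_bilinear.has_vector_derivative[OF bounded_bilinear_matrix_vector 1 2])
      moreover have "X (t - s) *v D s + - (X (t - s) ** A) *v V s = X (t - s) *v (A *v \<zeta> s + E s)"
      proof -
        have "- (X (t - s) ** A) *v V s = - (X (t - s) *v (A *v V s))"
          using matrix_vector_mult_diff_rdistrib[of 0 "X (t - s) ** A" "V s"] by (simp add: matrix_vector_mul_assoc)
        then show ?thesis by (simp add: DA matrix_vector_right_distrib)
      qed
      ultimately show ?thesis by simp
    qed
    have \<psi>_der: "(\<psi> has_vector_derivative C\<^sub>A * exp (- lam * (t - s)) * (norm (mat_op A) * \<zeta>m + C\<^sub>f * (exp (\<delta> * r) * K * exp (- \<delta> * s)))) (at s)" for s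
    proof -
      have d1: "(\<psi> has_real_derivative C\<^sub>A * (norm (mat_op A) * \<zeta>m / lam * (exp (- lam * (t - s)) * lam)
        + C\<^sub>f * exp (\<delta> * r) * K / (lam - \<delta>) * (exp (- lam * t + (lam - \<delta>) * s) * (lam - \<delta>)))) (at s)"
        unfolding \<psi>_def by (auto intro!: derivative_eq_intros)
      have d2: "exp (- lam * t + (lam - \<delta>) * s) = exp (- lam * (t - s)) * exp (- \<delta> * s)"
        by (simp flip: exp_add add: algebra_simps)
      have d3: "C\<^sub>A * (norm (mat_op A) * \<zeta>m / lam * (exp (- lam * (t - s)) * lam)
        + C\<^sub>f * exp (\<delta> * r) * K / (lam - \<delta>) * (exp (- lam * (t - s)) * exp (- \<delta> * s) * (lam - \<delta>)))
        = C\<^sub>A * exp (- lam * (t - s)) * (norm (mat_op A) * \<zeta>m + C\<^sub>f * (exp (\<delta> * r) * K * exp (- \<delta> * s)))"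
        using lam \<delta> by (simp add: distrib_left)
      show ?thesis
        using d1 unfolding d2 d3 by (simp only: has_real_derivative_iff_has_vector_derivative)
    qed
    have "norm (h t - h 0) \<le> \<psi> t - \<psi> 0"
    proof (rule differentiable_bound_general[OF t0])
      show "continuous_on {0..t} h" by (rule continuous_on_vector_derivative[OF h_der])
      show "continuous_on {0..t} \<psi>"
        by (rule continuous_on_vector_derivative[OF has_vector_derivative_at_within[OF \<psi>_der]])
      fix s assume s: "0 < s" "s < t"
      show "(h has_vector_derivative X (t - s) *v (A *v \<zeta> s + E s)) (at s)"
        using h_der[of s] s by (simp add: at_within_Icc_at)
      show "(\<psi> has_vector_derivative C\<^sub>A * exp (- lam * (t - s)) * (norm (mat_op A) * \<zeta>m + C\<^sub>f * (exp (\<delta> * r) * K * exp (- \<delta> * s)))) (at s)"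
        by (rule \<psi>_der)
      have "norm (A *v \<zeta> s + E s) \<le> norm (mat_op A) * \<zeta>m + C\<^sub>f * (exp (\<delta> * r) * K * exp (- \<delta> * s))"
        using s t by (intro order_trans[OF norm_triangle_ineq] add_mono E order_trans[OF norm_mat_op] mult_left_mono \<zeta>b) auto
      then show "norm (X (t - s) *v (A *v \<zeta> s + E s)) \<le> C\<^sub>A * exp (- lam * (t - s)) * (norm (mat_op A) * \<zeta>m + C\<^sub>f * (exp (\<delta> * r) * K * exp (- \<delta> * s)))"
        using s CA by (intro order_trans[OF Xb] mult_left_mono) auto
    qed
    also have "\<psi> t - \<psi> 0 \<le> \<psi> t" using CA lam \<zeta>m C\<^sub>f_nonneg K \<delta> by (simp add: \<psi>_def)
    also have "\<psi> t = C\<^sub>A * norm (mat_op A) / lam * \<zeta>m + \<kappa> * K * exp (- \<delta> * t)"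
      by (simp add: \<psi>_def \<kappa>_def algebra_simps)
    finally have hh: "norm (h t - h 0) \<le> C\<^sub>A * norm (mat_op A) / lam * \<zeta>m + \<kappa> * K * exp (- \<delta> * t)" .
    have ht: "h t = V t" by (simp add: h_def X_def)
    have h0: "norm (h 0) \<le> C\<^sub>A * exp (- lam * t) * N"
    proof -
      have "h 0 = X t *v z 0" by (simp add: h_def V_def \<zeta>_def)
      then have "norm (h 0) \<le> C\<^sub>A * exp (- lam * t) * norm (z 0)" using Xb[OF t0, of "z 0"] by simp
      also have "\<dots> \<le> C\<^sub>A * exp (- lam * t) * N" using z0[of 0] r CA by (intro mult_left_mono) auto
      finally show ?thesis .
    qed
    have "norm (z t) \<le> norm (h t - h 0) + norm (h 0) + norm (\<zeta> t)"
    proof -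
      have "z t = (h t - h 0) + h 0 + \<zeta> t" by (simp add: ht V_def)
      then have "norm (z t) \<le> norm ((h t - h 0) + h 0) + norm (\<zeta> t)" by (simp only: norm_triangle_ineq)
      also have "norm ((h t - h 0) + h 0) \<le> norm (h t - h 0) + norm (h 0)" by (rule norm_triangle_ineq)
      finally show ?thesis by simp
    qed
    also have "\<dots> \<le> (C\<^sub>A * norm (mat_op A) / lam * \<zeta>m + \<kappa> * K * exp (- \<delta> * t)) + C\<^sub>A * exp (- lam * t) * N + \<zeta>m"
      using hh h0 \<zeta>b[of t] t t0 by (intro add_mono) auto
    finally have "norm (z t) * exp (\<delta> * t) \<le> ((C\<^sub>A * norm (mat_op A) / lam * \<zeta>m + \<kappa> * K * exp (- \<delta> * t)) + C\<^sub>A * exp (- lam * t) * N + \<zeta>m) * exp (\<delta> * t)"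
      by (intro mult_right_mono) auto
    also have "\<dots> = (C\<^sub>A * norm (mat_op A) / lam + 1) * exp (\<delta> * t) * \<zeta>m + \<kappa> * K * (exp (- \<delta> * t) * exp (\<delta> * t))
        + C\<^sub>A * (exp (- lam * t) * exp (\<delta> * t)) * N"
      by (simp add: algebra_simps)
    also have "exp (- \<delta> * t) * exp (\<delta> * t) = 1" by (simp flip: exp_add)
    also have "(C\<^sub>A * norm (mat_op A) / lam + 1) * exp (\<delta> * t) * \<zeta>m + \<kappa> * K * 1 + C\<^sub>A * (exp (- lam * t) * exp (\<delta> * t)) * N
       \<le> (C\<^sub>A * norm (mat_op A) / lam + 1) * exp (\<delta> * T) * \<zeta>m + \<kappa> * K * 1 + C\<^sub>A * 1 * N"
    proof (intro add_mono mult_right_mono mult_left_mono order_refl)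
      show "exp (\<delta> * t) \<le> exp (\<delta> * T)" using t \<delta> by simp
      show "exp (- lam * t) * exp (\<delta> * t) \<le> 1"
        using t0 \<delta> by (simp flip: exp_add)
    qed (use CA lam \<zeta>m N K \<kappa> in auto)
    also have "\<dots> \<le> ((C\<^sub>A + 1) * N + (C\<^sub>A * norm (mat_op A) / lam + 1) * exp (\<delta> * T) * \<zeta>m) + \<kappa> * K"
      using N by (simp add: algebra_simps)
    finally show ?thesis .
  qed
  define c where "c = (C\<^sub>A + 1) * N + (C\<^sub>A * norm (mat_op A) / lam + 1) * exp (\<delta> * T) * \<zeta>m"
  have c: "0 \<le> c" using CA lam N \<zeta>m by (simp add: c_def)
  define Xm where "Xm = c / (1 - \<kappa>)"
  have Xm0: "0 \<le> Xm" using c \<kappa> by (simp add: Xm_def)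
  \<comment> \<open>Absorption of the term \<kappa> K: the iteration starts from the crude bound on
    the whole window and ends at c / (1 - \<kappa>).\<close>
  have "\<forall>u. -r \<le> u \<longrightarrow> u \<le> T \<longrightarrow> norm (z u) * exp (\<delta> * u) \<le> c / (1 - \<kappa>)"
  proof (rule bound_absorb[where P = "\<lambda>K. \<forall>u. -r \<le> u \<longrightarrow> u \<le> T \<longrightarrow> norm (z u) * exp (\<delta> * u) \<le> K" and ?K0.0 = "R * N * exp (\<delta> * T)"])
    show "\<forall>u. -r \<le> u \<longrightarrow> u \<le> T \<longrightarrow> norm (z u) * exp (\<delta> * u) \<le> R * N * exp (\<delta> * T)"
      by (intro allI impI mult_mono hbD[OF hbz]) (use \<delta> RN in auto)
    show "\<forall>u. -r \<le> u \<longrightarrow> u \<le> T \<longrightarrow> norm (z u) * exp (\<delta> * u) \<le> c + \<kappa> * K"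
      if "0 \<le> K" "\<forall>u. -r \<le> u \<longrightarrow> u \<le> T \<longrightarrow> norm (z u) * exp (\<delta> * u) \<le> K" for K
      unfolding c_def using step that by blast
    show "\<forall>u. -r \<le> u \<longrightarrow> u \<le> T \<longrightarrow> norm (z u) * exp (\<delta> * u) \<le> M"
      if "\<And>n::nat. \<forall>u. -r \<le> u \<longrightarrow> u \<le> T \<longrightarrow> norm (z u) * exp (\<delta> * u) \<le> Q n" "Q \<longlonglongrightarrow> M" for Q M
      using LIMSEQ_le_const[OF that(2)] that(1) by blast
  qed (use RN c \<kappa> in auto)
  then have zX: "norm (z u) * exp (\<delta> * u) \<le> Xm" if "-r \<le> u" "u \<le> T" for u
    using that by (simp add: Xm_def)
  define Y where "Y = exp (- \<delta> * (T - 2 * r)) * Xm"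
  have Y0: "0 \<le> Y" using Xm0 by (simp add: Y_def)
  \<comment> \<open>Two delay lengths before T are considered, because increments on [T - r, T]
    involve the drift, which looks back by another r.\<close>
  have zY: "norm (z u) \<le> Y" if u: "T - 2 * r \<le> u" "u \<le> T" for u
  proof -
    have "norm (z u) = (norm (z u) * exp (\<delta> * u)) * exp (- \<delta> * u)"
      by (simp add: mult.assoc flip: exp_add)
    also have "\<dots> \<le> Xm * exp (- \<delta> * (T - 2 * r))"
      using u T r \<delta> Xm0 by (intro mult_mono zX) auto
    finally show ?thesis by (simp add: Y_def mult.commute)
  qed
  define B where "B = v * (R * N) * (r powr (\<nu> - \<alpha>) + Z * r powr \<nu>)"
  have B0: "0 \<le> B" using v RN Z_nonneg by (simp add: B_def)
  let ?M = "Y * (1 + L * r powr (1 - \<alpha>)) + B"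
  have "hol \<alpha> (L * Y * (T - (T - r)) powr (1 - \<alpha>) + v * (R * N) * ((T - (T - r)) powr (\<nu> - \<alpha>) + Z * (T - (T - r)) powr (\<alpha> + \<nu> - \<alpha>))) (T - r) T z"
  proof (rule increment_hol)
    fix s t assume st: "T - r \<le> s" "s \<le> t" "t \<le> T"
    then have st': "0 \<le> s" "s \<le> t" "t \<le> T" using T r by auto
    have "norm (integral {s..t} D) \<le> L * Y * (t - s)"
    proof -
      have "continuous_on {s..t} D" by (rule continuous_on_subset[OF D_cont]) (use st' in auto)
      then have "(D has_integral integral {s..t} D) {s..t}"
        using integrable_continuous_real has_integral_integral by blast
      moreover have "norm (D u) \<le> L * Y" if "u \<in> {s..t}" for u
        unfolding D_def
      proof (rule F_diff[OF c1 c2])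
        fix q assume "u - r \<le> q" "q \<le> u"
        then show "norm (y1 q - y2 q) \<le> Y" using zY[of q] that st by (simp add: z_def)
      qed (use that st' in auto)
      moreover have "0 \<le> L * Y" using L_nonneg Y0 by simp
      ultimately show ?thesis using has_integral_bound_real[of "L * Y" "{}" D _ s t] st by simp
    qed
    then show "norm (z t - z s) \<le> L * Y * (t - s) + v * (R * N) * ((t - s) powr \<nu> + Z * (t - s) powr (\<alpha> + \<nu>))"
      unfolding inc[OF st'] using \<zeta>inc[OF st'] by (intro order_trans[OF norm_triangle_ineq] add_mono)
  qed (use L_nonneg Y0 v RN Z_nonneg exps \<nu>1 in auto)
  then have "hol \<alpha> (L * Y * r powr (1 - \<alpha>) + B) (T - r) T z" by (simp add: B_def)
  then have 1: "hol \<alpha> ?M (T - r) T z" by (rule hol_mono) (use Y0 in \<open>simp add: distrib_left mult.left_commute\<close>)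
  have 2: "norm (z u) \<le> ?M" if "T - r \<le> u" "u \<le> T" for u
  proof -
    have "norm (z u) \<le> Y" using zY[of u] that r by simp
    also have "Y = Y * 1" by simp
    also have "\<dots> \<le> Y * (1 + L * r powr (1 - \<alpha>))"
      using mult_nonneg_nonneg[OF L_nonneg powr_ge_zero] Y0 by (intro mult_left_mono) auto
    also have "\<dots> \<le> ?M" using B0 by simp
    finally show ?thesis .
  qed
  have "hb \<alpha> ?M (T - r) T z" using 1 2 by (simp add: hb_def)
  \<comment> \<open>All terms are homogeneous in the initial distance \<open>N\<close>, which is
    factored out.\<close>
  moreover have "?M = N * (exp (- \<delta> * (T - 2 * r)) * (1 + L * r powr (1 - \<alpha>)) *
     ((C\<^sub>A + 1) + (C\<^sub>A * norm (mat_op A) / lam + 1) * exp (\<delta> * T) * (v * R * (T powr \<nu> + Z * T powr (\<alpha> + \<nu>))))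
        / (1 - \<kappa>)
     + v * R * (r powr (\<nu> - \<alpha>) + Z * r powr \<nu>))"
  proof -
    have "c = N * ((C\<^sub>A + 1) + (C\<^sub>A * norm (mat_op A) / lam + 1) * exp (\<delta> * T) * (v * R * (T powr \<nu> + Z * T powr (\<alpha> + \<nu>))))"
      by (simp add: c_def \<zeta>m_def algebra_simps)
    moreover have "B = N * (v * R * (r powr (\<nu> - \<alpha>) + Z * r powr \<nu>))" by (simp add: B_def)
    ultimately show ?thesis by (simp add: Y_def Xm_def distrib_left[of N])
  qed
  ultimately show ?thesis unfolding v_def R_def \<kappa>_def z_def[abs_def] by simp
qed

end

text \<open>The order of the choices matters: the noise-free contraction determines T, and T
  determines the threshold \<open>c\<^sub>0\<close>; neither depends on g or on its bound.\<close>

lemma contraction_window_exists: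
  fixes A :: "real^'d^'d" and f :: "(real \<Rightarrow> real^'d) \<Rightarrow> real^'d"
  assumes r: "0 < r" and \<nu>: "\<nu> \<le> 1" "1 - \<nu> < \<alpha>" "\<alpha> < \<beta>" "\<beta> < \<nu>"
    and CA: "0 < C\<^sub>A" and lam: "0 < lam" and Cf: "0 \<le> C\<^sub>f"
    and expA: "\<And>t. 0 < t \<Longrightarrow> norm (mat_op (mat_exp (t *\<^sub>R A))) \<le> C\<^sub>A * exp (- lam * t)"
    and gap: "C\<^sub>A * C\<^sub>f < lam * exp (- lam * r)"
  obtains T c\<^sub>0 where "2 * r \<le> T" "1 \<le> T" "0 < c\<^sub>0" "c\<^sub>0 \<le> 1"
    "\<And>(g :: (real \<Rightarrow> real^'d) \<Rightarrow> real^'m^'d) C\<^sub>g x w \<eta>1 \<eta>2.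
       young_delay r \<nu> \<alpha> \<beta> f g C\<^sub>f C\<^sub>g \<Longrightarrow> young_delay.lhol \<nu> x \<Longrightarrow> hol \<nu> w 0 T x \<Longrightarrow> 0 \<le> w \<Longrightarrow> C\<^sub>g * w \<le> c\<^sub>0 \<Longrightarrow>
       \<eta>1 \<in> little_holder_space \<alpha> {-r..0} \<Longrightarrow> \<eta>2 \<in> little_holder_space \<alpha> {-r..0} \<Longrightarrow>
       holder_dist \<alpha> {-r..0} (delay_rds r \<alpha> \<beta> A f g T x \<eta>1) (delay_rds r \<alpha> \<beta> A f g T x \<eta>2)
         \<le> 1 / 4 * holder_dist \<alpha> {-r..0} \<eta>1 \<eta>2"
proof -
  obtain \<delta> where \<delta>: "0 < \<delta>" "\<delta> < lam" "C\<^sub>A * C\<^sub>f * exp (\<delta> * r) < lam - \<delta>"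
    using exponent_gap[OF gap lam r] by blast
  define L where "L = norm (mat_op A) + C\<^sub>f"
  define Z where "Z = young_const (\<alpha> + \<nu>)"
  define \<kappa> where "\<kappa> = C\<^sub>A * C\<^sub>f * exp (\<delta> * r) / (lam - \<delta>)"
  have \<kappa>: "0 \<le> \<kappa>" "\<kappa> < 1" using \<delta> CA Cf by (auto simp: \<kappa>_def)
  have L: "0 \<le> L" using Cf by (simp add: L_def)
  have Z: "0 \<le> Z" using young_const_nonneg[of "\<alpha> + \<nu>"] \<nu> by (simp add: Z_def)
  \<comment> \<open>\<open>q\<close> is the noise-free part of the contraction factor without its
    exponential.\<close>
  define q where "q = (1 + L * r powr (1 - \<alpha>)) * (C\<^sub>A + 1) / (1 - \<kappa>)"
  have q: "0 < q" using L CA \<kappa> by (auto simp: q_def intro!: divide_pos_pos mult_pos_pos add_pos_nonneg)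
  \<comment> \<open>The logarithm makes \<open>exp (- \<delta> * (T - 2 * r)) * q\<close> at most
    1/16; the maximum with 1 secures T \<ge> 1.\<close>
  define T where "T = 2 * r + max 1 (ln (16 * q) / \<delta>)"
  have T: "2 * r \<le> T" "0 < T" "1 \<le> T" using r by (auto simp: T_def)
  have T1: "exp (- \<delta> * (T - 2 * r)) * q \<le> 1 / 16"
  proof -
    have "ln (16 * q) = \<delta> * (ln (16 * q) / \<delta>)" using \<delta> by simp
    also have "\<dots> \<le> \<delta> * (T - 2 * r)" using \<delta> by (intro mult_left_mono) (auto simp: T_def)
    finally have "ln (16 * q) \<le> \<delta> * (T - 2 * r)" .
    then have "exp (- \<delta> * (T - 2 * r)) \<le> exp (- ln (16 * q))" by simp
    also have "\<dots> = 1 / (16 * q)" using q by (simp add: exp_minus inverse_eq_divide)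
    finally have "exp (- \<delta> * (T - 2 * r)) * q \<le> 1 / (16 * q) * q" using q by (intro mult_right_mono) auto
    then show ?thesis using q by simp
  qed
  \<comment> \<open>This is the value \<open>gf T 1\<close>, written out before any g is at
    hand.\<close>
  define R where "R = (2::real) ^ gsteps (\<nu> - \<alpha>) T (L + 1 * (1 + Z))"
  \<comment> \<open>\<open>Q\<close> is the coefficient of \<open>C\<^sub>g * w\<close> in the
    contraction factor.\<close>
  define Q where "Q = exp (- \<delta> * (T - 2 * r)) * (1 + L * r powr (1 - \<alpha>)) *
     ((C\<^sub>A * norm (mat_op A) / lam + 1) * exp (\<delta> * T) * (R * (T powr \<nu> + Z * T powr (\<alpha> + \<nu>)))) / (1 - \<kappa>)
     + R * (r powr (\<nu> - \<alpha>) + Z * r powr \<nu>)"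
  have Q: "0 \<le> Q" unfolding Q_def using L Z CA lam \<kappa>
    by (intro add_nonneg_nonneg mult_nonneg_nonneg divide_nonneg_nonneg) (auto simp: R_def)
  \<comment> \<open>With at most 1/16 from each of the two parts the factor is 1/8 in terms of
    \<open>hb\<close>, hence 1/4 for the distance.\<close>
  define c\<^sub>0 where "c\<^sub>0 = 1 / (16 * (Q + 1))"
  have c0: "0 < c\<^sub>0" "c\<^sub>0 \<le> 1" "c\<^sub>0 * Q \<le> 1 / 16" using Q by (auto simp: c\<^sub>0_def field_simps)
  show thesis
  proof (rule that[OF T(1,3) c0(1,2)])
    fix g :: "(real \<Rightarrow> real^'d) \<Rightarrow> real^'m^'d" and C\<^sub>g w :: real and x :: "real \<Rightarrow> real^'m" and \<eta>1 \<eta>2 :: "real \<Rightarrow> real^'d"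
    assume yd: "young_delay r \<nu> \<alpha> \<beta> f g C\<^sub>f C\<^sub>g" and x: "young_delay.lhol \<nu> x" and w: "hol \<nu> w 0 T x" "0 \<le> w" "C\<^sub>g * w \<le> c\<^sub>0"
      and \<eta>: "\<eta>1 \<in> little_holder_space \<alpha> {-r..0}" "\<eta>2 \<in> little_holder_space \<alpha> {-r..0}"
    interpret young_delay r \<nu> \<alpha> \<beta> A f g C\<^sub>f C\<^sub>g by (rule yd)
    let ?y1 = "ysol x \<eta>1" and ?y2 = "ysol x \<eta>2"
    note y1 = ysol[OF x \<eta>(1)] and y2 = ysol[OF x \<eta>(2)]
    have T0: "0 \<le> T" using T by simp
    let ?N = "dS \<eta>1 \<eta>2"
    have N: "0 \<le> ?N" by (simp add: holder_dist_def)
    obtain K1 where K1: "0 \<le> K1" "hol \<alpha> K1 (-r) T ?y1" using gsol_hol[OF y1 T0] by blast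
    obtain K2 where K2: "0 \<le> K2" "hol \<alpha> K2 (-r) T ?y2" using gsol_hol[OF y2 T0] by blast
    have "hb \<alpha> ?N (-r) 0 (\<lambda>t. \<eta>1 t - \<eta>2 t)" by (rule hb_holder_dist) (use \<eta> S_holder in auto)
    then have hb0: "hb \<alpha> ?N (-r) 0 (\<lambda>t. ?y1 t - ?y2 t)"
      by (subst hb_cong[where z = "\<lambda>t. \<eta>1 t - \<eta>2 t"]) (auto simp: gsol_past[OF y1] gsol_past[OF y2])
    have "C\<^sub>g * w \<le> 1" using w c0 by simp
    from window_contraction[OF CA lam expA \<delta> T(1) gsol_solves[OF y1 T0] gsol_solves[OF y2 T0] w(1,2) K1(2,1) K2(2,1) this hb0]
    have hb1: "hb \<alpha> (?N * (exp (- \<delta> * (T - 2 * r)) * (1 + L * r powr (1 - \<alpha>)) *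
     ((C\<^sub>A + 1) + (C\<^sub>A * norm (mat_op A) / lam + 1) * exp (\<delta> * T) * ((C\<^sub>g * w) * R * (T powr \<nu> + Z * T powr (\<alpha> + \<nu>))))
        / (1 - \<kappa>) + (C\<^sub>g * w) * R * (r powr (\<nu> - \<alpha>) + Z * r powr \<nu>))) (T - r) T (\<lambda>t. ?y1 t - ?y2 t)"
      unfolding L_def Z_def \<kappa>_def R_def gf_def .
    have gen: "E * l * (a + c * e * (v * R * t)) / k + v * R * u
        = E * (l * a / k) + v * (E * l * (c * e * (R * t)) / k + R * u)" for E l a c e v R t k u :: real
      by (simp add: algebra_simps add_divide_distrib)
    have "exp (- \<delta> * (T - 2 * r)) * (1 + L * r powr (1 - \<alpha>)) *
     ((C\<^sub>A + 1) + (C\<^sub>A * norm (mat_op A) / lam + 1) * exp (\<delta> * T) * ((C\<^sub>g * w) * R * (T powr \<nu> + Z * T powr (\<alpha> + \<nu>))))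
        / (1 - \<kappa>) + (C\<^sub>g * w) * R * (r powr (\<nu> - \<alpha>) + Z * r powr \<nu>) = exp (- \<delta> * (T - 2 * r)) * q + (C\<^sub>g * w) * Q"
      unfolding q_def Q_def by (rule gen)
    also have "\<dots> \<le> 1 / 16 + c\<^sub>0 * Q" using T1 w(3) Q by (intro add_mono mult_right_mono) auto
    also have "\<dots> \<le> 1 / 8" using c0 by simp
    finally have "hb \<alpha> (?N * (1 / 8)) (T - r) T (\<lambda>t. ?y1 t - ?y2 t)"
      using N by (intro hb_mono[OF hb1] mult_left_mono) auto
    from holder_dist_le[OF hb_segment[OF this]] N
    show "dS (\<phi> T x \<eta>1) (\<phi> T x \<eta>2) \<le> 1 / 4 * dS \<eta>1 \<eta>2"
      by (simp add: \<phi>_eq)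
  qed
qed

section \<open>Ergodic averages along a flow\<close>

text \<open>The maximal ergodic lemma with Garsia's proof: \<open>m n x\<close> is the maximum of 0
  and the first \<open>n\<close> partial sums, and where \<open>m (Suc n) x\<close> is positive it
  exceeds \<open>m (Suc n) (\<tau> x)\<close> by at most \<open>f x\<close>.\<close>

lemma (in prob_space) maximal_ergodic:
  fixes f :: "'a \<Rightarrow> real"
  assumes \<tau>: "\<tau> \<in> M \<rightarrow>\<^sub>M M" "distr M M \<tau> = M" and f: "integrable M f"
    and pos: "AE x in M. \<exists>n. 0 < (\<Sum>k<n. f ((\<tau> ^^ k) x))"
  shows "0 \<le> (\<integral>x. f x \<partial>M)"
proof -
  define m where "m = rec_nat (\<lambda>_. 0) (\<lambda>_ g x. max 0 (f x + g (\<tau> x)))"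
  have m0: "m 0 x = 0" and mS: "m (Suc n) x = max 0 (f x + m n (\<tau> x))" for n x
    by (simp_all add: m_def)
  have f_meas: "f \<in> borel_measurable M" using f by simp
  have int\<tau>: "integrable M (\<lambda>x. u (\<tau> x))" "(\<integral>x. u (\<tau> x) \<partial>M) = (\<integral>x. u x \<partial>M)"
    if u: "integrable M u" for u :: "'a \<Rightarrow> real"
  proof -
    have "integrable (distr M M \<tau>) u" using u \<tau> by simp
    then show "integrable M (\<lambda>x. u (\<tau> x))" by (rule integrable_distr[OF \<tau>(1)])
    have "(\<integral>x. u x \<partial>distr M M \<tau>) = (\<integral>x. u (\<tau> x) \<partial>M)"
      by (rule integral_distr[OF \<tau>(1)]) (use u in simp)
    then show "(\<integral>x. u (\<tau> x) \<partial>M) = (\<integral>x. u x \<partial>M)" using \<tau>(2) by simp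
  qed
  have m_int: "integrable M (m n)" for n
  proof (induct n)
    case 0
    have "m 0 = (\<lambda>_. 0)" by (simp add: m0 fun_eq_iff)
    then show ?case by simp
  next
    case (Suc n)
    have "m (Suc n) = (\<lambda>x. max 0 (f x + m n (\<tau> x)))" by (simp add: mS fun_eq_iff)
    then show ?case using f int\<tau>(1)[OF Suc] by (simp add: integrable_max)
  qed
  have m_nn: "0 \<le> m n x" for n x by (cases n) (simp_all add: m0 mS)
  have m_mono: "m n x \<le> m (Suc n) x" for n x
  proof (induct n arbitrary: x)
    case 0
    then show ?case using m_nn[of "Suc 0" x] by (simp only: m0)
  next
    case (Suc n)
    have a: "m n (\<tau> x) \<le> m (Suc n) (\<tau> x)" by (rule Suc)
    have e1: "m (Suc n) x = max 0 (f x + m n (\<tau> x))"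
      and e2: "m (Suc (Suc n)) x = max 0 (f x + m (Suc n) (\<tau> x))" by (rule mS)+
    show ?case unfolding e1 e2
      by (rule max.mono[OF order_refl add_left_mono[OF a]])
  qed
  have S_le: "(\<Sum>k<n. f ((\<tau> ^^ k) x)) \<le> m n x" for n x
  proof (induct n arbitrary: x)
    case 0
    then show ?case by (simp add: m0)
  next
    case (Suc n)
    have "(\<Sum>k<Suc n. f ((\<tau> ^^ k) x)) = f x + (\<Sum>k<n. f ((\<tau> ^^ k) (\<tau> x)))"
      by (simp only: sum.lessThan_Suc_shift funpow_0 funpow_Suc_right o_apply)
    also have "\<dots> \<le> f x + m n (\<tau> x)" using Suc by simp
    also have "\<dots> \<le> m (Suc n) x" by (simp add: mS)
    finally show ?case .
  qed
  let ?P = "\<lambda>n. {x \<in> space M. 0 < m n x}"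
  have P_meas: "?P n \<in> sets M" for n using m_int[of n] by measurable
  \<comment> \<open>By invariance the integral of \<open>m (Suc n) x - m (Suc n) (\<tau> x)\<close>
    is zero; off \<open>?P (Suc n)\<close> the integrand is at most 0.\<close>
  have key: "0 \<le> (\<integral>x. indicator (?P (Suc n)) x * f x \<partial>M)" for n
  proof -
    have "0 = (\<integral>x. m (Suc n) x - m (Suc n) (\<tau> x) \<partial>M)"
      using int\<tau>[OF m_int[of "Suc n"]] m_int[of "Suc n"] by simp
    also have "\<dots> \<le> (\<integral>x. indicator (?P (Suc n)) x * f x \<partial>M)"
    proof (rule integral_mono)
      show "integrable M (\<lambda>x. m (Suc n) x - m (Suc n) (\<tau> x))"
        using int\<tau>[OF m_int[of "Suc n"]] m_int[of "Suc n"] by simp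
      show "integrable M (\<lambda>x. indicator (?P (Suc n)) x * f x)"
        using integrable_mult_indicator[OF P_meas f] by simp
      fix x assume x: "x \<in> space M"
      show "m (Suc n) x - m (Suc n) (\<tau> x) \<le> indicator (?P (Suc n)) x * f x"
      proof (cases "0 < m (Suc n) x")
        case True
        then have "m (Suc n) x = f x + m n (\<tau> x)" by (simp add: mS max_def split: if_splits)
        then show ?thesis using True x m_mono[of n "\<tau> x"] by simp
      next
        case False
        then have "m (Suc n) x = 0" using m_nn[of "Suc n" x] by simp
        then show ?thesis using m_nn[of "Suc n" "\<tau> x"] by simp
      qed
    qed
    finally show ?thesis .
  qed
  \<comment> \<open>By assumption almost every point lies in all sets \<open>?P n\<close> from some
    \<open>n\<close> on, so the restricted integrals exhaust the full one.\<close>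
  have "(\<lambda>n. \<integral>x. indicator (?P (Suc n)) x * f x \<partial>M) \<longlonglongrightarrow> (\<integral>x. f x \<partial>M)"
  proof (rule integral_dominated_convergence[where w = "\<lambda>x. \<bar>f x\<bar>"])
    show "AE x in M. (\<lambda>n. indicator (?P (Suc n)) x * f x) \<longlonglongrightarrow> f x"
      using pos AE_space
    proof eventually_elim
      case (elim x)
      then obtain n where n: "0 < (\<Sum>k<n. f ((\<tau> ^^ k) x))" by blast
      have "indicator (?P (Suc k)) x * f x = f x" if "n \<le> k" for k
      proof -
        have "m n x \<le> m (Suc k) x" using lift_Suc_mono_le[of "\<lambda>n. m n x" n "Suc k"] m_mono that by simp
        then have "0 < m (Suc k) x" using n S_le[of x n] by linarith
        then show ?thesis using elim by simp
      qed
      then have "\<forall>\<^sub>F k in sequentially. indicator (?P (Suc k)) x * f x = f x"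
        by (auto simp: eventually_sequentially)
      then show ?case by (rule tendsto_eventually)
    qed
    show "AE x in M. norm (indicator (?P (Suc n)) x * f x) \<le> \<bar>f x\<bar>" for n
      by (intro AE_I2) (auto simp: indicator_def)
  qed (use f P_meas in \<open>auto intro!: borel_measurable_times borel_measurable_indicator\<close>)
  then show ?thesis by (rule LIMSEQ_le_const) (use key in auto)
qed

locale ergodic_flow_space = prob_space M for M :: "'w measure" +
  fixes \<theta> :: "real \<Rightarrow> 'w \<Rightarrow> 'w"
  assumes inv: "invariant_measure M \<theta>" and erg: "ergodic_flow M \<theta>"
    and \<theta>_add: "\<And>s t x. x \<in> space M \<Longrightarrow> \<theta> s (\<theta> t x) = \<theta> (s + t) x"
    and \<theta>_0: "\<And>x. x \<in> space M \<Longrightarrow> \<theta> 0 x = x"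
begin

lemma \<theta>_meas [measurable]: "\<theta> t \<in> M \<rightarrow>\<^sub>M M" and \<theta>_distr: "distr M M (\<theta> t) = M"
  using inv by (auto simp: invariant_measure_def)

lemma \<theta>_space: "x \<in> space M \<Longrightarrow> \<theta> t x \<in> space M"
  by (rule measurable_space[OF \<theta>_meas])

text \<open>Time reversal turns statements about large positive times into statements about large
  negative times, from which pullback limits start.\<close>

lemma reverse: "ergodic_flow_space M (\<lambda>t. \<theta> (- t))"
proof
  show "invariant_measure M (\<lambda>t. \<theta> (- t))" using inv by (simp add: invariant_measure_def)
  show "ergodic_flow M (\<lambda>t. \<theta> (- t))"
    unfolding ergodic_flow_def
  proof (intro ballI impI)
    fix E assume E: "E \<in> sets M" "\<forall>t. \<theta> (- t) -` E \<inter> space M = E"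
    then have "\<theta> t -` E \<inter> space M = E" for t using E(2)[rule_format, of "- t"] by simp
    then show "measure M E = 0 \<or> measure M E = 1" using erg E(1) by (simp add: ergodic_flow_def)
  qed
  show "\<theta> (- s) (\<theta> (- t) x) = \<theta> (- (s + t)) x" if "x \<in> space M" for s t x
    using \<theta>_add[OF that, of "- s" "- t"] by simp
  show "\<theta> (- 0) x = x" if "x \<in> space M" for x using \<theta>_0[OF that] by simp
qed

text \<open>Local boundedness along every orbit makes the orbit integrals finite at every point and
  not only almost everywhere. Sets defined through them can thus be exactly invariant, as
  \<open>ergodic_flow\<close> demands.\<close>

definition admissible :: "('w \<Rightarrow> real) \<Rightarrow> bool" where
  "admissible F \<longleftrightarrow> (\<forall>x\<in>space M. 0 \<le> F x) \<and> integrable M F \<and>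
     (\<lambda>(s, x). F (\<theta> s x)) \<in> borel_measurable (lborel \<Otimes>\<^sub>M M) \<and>
     (\<forall>x\<in>space M. \<forall>a b. \<exists>B. \<forall>s. a \<le> s \<longrightarrow> s \<le> b \<longrightarrow> F (\<theta> s x) \<le> B)"

definition I :: "('w \<Rightarrow> real) \<Rightarrow> real \<Rightarrow> real \<Rightarrow> 'w \<Rightarrow> real" where
  "I F a b x = (\<integral>u. indicator {a..b} u * F (\<theta> u x) \<partial>lborel)"

context
  fixes F assumes F: "admissible F"
begin

lemma F_nn: "x \<in> space M \<Longrightarrow> 0 \<le> F x" and F_int: "integrable M F"
  and F_joint: "(\<lambda>(s, x). F (\<theta> s x)) \<in> borel_measurable (lborel \<Otimes>\<^sub>M M)"
  and F_bdd: "x \<in> space M \<Longrightarrow> \<exists>B. \<forall>s. a \<le> s \<longrightarrow> s \<le> b \<longrightarrow> F (\<theta> s x) \<le> B"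
  using F by (auto simp: admissible_def)

lemma F_path: "x \<in> space M \<Longrightarrow> (\<lambda>s. F (\<theta> s x)) \<in> borel_measurable lborel"
  using measurable_compose[OF measurable_Pair2'[of x M lborel] F_joint] by simp

lemma I_integrable:
  assumes x: "x \<in> space M"
  shows "integrable lborel (\<lambda>u. indicator {a..b} u * F (\<theta> u x))"
proof -
  obtain B where B: "\<And>s. a \<le> s \<Longrightarrow> s \<le> b \<Longrightarrow> F (\<theta> s x) \<le> B" using F_bdd[OF x] by blast
  show ?thesis
  proof (rule Bochner_Integration.integrable_bound[where f = "\<lambda>u. indicator {a..b} u * B"])
    show "integrable lborel (\<lambda>u. indicator {a..b} u * B)"
      by (rule integrable_mult_left, rule integrable_real_indicator) (auto simp: emeasure_lborel_Icc_eq)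
    show "(\<lambda>u. indicator {a..b} u * F (\<theta> u x)) \<in> borel_measurable lborel"
      using F_path[OF x] by measurable
    show "AE u in lborel. norm (indicator {a..b} u * F (\<theta> u x)) \<le> norm (indicator {a..b} u * B)"
    proof (intro AE_I2)
      fix u :: real
      show "norm (indicator {a..b} u * F (\<theta> u x)) \<le> norm (indicator {a..b} u * B)"
        using B[of u] F_nn[OF \<theta>_space[OF x], of u]
        by (auto simp: indicator_def intro: order_trans[OF _ abs_ge_self])
    qed
  qed
qed

lemma I_nn: "x \<in> space M \<Longrightarrow> 0 \<le> I F a b x"
  unfolding I_def by (intro integral_nonneg_AE AE_I2) (simp add: F_nn \<theta>_space)

lemma I_mono:
  assumes x: "x \<in> space M" and "a' \<le> a" "b \<le> b'"
  shows "I F a b x \<le> I F a' b' x"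
  unfolding I_def
  by (rule integral_mono[OF I_integrable[OF x] I_integrable[OF x]])
     (use assms F_nn[OF \<theta>_space[OF x]] in \<open>auto simp: indicator_def\<close>)

lemma I_add:
  assumes x: "x \<in> space M" and "a \<le> b" "b \<le> c"
  shows "I F a c x = I F a b x + I F b c x"
proof -
  have "I F a c x = (\<integral>u. indicator {a..b} u * F (\<theta> u x) + indicator {b..c} u * F (\<theta> u x) \<partial>lborel)"
    unfolding I_def
  proof (rule integral_cong_AE)
    show "AE u in lborel. indicator {a..c} u * F (\<theta> u x) = indicator {a..b} u * F (\<theta> u x) + indicator {b..c} u * F (\<theta> u x)"
      using AE_lborel_singleton[of b] by eventually_elim (use assms in \<open>auto simp: indicator_def\<close>)
  qed (use F_path[OF x] in measurable)
  then show ?thesis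
    unfolding I_def using Bochner_Integration.integral_add[OF I_integrable[OF x] I_integrable[OF x]] by simp
qed

lemma I_shift:
  assumes x: "x \<in> space M"
  shows "I F a b (\<theta> t x) = I F (t + a) (t + b) x"
proof -
  have "I F (t + a) (t + b) x = (\<integral>u. indicator {t + a..t + b} (t + 1 * u) * F (\<theta> (t + 1 * u) x) \<partial>lborel)"
    unfolding I_def by (subst lborel_integral_real_affine[where c = 1 and t = t]) simp_all
  also have "\<dots> = I F a b (\<theta> t x)"
    unfolding I_def by (rule Bochner_Integration.integral_cong) (auto simp: indicator_def \<theta>_add[OF x] add.commute)
  finally show ?thesis by simp
qed

lemma I_meas: "I F a b \<in> borel_measurable M"
proof -
  have "(\<lambda>(x, s). F (\<theta> s x)) \<in> borel_measurable (M \<Otimes>\<^sub>M lborel)"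
    using measurable_compose[OF measurable_pair_swap' F_joint] by (simp add: case_prod_unfold comp_def)
  then have "(\<lambda>(x, s). indicator {a..b} s * F (\<theta> s x)) \<in> borel_measurable (M \<Otimes>\<^sub>M lborel)"
    by (simp add: case_prod_unfold)
  then show ?thesis
    unfolding I_def[abs_def] by (rule lborel.borel_measurable_lebesgue_integral)
qed

text \<open>Tonelli's theorem, and invariance of the measure at each single time.\<close>

lemma I_expectation: "integrable M (I F 0 1)" "(\<integral>x. I F 0 1 x \<partial>M) = (\<integral>x. F x \<partial>M)"
proof -
  have F_meas: "F \<in> borel_measurable M" using F_int by simp
  have eF: "(\<integral>\<^sup>+x. ennreal (F (\<theta> s x)) \<partial>M) = ennreal (\<integral>x. F x \<partial>M)" for s
  proof -
    have "(\<integral>\<^sup>+x. ennreal (F x) \<partial>distr M M (\<theta> s)) = (\<integral>\<^sup>+x. ennreal (F (\<theta> s x)) \<partial>M)"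
      by (rule nn_integral_distr) (use F_meas in measurable)
    then have "(\<integral>\<^sup>+x. ennreal (F (\<theta> s x)) \<partial>M) = (\<integral>\<^sup>+x. ennreal (F x) \<partial>M)"
      by (simp add: \<theta>_distr)
    also have "\<dots> = ennreal (\<integral>x. F x \<partial>M)"
      by (rule nn_integral_eq_integral[OF F_int]) (use F_nn in auto)
    finally show ?thesis .
  qed
  have joint: "(\<lambda>(x, s). indicator {0..1} s * ennreal (F (\<theta> s x))) \<in> borel_measurable (M \<Otimes>\<^sub>M lborel)"
    using measurable_compose[OF measurable_pair_swap' F_joint] by (simp add: case_prod_unfold comp_def)
  have "(\<integral>\<^sup>+x. ennreal (I F 0 1 x) \<partial>M) = (\<integral>\<^sup>+x. (\<integral>\<^sup>+s. indicator {0..1} s * ennreal (F (\<theta> s x)) \<partial>lborel) \<partial>M)"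
  proof (rule nn_integral_cong)
    fix x assume x: "x \<in> space M"
    have "ennreal (I F 0 1 x) = (\<integral>\<^sup>+s. ennreal (indicator {0..1} s * F (\<theta> s x)) \<partial>lborel)"
      unfolding I_def using F_nn[OF \<theta>_space[OF x]]
      by (subst nn_integral_eq_integral[OF I_integrable[OF x]]) auto
    then show "ennreal (I F 0 1 x) = (\<integral>\<^sup>+s. indicator {0..1} s * ennreal (F (\<theta> s x)) \<partial>lborel)"
      by (simp add: ennreal_mult'' ennreal_indicator F_nn \<theta>_space x)
  qed
  also have "\<dots> = (\<integral>\<^sup>+s. (\<integral>\<^sup>+x. indicator {0..1} s * ennreal (F (\<theta> s x)) \<partial>M) \<partial>lborel)"
  proof -
    interpret pair_sigma_finite M lborel
      by (intro pair_sigma_finite.intro) (unfold_locales)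
    show ?thesis using Fubini'[OF joint] by simp
  qed
  also have "\<dots> = (\<integral>\<^sup>+s. indicator {0..1} (s::real) * ennreal (\<integral>x. F x \<partial>M) \<partial>lborel)"
  proof (rule nn_integral_cong)
    fix s :: real
    have "(\<lambda>x. F (\<theta> s x)) \<in> borel_measurable M" using measurable_compose[OF \<theta>_meas F_meas] .
    then show "(\<integral>\<^sup>+x. indicator {0..1} s * ennreal (F (\<theta> s x)) \<partial>M) = indicator {0..1} s * ennreal (\<integral>x. F x \<partial>M)"
      by (subst nn_integral_cmult) (auto simp: eF)
  qed
  also have "\<dots> = ennreal (\<integral>x. F x \<partial>M)" by (simp add: nn_integral_multc)
  finally have *: "(\<integral>\<^sup>+x. ennreal (I F 0 1 x) \<partial>M) = ennreal (\<integral>x. F x \<partial>M)" .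
  show int: "integrable M (I F 0 1)"
    by (rule integrableI_nonneg[OF I_meas]) (use I_nn * in auto)
  have "ennreal (\<integral>x. I F 0 1 x \<partial>M) = ennreal (\<integral>x. F x \<partial>M)"
    using nn_integral_eq_integral[OF int] I_nn * by simp
  then show "(\<integral>x. I F 0 1 x \<partial>M) = (\<integral>x. F x \<partial>M)"
    by (subst (asm) ennreal_inj) (auto intro!: integral_nonneg_AE AE_I2 I_nn F_nn)
qed

text \<open>Reduces continuous time to the Birkhoff sums of the time-one map, to which the maximal
  inequality applies.\<close>

lemma I_sum:
  assumes x: "x \<in> space M"
  shows "(\<Sum>k<n. I F 0 1 ((\<theta> 1 ^^ k) x)) = I F 0 (real n) x"
proof -
  have pow: "(\<theta> 1 ^^ k) x = \<theta> (real k) x" for k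
    by (induct k) (simp_all add: \<theta>_0[OF x] \<theta>_add[OF x] add.commute)
  have I00: "I F 0 0 x = 0" using I_add[OF x, of 0 0 0] by simp
  show ?thesis
  proof (induct n)
    case (Suc n)
    have "I F 0 (real (Suc n)) x = I F 0 (real n) x + I F (real n + 0) (real n + 1) x"
      using I_add[OF x, of 0 "real n" "real n + 1"] by (simp add: add.commute)
    then show ?case using Suc by (simp add: pow I_shift[OF x])
  qed (simp add: I00)
qed

text \<open>The set where the upper averages are at most \<open>c\<close> is strictly invariant because \<open>F\<close> is
  nonnegative; the maximal inequality excludes measure zero.\<close>

lemma upper_average:
  assumes c: "(\<integral>x. F x \<partial>M) < c"
  shows "AE x in M. \<forall>q>c. \<forall>\<^sub>F n in sequentially. I F 0 (real n) x \<le> q * real n"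
proof -
  \<comment> \<open>Quantifying over all q > c leaves room to absorb bounded errors, which makes
    \<open>good\<close> invariant under every shift.\<close>
  define good where "good x \<longleftrightarrow> (\<forall>q>c. \<forall>\<^sub>F n in sequentially. I F 0 (real n) x \<le> q * real n)" for x
  define E where "E = {x \<in> space M. good x}"
  have E_eq: "E = {x \<in> space M. \<forall>m. \<exists>N. \<forall>n. N \<le> n \<longrightarrow> I F 0 (real n) x \<le> (c + 1 / Suc m) * real n}"
  proof -
    have "good x \<longleftrightarrow> (\<forall>m. \<exists>N. \<forall>n. N \<le> n \<longrightarrow> I F 0 (real n) x \<le> (c + 1 / Suc m) * real n)" for x
    proof
      assume "good x"
      then show "\<forall>m. \<exists>N. \<forall>n. N \<le> n \<longrightarrow> I F 0 (real n) x \<le> (c + 1 / Suc m) * real n"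
        unfolding good_def eventually_sequentially by simp
    next
      assume *: "\<forall>m. \<exists>N. \<forall>n. N \<le> n \<longrightarrow> I F 0 (real n) x \<le> (c + 1 / Suc m) * real n"
      show "good x" unfolding good_def eventually_sequentially
      proof (intro allI impI)
        fix q assume "c < q"
        then obtain m where m: "1 / real (Suc m) < q - c" using nat_approx_posE[of "q - c"] by auto
        obtain N where N: "\<And>n. N \<le> n \<Longrightarrow> I F 0 (real n) x \<le> (c + 1 / Suc m) * real n" using * by blast
        have "I F 0 (real n) x \<le> q * real n" if "N \<le> n" for n
          using N[OF that] m by (intro order_trans[OF N[OF that]] mult_right_mono) auto
        then show "\<exists>N. \<forall>n\<ge>N. I F 0 (real n) x \<le> q * real n" by blast
      qed
    qed
    then show ?thesis by (simp add: E_def)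
  qed
  have E_sets: "E \<in> sets M"
    unfolding E_eq using I_meas by measurable
  \<comment> \<open>Nonnegativity bounds the integral over [t, t + n] by the one over [0, n + 1];
    the additional unit of time is absorbed by the gap between q' and q.\<close>
  have up: "good (\<theta> t x)" if x: "x \<in> space M" and g: "good x" and t: "0 \<le> t" "t \<le> 1" for x t
    unfolding good_def
  proof (intro allI impI)
    fix q assume q: "c < q"
    define q' where "q' = (c + q) / 2"
    have q': "c < q'" "q' < q" using q by (auto simp: q'_def)
    obtain N where N: "\<And>n. N \<le> n \<Longrightarrow> I F 0 (real n) x \<le> q' * real n"
      using g q'(1) unfolding good_def eventually_sequentially by blast
    obtain K :: nat where K: "\<bar>q'\<bar> / (q - q') \<le> real K" using real_arch_simple by blast
    have "I F 0 (real n) (\<theta> t x) \<le> q * real n" if n: "max N K \<le> n" for n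
    proof -
      have "I F 0 (real n) (\<theta> t x) = I F (t + 0) (t + real n) x" by (rule I_shift[OF x])
      also have "\<dots> \<le> I F 0 (real (Suc n)) x" using t by (intro I_mono[OF x]) auto
      also have "\<dots> \<le> q' * real (Suc n)" using n by (intro N) auto
      also have "\<dots> \<le> q * real n"
      proof -
        have "\<bar>q'\<bar> / (q - q') \<le> real n" using K n by simp
        then have "\<bar>q'\<bar> \<le> real n * (q - q')" using q' by (simp add: pos_divide_le_eq)
        then have "q' \<le> real n * (q - q')" by simp
        then show ?thesis by (simp add: algebra_simps)
      qed
      finally show ?thesis .
    qed
    then show "\<forall>\<^sub>F n in sequentially. I F 0 (real n) (\<theta> t x) \<le> q * real n"
      unfolding eventually_sequentially by blast
  qed
  have down: "good x" if x: "x \<in> space M" and g: "good (\<theta> 1 x)" for x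
    unfolding good_def
  proof (intro allI impI)
    fix q assume q: "c < q"
    define q' where "q' = (c + q) / 2"
    have q': "c < q'" "q' < q" using q by (auto simp: q'_def)
    obtain N where N: "\<And>n. N \<le> n \<Longrightarrow> I F 0 (real n) (\<theta> 1 x) \<le> q' * real n"
      using g q'(1) unfolding good_def eventually_sequentially by blast
    obtain K :: nat where K: "(\<bar>q'\<bar> + I F 0 1 x) / (q - q') \<le> real K" using real_arch_simple by blast
    have "I F 0 (real n) x \<le> q * real n" if n: "max (Suc N) K \<le> n" for n
    proof -
      obtain k where k: "n = Suc k" "N \<le> k" using n by (cases n) auto
      have "I F 0 (real n) x = I F 0 1 x + I F (1 + 0) (1 + real k) x"
        using I_add[OF x, of 0 1 "1 + real k"] k by simp
      also have "I F (1 + 0) (1 + real k) x = I F 0 (real k) (\<theta> 1 x)" by (rule I_shift[OF x, symmetric])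
      also have "\<dots> \<le> q' * real k" using k by (intro N) auto
      also have "I F 0 1 x + q' * real k \<le> q * real n"
      proof -
        have "(\<bar>q'\<bar> + I F 0 1 x) / (q - q') \<le> real n" using K n by simp
        then have "\<bar>q'\<bar> + I F 0 1 x \<le> real n * (q - q')" using q' by (simp add: pos_divide_le_eq)
        moreover have "q' * real k \<le> q' * real n + \<bar>q'\<bar>" using k by (simp add: algebra_simps abs_if)
        ultimately show ?thesis by (simp add: algebra_simps)
      qed
      finally show ?thesis by simp
    qed
    then show "\<forall>\<^sub>F n in sequentially. I F 0 (real n) x \<le> q * real n"
      unfolding eventually_sequentially by blast
  qed
  \<comment> \<open>Moving on by 1 - t leads from time t to time 1, from which \<open>down\<close>
    returns; so a backward step of length 1 is all that has to be proved directly.\<close>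
  have iff01: "good (\<theta> t x) \<longleftrightarrow> good x" if x: "x \<in> space M" and t: "0 \<le> t" "t \<le> 1" for x t
  proof
    assume "good (\<theta> t x)"
    then have "good (\<theta> (1 - t) (\<theta> t x))" by (rule up[OF \<theta>_space[OF x]]) (use t in simp_all)
    then have "good (\<theta> 1 x)" by (simp add: \<theta>_add[OF x])
    then show "good x" by (rule down[OF x])
  qed (rule up[OF x _ t])
  have iffn: "good (\<theta> (real n) x) \<longleftrightarrow> good x" if x: "x \<in> space M" for x n
  proof (induct n)
    case (Suc n)
    have "\<theta> (real (Suc n)) x = \<theta> 1 (\<theta> (real n) x)" by (simp add: \<theta>_add[OF x] add.commute)
    then show ?case using Suc iff01[OF \<theta>_space[OF x], of 1 "real n"] by simp
  qed (simp add: \<theta>_0[OF x])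
  have iff0: "good (\<theta> t x) \<longleftrightarrow> good x" if x: "x \<in> space M" and t: "0 \<le> t" for x t
  proof -
    obtain n :: nat where n: "0 \<le> t - real n" "t - real n \<le> 1"
    proof
      show "0 \<le> t - real (nat \<lfloor>t\<rfloor>)" "t - real (nat \<lfloor>t\<rfloor>) \<le> 1" using t by linarith+
    qed
    have "\<theta> t x = \<theta> (t - real n) (\<theta> (real n) x)" by (simp add: \<theta>_add[OF x])
    then show ?thesis using iff01[OF \<theta>_space[OF x] n] iffn[OF x] by simp
  qed
  have iff: "good (\<theta> t x) \<longleftrightarrow> good x" if x: "x \<in> space M" for x t
  proof (cases "0 \<le> t")
    case False
    have "good (\<theta> (- t) (\<theta> t x)) \<longleftrightarrow> good (\<theta> t x)" by (rule iff0[OF \<theta>_space[OF x]]) (use False in simp)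
    then show ?thesis by (simp add: \<theta>_add[OF x] \<theta>_0[OF x])
  qed (rule iff0[OF x])
  \<comment> \<open>Ergodicity of the whole flow is used here, since the time-one map need not be
    ergodic.\<close>
  have "\<forall>t. \<theta> t -` E \<inter> space M = E" using iff \<theta>_space by (auto simp: E_def)
  then have "measure M E = 0 \<or> measure M E = 1" using erg E_sets by (simp add: ergodic_flow_def)
  moreover have "measure M E \<noteq> 0"
  proof
    assume "measure M E = 0"
    then have "E \<in> null_sets M" using E_sets by (auto simp: emeasure_eq_measure)
    then have notE: "AE x in M. x \<notin> E" by (rule AE_not_in)
    \<comment> \<open>If almost no point were good, some partial sum of \<open>I F 0 1 - c\<close>
      would be positive almost everywhere, and the maximal inequality would force the expectation of
      \<open>F\<close> up to c.\<close>
    have "0 \<le> (\<integral>x. I F 0 1 x - c \<partial>M)"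
    proof (rule maximal_ergodic[OF \<theta>_meas[of 1] \<theta>_distr[of 1]])
      show "integrable M (\<lambda>x. I F 0 1 x - c)" using I_expectation(1) by simp
      show "AE x in M. \<exists>n. 0 < (\<Sum>k<n. I F 0 1 ((\<theta> 1 ^^ k) x) - c)"
        using notE AE_space
      proof eventually_elim
        case (elim x)
        then have "\<not> good x" by (simp add: E_def)
        then obtain q where q: "c < q" "\<not> (\<forall>\<^sub>F n in sequentially. I F 0 (real n) x \<le> q * real n)"
          by (auto simp: good_def)
        then obtain n where n: "1 \<le> n" "q * real n < I F 0 (real n) x"
          unfolding eventually_sequentially by (metis not_le)
        have "c * real n < q * real n" using q n by simp
        then have "c * real n < I F 0 (real n) x" using n by linarith
        then have "0 < (\<Sum>k<n. I F 0 1 ((\<theta> 1 ^^ k) x) - c)"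
          using n I_sum[OF elim(2), of n] by (simp add: sum_subtractf mult.commute)
        then show ?case by blast
      qed
    qed
    then show False using c I_expectation by (simp add: prob_space)
  qed
  ultimately have "measure M E = 1" by simp
  then have "AE x in M. x \<in> E" using E_sets by (simp add: AE_in_set_eq_1)
  then show ?thesis by eventually_elim (simp add: E_def good_def)
qed

end

section \<open>Two-sided averages in both directions of time\<close>

lemma upper_average_limit:
  assumes F: "admissible F"
  shows "AE x in M. \<forall>q>(\<integral>x. F x \<partial>M). \<forall>\<^sub>F n in sequentially. I F 0 (real n) x \<le> q * real n"
proof -
  let ?e = "\<integral>x. F x \<partial>M"
  have "AE x in M. \<forall>m::nat. \<forall>q>?e + 1 / Suc m. \<forall>\<^sub>F n in sequentially. I F 0 (real n) x \<le> q * real n"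
    unfolding AE_all_countable by (intro allI upper_average[OF F]) simp
  then show ?thesis
  proof eventually_elim
    case (elim x)
    show ?case
    proof (intro allI impI)
      fix q assume "?e < q"
      then obtain m where "1 / real (Suc m) < q - ?e" using nat_approx_posE[of "q - ?e"] by auto
      then have "?e + 1 / Suc m < q" by simp
      then show "\<forall>\<^sub>F n in sequentially. I F 0 (real n) x \<le> q * real n" using elim by blast
    qed
  qed
qed

text \<open>-F is not nonnegative, so the upper bound is applied to K - min F K instead; K tends to
  infinity by dominated convergence.\<close>

lemma lower_average_limit:
  assumes F: "admissible F"
  shows "AE x in M. \<forall>q<(\<integral>x. F x \<partial>M). \<forall>\<^sub>F n in sequentially. q * real n \<le> I F 0 (real n) x"
proof -
  define H where "H K x = real K - min (F x) (real K)" for K :: nat and x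
  note F_facts = F_nn[OF F] F_int[OF F] F_joint[OF F]
  have Fm: "F \<in> borel_measurable M" using F_int[OF F] by simp
  have Hint: "integrable M (\<lambda>x. min (F x) (real K))" for K
    using F_int[OF F] by (intro integrable_min) auto
  have H: "admissible (H K)" for K
    unfolding admissible_def
  proof (intro conjI ballI allI)
    show "integrable M (H K)" unfolding H_def using Hint by simp
    show "(\<lambda>(s, x). H K (\<theta> s x)) \<in> borel_measurable (lborel \<Otimes>\<^sub>M M)"
      unfolding H_def using F_joint[OF F] by (simp add: case_prod_unfold)
    show "\<exists>B. \<forall>s. a \<le> s \<longrightarrow> s \<le> b \<longrightarrow> H K (\<theta> s x) \<le> B" if "x \<in> space M" for x a b
      using F_nn[OF F \<theta>_space[OF that]] by (intro exI[of _ "real K"]) (simp add: H_def)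
  qed (simp add: H_def)
  have lim: "(\<lambda>K. \<integral>x. min (F x) (real K) \<partial>M) \<longlonglongrightarrow> (\<integral>x. F x \<partial>M)"
  proof (rule integral_dominated_convergence[where w = F])
    show "AE x in M. (\<lambda>K. min (F x) (real K)) \<longlonglongrightarrow> F x"
    proof (intro AE_I2)
      fix x
      obtain N :: nat where N: "F x \<le> real N" using real_arch_simple by blast
      have "\<forall>\<^sub>F K in sequentially. min (F x) (real K) = F x"
        unfolding eventually_sequentially by (intro exI[of _ N]) (use N in auto)
      then show "(\<lambda>K. min (F x) (real K)) \<longlonglongrightarrow> F x" by (rule tendsto_eventually)
    qed
    show "AE x in M. norm (min (F x) (real K)) \<le> F x" for K
      by (intro AE_I2) (use F_nn[OF F] in auto)
  qed (use Fm F_int[OF F] in auto)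
  have "AE x in M. \<forall>K. \<forall>q>(\<integral>x. H K x \<partial>M). \<forall>\<^sub>F n in sequentially. I (H K) 0 (real n) x \<le> q * real n"
    unfolding AE_all_countable by (intro allI upper_average_limit[OF H])
  then show ?thesis using AE_space
  proof eventually_elim
    case (elim x)
    show ?case
    proof (intro allI impI)
      fix q assume "q < (\<integral>x. F x \<partial>M)"
      then have "\<forall>\<^sub>F K in sequentially. q < (\<integral>x. min (F x) (real K) \<partial>M)" using order_tendstoD(1)[OF lim] by blast
      then obtain K where K: "q < (\<integral>x. min (F x) (real K) \<partial>M)" by (auto simp: eventually_sequentially)
      have "(\<integral>x. H K x \<partial>M) = real K - (\<integral>x. min (F x) (real K) \<partial>M)"
        unfolding H_def using Hint by (simp add: prob_space)
      then have "(\<integral>x. H K x \<partial>M) < real K - q" using K by simp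
      then have "\<forall>\<^sub>F n in sequentially. I (H K) 0 (real n) x \<le> (real K - q) * real n" using elim(1) by blast
      then show "\<forall>\<^sub>F n in sequentially. q * real n \<le> I F 0 (real n) x"
      proof eventually_elim
        case (elim n)
        \<comment> \<open>Pointwise K \<le> H K + F, so an upper bound for the integral of
          \<open>H K\<close> gives a lower bound for that of F.\<close>
        have "real K * real n = (\<integral>u. indicator {0..real n} u * real K \<partial>lborel)" by simp
        also have "\<dots> \<le> (\<integral>u. indicator {0..real n} u * H K (\<theta> u x) + indicator {0..real n} u * F (\<theta> u x) \<partial>lborel)"
        proof (rule integral_mono)
          show "integrable lborel (\<lambda>u. indicator {0..real n} u * real K)"
            by (rule integrable_mult_left, rule integrable_real_indicator) (auto simp: emeasure_lborel_Icc_eq)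
          show "integrable lborel (\<lambda>u. indicator {0..real n} u * H K (\<theta> u x) + indicator {0..real n} u * F (\<theta> u x))"
            using I_integrable[OF H \<open>x \<in> space M\<close>] I_integrable[OF F \<open>x \<in> space M\<close>] by (rule Bochner_Integration.integrable_add)
        qed (auto simp: indicator_def H_def)
        also have "\<dots> = I (H K) 0 (real n) x + I F 0 (real n) x"
          unfolding I_def using I_integrable[OF H \<open>x \<in> space M\<close>] I_integrable[OF F \<open>x \<in> space M\<close>] by simp
        finally show ?case using elim by (simp add: algebra_simps)
      qed
    qed
  qed
qed

text \<open>The deviations at the finitely many early times are collected in the constant C, so that
  the bound holds for all n.\<close>

lemma average_bound:
  assumes F: "admissible F"
  shows "AE x in M. \<forall>e>0. \<exists>C\<ge>0. \<forall>n. \<bar>I F 0 (real n) x - (\<integral>x. F x \<partial>M) * real n\<bar> \<le> e * real n + C"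
  using upper_average_limit[OF F] lower_average_limit[OF F]
proof eventually_elim
  case (elim x)
  let ?e = "\<integral>x. F x \<partial>M"
  show ?case
  proof (intro allI impI)
    fix e :: real assume e: "0 < e"
    have "\<forall>\<^sub>F n in sequentially. \<bar>I F 0 (real n) x - ?e * real n\<bar> \<le> e * real n"
    proof -
      have "\<forall>\<^sub>F n in sequentially. I F 0 (real n) x \<le> (?e + e) * real n"
        "\<forall>\<^sub>F n in sequentially. (?e - e) * real n \<le> I F 0 (real n) x"
        using elim e by simp_all
      then show ?thesis
      proof eventually_elim
        case (elim n)
        then show ?case by (simp add: algebra_simps abs_le_iff)
      qed
    qed
    then obtain N where N: "\<And>n. N \<le> n \<Longrightarrow> \<bar>I F 0 (real n) x - ?e * real n\<bar> \<le> e * real n"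
      by (auto simp: eventually_sequentially)
    define C where "C = (\<Sum>n<N. \<bar>I F 0 (real n) x - ?e * real n\<bar>)"
    have C0: "0 \<le> C" by (simp add: C_def sum_nonneg)
    have "\<bar>I F 0 (real n) x - ?e * real n\<bar> \<le> e * real n + C" for n
    proof (cases "n < N")
      case True
      then have "\<bar>I F 0 (real n) x - ?e * real n\<bar> \<le> C"
        unfolding C_def by (intro member_le_sum) auto
      moreover have "0 \<le> e * real n" using e by simp
      ultimately show ?thesis by linarith
    next
      case False
      then show ?thesis using N[of n] C0 by simp
    qed
    then show "\<exists>C\<ge>0. \<forall>n. \<bar>I F 0 (real n) x - ?e * real n\<bar> \<le> e * real n + C" using C0 by blast
  qed
qed

lemma average_bound_backward:
  assumes F: "admissible F"
  shows "AE x in M. \<forall>e>0. \<exists>C\<ge>0. \<forall>n. \<bar>I F (- real n) 0 x - (\<integral>x. F x \<partial>M) * real n\<bar> \<le> e * real n + C"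
proof -
  interpret R: ergodic_flow_space M "\<lambda>t. \<theta> (- t)" by (rule reverse)
  have RF: "R.admissible F"
    unfolding R.admissible_def
  proof (intro conjI ballI allI)
    have "(\<lambda>p. (- fst p, snd p)) \<in> lborel \<Otimes>\<^sub>M M \<rightarrow>\<^sub>M lborel \<Otimes>\<^sub>M M" by measurable
    from measurable_compose[OF this F_joint[OF F]]
    show "(\<lambda>(s, x). F (\<theta> (- s) x)) \<in> borel_measurable (lborel \<Otimes>\<^sub>M M)" by (simp add: case_prod_unfold)
    show "\<exists>B. \<forall>s. a \<le> s \<longrightarrow> s \<le> b \<longrightarrow> F (\<theta> (- s) x) \<le> B" if x: "x \<in> space M" for x a b
    proof -
      obtain B where B: "\<forall>s. - b \<le> s \<longrightarrow> s \<le> - a \<longrightarrow> F (\<theta> s x) \<le> B"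
        using F_bdd[OF F x, of "- b" "- a"] by blast
      have "F (\<theta> (- s) x) \<le> B" if "a \<le> s" "s \<le> b" for s using B[rule_format, of "- s"] that by simp
      then show ?thesis by blast
    qed
  qed (use F_nn[OF F] F_int[OF F] in auto)
  have "R.I F 0 (real n) x = I F (- real n) 0 x" for n x
  proof -
    have "I F (- real n) 0 x = (\<integral>u. indicator {- real n..0} (0 + (- 1) * u) * F (\<theta> (0 + (- 1) * u) x) \<partial>lborel)"
      unfolding I_def by (subst lborel_integral_real_affine[where c = "- 1" and t = 0]) simp_all
    also have "\<dots> = R.I F 0 (real n) x"
      unfolding R.I_def by (rule Bochner_Integration.integral_cong) (auto simp: indicator_def)
    finally show ?thesis by simp
  qed
  then show ?thesis using R.average_bound[OF RF] by simp
qed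

text \<open>The error grows, with arbitrarily small slope, in the distances of both end points from
  time 0 and not only in the length of the interval. Along a typical orbit this allows for bad
  intervals far away from time 0; it becomes the subexponential factor of the contraction.\<close>

definition regular :: "('w \<Rightarrow> real) \<Rightarrow> 'w \<Rightarrow> bool" where
  "regular F x \<longleftrightarrow> (\<forall>e>0. \<exists>C\<ge>0. \<forall>s t. s \<le> t \<longrightarrow>
     I F s t x \<le> (\<integral>x. F x \<partial>M) * (t - s) + e * (\<bar>s\<bar> + \<bar>t\<bar>) + C)"

lemma regularD: "regular F x \<Longrightarrow> 0 < e \<Longrightarrow> \<exists>C\<ge>0. \<forall>s t. s \<le> t \<longrightarrow>
     I F s t x \<le> (\<integral>x. F x \<partial>M) * (t - s) + e * (\<bar>s\<bar> + \<bar>t\<bar>) + C"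
  by (simp add: regular_def)

lemma regular_shift:
  assumes F: "admissible F" and x: "x \<in> space M" and reg: "regular F x"
  shows "regular F (\<theta> a x)"
  unfolding regular_def
proof (intro allI impI)
  fix e :: real assume e: "0 < e"
  obtain C where C: "0 \<le> C" "\<And>s t. s \<le> t \<Longrightarrow> I F s t x \<le> (\<integral>x. F x \<partial>M) * (t - s) + e * (\<bar>s\<bar> + \<bar>t\<bar>) + C"
    using regularD[OF reg e] by blast
  have "I F s t (\<theta> a x) \<le> (\<integral>x. F x \<partial>M) * (t - s) + e * (\<bar>s\<bar> + \<bar>t\<bar>) + (C + e * (2 * \<bar>a\<bar>))" if st: "s \<le> t" for s t
  proof -
    have "I F s t (\<theta> a x) = I F (a + s) (a + t) x" by (rule I_shift[OF F x])
    also have "\<dots> \<le> (\<integral>x. F x \<partial>M) * ((a + t) - (a + s)) + e * (\<bar>a + s\<bar> + \<bar>a + t\<bar>) + C" using st by (intro C) simp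
    also have "e * (\<bar>a + s\<bar> + \<bar>a + t\<bar>) \<le> e * ((\<bar>a\<bar> + \<bar>s\<bar>) + (\<bar>a\<bar> + \<bar>t\<bar>))"
      using e by (intro mult_left_mono add_mono abs_triangle_ineq) auto
    finally show ?thesis by (simp add: algebra_simps)
  qed
  moreover have "0 \<le> C + e * (2 * \<bar>a\<bar>)" using C e by simp
  ultimately show "\<exists>C\<ge>0. \<forall>s t. s \<le> t \<longrightarrow>
     I F s t (\<theta> a x) \<le> (\<integral>x. F x \<partial>M) * (t - s) + e * (\<bar>s\<bar> + \<bar>t\<bar>) + C" by blast
qed

lemma EF_nn: "admissible F \<Longrightarrow> 0 \<le> (\<integral>x. F x \<partial>M)"
  by (intro integral_nonneg_AE AE_I2 F_nn)

text \<open>Enlarging [s, t] to integer end points costs a bounded amount, since F is nonnegative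
  with finite mean. Integer end points, slopes 1/(m + 1) and natural constants make the condition
  countable and hence measurable.\<close>

lemma regular_integers:
  assumes F: "admissible F" and x: "x \<in> space M"
  shows "regular F x \<longleftrightarrow> (\<forall>m::nat. \<exists>C::nat. \<forall>i j::int. i \<le> j \<longrightarrow>
     I F (real_of_int i) (real_of_int j) x \<le> (\<integral>x. F x \<partial>M) * (real_of_int j - real_of_int i) + 1 / Suc m * (\<bar>real_of_int i\<bar> + \<bar>real_of_int j\<bar>) + C)"
    (is "_ \<longleftrightarrow> ?R")
proof
  assume reg: "regular F x"
  show ?R
  proof
    fix m :: nat
    obtain C where C: "0 \<le> C" "\<And>s t. s \<le> t \<Longrightarrow> I F s t x \<le> (\<integral>x. F x \<partial>M) * (t - s) + 1 / Suc m * (\<bar>s\<bar> + \<bar>t\<bar>) + C"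
      using regularD[OF reg, of "1 / Suc m"] by auto
    obtain n :: nat where "C \<le> real n" using real_arch_simple by blast
    then have "I F (real_of_int i) (real_of_int j) x \<le> (\<integral>x. F x \<partial>M) * (real_of_int j - real_of_int i) + 1 / Suc m * (\<bar>real_of_int i\<bar> + \<bar>real_of_int j\<bar>) + n"
      if "i \<le> j" for i j using C(2)[of "real_of_int i" "real_of_int j"] that by simp
    then show "\<exists>C::nat. \<forall>i j::int. i \<le> j \<longrightarrow>
      I F (real_of_int i) (real_of_int j) x \<le> (\<integral>x. F x \<partial>M) * (real_of_int j - real_of_int i) + 1 / Suc m * (\<bar>real_of_int i\<bar> + \<bar>real_of_int j\<bar>) + C"
      by (intro exI[of _ n] allI impI)
  qed
next
  assume R: ?R
  let ?e = "\<integral>x. F x \<partial>M"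
  show "regular F x"
    unfolding regular_def
  proof (intro allI impI)
    fix e :: real assume e: "0 < e"
    then obtain m where m: "1 / real (Suc m) < e" using nat_approx_posE by blast
    obtain C :: nat where C: "\<And>i j::int. i \<le> j \<Longrightarrow>
      I F (real_of_int i) (real_of_int j) x \<le> ?e * (real_of_int j - real_of_int i) + 1 / Suc m * (\<bar>real_of_int i\<bar> + \<bar>real_of_int j\<bar>) + C"
      using R by blast
    have "I F s t x \<le> ?e * (t - s) + e * (\<bar>s\<bar> + \<bar>t\<bar>) + (?e * 2 + e * 2 + C)" if st: "s \<le> t" for s t
    proof -
      have "I F s t x \<le> I F (real_of_int \<lfloor>s\<rfloor>) (real_of_int \<lceil>t\<rceil>) x" by (rule I_mono[OF F x]) auto
      also have "\<dots> \<le> ?e * (real_of_int \<lceil>t\<rceil> - real_of_int \<lfloor>s\<rfloor>) + 1 / Suc m * (\<bar>real_of_int \<lfloor>s\<rfloor>\<bar> + \<bar>real_of_int \<lceil>t\<rceil>\<bar>) + C"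
        by (rule C) (use st in linarith)
      also have "\<dots> \<le> ?e * (t - s + 2) + e * (\<bar>s\<bar> + \<bar>t\<bar> + 2) + C"
      proof (intro add_mono order_refl)
        show "?e * (real_of_int \<lceil>t\<rceil> - real_of_int \<lfloor>s\<rfloor>) \<le> ?e * (t - s + 2)"
          by (intro mult_left_mono EF_nn[OF F]) linarith
        have "\<bar>real_of_int \<lfloor>s\<rfloor>\<bar> + \<bar>real_of_int \<lceil>t\<rceil>\<bar> \<le> \<bar>s\<bar> + \<bar>t\<bar> + 2" by linarith
        then show "1 / real (Suc m) * (\<bar>real_of_int \<lfloor>s\<rfloor>\<bar> + \<bar>real_of_int \<lceil>t\<rceil>\<bar>) \<le> e * (\<bar>s\<bar> + \<bar>t\<bar> + 2)"
          using m e by (intro mult_mono) auto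
      qed
      finally show ?thesis by (simp add: algebra_simps)
    qed
    moreover have "0 \<le> ?e * 2 + e * 2 + C" using e EF_nn[OF F] by simp
    ultimately show "\<exists>C\<ge>0. \<forall>s t. s \<le> t \<longrightarrow> I F s t x \<le> ?e * (t - s) + e * (\<bar>s\<bar> + \<bar>t\<bar>) + C" by blast
  qed
qed

lemma regular_meas:
  assumes F: "admissible F"
  shows "{x \<in> space M. regular F x} \<in> sets M"
proof -
  have "{x \<in> space M. regular F x} = {x \<in> space M. \<forall>m::nat. \<exists>C::nat. \<forall>i j::int. i \<le> j \<longrightarrow>
     I F (real_of_int i) (real_of_int j) x \<le> (\<integral>x. F x \<partial>M) * (real_of_int j - real_of_int i) + 1 / Suc m * (\<bar>real_of_int i\<bar> + \<bar>real_of_int j\<bar>) + C}"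
    using regular_integers[OF F] by blast
  also have "\<dots> \<in> sets M" using I_meas[OF F] by measurable
  finally show ?thesis .
qed

theorem regular_AE:
  assumes F: "admissible F"
  shows "AE x in M. regular F x"
  using average_bound[OF F] average_bound_backward[OF F] AE_space
proof eventually_elim
  case (elim x)
  let ?e = "\<integral>x. F x \<partial>M"
  have x: "x \<in> space M" by (rule elim)
  \<comment> \<open>A primitive along the integers. The integral over [i, j] is B j - B i, so an
    upper bound for it needs a lower bound for \<open>B\<close> as well; hence the two-sided
    averages.\<close>
  define B where "B k = (if 0 \<le> k then I F 0 (real_of_int k) x else - I F (real_of_int k) 0 x)" for k :: int
  have BI: "I F (real_of_int i) (real_of_int j) x = B j - B i" if "i \<le> j" for i j :: int
  proof -
    consider "0 \<le> i" | "i < 0" "0 \<le> j" | "j < 0" by linarith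
    then show ?thesis
    proof cases
      case 1
      then show ?thesis using I_add[OF F x, of 0 "real_of_int i" "real_of_int j"] that by (simp add: B_def)
    next
      case 2
      then show ?thesis using I_add[OF F x, of "real_of_int i" 0 "real_of_int j"] by (simp add: B_def)
    next
      case 3
      then show ?thesis using I_add[OF F x, of "real_of_int i" "real_of_int j" 0] that by (simp add: B_def)
    qed
  qed
  show ?case
    unfolding regular_integers[OF F x]
  proof
    fix m :: nat
    let ?d = "1 / real (Suc m)"
    obtain C1 where C1: "0 \<le> C1" "\<And>n. \<bar>I F 0 (real n) x - ?e * real n\<bar> \<le> ?d * real n + C1"
      using elim(1)[rule_format, of ?d] by auto
    obtain C2 where C2: "0 \<le> C2" "\<And>n. \<bar>I F (- real n) 0 x - ?e * real n\<bar> \<le> ?d * real n + C2"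
      using elim(2)[rule_format, of ?d] by auto
    have B: "\<bar>B k - ?e * k\<bar> \<le> ?d * \<bar>real_of_int k\<bar> + (C1 + C2)" for k
    proof (cases "0 \<le> k")
      case True
      then show ?thesis using C1(2)[of "nat k"] C2(1) by (simp add: B_def)
    next
      case False
      then have "real (nat (- k)) = - real_of_int k" by simp
      then show ?thesis using C2(2)[of "nat (- k)"] C1(1) False by (simp add: B_def)
    qed
    have gen: "\<bar>bi - ei\<bar> \<le> di + c \<Longrightarrow> \<bar>bj - ej\<bar> \<le> dj + c \<Longrightarrow> v = bj - bi \<Longrightarrow> 2 * c \<le> k \<Longrightarrow>
        v \<le> (ej - ei) + (di + dj) + k" for bi ei di c bj ej dj v k :: real
      by linarith
    obtain n :: nat where n: "2 * (C1 + C2) \<le> real n" using real_arch_simple by blast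
    have "I F (real_of_int i) (real_of_int j) x \<le> ?e * (real_of_int j - real_of_int i) + ?d * (\<bar>real_of_int i\<bar> + \<bar>real_of_int j\<bar>) + n"
      if "i \<le> j" for i j
    proof -
      have "I F (real_of_int i) (real_of_int j) x \<le> (?e * j - ?e * i) + (?d * \<bar>real_of_int i\<bar> + ?d * \<bar>real_of_int j\<bar>) + n"
        by (rule gen[OF B[of i] B[of j] BI[OF that] n])
      then show ?thesis by (simp only: right_diff_distrib distrib_left)
    qed
    then show "\<exists>C::nat. \<forall>i j::int. i \<le> j \<longrightarrow>
      I F (real_of_int i) (real_of_int j) x \<le> ?e * (real_of_int j - real_of_int i) + ?d * (\<bar>real_of_int i\<bar> + \<bar>real_of_int j\<bar>) + C" by blast
  qed
qed

end

section \<open>The noise space\<close>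

lemma holder_norm_0 [simp]: "holder_norm \<alpha> {a..b} (\<lambda>_. 0) = 0"
proof -
  have "hb \<alpha> 0 a b (\<lambda>_. 0)" by (simp add: hb_def hol_def)
  from hb_imp_holder_norm_le[OF this] show ?thesis by simp
qed

lemma topspace_noise: "topspace (noise_topology \<nu>) = noise_paths \<nu>"
proof -
  have "x \<in> {z \<in> noise_paths \<nu>. holder_norm \<nu> {0..1} (\<lambda>t. z t - x t) < ennreal 1}"
    if "x \<in> noise_paths \<nu>" for x :: "real \<Rightarrow> 'a::real_normed_vector" using that by simp
  moreover have "0 < (1::real)" "(0::real) < 1" by simp_all
  ultimately show ?thesis unfolding noise_topology_def topology_generated_by_topspace by blast
qed

lemma space_borel_of_topology: "space (borel_of_topology X) = topspace X"
  by (simp add: borel_of_topology_def space_measure_of_conv)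

lemma openin_borel_of_topology: "openin X U \<Longrightarrow> U \<in> sets (borel_of_topology X)"
proof -
  assume U: "openin X U"
  have "{U. openin X U} \<subseteq> Pow (topspace X)" using openin_subset by auto
  then show ?thesis unfolding borel_of_topology_def using U by (auto simp: sets_measure_of)
qed

lemma noise_paths_hol:
  fixes x :: "real \<Rightarrow> 'a::euclidean_space"
  assumes "x \<in> noise_paths \<nu>"
  shows "\<exists>w\<ge>0. hol \<nu> w a b x"
proof -
  \<comment> \<open>The noise space speaks of nondegenerate intervals, so a possibly empty or
    trivial [a, b] is enlarged.\<close>
  let ?b = "max b (a + 1)"
  have "restrict x {a..?b} \<in> holder_space \<nu> {a..?b}"
    using assms by (intro little_holder_imp_holder) (auto simp: noise_paths_def)
  then obtain N where N: "0 \<le> N" "hb \<nu> N a ?b (restrict x {a..?b})" by (auto simp: holder_space_iff)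
  then have "hol \<nu> N a ?b x" using hb_hol[OF N(2)] hol_cong[of a ?b x "restrict x {a..?b}" \<nu> N] by simp
  then have "hol \<nu> N a b x" by (rule hol_subset) auto
  then show ?thesis using N(1) by blast
qed

text \<open>Symmetric intervals and \<open>hb\<close> suffice to test openness: each such
  neighbourhood contains a ball that generates the topology.\<close>

lemma noise_openin:
  fixes U :: "(real \<Rightarrow> 'a::euclidean_space) set"
  assumes U: "U \<subseteq> noise_paths \<nu>"
    and near: "\<And>x. x \<in> U \<Longrightarrow> \<exists>T>0. \<exists>e>0. \<forall>z\<in>noise_paths \<nu>. hb \<nu> e (-T) T (\<lambda>t. z t - x t) \<longrightarrow> z \<in> U"
  shows "openin (noise_topology \<nu>) U"
proof (subst openin_subopen, intro ballI)
  fix x assume x: "x \<in> U"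
  obtain T e where T: "0 < T" "0 < e" "\<And>z. z \<in> noise_paths \<nu> \<Longrightarrow> hb \<nu> e (-T) T (\<lambda>t. z t - x t) \<Longrightarrow> z \<in> U"
    using near[OF x] by blast
  let ?B = "{z \<in> noise_paths \<nu>. holder_norm \<nu> {-T..T} (\<lambda>t. z t - x t) < ennreal e}"
  have "openin (noise_topology \<nu>) ?B"
    unfolding noise_topology_def
  proof (rule topology_generated_by_Basis)
    have "x \<in> noise_paths \<nu> \<and> -T < T \<and> 0 < e" using x U T by auto
    then show "?B \<in> {{z \<in> noise_paths \<nu>. holder_norm \<nu> {a..b} (\<lambda>t. z t - x t) < ennreal e} | x a b e.
        x \<in> noise_paths \<nu> \<and> a < b \<and> 0 < e}" by blast
  qed
  moreover have "x \<in> ?B" using x U T by auto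
  moreover have "?B \<subseteq> U"
  proof
    fix z assume z: "z \<in> ?B"
    then have "hb \<nu> e (-T) T (\<lambda>t. z t - x t)" by (intro holder_norm_le_imp_hb) (use T in auto)
    then show "z \<in> U" using T(3) z by blast
  qed
  ultimately show "\<exists>B. openin (noise_topology \<nu>) B \<and> x \<in> B \<and> B \<subseteq> U" by blast
qed

locale noise_space = prob_space P for P :: "(real \<Rightarrow> real^'m) measure" +
  fixes \<nu> :: real
  assumes sets_P: "sets P = sets (borel_of_topology (noise_topology \<nu>))"
    and inv: "invariant_measure P wiener_shift" and erg: "ergodic_flow P wiener_shift"
    and \<nu>_pos: "0 < \<nu>" and \<nu>_le1: "\<nu> \<le> 1"
begin

lemma space_P: "space P = noise_paths \<nu>"
  using sets_eq_imp_space_eq[OF sets_P] by (simp add: space_borel_of_topology topspace_noise)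

lemma space_hol: "x \<in> space P \<Longrightarrow> \<exists>w\<ge>0. hol \<nu> w a b x"
  using noise_paths_hol by (simp add: space_P)


sublocale ergodic_flow_space P wiener_shift
proof
  show "invariant_measure P wiener_shift" by (rule inv)
  show "ergodic_flow P wiener_shift" by (rule erg)
  fix s t and x :: "real \<Rightarrow> real^'m" assume x: "x \<in> space P"
  show "wiener_shift s (wiener_shift t x) = wiener_shift (s + t) x"
    by (simp add: wiener_shift_def fun_eq_iff algebra_simps)
  show "wiener_shift 0 x = x"
    using x by (simp add: space_P noise_paths_def wiener_shift_def)
qed

text \<open>The measurable sets of \<open>P\<close> are the Borel sets of the noise topology, so
  local continuity in the Hoelder norm over some compact interval gives measurability.\<close>

lemma continuous_measurable:
  fixes h :: "(real \<Rightarrow> real^'m) \<Rightarrow> 'b::metric_space"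
  assumes "\<And>x e. x \<in> space P \<Longrightarrow> 0 < e \<Longrightarrow>
     \<exists>T>0. \<exists>\<delta>>0. \<forall>z\<in>space P. hb \<nu> \<delta> (-T) T (\<lambda>t. z t - x t) \<longrightarrow> dist (h z) (h x) < e"
  shows "h \<in> borel_measurable P"
proof (rule borel_measurableI)
  fix S :: "'b set" assume S: "open S"
  have "openin (noise_topology \<nu>) (h -` S \<inter> space P)"
  proof (rule noise_openin)
    show "h -` S \<inter> space P \<subseteq> noise_paths \<nu>" by (simp add: space_P)
    fix x assume x: "x \<in> h -` S \<inter> space P"
    then obtain e where e: "0 < e" "\<And>y. dist y (h x) < e \<Longrightarrow> y \<in> S"
      using S unfolding open_dist by blast
    obtain T \<delta> where "0 < T" "0 < \<delta>" "\<forall>z\<in>space P. hb \<nu> \<delta> (-T) T (\<lambda>t. z t - x t) \<longrightarrow> dist (h z) (h x) < e"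
      using assms[of x e] x e(1) by blast
    then show "\<exists>T>0. \<exists>\<delta>>0. \<forall>z\<in>noise_paths \<nu>. hb \<nu> \<delta> (-T) T (\<lambda>t. z t - x t) \<longrightarrow> z \<in> h -` S \<inter> space P"
      using e(2) by (auto simp: space_P)
  qed
  then show "h -` S \<inter> space P \<in> sets P" unfolding sets_P by (rule openin_borel_of_topology)
qed

lemma eval_measurable: "(\<lambda>x. x t) \<in> borel_measurable P"
proof (rule continuous_measurable)
  fix x :: "real \<Rightarrow> real^'m" and e :: real assume e: "0 < e"
  have "dist (z t) (x t) < e" if "hb \<nu> (e / 2) (- (\<bar>t\<bar> + 1)) (\<bar>t\<bar> + 1) (\<lambda>t. z t - x t)" for z
  proof -
    have "norm (z t - x t) \<le> e / 2" by (rule hbD[OF that]) linarith+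
    then show ?thesis using e by (simp add: dist_norm)
  qed
  then show "\<exists>T>0. \<exists>\<delta>>0. \<forall>z\<in>space P. hb \<nu> \<delta> (-T) T (\<lambda>t. z t - x t) \<longrightarrow> dist (z t) (x t) < e"
    using e by (intro exI[of _ "\<bar>t\<bar> + 1"] conjI exI[of _ "e / 2"]) auto
qed

end

section \<open>Hoelder seminorms as countable suprema\<close>

lemma ennreal_eqI_real:
  assumes "\<And>K. 0 \<le> K \<Longrightarrow> a \<le> ennreal K \<longleftrightarrow> b \<le> ennreal K"
  shows "a = b"
proof (rule antisym)
  show "a \<le> b"
  proof (cases b)
    case (real K)
    then show ?thesis using assms[of K] by simp
  qed simp
  show "b \<le> a"
  proof (cases a)
    case (real K)
    then show ?thesis using assms[of K] by simp
  qed simp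
qed

definition rat_pairs :: "(real \<times> real) set" where
  "rat_pairs = {(u, v). u \<in> \<rat> \<and> v \<in> \<rat> \<and> u < v}"

lemma countable_rat_pairs: "countable rat_pairs"
  by (rule countable_subset[of _ "\<rat> \<times> \<rat>"]) (auto simp: rat_pairs_def countable_rat)

lemma rat_approx:
  fixes s t :: real
  assumes "s < t"
  shows "\<exists>u. (\<forall>n::nat. u n \<in> \<rat> \<and> s < u n \<and> u n < t) \<and> u \<longlonglongrightarrow> s"
proof -
  have "\<exists>q\<in>\<rat>. s < q \<and> q < s + (t - s) / real (Suc n)" for n
    by (rule Rats_dense_in_real) (use assms in simp)
  then obtain u where u: "\<And>n::nat. u n \<in> \<rat> \<and> s < u n \<and> u n < s + (t - s) / real (Suc n)" by metis
  have "(\<lambda>n. (t - s) * (1 / real (Suc n))) \<longlonglongrightarrow> (t - s) * 0"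
    by (intro tendsto_intros LIMSEQ_Suc lim_1_over_n)
  then have "(\<lambda>n. s + (t - s) / real (Suc n)) \<longlonglongrightarrow> s + 0" by (intro tendsto_intros) simp
  then have "u \<longlonglongrightarrow> s"
    using tendsto_sandwich[of "\<lambda>_. s" u sequentially "\<lambda>n. s + (t - s) / real (Suc n)" s] u
    by (auto intro: always_eventually less_imp_le)
  moreover have "u n < t" for n
  proof -
    have "(t - s) / real (Suc n) \<le> (t - s) / 1" using assms by (intro divide_left_mono) auto
    then show ?thesis using u[of n] by simp
  qed
  ultimately show ?thesis using u by blast
qed

lemma rat_approx_left:
  fixes s t :: real
  assumes "s < t"
  shows "\<exists>u. (\<forall>n::nat. u n \<in> \<rat> \<and> s < u n \<and> u n < t) \<and> u \<longlonglongrightarrow> t"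
proof -
  have "- t < - s" using assms by simp
  from rat_approx[OF this] obtain u where u: "\<And>n::nat. u n \<in> \<rat> \<and> - t < u n \<and> u n < - s" "u \<longlonglongrightarrow> - t"
    by blast
  show ?thesis
  proof (intro exI[of _ "\<lambda>n. - u n"] conjI allI)
    show "(\<lambda>n. - u n) \<longlonglongrightarrow> t" using tendsto_minus[OF u(2)] by simp
    show "- u n \<in> \<rat>" "s < - u n" "- u n < t" for n using u(1)[of n] by auto
  qed
qed

text \<open>A countable supremum of quotients can be shown to be measurable, also jointly in the
  path and in the position of the interval.\<close>

lemma holder_seminorm_rat:
  fixes x :: "real \<Rightarrow> 'a::real_normed_vector"
  assumes x: "continuous_on {a..b} x"
  shows "holder_seminorm \<nu> {a..b} x
     = (SUP p\<in>rat_pairs. if a \<le> fst p \<and> snd p \<le> b then ennreal (norm (x (snd p) - x (fst p)) / (snd p - fst p) powr \<nu>) else 0)"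
    (is "_ = ?R")
proof (rule ennreal_eqI_real)
  fix K :: real assume K: "0 \<le> K"
  have "?R \<le> ennreal K \<longleftrightarrow> hol \<nu> K a b x"
  proof
    assume R: "?R \<le> ennreal K"
    have rat: "norm (x v - x u) \<le> K * (v - u) powr \<nu>" if "u \<in> \<rat>" "v \<in> \<rat>" "u < v" "a \<le> u" "v \<le> b" for u v
    proof -
      have "(u, v) \<in> rat_pairs" using that by (simp add: rat_pairs_def)
      then have "ennreal (norm (x v - x u) / (v - u) powr \<nu>) \<le> ennreal K"
        using R that unfolding SUP_le_iff by fastforce
      then show ?thesis using that K by (simp add: pos_divide_le_eq)
    qed
    show "hol \<nu> K a b x"
      unfolding hol_def
    proof (intro allI impI)
      fix s t assume st: "a \<le> s" "s \<le> t" "t \<le> b"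
      show "norm (x t - x s) \<le> K * (t - s) powr \<nu>"
      proof (cases "s = t")
        case False
        then have lt: "s < t" using st by simp
        \<comment> \<open>Both end points are approximated from inside, on either side of the
          midpoint; this keeps the rational points in [a, b] and in order.\<close>
        define m where "m = (s + t) / 2"
        have m: "s < m" "m < t" using lt by (auto simp: m_def)
        obtain u where u: "\<And>n::nat. u n \<in> \<rat> \<and> s < u n \<and> u n < m" "u \<longlonglongrightarrow> s" using rat_approx[OF m(1)] by blast
        obtain v where v: "\<And>n::nat. v n \<in> \<rat> \<and> m < v n \<and> v n < t" "v \<longlonglongrightarrow> t" using rat_approx_left[OF m(2)] by blast
        have inside: "a \<le> u n" "u n \<le> b" for n using u(1)[of n] m st by auto
        have "(\<lambda>n. x (u n)) \<longlonglongrightarrow> x s"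
          by (rule continuous_on_tendsto_compose[OF x u(2)])
             (use st m u(1) in \<open>auto intro!: always_eventually inside\<close>)
        moreover have "(\<lambda>n. x (v n)) \<longlonglongrightarrow> x t"
        proof (rule continuous_on_tendsto_compose[OF x v(2)])
          show "\<forall>\<^sub>F n in sequentially. v n \<in> {a..b}"
            using v(1) m st by (intro always_eventually allI) (metis atLeastAtMost_iff less_imp_le order_trans)
        qed (use st in auto)
        ultimately have 1: "(\<lambda>n. norm (x (v n) - x (u n))) \<longlonglongrightarrow> norm (x t - x s)" by (intro tendsto_intros)
        have "(\<lambda>n. (v n - u n) powr \<nu>) \<longlonglongrightarrow> (t - s) powr \<nu>"
          using lt by (intro tendsto_powr tendsto_diff u(2) v(2) tendsto_const) auto
        then have 2: "(\<lambda>n. K * (v n - u n) powr \<nu>) \<longlonglongrightarrow> K * (t - s) powr \<nu>" by (intro tendsto_mult tendsto_const)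
        have "norm (x (v n) - x (u n)) \<le> K * (v n - u n) powr \<nu>" for n
          using u(1)[of n] v(1)[of n] st by (intro rat) auto
        then show ?thesis by (intro LIMSEQ_le[OF 1 2]) auto
      qed simp
    qed
  next
    assume h: "hol \<nu> K a b x"
    show "?R \<le> ennreal K"
    proof (rule SUP_least)
      fix p assume "p \<in> rat_pairs"
      then obtain u v where p: "p = (u, v)" "u < v" by (auto simp: rat_pairs_def)
      show "(if a \<le> fst p \<and> snd p \<le> b then ennreal (norm (x (snd p) - x (fst p)) / (snd p - fst p) powr \<nu>) else 0) \<le> ennreal K"
        using holD[OF h, of u v] p K by (auto simp: pos_divide_le_eq)
    qed
  qed
  then show "holder_seminorm \<nu> {a..b} x \<le> ennreal K \<longleftrightarrow> ?R \<le> ennreal K"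
    using holder_seminorm_le_iff[OF K] by simp
qed

lemma sup_norm_rat:
  fixes x :: "real \<Rightarrow> 'a::real_normed_vector"
  assumes x: "continuous_on {a..b} x" and ab: "a < b"
  shows "sup_norm {a..b} x = (SUP q\<in>\<rat>. if a \<le> q \<and> q \<le> b then ennreal (norm (x q)) else 0)" (is "_ = ?R")
proof (rule ennreal_eqI_real)
  fix K :: real assume K: "0 \<le> K"
  have "?R \<le> ennreal K \<longleftrightarrow> (\<forall>t. a \<le> t \<longrightarrow> t \<le> b \<longrightarrow> norm (x t) \<le> K)"
  proof
    assume R: "?R \<le> ennreal K"
    have rat: "norm (x q) \<le> K" if "q \<in> \<rat>" "a \<le> q" "q \<le> b" for q
    proof -
      have "ennreal (norm (x q)) \<le> ennreal K" using R that unfolding SUP_le_iff by fastforce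
      then show ?thesis using K by simp
    qed
    show "\<forall>t. a \<le> t \<longrightarrow> t \<le> b \<longrightarrow> norm (x t) \<le> K"
    proof (intro allI impI)
      fix t assume t: "a \<le> t" "t \<le> b"
      have "\<exists>u. (\<forall>n::nat. u n \<in> \<rat> \<and> a \<le> u n \<and> u n \<le> b) \<and> u \<longlonglongrightarrow> t"
      proof (cases "t < b")
        case True
        then show ?thesis using rat_approx[OF True] t by (meson less_imp_le order_trans)
      next
        case False
        then have "a < t" using t ab by simp
        then show ?thesis using rat_approx_left[of a t] t by (meson less_imp_le order_trans)
      qed
      then obtain u where u: "\<And>n::nat. u n \<in> \<rat> \<and> a \<le> u n \<and> u n \<le> b" "u \<longlonglongrightarrow> t" by blast
      have "(\<lambda>n. x (u n)) \<longlonglongrightarrow> x t"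
        by (rule continuous_on_tendsto_compose[OF x u(2)]) (use t u(1) in auto)
      then have "(\<lambda>n. norm (x (u n))) \<longlonglongrightarrow> norm (x t)" by (rule tendsto_norm)
      then show "norm (x t) \<le> K" by (rule LIMSEQ_le_const2) (use u(1) rat in auto)
    qed
  next
    assume "\<forall>t. a \<le> t \<longrightarrow> t \<le> b \<longrightarrow> norm (x t) \<le> K"
    then show "?R \<le> ennreal K" by (intro SUP_least) (use K in auto)
  qed
  then show "sup_norm {a..b} x \<le> ennreal K \<longleftrightarrow> ?R \<le> ennreal K"
    using sup_norm_le_iff[OF K] by simp
qed

lemma quotient_measurable:
  fixes e :: "real \<Rightarrow> 'q \<Rightarrow> real^'m" and e0 :: "'q \<Rightarrow> real"
  assumes [measurable]: "\<And>t. e t \<in> borel_measurable N" "e0 \<in> borel_measurable N"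
  shows "(\<lambda>q. if e0 q - T \<le> u \<and> v \<le> e0 q + T then ennreal (norm (e v q - e u q) / (v - u) powr \<nu>) else 0)
    \<in> borel_measurable N"
  by measurable

section \<open>Integrability of the noise seminorm\<close>

text \<open>Comparison with \<open>m\<close> times the largest term works for every p > 0, whether
  or not the power is convex.\<close>

lemma sum_powr_le:
  fixes a :: "nat \<Rightarrow> real"
  assumes "\<And>i. i < m \<Longrightarrow> 0 \<le> a i" "0 < p"
  shows "(\<Sum>i<m. a i) powr p \<le> real m powr p * (\<Sum>i<m. a i powr p)"
proof (cases "m = 0")
  case False
  define M where "M = Max (a ` {..<m})"
  have fin: "finite (a ` {..<m})" "a ` {..<m} \<noteq> {}" using False by auto
  have "M \<in> a ` {..<m}" unfolding M_def by (rule Max_in[OF fin])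
  then obtain j where j: "j < m" "M = a j" by auto
  have le: "a i \<le> M" if "i < m" for i unfolding M_def using that by (intro Max_ge fin(1)) auto
  have "(\<Sum>i<m. a i) \<le> (\<Sum>i<m. M)" by (intro sum_mono le) auto
  then have "(\<Sum>i<m. a i) powr p \<le> (real m * M) powr p"
    using assms by (intro powr_mono2) (auto intro!: sum_nonneg)
  also have "\<dots> = real m powr p * a j powr p" using assms j by (simp add: powr_mult)
  also have "\<dots> \<le> real m powr p * (\<Sum>i<m. a i powr p)"
    using j by (intro mult_left_mono member_le_sum) auto
  finally show ?thesis .
qed simp

context noise_space
begin

text \<open>The interval [-T, T] contains every window of length T that contains time 0, wherever
  the window begins; \<open>window_noise\<close> depends on this.\<close>

definition W :: "real \<Rightarrow> (real \<Rightarrow> real^'m) \<Rightarrow> real" where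
  "W T x = enn2real (holder_seminorm \<nu> {-T..T} x)"

lemma seminorm_shift:
  "holder_seminorm \<nu> {a..b} (wiener_shift s x) = holder_seminorm \<nu> {s + a..s + b} x" for x :: "real \<Rightarrow> real^'m"
proof (rule ennreal_eqI_real)
  fix K :: real assume K: "0 \<le> K"
  have "hol \<nu> K a b (wiener_shift s x) \<longleftrightarrow> hol \<nu> K a b (\<lambda>t. x (s + t))"
    by (simp add: hol_def wiener_shift_def)
  then show "holder_seminorm \<nu> {a..b} (wiener_shift s x) \<le> ennreal K \<longleftrightarrow> holder_seminorm \<nu> {s + a..s + b} x \<le> ennreal K"
    by (simp add: holder_seminorm_le_iff[OF K] hol_shift)
qed

lemma seminorm_finite: "x \<in> space P \<Longrightarrow> holder_seminorm \<nu> {a..b} x < \<top>"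
  using space_hol[of x a b] holder_seminorm_le_iff[of _ \<nu> a b x] ennreal_less_top order_le_less_trans by blast

lemma W_nonneg: "0 \<le> W T x" by (simp add: W_def)

lemma hol_W:
  assumes "x \<in> space P"
  shows "hol \<nu> (W T (wiener_shift s x)) (s - T) (s + T) x"
proof -
  have "holder_seminorm \<nu> {s - T..s + T} x = ennreal (W T (wiener_shift s x))"
    using seminorm_finite[OF assms, of "s - T" "s + T"] by (simp add: W_def seminorm_shift)
  then have "holder_seminorm \<nu> {s - T..s + T} x \<le> ennreal (W T (wiener_shift s x))" by simp
  then show ?thesis by (subst (asm) holder_seminorm_le_iff[OF W_nonneg])
qed

lemma W_le:
  assumes "hol \<nu> K (s - T) (s + T) x" "0 \<le> K"
  shows "W T (wiener_shift s x) \<le> K"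
  unfolding W_def using assms by (intro enn2real_leI) (simp_all add: seminorm_shift holder_seminorm_le_iff)

text \<open>Instead of shifting the path, the interval is moved across fixed rational points. Each
  quotient then depends on the path through two evaluations, and on s only through the question
  whether it is counted.\<close>

lemma W_joint: "(\<lambda>(s, x). W T (wiener_shift s x)) \<in> borel_measurable (lborel \<Otimes>\<^sub>M P)"
proof -
  define h where "h p q = (if fst q - T \<le> fst p \<and> snd p \<le> fst q + T
      then ennreal (norm (snd q (snd p) - snd q (fst p)) / (snd p - fst p) powr \<nu>) else 0)"
    for p :: "real \<times> real" and q :: "real \<times> (real \<Rightarrow> real^'m)"
  have "h p \<in> borel_measurable (lborel \<Otimes>\<^sub>M P)" for p
  proof -
    define e where "e t q = snd q t" for t and q :: "real \<times> (real \<Rightarrow> real^'m)"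
    have "e t \<in> borel_measurable (lborel \<Otimes>\<^sub>M P)" for t
      unfolding e_def using measurable_compose[OF measurable_snd eval_measurable] .
    define e0 where "e0 q = fst q" for q :: "real \<times> (real \<Rightarrow> real^'m)"
    have "e0 \<in> borel_measurable (lborel \<Otimes>\<^sub>M P)"
      unfolding e0_def using measurable_fst[of lborel P] by simp
    have "h p = (\<lambda>q. if e0 q - T \<le> fst p \<and> snd p \<le> e0 q + T
      then ennreal (norm (e (snd p) q - e (fst p) q) / (snd p - fst p) powr \<nu>) else 0)"
      by (rule ext, unfold h_def e_def e0_def, rule refl)
    moreover have "(\<lambda>q. if e0 q - T \<le> fst p \<and> snd p \<le> e0 q + T
      then ennreal (norm (e (snd p) q - e (fst p) q) / (snd p - fst p) powr \<nu>) else 0) \<in> borel_measurable (lborel \<Otimes>\<^sub>M P)"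
      by (rule quotient_measurable) fact+
    ultimately show ?thesis by (simp only:)
  qed
  then have "(\<lambda>q. SUP p\<in>rat_pairs. h p q) \<in> borel_measurable (lborel \<Otimes>\<^sub>M P)"
    by (intro borel_measurable_SUP[OF countable_rat_pairs])
  then have "(\<lambda>q. enn2real (SUP p\<in>rat_pairs. h p q)) \<in> borel_measurable (lborel \<Otimes>\<^sub>M P)"
    by (rule borel_measurable_enn2real)
  moreover have "(\<lambda>(s, x). W T (wiener_shift s x)) q = enn2real (SUP p\<in>rat_pairs. h p q)"
    if "q \<in> space (lborel \<Otimes>\<^sub>M P)" for q
  proof -
    obtain s x where q: "q = (s, x)" by (cases q)
    have x: "x \<in> space P" using that q by (simp add: space_pair_measure)
    obtain w where "hol \<nu> w (s - T) (s + T) x" using space_hol[OF x] by blast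
    then have "continuous_on {s - T..s + T} x" using hol_imp_continuous_on \<nu>_pos by blast
    from holder_seminorm_rat[OF this, of \<nu>] show ?thesis by (simp add: q W_def seminorm_shift h_def)
  qed
  ultimately show ?thesis by (simp cong: measurable_cong)
qed

lemma W_meas [measurable]: "W T \<in> borel_measurable P"
proof -
  have "(\<lambda>x. W T (wiener_shift 0 x)) \<in> borel_measurable P"
    using measurable_compose[OF measurable_Pair1'[of 0 lborel P] W_joint] by simp
  moreover have "W T (wiener_shift 0 x) = W T x" if "x \<in> space P" for x
    using \<theta>_0[OF that] by simp
  ultimately show ?thesis by (simp cong: measurable_cong)
qed

text \<open>The interval [-T, T] is covered by finitely many intervals of length r, the seminorm is
  subadditive under gluing, and the shifted seminorms all have the same law.\<close>

lemma W_powr_integrable: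
  assumes r: "0 < r" and p: "0 < p" and fin: "integrable P (\<lambda>x. W r x powr p)"
  shows "integrable P (\<lambda>x. W T x powr p)"
proof -
  obtain N :: nat where N: "T \<le> real N * r" using real_arch_simple[of "T / r"] r by (auto simp: field_simps)
  \<comment> \<open>A grid of mesh r starting at - N r; the interval of radius r around
    \<open>c i\<close> contains the cell from \<open>c i\<close> to
    \<open>c (Suc i)\<close>.\<close>
  define c where "c i = real i * r - real N * r" for i :: nat
  let ?V = "\<lambda>i x. W r (wiener_shift (c i) x)"
  have bound: "W T x \<le> (\<Sum>i<2 * N. ?V i x)" if x: "x \<in> space P" for x
  proof -
    have "hol \<nu> (\<Sum>i<k. ?V i x) (- real N * r) (c k) x" for k
    proof (induct k)
      case 0
      show ?case
        unfolding hol_def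
      proof (intro allI impI)
        fix s t assume "- real N * r \<le> s" "s \<le> t" "t \<le> c 0"
        then have "s = t" by (simp add: c_def)
        then show "norm (x t - x s) \<le> (\<Sum>i<0. ?V i x) * (t - s) powr \<nu>" by simp
      qed
    next
      case (Suc k)
      have "hol \<nu> (?V k x) (c k) (c (Suc k)) x"
        by (rule hol_subset[OF hol_W[OF x]]) (use r in \<open>auto simp: c_def algebra_simps\<close>)
      then have "hol \<nu> ((\<Sum>i<k. ?V i x) + ?V k x) (- real N * r) (c (Suc k)) x"
        by (rule hol_glue[OF Suc _ sum_nonneg W_nonneg \<nu>_pos]) (simp add: W_nonneg)
      then show ?case by simp
    qed
    from this[of "2 * N"] have "hol \<nu> (\<Sum>i<2 * N. ?V i x) (0 - T) (0 + T) x"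
      by (rule hol_subset) (use N in \<open>auto simp: c_def mult.commute\<close>)
    then have "W T (wiener_shift 0 x) \<le> (\<Sum>i<2 * N. ?V i x)" by (rule W_le) (simp add: sum_nonneg W_nonneg)
    then show ?thesis using \<theta>_0[OF x] by simp
  qed
  show ?thesis
  proof (rule Bochner_Integration.integrable_bound)
    show "integrable P (\<lambda>x. real (2 * N) powr p * (\<Sum>i<2 * N. ?V i x powr p))"
    proof (intro integrable_mult_right Bochner_Integration.integrable_sum)
      fix i
      have "integrable (distr P P (wiener_shift (c i))) (\<lambda>x. W r x powr p)" using fin by (simp add: \<theta>_distr)
      then show "integrable P (\<lambda>x. ?V i x powr p)" by (rule integrable_distr[OF \<theta>_meas])
    qed
    show "AE x in P. norm (W T x powr p) \<le> norm (real (2 * N) powr p * (\<Sum>i<2 * N. ?V i x powr p))"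
    proof (intro AE_I2)
      fix x assume x: "x \<in> space P"
      have "W T x powr p \<le> (\<Sum>i<2 * N. ?V i x) powr p"
        using p by (intro powr_mono2 bound x W_nonneg) auto
      also have "\<dots> \<le> real (2 * N) powr p * (\<Sum>i<2 * N. ?V i x powr p)"
        by (rule sum_powr_le[OF W_nonneg p])
      finally show "norm (W T x powr p) \<le> norm (real (2 * N) powr p * (\<Sum>i<2 * N. ?V i x powr p))" by simp
    qed
  qed measurable
qed

text \<open>The logarithmic loss of a window with scaled noise \<open>v\<close>: nothing on quiet
  windows, at most polynomial on noisy ones.\<close>

definition hfun :: "real \<Rightarrow> real \<Rightarrow> real \<Rightarrow> real \<Rightarrow> real" where
  "hfun c\<^sub>0 K p v = (if v \<le> c\<^sub>0 then 0 else K * (1 + v powr p))"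

lemma hfun_nonneg: "0 \<le> K \<Longrightarrow> 0 \<le> hfun c\<^sub>0 K p v"
  by (simp add: hfun_def)

lemma hfun_mono: "0 \<le> K \<Longrightarrow> 0 < p \<Longrightarrow> 0 \<le> v \<Longrightarrow> v \<le> v' \<Longrightarrow> hfun c\<^sub>0 K p v \<le> hfun c\<^sub>0 K p v'"
  by (auto simp: hfun_def intro!: mult_left_mono powr_mono2)

lemma hfun_meas [measurable]: "hfun c\<^sub>0 K p \<in> borel_measurable borel"
  unfolding hfun_def by measurable

lemma hfun_admissible:
  assumes K: "0 \<le> K" and p: "0 < p" and \<epsilon>: "0 \<le> \<epsilon>" "\<epsilon> \<le> 1" and T: "0 < T"
    and int: "integrable P (\<lambda>x. W T x powr p)"
  shows "admissible (\<lambda>x. hfun c\<^sub>0 K p (\<epsilon> * W T x) / T)"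
  unfolding admissible_def
proof (intro conjI ballI allI)
  show "0 \<le> hfun c\<^sub>0 K p (\<epsilon> * W T x) / T" for x using hfun_nonneg[OF K] T by simp
  have "(\<lambda>x. hfun c\<^sub>0 K p (\<epsilon> * W T x)) \<in> borel_measurable P" by measurable
  then have m: "(\<lambda>x. hfun c\<^sub>0 K p (\<epsilon> * W T x) / T) \<in> borel_measurable P" by simp
  show "integrable P (\<lambda>x. hfun c\<^sub>0 K p (\<epsilon> * W T x) / T)"
  proof (rule Bochner_Integration.integrable_bound[OF _ m])
    show "integrable P (\<lambda>x. K * (1 + W T x powr p) / T)" using int by simp
    show "AE x in P. norm (hfun c\<^sub>0 K p (\<epsilon> * W T x) / T) \<le> norm (K * (1 + W T x powr p) / T)"
    proof (intro AE_I2)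
      fix x
      have "\<epsilon> * W T x \<le> 1 * W T x" using \<epsilon> W_nonneg by (intro mult_right_mono) auto
      then have "(\<epsilon> * W T x) powr p \<le> W T x powr p" using \<epsilon> p W_nonneg by (intro powr_mono2) auto
      then have "hfun c\<^sub>0 K p (\<epsilon> * W T x) \<le> K * (1 + W T x powr p)"
        unfolding hfun_def using K by (auto intro!: mult_left_mono)
      then show "norm (hfun c\<^sub>0 K p (\<epsilon> * W T x) / T) \<le> norm (K * (1 + W T x powr p) / T)"
        using hfun_nonneg[OF K] T K by (simp add: divide_right_mono)
    qed
  qed
  show "(\<lambda>(s, x). hfun c\<^sub>0 K p (\<epsilon> * W T (wiener_shift s x)) / T) \<in> borel_measurable (lborel \<Otimes>\<^sub>M P)"
  proof -
    have "(\<lambda>q. W T (wiener_shift (fst q) (snd q))) \<in> borel_measurable (lborel \<Otimes>\<^sub>M P)"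
      using W_joint[of T] by (simp add: case_prod_unfold)
    then have "(\<lambda>q. \<epsilon> * W T (wiener_shift (fst q) (snd q))) \<in> borel_measurable (lborel \<Otimes>\<^sub>M P)" by simp
    from measurable_compose[OF this hfun_meas[of c\<^sub>0 K p]]
    show ?thesis by (simp add: case_prod_unfold)
  qed
  show "\<exists>B. \<forall>s. a \<le> s \<longrightarrow> s \<le> b \<longrightarrow> hfun c\<^sub>0 K p (\<epsilon> * W T (wiener_shift s x)) / T \<le> B"
    if x: "x \<in> space P" for x a b
  proof -
    obtain w where w: "0 \<le> w" "hol \<nu> w (a - T) (b + T) x" using space_hol[OF x] by blast
    have "hfun c\<^sub>0 K p (\<epsilon> * W T (wiener_shift s x)) / T \<le> hfun c\<^sub>0 K p (\<epsilon> * w) / T" if "a \<le> s" "s \<le> b" for s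
    proof -
      have "hol \<nu> w (s - T) (s + T) x" by (rule hol_subset[OF w(2)]) (use that in auto)
      then have "W T (wiener_shift s x) \<le> w" by (rule W_le[OF _ w(1)])
      then show ?thesis
        using T \<epsilon> W_nonneg by (intro divide_right_mono hfun_mono[OF K p]) (auto intro: mult_left_mono)
    qed
    then show ?thesis by blast
  qed
qed

text \<open>For each path the scaled noise falls below the threshold once the scale is small, so the
  loss vanishes pointwise and dominated convergence applies. The threshold is essential here, since
  \<open>K * (1 + v powr p)\<close> never falls below \<open>K\<close>. Monotonicity extends the
  bound from one scale to all smaller ones.\<close>

lemma hfun_small:
  assumes K: "0 \<le> K" and p: "0 < p" and c0: "0 < c\<^sub>0" and \<eta>: "0 < \<eta>"
    and int: "integrable P (\<lambda>x. W T x powr p)"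
  shows "\<exists>\<epsilon>>0. \<epsilon> \<le> 1 \<and> (\<forall>c. 0 \<le> c \<longrightarrow> c \<le> \<epsilon> \<longrightarrow> (\<integral>x. hfun c\<^sub>0 K p (c * W T x) \<partial>P) < \<eta>)"
proof -
  have int2: "integrable P (\<lambda>x. K * (1 + W T x powr p))" using int by simp
  have bd: "0 \<le> hfun c\<^sub>0 K p (c * W T x) \<and> hfun c\<^sub>0 K p (c * W T x) \<le> K * (1 + W T x powr p)"
    if "0 \<le> c" "c \<le> 1" for c x
  proof -
    have "c * W T x \<le> 1 * W T x" using that W_nonneg by (intro mult_right_mono) auto
    then have "(c * W T x) powr p \<le> W T x powr p" using that p W_nonneg by (intro powr_mono2) auto
    then show ?thesis unfolding hfun_def using K by (auto intro!: mult_left_mono)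
  qed
  have meas: "(\<lambda>x. hfun c\<^sub>0 K p (c * W T x)) \<in> borel_measurable P" for c by measurable
  have inth: "integrable P (\<lambda>x. hfun c\<^sub>0 K p (c * W T x))" if "0 \<le> c" "c \<le> 1" for c
    by (rule Bochner_Integration.integrable_bound[OF int2 meas])
       (use bd[OF that] in \<open>auto intro!: AE_I2 intro: order_trans[OF _ abs_ge_self]\<close>)
  have "(\<lambda>n. \<integral>x. hfun c\<^sub>0 K p (1 / real (Suc n) * W T x) \<partial>P) \<longlonglongrightarrow> (\<integral>x. 0 \<partial>P)"
  proof (rule integral_dominated_convergence[where w = "\<lambda>x. K * (1 + W T x powr p)"])
    show "AE x in P. (\<lambda>n. hfun c\<^sub>0 K p (1 / real (Suc n) * W T x)) \<longlonglongrightarrow> 0"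
    proof (intro AE_I2)
      fix x
      obtain N :: nat where N: "W T x / c\<^sub>0 \<le> real N" using real_arch_simple by blast
      have "hfun c\<^sub>0 K p (1 / real (Suc n) * W T x) = 0" if "N \<le> n" for n
      proof -
        have "W T x / c\<^sub>0 \<le> real (Suc n)" using N that by simp
        then have "1 / real (Suc n) * W T x \<le> c\<^sub>0" using c0 by (simp add: field_simps)
        then show ?thesis by (simp add: hfun_def)
      qed
      then have "\<forall>\<^sub>F n in sequentially. hfun c\<^sub>0 K p (1 / real (Suc n) * W T x) = 0"
        unfolding eventually_sequentially by blast
      then show "(\<lambda>n. hfun c\<^sub>0 K p (1 / real (Suc n) * W T x)) \<longlonglongrightarrow> 0" by (rule tendsto_eventually)
    qed
    show "AE x in P. norm (hfun c\<^sub>0 K p (1 / real (Suc n) * W T x)) \<le> K * (1 + W T x powr p)" for n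
    proof (intro AE_I2)
      fix x show "norm (hfun c\<^sub>0 K p (1 / real (Suc n) * W T x)) \<le> K * (1 + W T x powr p)"
        using bd[of "1 / real (Suc n)" x] by simp
    qed
  qed (use int2 meas in auto)
  then have "\<forall>\<^sub>F n in sequentially. (\<integral>x. hfun c\<^sub>0 K p (1 / real (Suc n) * W T x) \<partial>P) < \<eta>"
    using \<eta> by (intro order_tendstoD(2)) auto
  then obtain n where n: "(\<integral>x. hfun c\<^sub>0 K p (1 / real (Suc n) * W T x) \<partial>P) < \<eta>"
    unfolding eventually_sequentially by blast
  let ?\<epsilon> = "1 / real (Suc n)"
  have e: "0 < ?\<epsilon>" "?\<epsilon> \<le> 1" by auto
  have "(\<integral>x. hfun c\<^sub>0 K p (c * W T x) \<partial>P) < \<eta>" if c: "0 \<le> c" "c \<le> ?\<epsilon>" for c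
  proof -
    have c1: "c \<le> 1" using c(2) e(2) by (rule order_trans)
    have "(\<integral>x. hfun c\<^sub>0 K p (c * W T x) \<partial>P) \<le> (\<integral>x. hfun c\<^sub>0 K p (?\<epsilon> * W T x) \<partial>P)"
    proof (rule integral_mono[OF inth[OF c(1) c1] inth[OF less_imp_le[OF e(1)] e(2)]])
      fix x show "hfun c\<^sub>0 K p (c * W T x) \<le> hfun c\<^sub>0 K p (?\<epsilon> * W T x)"
        using c W_nonneg by (intro hfun_mono[OF K p] mult_right_mono mult_nonneg_nonneg) auto
    qed
    then show ?thesis using n by simp
  qed
  then show ?thesis using e by blast
qed

end

section \<open>Attractors of nonuniformly contracting cocycles\<close>

lemma (in Metric_space) geometric_limit:
  assumes complete: mcomplete and \<sigma>: "\<And>n::nat. \<sigma> n \<in> M"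
    and step: "\<And>n. d (\<sigma> n) (\<sigma> (Suc n)) \<le> B * q ^ n" and q: "0 \<le> q" "q < 1" and B: "0 \<le> B"
  shows "\<exists>l\<in>M. limitin mtopology \<sigma> l sequentially \<and> d (\<sigma> 0) l \<le> B / (1 - q)"
proof -
  have dist: "d (\<sigma> n) (\<sigma> (n + k)) \<le> B * q ^ n / (1 - q)" for n k
  proof -
    have "d (\<sigma> n) (\<sigma> (n + k)) \<le> B * q ^ n * (1 - q ^ k) / (1 - q)"
    proof (induct k)
      case 0
      then show ?case using \<sigma> by simp
    next
      case (Suc k)
      have "d (\<sigma> n) (\<sigma> (n + Suc k)) \<le> d (\<sigma> n) (\<sigma> (n + k)) + d (\<sigma> (n + k)) (\<sigma> (Suc (n + k)))"
        using triangle[OF \<sigma> \<sigma> \<sigma>] by simp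
      also have "\<dots> \<le> B * q ^ n * (1 - q ^ k) / (1 - q) + B * q ^ (n + k)"
        by (intro add_mono Suc step)
      also have "\<dots> = B * q ^ n * (1 - q ^ Suc k) / (1 - q)"
        using q by (simp add: field_simps power_add)
      finally show ?case .
    qed
    also have "\<dots> \<le> B * q ^ n * 1 / (1 - q)"
      using q B by (intro divide_right_mono mult_left_mono) auto
    finally show ?thesis by simp
  qed
  have "MCauchy \<sigma>"
    unfolding MCauchy_def
  proof (intro conjI allI impI)
    show "range \<sigma> \<subseteq> M" using \<sigma> by auto
    fix e :: real assume e: "0 < e"
    have "(\<lambda>n. B * q ^ n / (1 - q)) \<longlonglongrightarrow> B * 0 / (1 - q)"
      using q by (intro tendsto_intros LIMSEQ_power_zero) auto
    then have "\<forall>\<^sub>F n in sequentially. B * q ^ n / (1 - q) < e" using e by (intro order_tendstoD(2)) auto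
    then obtain N where N: "\<And>n. N \<le> n \<Longrightarrow> B * q ^ n / (1 - q) < e" by (auto simp: eventually_sequentially)
    have *: "d (\<sigma> n) (\<sigma> m) < e" if "N \<le> n" "n \<le> m" for n m
      using order_le_less_trans[OF dist[of n "m - n"] N[OF that(1)]] that by simp
    show "\<exists>N. \<forall>n n'. N \<le> n \<longrightarrow> N \<le> n' \<longrightarrow> d (\<sigma> n) (\<sigma> n') < e"
    proof (intro exI[of _ N] allI impI)
      fix n n' assume "N \<le> n" "N \<le> n'"
      then show "d (\<sigma> n) (\<sigma> n') < e"
        using *[of n n'] *[of n' n] commute[of "\<sigma> n" "\<sigma> n'"] by (cases "n \<le> n'") auto
    qed
  qed
  then obtain l where l: "limitin mtopology \<sigma> l sequentially" using complete unfolding mcomplete_def by blast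
  then have lM: "l \<in> M" by (rule limitin_mspace)
  have "d (\<sigma> 0) l \<le> B / (1 - q)"
  proof (rule field_le_epsilon)
    fix e :: real assume "0 < e"
    then obtain n where n: "d (\<sigma> n) l < e"
      using l unfolding limitin_metric eventually_sequentially by blast
    have "d (\<sigma> 0) l \<le> d (\<sigma> 0) (\<sigma> n) + d (\<sigma> n) l" using triangle[OF \<sigma> \<sigma> lM] .
    then show "d (\<sigma> 0) l \<le> B / (1 - q) + e" using dist[of 0 n] n by simp
  qed
  then show ?thesis using l lM by blast
qed

lemma (in Metric_space) limitin_dist:
  assumes "limitin mtopology \<sigma> l sequentially"
  shows "(\<lambda>n. d (\<sigma> n) l) \<longlonglongrightarrow> 0"
proof (rule tendstoI)
  fix e :: real assume "0 < e"
  then have "\<forall>\<^sub>F n in sequentially. \<sigma> n \<in> M \<and> d (\<sigma> n) l < e" using assms by (simp add: limitin_metric)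
  then show "\<forall>\<^sub>F n in sequentially. dist (d (\<sigma> n) l) 0 < e" by eventually_elim simp
qed

text \<open>A setting without probability: on \<Gamma> the constants may vary with the point, and
  for every e > 0 the contraction may be weakened by a factor exponential in e times the distances
  of both times from 0. Growth is controlled for the single state \<open>z0\<close> over unit
  times.\<close>

locale contracting_cocycle = Metric_space S d for S :: "'s set" and d +
  fixes \<Gamma> :: "'w set" and \<theta> :: "real \<Rightarrow> 'w \<Rightarrow> 'w" and \<phi> :: "real \<Rightarrow> 'w \<Rightarrow> 's \<Rightarrow> 's" and z0 :: 's and \<kappa> :: real
  assumes complete: mcomplete and z0: "z0 \<in> S" and \<kappa>: "0 < \<kappa>"
    and \<theta>_\<Gamma>: "\<And>x t. x \<in> \<Gamma> \<Longrightarrow> \<theta> t x \<in> \<Gamma>"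
    and \<theta>_add_\<Gamma>: "\<And>x s t. x \<in> \<Gamma> \<Longrightarrow> \<theta> s (\<theta> t x) = \<theta> (s + t) x"
    and \<theta>_0_\<Gamma>: "\<And>x. x \<in> \<Gamma> \<Longrightarrow> \<theta> 0 x = x"
    and \<phi>_in: "\<And>x \<eta> t. x \<in> \<Gamma> \<Longrightarrow> \<eta> \<in> S \<Longrightarrow> 0 \<le> t \<Longrightarrow> \<phi> t x \<eta> \<in> S"
    and \<phi>_id: "\<And>x \<eta>. x \<in> \<Gamma> \<Longrightarrow> \<eta> \<in> S \<Longrightarrow> \<phi> 0 x \<eta> = \<eta>"
    and \<phi>_add: "\<And>x \<eta> s t. x \<in> \<Gamma> \<Longrightarrow> \<eta> \<in> S \<Longrightarrow> 0 \<le> s \<Longrightarrow> 0 \<le> t \<Longrightarrow> \<phi> (s + t) x \<eta> = \<phi> t (\<theta> s x) (\<phi> s x \<eta>)"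
    and contraction: "\<And>x e. x \<in> \<Gamma> \<Longrightarrow> 0 < e \<Longrightarrow> \<exists>C\<ge>0. \<forall>s t \<eta> \<eta>'. s \<le> t \<longrightarrow> \<eta> \<in> S \<longrightarrow> \<eta>' \<in> S \<longrightarrow>
       d (\<phi> (t - s) (\<theta> s x) \<eta>) (\<phi> (t - s) (\<theta> s x) \<eta>') \<le> C * exp (- \<kappa> * (t - s) + e * (\<bar>s\<bar> + \<bar>t\<bar>)) * d \<eta> \<eta>'"
    and growth: "\<And>x e. x \<in> \<Gamma> \<Longrightarrow> 0 < e \<Longrightarrow> \<exists>C\<ge>0. \<forall>s t. s \<le> t \<longrightarrow> t \<le> s + 1 \<longrightarrow>
       d (\<phi> (t - s) (\<theta> s x) z0) z0 \<le> C * exp (e * \<bar>s\<bar>)"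
begin

section \<open>Pullback limits of the reference state\<close>

definition pull :: "'w \<Rightarrow> nat \<Rightarrow> 's" where
  "pull x n = \<phi> (real n) (\<theta> (- real n) x) z0"

lemma pull_in: "x \<in> \<Gamma> \<Longrightarrow> pull x n \<in> S"
  unfolding pull_def by (intro \<phi>_in \<theta>_\<Gamma> z0) auto

text \<open>The flow started at time \<tau> - n - s arrives at time \<tau> - n in a state whose
  distance from \<open>z0\<close> the growth bound controls, and contraction acts over the remaining
  time n. The case s = 1 compares successive pullbacks; general s admits starting times off the
  integer grid of \<tau>, as invariance requires. For e \<le> \<kappa>/4 the errors consume at most
  half of the rate \<kappa>.\<close>

lemma restart_dist:
  assumes x: "x \<in> \<Gamma>" and e: "0 < e" "e \<le> \<kappa> / 4"
  shows "\<exists>B\<ge>0. \<forall>\<tau> n s. 0 \<le> s \<longrightarrow> s \<le> 1 \<longrightarrow>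
    d (pull (\<theta> \<tau> x) n) (\<phi> (s + real n) (\<theta> (\<tau> - real n - s) x) z0) \<le> B * exp (3 * e * \<bar>\<tau>\<bar>) * exp (- \<kappa> / 2) ^ n"
proof -
  obtain C1 where C1: "0 \<le> C1" "\<And>s t \<eta> \<eta>'. s \<le> t \<Longrightarrow> \<eta> \<in> S \<Longrightarrow> \<eta>' \<in> S \<Longrightarrow>
       d (\<phi> (t - s) (\<theta> s x) \<eta>) (\<phi> (t - s) (\<theta> s x) \<eta>') \<le> C1 * exp (- \<kappa> * (t - s) + e * (\<bar>s\<bar> + \<bar>t\<bar>)) * d \<eta> \<eta>'"
    using contraction[OF x e(1)] by blast
  obtain C2 where C2: "0 \<le> C2" "\<And>s t. s \<le> t \<Longrightarrow> t \<le> s + 1 \<Longrightarrow> d (\<phi> (t - s) (\<theta> s x) z0) z0 \<le> C2 * exp (e * \<bar>s\<bar>)"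
    using growth[OF x e(1)] by blast
  have "d (pull (\<theta> \<tau> x) n) (\<phi> (s + real n) (\<theta> (\<tau> - real n - s) x) z0) \<le> (C1 * C2 * exp e) * exp (3 * e * \<bar>\<tau>\<bar>) * exp (- \<kappa> / 2) ^ n"
    if s: "0 \<le> s" "s \<le> 1" for \<tau> n s
  proof -
    let ?w = "\<phi> s (\<theta> (\<tau> - real n - s) x) z0"
    have w: "?w \<in> S" using s by (intro \<phi>_in \<theta>_\<Gamma> x z0)
    have p: "pull (\<theta> \<tau> x) n = \<phi> (\<tau> - (\<tau> - real n)) (\<theta> (\<tau> - real n) x) z0"
      by (simp add: pull_def \<theta>_add_\<Gamma>[OF x])
    have "\<phi> (s + real n) (\<theta> (\<tau> - real n - s) x) z0 = \<phi> (real n) (\<theta> s (\<theta> (\<tau> - real n - s) x)) ?w"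
      using s by (intro \<phi>_add \<theta>_\<Gamma> x z0) auto
    also have "\<theta> s (\<theta> (\<tau> - real n - s) x) = \<theta> (\<tau> - real n) x" by (simp add: \<theta>_add_\<Gamma>[OF x])
    finally have pn: "\<phi> (s + real n) (\<theta> (\<tau> - real n - s) x) z0 = \<phi> (\<tau> - (\<tau> - real n)) (\<theta> (\<tau> - real n) x) ?w" by simp
    have d1: "d z0 ?w \<le> C2 * exp (e * \<bar>\<tau> - real n - s\<bar>)"
      using C2(2)[of "\<tau> - real n - s" "\<tau> - real n"] s commute by simp
    have "d (pull (\<theta> \<tau> x) n) (\<phi> (s + real n) (\<theta> (\<tau> - real n - s) x) z0)
       \<le> C1 * exp (- \<kappa> * (\<tau> - (\<tau> - real n)) + e * (\<bar>\<tau> - real n\<bar> + \<bar>\<tau>\<bar>)) * d z0 ?w"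
      unfolding p pn by (rule C1(2)) (use z0 w in auto)
    also have "\<dots> \<le> C1 * exp (- \<kappa> * (\<tau> - (\<tau> - real n)) + e * (\<bar>\<tau> - real n\<bar> + \<bar>\<tau>\<bar>)) * (C2 * exp (e * \<bar>\<tau> - real n - s\<bar>))"
      using C1 by (intro mult_left_mono d1) auto
    also have "\<dots> = C1 * C2 * exp (- \<kappa> * real n + e * (\<bar>\<tau> - real n\<bar> + \<bar>\<tau>\<bar> + \<bar>\<tau> - real n - s\<bar>))"
      by (simp add: distrib_left flip: exp_add)
    also have "\<dots> \<le> C1 * C2 * exp (e + 3 * e * \<bar>\<tau>\<bar> + real n * (- \<kappa> / 2))"
    proof (intro mult_left_mono)
      have "e * (\<bar>\<tau> - real n\<bar> + \<bar>\<tau>\<bar> + \<bar>\<tau> - real n - s\<bar>) \<le> e * (3 * \<bar>\<tau>\<bar> + 2 * real n + 1)"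
        using e s by (intro mult_left_mono) auto
      moreover have "e * (2 * real n) \<le> (\<kappa> / 4) * (2 * real n)" using e by (intro mult_right_mono) auto
      ultimately show "exp (- \<kappa> * real n + e * (\<bar>\<tau> - real n\<bar> + \<bar>\<tau>\<bar> + \<bar>\<tau> - real n - s\<bar>)) \<le> exp (e + 3 * e * \<bar>\<tau>\<bar> + real n * (- \<kappa> / 2))"
        by (simp add: algebra_simps)
    qed (use C1 C2 in auto)
    also have "\<dots> = (C1 * C2 * exp e) * exp (3 * e * \<bar>\<tau>\<bar>) * exp (- \<kappa> / 2) ^ n"
      by (simp only: exp_add exp_of_nat_mult mult.assoc)
    finally show ?thesis .
  qed
  moreover have "0 \<le> C1 * C2 * exp e" using C1 C2 by simp
  ultimately show ?thesis by blast
qed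

text \<open>One constant \<open>B\<close> serves the whole orbit, up to an exponential of small rate
  in \<tau>; this uniformity is what makes the attractor tempered.\<close>

lemma pull_limit:
  assumes x: "x \<in> \<Gamma>" and e: "0 < e" "e \<le> \<kappa> / 4"
  shows "\<exists>B\<ge>0. \<forall>\<tau>. \<exists>l\<in>S. limitin mtopology (pull (\<theta> \<tau> x)) l sequentially \<and> d z0 l \<le> B * exp (3 * e * \<bar>\<tau>\<bar>)"
proof -
  obtain B where B: "0 \<le> B" "\<And>\<tau> n s. 0 \<le> s \<Longrightarrow> s \<le> 1 \<Longrightarrow>
    d (pull (\<theta> \<tau> x) n) (\<phi> (s + real n) (\<theta> (\<tau> - real n - s) x) z0) \<le> B * exp (3 * e * \<bar>\<tau>\<bar>) * exp (- \<kappa> / 2) ^ n"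
    using restart_dist[OF assms] by blast
  let ?q = "exp (- \<kappa> / 2)"
  have q: "0 \<le> ?q" "?q < 1" using \<kappa> by auto
  have "\<exists>l\<in>S. limitin mtopology (pull (\<theta> \<tau> x)) l sequentially \<and> d z0 l \<le> B / (1 - ?q) * exp (3 * e * \<bar>\<tau>\<bar>)" for \<tau>
  proof -
    have "d (pull (\<theta> \<tau> x) n) (pull (\<theta> \<tau> x) (Suc n)) \<le> (B * exp (3 * e * \<bar>\<tau>\<bar>)) * ?q ^ n" for n
    proof -
      have "pull (\<theta> \<tau> x) (Suc n) = \<phi> (1 + real n) (\<theta> (\<tau> - real n - 1) x) z0"
        by (simp add: pull_def \<theta>_add_\<Gamma>[OF x] algebra_simps)
      then show ?thesis using B(2)[of 1 \<tau> n] by simp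
    qed
    from geometric_limit[OF complete pull_in[OF \<theta>_\<Gamma>[OF x]] this q]
    obtain l where l: "l \<in> S" "limitin mtopology (pull (\<theta> \<tau> x)) l sequentially"
      "d (pull (\<theta> \<tau> x) 0) l \<le> (B * exp (3 * e * \<bar>\<tau>\<bar>)) / (1 - ?q)"
      using B(1) by auto
    have "pull (\<theta> \<tau> x) 0 = z0" using \<phi>_id[OF \<theta>_\<Gamma>[OF \<theta>_\<Gamma>[OF x]] z0] by (simp add: pull_def)
    then show ?thesis using l by (auto simp: algebra_simps)
  qed
  moreover have "0 \<le> B / (1 - ?q)" using B q by simp
  ultimately show ?thesis by blast
qed

definition att :: "'w \<Rightarrow> 's" where
  "att x = (SOME l. l \<in> S \<and> limitin mtopology (pull x) l sequentially)"

lemma att: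
  assumes x: "x \<in> \<Gamma>"
  shows "att x \<in> S" "limitin mtopology (pull x) (att x) sequentially"
proof -
  have "\<exists>l. l \<in> S \<and> limitin mtopology (pull x) l sequentially"
    using pull_limit[OF x, of "\<kappa> / 4"] \<kappa> \<theta>_0_\<Gamma>[OF x] by (metis divide_pos_pos order_refl zero_less_numeral)
  then have "att x \<in> S \<and> limitin mtopology (pull x) (att x) sequentially"
    unfolding att_def by (rule someI_ex)
  then show "att x \<in> S" "limitin mtopology (pull x) (att x) sequentially" by auto
qed

lemma att_tempered:
  assumes x: "x \<in> \<Gamma>" and e: "0 < e"
  shows "\<exists>C\<ge>0. \<forall>t. d (att (\<theta> t x)) z0 \<le> C * exp (e * \<bar>t\<bar>)"
proof -
  define e' where "e' = min (\<kappa> / 4) (e / 3)"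
  have e': "0 < e'" "e' \<le> \<kappa> / 4" "3 * e' \<le> e" using \<kappa> e by (auto simp: e'_def)
  obtain B where B: "0 \<le> B" "\<And>\<tau>. \<exists>l\<in>S. limitin mtopology (pull (\<theta> \<tau> x)) l sequentially \<and> d z0 l \<le> B * exp (3 * e' * \<bar>\<tau>\<bar>)"
    using pull_limit[OF x e'(1,2)] by blast
  have "d (att (\<theta> t x)) z0 \<le> B * exp (e * \<bar>t\<bar>)" for t
  proof -
    obtain l where l: "l \<in> S" "limitin mtopology (pull (\<theta> t x)) l sequentially" "d z0 l \<le> B * exp (3 * e' * \<bar>t\<bar>)"
      using B(2) by blast
    have "att (\<theta> t x) = l"
      using limitin_metric_unique[OF att(2)[OF \<theta>_\<Gamma>[OF x]] l(2)] by simp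
    then have "d (att (\<theta> t x)) z0 \<le> B * exp (3 * e' * \<bar>t\<bar>)" using l(3) commute by simp
    also have "\<dots> \<le> B * exp (e * \<bar>t\<bar>)" using e' B(1) by (intro mult_left_mono) (auto intro: mult_right_mono)
    finally show ?thesis .
  qed
  then show ?thesis using B(1) by blast
qed

text \<open>The Lipschitz bound for \<open>\<phi> t x\<close> carries the pullbacks to time 0 over
  to time t. There they differ from the pullbacks to time t by their starting times alone, and
  \<open>restart_dist\<close> shows this difference to be negligible.\<close>

lemma att_invariant_unit:
  assumes x: "x \<in> \<Gamma>" and t: "0 \<le> t" "t \<le> 1"
  shows "\<phi> t x (att x) = att (\<theta> t x)"
proof -
  have e: "0 < \<kappa> / 4" using \<kappa> by simp
  obtain C1 where C1: "0 \<le> C1" "\<And>s t \<eta> \<eta>'. s \<le> t \<Longrightarrow> \<eta> \<in> S \<Longrightarrow> \<eta>' \<in> S \<Longrightarrow>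
       d (\<phi> (t - s) (\<theta> s x) \<eta>) (\<phi> (t - s) (\<theta> s x) \<eta>') \<le> C1 * exp (- \<kappa> * (t - s) + \<kappa> / 4 * (\<bar>s\<bar> + \<bar>t\<bar>)) * d \<eta> \<eta>'"
    using contraction[OF x e] by blast
  obtain B where B: "0 \<le> B" "\<And>\<tau> n s. 0 \<le> s \<Longrightarrow> s \<le> 1 \<Longrightarrow>
    d (pull (\<theta> \<tau> x) n) (\<phi> (s + real n) (\<theta> (\<tau> - real n - s) x) z0) \<le> B * exp (3 * (\<kappa> / 4) * \<bar>\<tau>\<bar>) * exp (- \<kappa> / 2) ^ n"
    using restart_dist[OF x e order_refl] by blast
  let ?L = "C1 * exp (- \<kappa> * (t - 0) + \<kappa> / 4 * (\<bar>0\<bar> + \<bar>t\<bar>))"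
  let ?B = "B * exp (3 * (\<kappa> / 4) * \<bar>t\<bar>)"
  have \<theta>x: "\<theta> t x \<in> \<Gamma>" by (rule \<theta>_\<Gamma>[OF x])
  have in1: "\<phi> t x (att x) \<in> S" by (rule \<phi>_in[OF x att(1)[OF x] t(1)])
  have "d (\<phi> t x (att x)) (att (\<theta> t x)) \<le> ?L * d (pull x n) (att x) + ?B * exp (- \<kappa> / 2) ^ n + d (pull (\<theta> t x) n) (att (\<theta> t x))" for n
  proof -
    have in2: "\<phi> t x (pull x n) \<in> S" by (rule \<phi>_in[OF x pull_in[OF x] t(1)])
    have 1: "d (\<phi> t x (att x)) (\<phi> t x (pull x n)) \<le> ?L * d (pull x n) (att x)"
      using C1(2)[OF t(1) att(1)[OF x] pull_in[OF x, of n]] \<theta>_0_\<Gamma>[OF x] commute by simp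
    have "\<phi> t x (pull x n) = \<phi> (real n + t) (\<theta> (- real n) x) z0"
      unfolding pull_def using \<phi>_add[OF \<theta>_\<Gamma>[OF x, of "- real n"] z0, of "real n" t] t \<theta>_0_\<Gamma>[OF x]
      by (simp add: \<theta>_add_\<Gamma>[OF x])
    then have 2: "d (\<phi> t x (pull x n)) (pull (\<theta> t x) n) \<le> ?B * exp (- \<kappa> / 2) ^ n"
      using B(2)[OF t, of t n] commute by (simp add: add.commute)
    have "d (\<phi> t x (att x)) (att (\<theta> t x)) \<le> d (\<phi> t x (att x)) (\<phi> t x (pull x n)) + d (\<phi> t x (pull x n)) (att (\<theta> t x))"
      by (rule triangle[OF in1 in2 att(1)[OF \<theta>x]])
    also have "d (\<phi> t x (pull x n)) (att (\<theta> t x)) \<le> d (\<phi> t x (pull x n)) (pull (\<theta> t x) n) + d (pull (\<theta> t x) n) (att (\<theta> t x))"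
      by (rule triangle[OF in2 pull_in[OF \<theta>x] att(1)[OF \<theta>x]])
    finally show ?thesis using 1 2 by simp
  qed
  moreover have "(\<lambda>n. ?L * d (pull x n) (att x) + ?B * exp (- \<kappa> / 2) ^ n + d (pull (\<theta> t x) n) (att (\<theta> t x))) \<longlonglongrightarrow> ?L * 0 + ?B * 0 + 0"
    using \<kappa> by (intro tendsto_intros limitin_dist att x \<theta>x LIMSEQ_power_zero) auto
  ultimately have "d (\<phi> t x (att x)) (att (\<theta> t x)) \<le> ?L * 0 + ?B * 0 + 0" by (intro LIMSEQ_le_const) auto
  then have "d (\<phi> t x (att x)) (att (\<theta> t x)) = 0" using nonneg[of "\<phi> t x (att x)" "att (\<theta> t x)"] by simp
  then show ?thesis using zero[OF in1 att(1)[OF \<theta>x]] by simp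
qed

lemma att_invariant:
  assumes x: "x \<in> \<Gamma>" and t: "0 \<le> t"
  shows "\<phi> t x (att x) = att (\<theta> t x)"
proof -
  have "\<phi> t x (att x) = att (\<theta> t x)" if "x \<in> \<Gamma>" "0 \<le> t" "t \<le> real n" for n x t
    using that
  proof (induct n arbitrary: x t)
    case 0
    then show ?case by (intro att_invariant_unit) auto
  next
    case (Suc n)
    show ?case
    proof (cases "t \<le> 1")
      case True
      then show ?thesis using Suc by (intro att_invariant_unit) auto
    next
      case False
      have "\<phi> (1 + (t - 1)) x (att x) = \<phi> (t - 1) (\<theta> 1 x) (\<phi> 1 x (att x))"
        using False by (intro \<phi>_add Suc att) auto
      also have "\<phi> 1 x (att x) = att (\<theta> 1 x)" by (rule att_invariant_unit[OF Suc(2)]) auto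
      also have "\<phi> (t - 1) (\<theta> 1 x) (att (\<theta> 1 x)) = att (\<theta> (t - 1) (\<theta> 1 x))"
        using False Suc by (intro Suc(1) \<theta>_\<Gamma>) auto
      finally show ?thesis by (simp add: \<theta>_add_\<Gamma>[OF Suc(2)])
    qed
  qed
  moreover obtain n :: nat where "t \<le> real n" using real_arch_simple by blast
  ultimately show ?thesis using assms by blast
qed

text \<open>The contraction is used from time 0 with e = \<kappa>/2, which sacrifices half of the
  rate; invariance replaces the image of \<open>att x\<close> by the attractor at time t.\<close>

lemma forward_attraction:
  assumes x: "x \<in> \<Gamma>"
  shows "\<exists>C\<ge>0. \<forall>t \<eta>. 0 \<le> t \<longrightarrow> \<eta> \<in> S \<longrightarrow> d (\<phi> t x \<eta>) (att (\<theta> t x)) \<le> C * exp (- (\<kappa> / 2) * t) * d \<eta> (att x)"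
proof -
  have e: "0 < \<kappa> / 2" using \<kappa> by simp
  obtain C where C: "0 \<le> C" "\<And>s t \<eta> \<eta>'. s \<le> t \<Longrightarrow> \<eta> \<in> S \<Longrightarrow> \<eta>' \<in> S \<Longrightarrow>
       d (\<phi> (t - s) (\<theta> s x) \<eta>) (\<phi> (t - s) (\<theta> s x) \<eta>') \<le> C * exp (- \<kappa> * (t - s) + \<kappa> / 2 * (\<bar>s\<bar> + \<bar>t\<bar>)) * d \<eta> \<eta>'"
    using contraction[OF x e] by blast
  have "d (\<phi> t x \<eta>) (att (\<theta> t x)) \<le> C * exp (- (\<kappa> / 2) * t) * d \<eta> (att x)" if "0 \<le> t" "\<eta> \<in> S" for t \<eta>
  proof -
    have "- \<kappa> * t + \<kappa> / 2 * t = - (\<kappa> / 2) * t" by simp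
    then show ?thesis
      using C(2)[OF that att(1)[OF x]] that \<theta>_0_\<Gamma>[OF x] att_invariant[OF x that(1)] by simp
  qed
  then show ?thesis using C(1) by blast
qed

text \<open>A quarter of \<kappa> is lost to the nonuniformity of the contraction and a quarter to
  the growth of \<open>att\<close> in the past, which leaves \<kappa>/2.\<close>

lemma pullback_attraction:
  assumes x: "x \<in> \<Gamma>"
  shows "\<exists>C\<ge>0. \<forall>t \<eta>. 0 \<le> t \<longrightarrow> \<eta> \<in> S \<longrightarrow> d (\<phi> t (\<theta> (- t) x) \<eta>) (att x) \<le> C * exp (- (\<kappa> / 2) * t) * (d \<eta> z0 + 1)"
proof -
  have e: "0 < \<kappa> / 4" using \<kappa> by simp
  obtain C where C: "0 \<le> C" "\<And>s t \<eta> \<eta>'. s \<le> t \<Longrightarrow> \<eta> \<in> S \<Longrightarrow> \<eta>' \<in> S \<Longrightarrow>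
       d (\<phi> (t - s) (\<theta> s x) \<eta>) (\<phi> (t - s) (\<theta> s x) \<eta>') \<le> C * exp (- \<kappa> * (t - s) + \<kappa> / 4 * (\<bar>s\<bar> + \<bar>t\<bar>)) * d \<eta> \<eta>'"
    using contraction[OF x e] by blast
  obtain C3 where C3: "0 \<le> C3" "\<And>t. d (att (\<theta> t x)) z0 \<le> C3 * exp (\<kappa> / 4 * \<bar>t\<bar>)"
    using att_tempered[OF x e] by blast
  have "d (\<phi> t (\<theta> (- t) x) \<eta>) (att x) \<le> (C * (1 + C3)) * exp (- (\<kappa> / 2) * t) * (d \<eta> z0 + 1)"
    if t: "0 \<le> t" and \<eta>: "\<eta> \<in> S" for t \<eta>
  proof -
    let ?x = "\<theta> (- t) x"
    have x': "?x \<in> \<Gamma>" by (rule \<theta>_\<Gamma>[OF x])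
    have "\<phi> t ?x (att ?x) = att x"
      using att_invariant[OF x' t] by (simp add: \<theta>_add_\<Gamma>[OF x] \<theta>_0_\<Gamma>[OF x])
    then have "d (\<phi> t ?x \<eta>) (att x) \<le> C * exp (- \<kappa> * t + \<kappa> / 4 * t) * d \<eta> (att ?x)"
      using C(2)[of "- t" 0, OF _ \<eta> att(1)[OF x']] t by simp
    also have "\<dots> \<le> C * exp (- \<kappa> * t + \<kappa> / 4 * t) * ((1 + C3) * exp (\<kappa> / 4 * t) * (d \<eta> z0 + 1))"
    proof (intro mult_left_mono)
      have "d \<eta> (att ?x) \<le> d \<eta> z0 + d z0 (att ?x)" by (rule triangle[OF \<eta> z0 att(1)[OF x']])
      also have "d z0 (att ?x) \<le> C3 * exp (\<kappa> / 4 * t)" using C3(2)[of "- t"] t commute by simp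
      also have "d \<eta> z0 + C3 * exp (\<kappa> / 4 * t) \<le> (1 + C3) * exp (\<kappa> / 4 * t) * (d \<eta> z0 + 1)"
      proof -
        have E: "1 \<le> exp (\<kappa> / 4 * t)" using \<kappa> t by simp
        have "d \<eta> z0 * 1 \<le> d \<eta> z0 * exp (\<kappa> / 4 * t)" using E by (intro mult_left_mono) auto
        moreover have "0 \<le> exp (\<kappa> / 4 * t) * (1 + C3 * d \<eta> z0)" using C3 by simp
        ultimately show ?thesis by (simp add: algebra_simps)
      qed
      finally show "d \<eta> (att ?x) \<le> (1 + C3) * exp (\<kappa> / 4 * t) * (d \<eta> z0 + 1)" by simp
    qed (use C in auto)
    also have "\<dots> = (C * (1 + C3)) * (exp (- \<kappa> * t + \<kappa> / 4 * t) * exp (\<kappa> / 4 * t)) * (d \<eta> z0 + 1)" by (simp add: mult_ac)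
    also have "exp (- \<kappa> * t + \<kappa> / 4 * t) * exp (\<kappa> / 4 * t) = exp (- (\<kappa> / 2) * t)"
      by (simp flip: exp_add)
    finally show ?thesis .
  qed
  moreover have "0 \<le> C * (1 + C3)" using C C3 by simp
  ultimately show ?thesis by blast
qed

end

section \<open>Tempered growth and semidistances\<close>

text \<open>The constant C contributes ln C divided by the time, which vanishes in either direction;
  the rate e is arbitrary.\<close>

lemma subexponential_tempered:
  fixes h :: "real \<Rightarrow> real"
  assumes "\<And>e. 0 < e \<Longrightarrow> \<exists>C. \<forall>t. h t \<le> C * exp (e * \<bar>t\<bar>)"
  shows "((\<lambda>t. 1 / t * ln (max 1 (h t))) \<longlongrightarrow> 0) at_top" "((\<lambda>t. 1 / t * ln (max 1 (h t))) \<longlongrightarrow> 0) at_bot"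
proof -
  have bound: "\<exists>R. \<forall>t. R < \<bar>t\<bar> \<longrightarrow> \<bar>1 / t * ln (max 1 (h t))\<bar> < e" if e: "0 < e" for e
  proof -
    obtain C where C: "\<And>t. h t \<le> C * exp (e / 2 * \<bar>t\<bar>)" using assms[of "e / 2"] e by auto
    let ?C = "max 1 C"
    have "\<bar>1 / t * ln (max 1 (h t))\<bar> < e" if t: "max 1 (2 * ln ?C / e) < \<bar>t\<bar>" for t
    proof -
      have a: "C * exp (e / 2 * \<bar>t\<bar>) \<le> ?C * exp (e / 2 * \<bar>t\<bar>)" by (intro mult_right_mono) auto
      have b: "1 * 1 \<le> ?C * exp (e / 2 * \<bar>t\<bar>)" using e by (intro mult_mono) auto
      have "max 1 (h t) \<le> ?C * exp (e / 2 * \<bar>t\<bar>)"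
        by (rule max.boundedI[OF _ order_trans[OF C a]]) (use b in simp)
      then have "ln (max 1 (h t)) \<le> ln (?C * exp (e / 2 * \<bar>t\<bar>))" by (subst ln_le_cancel_iff) auto
      also have "\<dots> = ln ?C + e / 2 * \<bar>t\<bar>" by (subst ln_mult) auto
      also have "ln ?C < e / 2 * \<bar>t\<bar>" using t e by (simp add: pos_divide_less_eq field_simps)
      finally have "ln (max 1 (h t)) < e * \<bar>t\<bar>" by simp
      moreover have "0 \<le> ln (max 1 (h t))" by simp
      moreover have "0 < \<bar>t\<bar>" using t by linarith
      ultimately show ?thesis by (simp add: abs_mult pos_divide_less_eq)
    qed
    then show ?thesis by blast
  qed
  show "((\<lambda>t. 1 / t * ln (max 1 (h t))) \<longlongrightarrow> 0) at_top"
  proof (rule tendstoI)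
    fix e :: real assume "0 < e"
    then obtain R where R: "\<And>t. R < \<bar>t\<bar> \<Longrightarrow> \<bar>1 / t * ln (max 1 (h t))\<bar> < e" using bound by blast
    have "\<forall>\<^sub>F t in at_top. R < t" by (rule eventually_gt_at_top)
    then show "\<forall>\<^sub>F t in at_top. dist (1 / t * ln (max 1 (h t))) 0 < e"
    proof eventually_elim
      case (elim t)
      then show ?case using R[of t] by simp
    qed
  qed
  show "((\<lambda>t. 1 / t * ln (max 1 (h t))) \<longlongrightarrow> 0) at_bot"
  proof (rule tendstoI)
    fix e :: real assume "0 < e"
    then obtain R where R: "\<And>t. R < \<bar>t\<bar> \<Longrightarrow> \<bar>1 / t * ln (max 1 (h t))\<bar> < e" using bound by blast
    have "\<forall>\<^sub>F t in at_bot. t < - R" by (rule eventually_gt_at_bot)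
    then show "\<forall>\<^sub>F t in at_bot. dist (1 / t * ln (max 1 (h t))) 0 < e"
    proof eventually_elim
      case (elim t)
      then show ?case using R[of t] by simp
    qed
  qed
qed

text \<open>Temperedness at minus infinity, rewritten for the starting time -t of a
  pullback.\<close>

lemma tempered_subexponential:
  fixes h :: "real \<Rightarrow> real"
  assumes "((\<lambda>t. 1 / t * ln (max 1 (h t))) \<longlongrightarrow> 0) at_bot" "0 < e"
  shows "\<forall>\<^sub>F t in at_top. h (- t) \<le> exp (e * t)"
proof -
  have "((\<lambda>t. 1 / (- t) * ln (max 1 (h (- t)))) \<longlongrightarrow> 0) at_top"
    using filterlim_compose[OF assms(1) filterlim_uminus_at_bot_at_top] by simp
  then have "\<forall>\<^sub>F t in at_top. dist (1 / (- t) * ln (max 1 (h (- t)))) 0 < e" using assms(2) by (rule tendstoD)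
  then show ?thesis using eventually_gt_at_top[of 0]
  proof eventually_elim
    case (elim t)
    then have "ln (max 1 (h (- t))) < e * t" by (simp add: abs_mult pos_divide_less_eq)
    then have "exp (ln (max 1 (h (- t)))) < exp (e * t)" by (subst exp_less_cancel_iff)
    moreover have "exp (ln (max 1 (h (- t)))) = max 1 (h (- t))" by (rule exp_ln) auto
    ultimately have "max 1 (h (- t)) < exp (e * t)" by simp
    then show ?case by (intro less_imp_le) (rule order_le_less_trans[OF max.cobounded2])
  qed
qed

lemma semidist_tendsto_0:
  assumes "\<forall>\<^sub>F t in F. \<forall>y\<in>E t. d y (a t) \<le> h t" "(h \<longlongrightarrow> 0) F"
  shows "((\<lambda>t. semidist d (E t) {a t}) \<longlongrightarrow> 0) F"
proof (rule tendsto_sandwich[of "\<lambda>_. 0"])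
  show "\<forall>\<^sub>F t in F. semidist d (E t) {a t} \<le> ennreal (h t)"
    using assms(1)
  proof eventually_elim
    case (elim t)
    then show ?case unfolding semidist_def by (intro SUP_least) (auto intro: ennreal_leI)
  qed
  show "((\<lambda>t. ennreal (h t)) \<longlongrightarrow> 0) F" using tendsto_ennrealI[OF assms(2)] by simp
qed auto

section \<open>The attractor of the delay equation\<close>

text \<open>Evaluation is continuous on the state space because the sup norm is part of the Hoelder
  norm.\<close>

lemma state_openin_eval:
  fixes U :: "(real^'d) set"
  assumes U: "open U" and q: "-r \<le> q" "q \<le> 0"
  shows "openin (state_topology r \<alpha>) {\<eta> \<in> little_holder_space \<alpha> {-r..0}. \<eta> q \<in> U}"
proof -
  interpret Metric_space "holder_space \<alpha> {-r..0} :: (real \<Rightarrow> real^'d) set" "holder_dist \<alpha> {-r..0}"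
    by (rule Metric_space_holder)
  let ?V = "{\<eta> \<in> holder_space \<alpha> {-r..0}. \<eta> q \<in> U}"
  have "openin mtopology ?V"
    unfolding openin_mtopology
  proof (intro conjI allI impI)
    fix \<eta> assume \<eta>: "\<eta> \<in> ?V"
    then obtain e where e: "0 < e" "\<And>y. dist y (\<eta> q) < e \<Longrightarrow> y \<in> U" using U unfolding open_dist by blast
    have "mball \<eta> e \<subseteq> ?V"
    proof
      fix \<xi> assume "\<xi> \<in> mball \<eta> e"
      then have \<xi>: "\<xi> \<in> holder_space \<alpha> {-r..0}" "holder_dist \<alpha> {-r..0} \<eta> \<xi> < e" by auto
      have "norm (\<eta> q - \<xi> q) \<le> holder_dist \<alpha> {-r..0} \<eta> \<xi>"
        using hbD[OF hb_holder_dist[OF _ \<xi>(1)] q] \<eta> by blast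
      then have "dist (\<xi> q) (\<eta> q) < e" using \<xi>(2) by (simp add: dist_norm norm_minus_commute)
      then show "\<xi> \<in> ?V" using \<xi>(1) e(2) by simp
    qed
    then show "\<exists>r>0. mball \<eta> r \<subseteq> ?V" using e(1) by blast
  qed auto
  then have "openin (holder_topology \<alpha> {-r..0}) ?V" by (simp add: holder_topology_def)
  moreover have "{\<eta> \<in> little_holder_space \<alpha> {-r..0}. \<eta> q \<in> U} = ?V \<inter> little_holder_space \<alpha> {-r..0}"
    using little_holder_imp_holder by blast
  ultimately show ?thesis unfolding state_topology_def openin_subtopology by blast
qed

lemma topspace_state: "topspace (state_topology r \<alpha>) = (little_holder_space \<alpha> {-r..0} :: (real \<Rightarrow> 'a::real_normed_vector) set)"
proof -
  interpret Metric_space "holder_space \<alpha> {-r..0} :: (real \<Rightarrow> 'a) set" "holder_dist \<alpha> {-r..0}"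
    by (rule Metric_space_holder)
  show ?thesis
    using little_holder_imp_holder by (auto simp: state_topology_def holder_topology_def)
qed

locale young_noise = noise_space P \<nu> + young_delay r \<nu> \<alpha> \<beta> A f g C\<^sub>f C\<^sub>g
  for P :: "(real \<Rightarrow> real^'m) measure" and r \<nu> \<alpha> \<beta> :: real and A :: "real^'d^'d"
    and f :: "(real \<Rightarrow> real^'d) \<Rightarrow> real^'d" and g :: "(real \<Rightarrow> real^'d) \<Rightarrow> real^'m^'d"
    and C\<^sub>f C\<^sub>g :: real
begin

lemma space_lhol: "x \<in> space P \<Longrightarrow> lhol x"
  using space_hol by (simp add: lhol_def)

end

text \<open>Separates measurability and the passage to almost sure statements from the dynamical
  estimates: \<Gamma> is measurable, has full measure and carries a contracting cocycle.\<close>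

locale young_attractor = young_noise P r \<nu> \<alpha> \<beta> A f g C\<^sub>f C\<^sub>g
  + coc: contracting_cocycle "little_holder_space \<alpha> {-r..0}" "holder_dist \<alpha> {-r..0}" \<Gamma> wiener_shift
      "delay_rds r \<alpha> \<beta> A f g" "young_delay.cst r 0" \<kappa>
  for P :: "(real \<Rightarrow> real^'m) measure" and r \<nu> \<alpha> \<beta> :: real and A :: "real^'d^'d"
    and f :: "(real \<Rightarrow> real^'d) \<Rightarrow> real^'d" and g :: "(real \<Rightarrow> real^'d) \<Rightarrow> real^'m^'d"
    and C\<^sub>f C\<^sub>g :: real and \<Gamma> \<kappa> +
  assumes \<Gamma>_sets: "\<Gamma> \<in> sets P" and \<Gamma>_AE: "AE x in P. x \<in> \<Gamma>"
begin

section \<open>Measurability of the attracting point\<close>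

lemma \<Gamma>_space: "x \<in> \<Gamma> \<Longrightarrow> x \<in> space P"
  using sets.sets_into_space[OF \<Gamma>_sets] by blast

text \<open>For fixed initial path the solution is continuous in the noise. Late times t must be
  covered, because pullbacks from the remote past are solution values at late times.\<close>

lemma ysol_measurable:
  assumes \<eta>: "\<eta> \<in> S" and t: "-r \<le> t"
  shows "(\<lambda>x. ysol x \<eta> t) \<in> borel_measurable P"
proof (rule continuous_measurable)
  fix x :: "real \<Rightarrow> real^'m" and e :: real assume x: "x \<in> space P" and e: "0 < e"
  let ?T = "max 1 t"
  have T: "0 \<le> ?T" by simp
  obtain C where C: "0 \<le> C" "\<forall>x' e. lhol x' \<longrightarrow> 0 \<le> e \<longrightarrow> e \<le> 1 \<longrightarrow> hol \<nu> e 0 ?T (\<lambda>t. x' t - x t) \<longrightarrow>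
     (\<forall>t. -r \<le> t \<longrightarrow> t \<le> ?T \<longrightarrow> norm (ysol x' \<eta> t - ysol x \<eta> t) \<le> C * e)"
    using \<phi>_driver_stability[OF space_lhol[OF x] \<eta> T] by blast
  define \<delta> where "\<delta> = min 1 (e / (C + 1))"
  have \<delta>: "0 < \<delta>" "\<delta> \<le> 1" using e C by (auto simp: \<delta>_def)
  have "\<delta> \<le> e / (C + 1)" by (simp add: \<delta>_def)
  then have "\<delta> * (C + 1) \<le> e" using C(1) by (simp add: pos_le_divide_eq)
  then have C\<delta>: "C * \<delta> < e" using \<delta> by (simp add: algebra_simps)
  have "dist (ysol z \<eta> t) (ysol x \<eta> t) < e"
    if z: "z \<in> space P" "hb \<nu> \<delta> (-?T) ?T (\<lambda>t. z t - x t)" for z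
  proof -
    have "hol \<nu> \<delta> 0 ?T (\<lambda>t. z t - x t)" by (rule hol_subset[OF hb_hol[OF z(2)]]) auto
    then have "norm (ysol z \<eta> t - ysol x \<eta> t) \<le> C * \<delta>" using \<delta> t by (intro C(2)[rule_format] space_lhol z(1)) auto
    then show ?thesis using C\<delta> by (simp add: dist_norm)
  qed
  then show "\<exists>T>0. \<exists>\<delta>>0. \<forall>z\<in>space P. hb \<nu> \<delta> (-T) T (\<lambda>t. z t - x t) \<longrightarrow> dist (ysol z \<eta> t) (ysol x \<eta> t) < e"
    using \<delta>(1) by (intro exI[of _ ?T] conjI exI[of _ \<delta>]) auto
qed

text \<open>Extension by 0 off \<Gamma>, so that measurability can be stated on the whole noise
  space.\<close>

definition att0 :: "(real \<Rightarrow> real^'m) \<Rightarrow> real \<Rightarrow> real^'d" where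
  "att0 x t = (if x \<in> \<Gamma> then coc.att x t else 0)"

lemma att0_measurable:
  assumes t: "-r \<le> t" "t \<le> 0"
  shows "(\<lambda>x. att0 x t) \<in> borel_measurable P"
proof (rule borel_measurable_LIMSEQ_metric)
  \<comment> \<open>The pullback from time -n, read at \<open>t\<close>, is the value of a solution
    at time n + t for the shifted noise, hence measurable.\<close>
  let ?u = "\<lambda>n x. if x \<in> \<Gamma> then ysol (wiener_shift (- real n) x) (cst 0) (real n + t) else 0"
  show "?u n \<in> borel_measurable P" for n
  proof (rule measurable_If)
    show "(\<lambda>x. ysol (wiener_shift (- real n) x) (cst 0) (real n + t)) \<in> borel_measurable P"
      by (rule measurable_compose[OF \<theta>_meas ysol_measurable[OF cst_S]]) (use t in auto)
    have "{x \<in> space P. x \<in> \<Gamma>} = \<Gamma>" using \<Gamma>_space by blast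
    then show "{x \<in> space P. x \<in> \<Gamma>} \<in> sets P" using \<Gamma>_sets by simp
  qed auto
  fix x assume x: "x \<in> space P"
  show "(\<lambda>n. ?u n x) \<longlonglongrightarrow> att0 x t"
  proof (cases "x \<in> \<Gamma>")
    case True
    have "(\<lambda>n. coc.pull x n t - coc.att x t) \<longlonglongrightarrow> 0"
    proof (rule Lim_null_comparison[OF _ coc.limitin_dist[OF coc.att(2)[OF True]]])
      show "\<forall>\<^sub>F n in sequentially. norm (coc.pull x n t - coc.att x t) \<le> dS (coc.pull x n) (coc.att x)"
        by (intro always_eventually allI hbD[OF hb_holder_dist] S_holder coc.pull_in coc.att(1) True t)
    qed
    then have "(\<lambda>n. coc.pull x n t) \<longlonglongrightarrow> coc.att x t" by (simp add: LIM_zero_iff)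
    moreover have "coc.pull x n t = ?u n x" for n
      using True t by (simp add: coc.pull_def \<phi>_eq segment_apply)
    ultimately show ?thesis using True by (simp add: att0_def)
  qed (simp add: att0_def)
qed

lemma att0_cont: "continuous_on {-r..0} (att0 x)"
proof (cases "x \<in> \<Gamma>")
  case True
  then have "att0 x = coc.att x" by (simp add: att0_def fun_eq_iff)
  moreover have "vm \<alpha> (-r) 0 (coc.att x)" using coc.att(1)[OF True] by (simp add: S_iff)
  ultimately show ?thesis using vm_imp_continuous_on exps by metis
next
  case False
  then have "att0 x = (\<lambda>_. 0)" by (simp add: att0_def fun_eq_iff)
  then show ?thesis by simp
qed

text \<open>This norm will be the radius of the tempered ball; rational times reduce it to countable
  suprema of measurable functions.\<close>

lemma att0_norm_measurable: "(\<lambda>x. holder_norm \<alpha> {-r..0} (att0 x)) \<in> borel_measurable P"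
proof -
  have 1: "(\<lambda>x. if -r \<le> q \<and> q \<le> 0 then ennreal (norm (att0 x q)) else 0) \<in> borel_measurable P" for q
    using att0_measurable[of q] by (cases "-r \<le> q \<and> q \<le> 0") auto
  have 2: "(\<lambda>x. if -r \<le> u \<and> v \<le> 0 then ennreal (norm (att0 x v - att0 x u) / (v - u) powr \<alpha>) else 0) \<in> borel_measurable P"
    if "u < v" for u v
  proof (cases "-r \<le> u \<and> v \<le> 0")
    case True
    then have "(\<lambda>x. att0 x u) \<in> borel_measurable P" "(\<lambda>x. att0 x v) \<in> borel_measurable P"
      using att0_measurable[of u] att0_measurable[of v] that by auto
    then have "(\<lambda>x. ennreal (norm (att0 x v - att0 x u) / (v - u) powr \<alpha>)) \<in> borel_measurable P" by measurable
    then show ?thesis using True by simp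
  qed auto
  have "(\<lambda>x. SUP q\<in>\<rat>. if -r \<le> q \<and> q \<le> 0 then ennreal (norm (att0 x q)) else 0) \<in> borel_measurable P"
    by (rule borel_measurable_SUP[OF countable_rat 1])
  moreover have "(\<lambda>x. SUP p\<in>rat_pairs. if -r \<le> fst p \<and> snd p \<le> 0
      then ennreal (norm (att0 x (snd p) - att0 x (fst p)) / (snd p - fst p) powr \<alpha>) else 0) \<in> borel_measurable P"
    by (rule borel_measurable_SUP[OF countable_rat_pairs 2]) (auto simp: rat_pairs_def)
  ultimately show ?thesis
    unfolding holder_norm_def sup_norm_rat[OF att0_cont r[THEN neg_less_0_iff_less[THEN iffD2]]] holder_seminorm_rat[OF att0_cont]
    by (rule borel_measurable_add)
qed

abbreviation X where "X \<equiv> (state_topology r \<alpha> :: (real \<Rightarrow> real^'d) topology)"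

lemma state_eval_measurable:
  assumes q: "-r \<le> q" "q \<le> 0"
  shows "(\<lambda>\<eta>. \<eta> q) \<in> borel_measurable (borel_of_topology X)"
proof (rule borel_measurableI)
  fix U :: "(real^'d) set" assume "open U"
  from openin_borel_of_topology[OF state_openin_eval[OF this q]]
  show "(\<lambda>\<eta>. \<eta> q) -` U \<inter> space (borel_of_topology X) \<in> sets (borel_of_topology X)"
    by (simp add: space_borel_of_topology topspace_state vimage_def Int_def conj_commute)
qed

text \<open>The fibres are singletons on \<Gamma> and empty elsewhere, so compactness and
  \<beta>-regularity hold for every noise path and not merely for almost every one.\<close>

definition graph :: "((real \<Rightarrow> real^'m) \<times> (real \<Rightarrow> real^'d)) set" where
  "graph = {(x, \<eta>). x \<in> \<Gamma> \<and> \<eta> = coc.att x}"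

lemma graph_Image: "graph `` {x} = (if x \<in> \<Gamma> then {coc.att x} else {})"
  by (auto simp: graph_def)

text \<open>Two paths in the state space agree as soon as they agree at the rational times of the
  open interval, so measurability of the graph needs no separability of the state space.\<close>

lemma graph_sets: "graph \<in> sets (P \<Otimes>\<^sub>M borel_of_topology X)"
proof -
  let ?B = "P \<Otimes>\<^sub>M borel_of_topology X"
  let ?Q = "\<rat> \<inter> {-r..0}"
  have space: "space ?B = space P \<times> S" by (simp add: space_pair_measure space_borel_of_topology topspace_state)
  have E: "{p \<in> space ?B. snd p q - att0 (fst p) q = 0} \<in> sets ?B" if q: "q \<in> ?Q" for q
  proof -
    have "(\<lambda>p. snd p q) \<in> borel_measurable ?B"
      using measurable_compose[OF measurable_snd state_eval_measurable] q by auto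
    moreover have "(\<lambda>p. att0 (fst p) q) \<in> borel_measurable ?B"
      using measurable_compose[OF measurable_fst att0_measurable] q by auto
    ultimately have m: "(\<lambda>p. snd p q - att0 (fst p) q) \<in> borel_measurable ?B" by (rule borel_measurable_diff)
    have "{p \<in> space ?B. snd p q - att0 (fst p) q = 0} = (\<lambda>p. snd p q - att0 (fst p) q) -` {0} \<inter> space ?B" by auto
    then show ?thesis using measurable_sets[OF m, of "{0}"] by simp
  qed
  have "graph = (\<Inter>q\<in>?Q. {p \<in> space ?B. snd p q - att0 (fst p) q = 0}) \<inter> (\<Gamma> \<times> space (borel_of_topology X))"
    (is "_ = ?I \<inter> _")
  proof (intro equalityI subsetI)
    fix p assume "p \<in> graph"
    then obtain x where x: "p = (x, coc.att x)" "x \<in> \<Gamma>" by (auto simp: graph_def)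
    then show "p \<in> ?I \<inter> (\<Gamma> \<times> space (borel_of_topology X))"
      using coc.att(1)[OF x(2)] \<Gamma>_space[OF x(2)]
      by (auto simp: space space_borel_of_topology topspace_state att0_def)
  next
    fix p assume p: "p \<in> ?I \<inter> (\<Gamma> \<times> space (borel_of_topology X))"
    obtain x \<eta> where p_eq: "p = (x, \<eta>)" by (cases p)
    have x: "x \<in> \<Gamma>" and \<eta>: "\<eta> \<in> S" using p by (auto simp: p_eq space_borel_of_topology topspace_state)
    have eq: "\<eta> q = coc.att x q" if "q \<in> \<rat>" "-r \<le> q" "q \<le> 0" for q
      using p that x by (auto simp: p_eq att0_def)
    have cont: "continuous_on {-r..0} \<eta>" "continuous_on {-r..0} (coc.att x)"
      using \<eta> coc.att(1)[OF x] vm_imp_continuous_on exps by (auto simp: S_iff)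
    have "\<eta> = coc.att x"
    proof (rule extensionalityI[of _ "{-r..0}"])
      show "\<eta> \<in> extensional {-r..0}" "coc.att x \<in> extensional {-r..0}"
        using \<eta> coc.att(1)[OF x] by (auto simp: S_iff)
      fix t assume t: "t \<in> {-r..0}"
      have "\<exists>u. (\<forall>n::nat. u n \<in> \<rat> \<and> -r \<le> u n \<and> u n \<le> 0) \<and> u \<longlonglongrightarrow> t"
      proof (cases "t < 0")
        case True
        then obtain u where u: "\<And>n::nat. u n \<in> \<rat> \<and> t < u n \<and> u n < 0" "u \<longlonglongrightarrow> t" using rat_approx by blast
        have "u n \<in> \<rat> \<and> -r \<le> u n \<and> u n \<le> 0" for n using u(1)[of n] t by auto
        then show ?thesis using u(2) by blast
      next
        case False
        then have "t = 0" using t by simp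
        then show ?thesis using r by (intro exI[of _ "\<lambda>_. 0"]) auto
      qed
      then obtain u where u: "\<And>n::nat. u n \<in> \<rat> \<and> -r \<le> u n \<and> u n \<le> 0" "u \<longlonglongrightarrow> t" by blast
      have "(\<lambda>n. \<eta> (u n)) \<longlonglongrightarrow> \<eta> t" "(\<lambda>n. coc.att x (u n)) \<longlonglongrightarrow> coc.att x t"
        using u t by (auto intro!: continuous_on_tendsto_compose[OF cont(1) u(2)] continuous_on_tendsto_compose[OF cont(2) u(2)])
      moreover have "(\<lambda>n. \<eta> (u n)) = (\<lambda>n. coc.att x (u n))" using eq u(1) by auto
      ultimately show "\<eta> t = coc.att x t" using LIMSEQ_unique by auto
    qed
    then show "p \<in> graph" using x by (simp add: p_eq graph_def)
  qed
  moreover have "?I \<in> sets ?B"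
  proof (rule sets.countable_INT')
    show "countable ?Q" using countable_rat by auto
    have "0 \<in> ?Q" using r by simp
    then show "?Q \<noteq> {}" by blast
  qed (use E in auto)
  moreover have "\<Gamma> \<times> space (borel_of_topology X) \<in> sets ?B" using \<Gamma>_sets by (intro pair_measureI) auto
  ultimately show ?thesis by auto
qed

lemma dS_le_of_norm:
  assumes "\<eta> \<in> S" "holder_norm \<alpha> {-r..0} \<eta> \<le> ennreal \<rho>" "0 \<le> \<rho>"
  shows "dS \<eta> (cst 0) \<le> 2 * \<rho>"
proof (rule holder_dist_le[OF _ assms(3)])
  have "hb \<alpha> \<rho> (-r) 0 \<eta>" by (rule holder_norm_le_imp_hb[OF assms(2,3)])
  then show "hb \<alpha> \<rho> (-r) 0 (\<lambda>t. \<eta> t - cst 0 t)"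
    by (subst hb_cong[where z = \<eta>]) (auto simp: cst_def)
qed

lemma norm_le_of_dS:
  assumes "\<eta> \<in> S"
  shows "holder_norm \<alpha> {-r..0} \<eta> \<le> ennreal (2 * dS \<eta> (cst 0))"
proof (rule hb_imp_holder_norm_le)
  have "hb \<alpha> (dS \<eta> (cst 0)) (-r) 0 (\<lambda>t. \<eta> t - cst 0 t)" by (rule hb_holder_dist) (use assms cst_S S_holder in auto)
  then show "hb \<alpha> (dS \<eta> (cst 0)) (-r) 0 \<eta>"
    by (subst hb_cong[where z = "\<lambda>t. \<eta> t - cst 0 t"]) (auto simp: cst_def)
qed simp

text \<open>The radius is the norm of the attracting point itself, which grows subexponentially
  along orbits by \<open>att_tempered\<close>. As the fibres off \<Gamma> are empty, the inclusion
  in the ball holds along every orbit.\<close>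

lemma graph_universe: "graph \<in> tempered_universe P wiener_shift r \<alpha>"
proof -
  define \<rho> where "\<rho> x = enn2real (holder_norm \<alpha> {-r..0} (att0 x))" for x
  have \<rho>_att: "holder_norm \<alpha> {-r..0} (coc.att x) = ennreal (\<rho> x)" "\<rho> x \<le> 2 * dS (coc.att x) (cst 0)" if x: "x \<in> \<Gamma>" for x
  proof -
    have a: "att0 x = coc.att x" using x by (simp add: att0_def fun_eq_iff)
    have le: "holder_norm \<alpha> {-r..0} (coc.att x) \<le> ennreal (2 * dS (coc.att x) (cst 0))"
      by (rule norm_le_of_dS[OF coc.att(1)[OF x]])
    then have "holder_norm \<alpha> {-r..0} (coc.att x) < \<top>" using ennreal_less_top order_le_less_trans by blast
    then show "holder_norm \<alpha> {-r..0} (coc.att x) = ennreal (\<rho> x)" by (simp add: \<rho>_def a)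
    show "\<rho> x \<le> 2 * dS (coc.att x) (cst 0)" unfolding \<rho>_def a using le by (intro enn2real_leI) auto
  qed
  have sub: "\<exists>C. \<forall>t. \<rho> (wiener_shift t x) \<le> C * exp (e * \<bar>t\<bar>)" if x: "x \<in> \<Gamma>" and e: "0 < e" for x e
  proof -
    obtain C where C: "\<And>t. dS (coc.att (wiener_shift t x)) (cst 0) \<le> C * exp (e * \<bar>t\<bar>)"
      using coc.att_tempered[OF x e] by blast
    have "\<rho> (wiener_shift t x) \<le> (2 * C) * exp (e * \<bar>t\<bar>)" for t
      using \<rho>_att(2)[OF coc.\<theta>_\<Gamma>[OF x, of t]] C[of t] by simp
    then show ?thesis by blast
  qed
  have "tempered P wiener_shift \<rho>"
    unfolding tempered_def
  proof (intro conjI ballI)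
    show "\<rho> \<in> borel_measurable P"
      unfolding \<rho>_def[abs_def] by (rule borel_measurable_enn2real[OF att0_norm_measurable])
    show "AE x in P. ((\<lambda>t. 1 / t * ln (max 1 (\<rho> (wiener_shift t x)))) \<longlongrightarrow> 0) at_top \<and>
                 ((\<lambda>t. 1 / t * ln (max 1 (\<rho> (wiener_shift t x)))) \<longlongrightarrow> 0) at_bot"
      using \<Gamma>_AE
    proof eventually_elim
      case (elim x)
      show ?case using subexponential_tempered[of "\<lambda>t. \<rho> (wiener_shift t x)", OF sub[OF elim]] by blast
    qed
  qed (simp add: \<rho>_def)
  moreover have "AE x in P. \<forall>t. graph `` {wiener_shift t x} \<subseteq> {\<eta>. holder_norm \<alpha> {-r..0} \<eta> \<le> ennreal (\<rho> (wiener_shift t x))}"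
    by (intro AE_I2 allI) (auto simp: graph_Image \<rho>_att)
  ultimately show ?thesis
    unfolding tempered_universe_def random_set_def using graph_sets by blast
qed

text \<open>Collects on one event of full measure what both attractions use: bounds for the fibres
  along the whole orbit and subexponential growth of the radius towards the past.\<close>

lemma universe_bound:
  assumes D: "D \<in> tempered_universe P wiener_shift r \<alpha>"
  shows "\<exists>\<rho>. AE x in P. x \<in> \<Gamma> \<and> (\<forall>t \<eta>. \<eta> \<in> D `` {wiener_shift t x} \<longrightarrow> \<eta> \<in> S \<and> dS \<eta> (cst 0) \<le> 2 * \<rho> (wiener_shift t x)) \<and>
     ((\<lambda>t. 1 / t * ln (max 1 (\<rho> (wiener_shift t x)))) \<longlongrightarrow> 0) at_bot"
proof -
  obtain \<rho> where \<rho>: "tempered P wiener_shift \<rho>"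
    "AE x in P. \<forall>t. D `` {wiener_shift t x} \<subseteq> {\<eta>. holder_norm \<alpha> {-r..0} \<eta> \<le> ennreal (\<rho> (wiener_shift t x))}"
    and Ds: "D \<in> sets (P \<Otimes>\<^sub>M borel_of_topology X)"
    using D unfolding tempered_universe_def random_set_def by blast
  have "D \<subseteq> space P \<times> S"
    using sets.sets_into_space[OF Ds] by (simp add: space_pair_measure space_borel_of_topology topspace_state)
  then have DS: "\<eta> \<in> S" if "\<eta> \<in> D `` {x}" for x \<eta> using that by auto
  have "AE x in P. ((\<lambda>t. 1 / t * ln (max 1 (\<rho> (wiener_shift t x)))) \<longlongrightarrow> 0) at_top \<and>
                 ((\<lambda>t. 1 / t * ln (max 1 (\<rho> (wiener_shift t x)))) \<longlongrightarrow> 0) at_bot"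
    using \<rho>(1) by (simp add: tempered_def)
  then have "AE x in P. x \<in> \<Gamma> \<and> (\<forall>t \<eta>. \<eta> \<in> D `` {wiener_shift t x} \<longrightarrow> \<eta> \<in> S \<and> dS \<eta> (cst 0) \<le> 2 * \<rho> (wiener_shift t x)) \<and>
     ((\<lambda>t. 1 / t * ln (max 1 (\<rho> (wiener_shift t x)))) \<longlongrightarrow> 0) at_bot"
    using \<Gamma>_AE \<rho>(2)
  proof eventually_elim
    case (elim x)
    have "dS \<eta> (cst 0) \<le> 2 * \<rho> (wiener_shift t x)" if \<eta>: "\<eta> \<in> D `` {wiener_shift t x}" for t \<eta>
    proof (rule dS_le_of_norm[OF DS[OF \<eta>]])
      show "holder_norm \<alpha> {-r..0} \<eta> \<le> ennreal (\<rho> (wiener_shift t x))" using elim(3) \<eta> by blast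
      show "0 \<le> \<rho> (wiener_shift t x)"
        using \<rho>(1) \<theta>_space[OF \<Gamma>_space[OF elim(2)]] by (simp add: tempered_def)
    qed
    then show ?case using elim DS by blast
  qed
  then show ?thesis by blast
qed

lemma exp_decay: "0 < c \<Longrightarrow> ((\<lambda>t. exp (- c * t)) \<longlongrightarrow> 0) at_top" for c :: real
  using filterlim_compose[OF exp_at_bot filterlim_tendsto_neg_mult_at_bot[OF tendsto_const _ filterlim_ident], of "- c"]
  by simp

theorem graph_attractor:
  "\<exists>\<A> \<in> tempered_universe P wiener_shift r \<alpha>.
     random_pullback_attractor P wiener_shift X dS \<phi> (tempered_universe P wiener_shift r \<alpha>) \<A> \<and>
     (\<forall>x\<in>space P. \<A> `` {x} \<subseteq> holder_space \<beta> {-r..0}) \<and>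
     (AE x in P. \<exists>\<eta>. \<A> `` {x} = {\<eta>}) \<and>
     random_forward_attractor P wiener_shift X dS \<phi> (tempered_universe P wiener_shift r \<alpha>) \<A>"
proof (intro bexI[OF _ graph_universe] conjI)
  have comp: "compact_random_set P X graph"
    unfolding compact_random_set_def random_set_def
    using graph_sets coc.att(1) by (auto simp: graph_Image topspace_state intro!: finite_imp_compactin)
  have invar: "invariant_random_set P wiener_shift \<phi> graph"
    unfolding invariant_random_set_def
  proof (intro allI impI)
    fix t :: real assume t: "0 \<le> t"
    show "AE x in P. \<phi> t x ` (graph `` {x}) = graph `` {wiener_shift t x}"
      using \<Gamma>_AE
    proof eventually_elim
      case (elim x)
      then show ?case using coc.\<theta>_\<Gamma>[OF elim, of t] coc.att_invariant[OF elim t] by (simp add: graph_Image)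
    qed
  qed
  have c: "0 < \<kappa> / 2" "0 < \<kappa> / 4" using coc.\<kappa> by auto
  have pullb: "AE x in P. ((\<lambda>t. semidist dS (\<phi> t (wiener_shift (- t) x) ` (D `` {wiener_shift (- t) x})) (graph `` {x})) \<longlongrightarrow> 0) at_top"
    if D: "D \<in> tempered_universe P wiener_shift r \<alpha>" for D
  proof -
    obtain \<rho> where "AE x in P. x \<in> \<Gamma> \<and> (\<forall>t \<eta>. \<eta> \<in> D `` {wiener_shift t x} \<longrightarrow> \<eta> \<in> S \<and> dS \<eta> (cst 0) \<le> 2 * \<rho> (wiener_shift t x)) \<and>
     ((\<lambda>t. 1 / t * ln (max 1 (\<rho> (wiener_shift t x)))) \<longlongrightarrow> 0) at_bot"
      using universe_bound[OF D] by blast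
    then show ?thesis
    proof eventually_elim
      case (elim x)
      then have x: "x \<in> \<Gamma>" by blast
      obtain C where C: "0 \<le> C" "\<And>t \<eta>. 0 \<le> t \<Longrightarrow> \<eta> \<in> S \<Longrightarrow>
          dS (\<phi> t (wiener_shift (- t) x) \<eta>) (coc.att x) \<le> C * exp (- (\<kappa> / 2) * t) * (dS \<eta> (cst 0) + 1)"
        using coc.pullback_attraction[OF x] by blast
      \<comment> \<open>The radius may grow at rate \<kappa>/4; attraction at rate \<kappa>/2 then
        leaves a decay at rate \<kappa>/4.\<close>
      have ev: "\<forall>\<^sub>F t in at_top. \<rho> (wiener_shift (- t) x) \<le> exp (\<kappa> / 4 * t)"
        using tempered_subexponential[of "\<lambda>t. \<rho> (wiener_shift t x)"] elim c(2) by blast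
      have "((\<lambda>t. semidist dS (\<phi> t (wiener_shift (- t) x) ` (D `` {wiener_shift (- t) x})) {coc.att x}) \<longlongrightarrow> 0) at_top"
      proof (rule semidist_tendsto_0[where h = "\<lambda>t. C * (2 * exp (- (\<kappa> / 4) * t) + exp (- (\<kappa> / 2) * t))"])
        show "\<forall>\<^sub>F t in at_top. \<forall>y\<in>\<phi> t (wiener_shift (- t) x) ` (D `` {wiener_shift (- t) x}).
            dS y (coc.att x) \<le> C * (2 * exp (- (\<kappa> / 4) * t) + exp (- (\<kappa> / 2) * t))"
          using ev eventually_ge_at_top[of 0]
        proof eventually_elim
          case (elim t)
          show ?case
          proof
            fix y assume "y \<in> \<phi> t (wiener_shift (- t) x) ` (D `` {wiener_shift (- t) x})"
            then obtain \<eta> where \<eta>: "\<eta> \<in> D `` {wiener_shift (- t) x}" "y = \<phi> t (wiener_shift (- t) x) \<eta>" by blast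
            have \<eta>S: "\<eta> \<in> S" "dS \<eta> (cst 0) \<le> 2 * \<rho> (wiener_shift (- t) x)"
              using \<open>x \<in> \<Gamma> \<and> _\<close> \<eta>(1) by blast+
            have "dS y (coc.att x) \<le> C * exp (- (\<kappa> / 2) * t) * (dS \<eta> (cst 0) + 1)"
              unfolding \<eta>(2) by (rule C(2)[OF elim(2) \<eta>S(1)])
            also have "\<dots> \<le> C * exp (- (\<kappa> / 2) * t) * (2 * exp (\<kappa> / 4 * t) + 1)"
              using \<eta>S(2) elim(1) C(1) by (intro mult_left_mono) auto
            also have "\<dots> = C * (2 * (exp (- (\<kappa> / 2) * t) * exp (\<kappa> / 4 * t)) + exp (- (\<kappa> / 2) * t))"
              by (simp add: algebra_simps)
            also have "exp (- (\<kappa> / 2) * t) * exp (\<kappa> / 4 * t) = exp (- (\<kappa> / 4) * t)" by (simp flip: exp_add)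
            finally show "dS y (coc.att x) \<le> C * (2 * exp (- (\<kappa> / 4) * t) + exp (- (\<kappa> / 2) * t))" .
          qed
        qed
        have "((\<lambda>t. C * (2 * exp (- (\<kappa> / 4) * t) + exp (- (\<kappa> / 2) * t))) \<longlongrightarrow> C * (2 * 0 + 0)) at_top"
          by (intro tendsto_intros exp_decay c)
        then show "((\<lambda>t. C * (2 * exp (- (\<kappa> / 4) * t) + exp (- (\<kappa> / 2) * t))) \<longlongrightarrow> 0) at_top" by simp
      qed
      then show ?case using x by (simp add: graph_Image)
    qed
  qed
  show "random_pullback_attractor P wiener_shift X dS \<phi> (tempered_universe P wiener_shift r \<alpha>) graph"
    unfolding random_pullback_attractor_def using comp invar pullb by blast
  have forw: "AE x in P. ((\<lambda>t. semidist dS (\<phi> t x ` (D `` {x})) (graph `` {wiener_shift t x})) \<longlongrightarrow> 0) at_top"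
    if D: "D \<in> tempered_universe P wiener_shift r \<alpha>" for D
  proof -
    obtain \<rho> where "AE x in P. x \<in> \<Gamma> \<and> (\<forall>t \<eta>. \<eta> \<in> D `` {wiener_shift t x} \<longrightarrow> \<eta> \<in> S \<and> dS \<eta> (cst 0) \<le> 2 * \<rho> (wiener_shift t x)) \<and>
     ((\<lambda>t. 1 / t * ln (max 1 (\<rho> (wiener_shift t x)))) \<longlongrightarrow> 0) at_bot"
      using universe_bound[OF D] by blast
    then show ?thesis
    proof eventually_elim
      case (elim x)
      then have x: "x \<in> \<Gamma>" by blast
      obtain C where C: "0 \<le> C" "\<And>t \<eta>. 0 \<le> t \<Longrightarrow> \<eta> \<in> S \<Longrightarrow>
          dS (\<phi> t x \<eta>) (coc.att (wiener_shift t x)) \<le> C * exp (- (\<kappa> / 2) * t) * dS \<eta> (coc.att x)"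
        using coc.forward_attraction[OF x] by blast
      \<comment> \<open>Forward attraction starts from the fibre at time 0 alone, so a fixed radius
        is enough.\<close>
      let ?R = "2 * \<rho> x + dS (cst 0) (coc.att x)"
      have "((\<lambda>t. semidist dS (\<phi> t x ` (D `` {x})) {coc.att (wiener_shift t x)}) \<longlongrightarrow> 0) at_top"
      proof (rule semidist_tendsto_0[where h = "\<lambda>t. C * exp (- (\<kappa> / 2) * t) * ?R"])
        show "\<forall>\<^sub>F t in at_top. \<forall>y\<in>\<phi> t x ` (D `` {x}). dS y (coc.att (wiener_shift t x)) \<le> C * exp (- (\<kappa> / 2) * t) * ?R"
          using eventually_ge_at_top[of 0]
        proof eventually_elim
          case (elim t)
          show ?case
          proof
            fix y assume "y \<in> \<phi> t x ` (D `` {x})"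
            then obtain \<eta> where \<eta>: "\<eta> \<in> D `` {x}" "y = \<phi> t x \<eta>" by blast
            have "\<eta> \<in> D `` {wiener_shift 0 x}" using \<eta>(1) coc.\<theta>_0_\<Gamma>[OF x] by simp
            then have \<eta>S: "\<eta> \<in> S" "dS \<eta> (cst 0) \<le> 2 * \<rho> (wiener_shift 0 x)"
              using \<open>x \<in> \<Gamma> \<and> _\<close> by blast+
            have "dS y (coc.att (wiener_shift t x)) \<le> C * exp (- (\<kappa> / 2) * t) * dS \<eta> (coc.att x)"
              unfolding \<eta>(2) by (rule C(2)[OF elim \<eta>S(1)])
            also have "\<dots> \<le> C * exp (- (\<kappa> / 2) * t) * ?R"
              using coc.triangle[OF \<eta>S(1) cst_S coc.att(1)[OF x], of 0] \<eta>S(2) coc.\<theta>_0_\<Gamma>[OF x] C(1)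
              by (intro mult_left_mono) auto
            finally show "dS y (coc.att (wiener_shift t x)) \<le> C * exp (- (\<kappa> / 2) * t) * ?R" .
          qed
        qed
        have "((\<lambda>t. C * exp (- (\<kappa> / 2) * t) * ?R) \<longlongrightarrow> C * 0 * ?R) at_top"
          by (intro tendsto_intros exp_decay c)
        then show "((\<lambda>t. C * exp (- (\<kappa> / 2) * t) * ?R) \<longlongrightarrow> 0) at_top" by simp
      qed
      then show ?case using coc.\<theta>_\<Gamma>[OF x] by (simp add: graph_Image)
    qed
  qed
  show "random_forward_attractor P wiener_shift X dS \<phi> (tempered_universe P wiener_shift r \<alpha>) graph"
    unfolding random_forward_attractor_def using comp invar forw by blast
  show "AE x in P. \<exists>\<eta>. graph `` {x} = {\<eta>}"
    using \<Gamma>_AE by eventually_elim (simp add: graph_Image)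
  show "\<forall>x\<in>space P. graph `` {x} \<subseteq> holder_space \<beta> {-r..0}"
  proof
    fix x
    show "graph `` {x} \<subseteq> holder_space \<beta> {-r..0}"
    proof (cases "x \<in> \<Gamma>")
      case True
      \<comment> \<open>The attracting point at \<open>x\<close> is the image, under the flow over
        time r, of the one at time -r, and this flow maps into the \<beta>-Hoelder paths.\<close>
      let ?x = "wiener_shift (- r) x"
      have x': "?x \<in> \<Gamma>" by (rule coc.\<theta>_\<Gamma>[OF True])
      have "\<phi> r ?x (coc.att ?x) = coc.att x"
        using coc.att_invariant[OF x', of r] r by (simp add: coc.\<theta>_add_\<Gamma>[OF True] coc.\<theta>_0_\<Gamma>[OF True])
      moreover have "\<phi> r ?x (coc.att ?x) \<in> holder_space \<beta> {-r..0}"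
        by (rule \<phi>_beta[OF space_lhol[OF \<Gamma>_space[OF x']] coc.att(1)[OF x'] order_refl])
      ultimately show ?thesis using True by (simp add: graph_Image)
    qed (simp add: graph_Image)
  qed
qed

end

section \<open>Loss and gain over windows of length \<open>T\<close>\<close>

lemma gsteps_exp_bound:
  assumes \<kappa>: "0 < \<kappa>" "1 / \<kappa> \<le> p" and nn: "0 \<le> T" "0 \<le> L" "0 \<le> b"
  shows "\<exists>K\<ge>0. \<forall>v\<ge>0. 8 * 2 ^ gsteps \<kappa> T (L + v * b) \<le> exp (K * (1 + v powr p))"
proof -
  have p: "0 < p" using \<kappa> by (meson less_le_trans zero_less_divide_1_iff)
  let ?c1 = "(2 * (4 * L + 1)) powr p" and ?c2 = "(8 * b) powr p"
  \<comment> \<open>The number of steps is T times the power 1/\<kappa> of 4 (L + v b) + 1, rounded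
    up. This base is at least 1, so the exponent may be raised to p, and the result is of order 1 +
    v powr p. The 4 in \<open>K\<close> consists of 3 for the factor 8 = 2^3 and 1 for the
    rounding.\<close>
  define K where "K = T * (?c1 + ?c2) + 4"
  have c: "0 \<le> ?c1" "0 \<le> ?c2" by simp_all
  have K: "0 \<le> K" using nn by (simp add: K_def)
  have "8 * 2 ^ gsteps \<kappa> T (L + v * b) \<le> exp (K * (1 + v powr p))" if v: "0 \<le> v" for v
  proof -
    let ?V = "L + v * b" and ?n = "gsteps \<kappa> T (L + v * b)"
    have V: "0 \<le> v * b" "0 \<le> ?V" using nn v by auto
    have "(4 * ?V + 1) powr p \<le> (2 * max (4 * L + 1) (4 * b * v)) powr p"
      using V nn p by (intro powr_mono2) (auto simp: max_def algebra_simps)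
    also have "\<dots> \<le> ?c1 + (8 * b * v) powr p"
      by (auto simp: max_def mult.assoc)
    also have "(8 * b * v) powr p = ?c2 * v powr p" using nn v by (simp add: powr_mult)
    finally have 1: "(4 * ?V + 1) powr p \<le> ?c1 + ?c2 * v powr p" .
    have "T / gstep \<kappa> ?V = T * (4 * ?V + 1) powr (1 / \<kappa>)"
      unfolding gstep_def powr_minus_divide by simp
    also have "\<dots> \<le> T * (4 * ?V + 1) powr p"
      using V nn \<kappa> by (intro mult_left_mono powr_mono) auto
    also have "\<dots> \<le> T * (?c1 + ?c2 * v powr p)" by (intro mult_left_mono 1 nn)
    finally have 2: "T / gstep \<kappa> ?V \<le> T * (?c1 + ?c2 * v powr p)" .
    have "0 \<le> T / gstep \<kappa> ?V" using nn by (simp add: gstep_def)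
    then have "real ?n \<le> T / gstep \<kappa> ?V + 1" unfolding gsteps_def by linarith
    then have "real ?n + 3 \<le> T * (?c1 + ?c2 * v powr p) + 4" using 2 by linarith
    also have "\<dots> \<le> T * (?c1 + ?c2) * (1 + v powr p) + 4 * (1 + v powr p)"
    proof (intro add_mono)
      have "?c1 + ?c2 * v powr p \<le> (?c1 + ?c2) * (1 + v powr p)"
        by (simp add: algebra_simps)
      then show "T * (?c1 + ?c2 * v powr p) \<le> T * (?c1 + ?c2) * (1 + v powr p)"
        using mult_left_mono[OF _ nn(1)] by (simp add: mult.assoc)
    qed simp
    finally have 3: "real ?n + 3 \<le> K * (1 + v powr p)" by (simp add: K_def distrib_right)
    have "(8 :: real) * 2 ^ ?n = 2 ^ (?n + 3)" by (simp add: power_add)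
    also have "\<dots> \<le> exp 1 ^ (?n + 3)" using exp_ge_add_one_self[of 1] by (intro power_mono) auto
    also have "\<dots> = exp (real ?n + 3)" by (simp flip: exp_of_nat_mult)
    also have "\<dots> \<le> exp (K * (1 + v powr p))" using 3 by simp
    finally show ?thesis .
  qed
  then show ?thesis using K by blast
qed

text \<open>The 8 in \<open>noisy\<close> is 2 times 4: the 2 comes from the passage from
  \<open>hb\<close> to the distance, the 4 offsets the gain ln 4 with which every window will be
  credited. By \<open>small\<close> the mean loss of a window is at most half of that gain.\<close>

locale young_windows = young_noise P r \<nu> \<alpha> \<beta> A f g C\<^sub>f C\<^sub>g
  for P :: "(real \<Rightarrow> real^'m) measure" and r \<nu> \<alpha> \<beta> :: real and A :: "real^'d^'d"
    and f :: "(real \<Rightarrow> real^'d) \<Rightarrow> real^'d" and g :: "(real \<Rightarrow> real^'d) \<Rightarrow> real^'m^'d"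
    and C\<^sub>f C\<^sub>g :: real +
  fixes T c\<^sub>0 K p :: real
  assumes T: "1 \<le> T" and c0: "c\<^sub>0 \<le> 1" and K: "0 \<le> K" and p: "0 < p" and C\<^sub>g1: "C\<^sub>g \<le> 1"
    and W_int: "integrable P (\<lambda>x. W T x powr p)"
    and quiet: "\<And>x w \<eta>1 \<eta>2. lhol x \<Longrightarrow> hol \<nu> w 0 T x \<Longrightarrow> 0 \<le> w \<Longrightarrow> C\<^sub>g * w \<le> c\<^sub>0 \<Longrightarrow> \<eta>1 \<in> S \<Longrightarrow> \<eta>2 \<in> S \<Longrightarrow>
       dS (\<phi> T x \<eta>1) (\<phi> T x \<eta>2) \<le> 1 / 4 * dS \<eta>1 \<eta>2"
    and noisy: "\<And>v. 0 \<le> v \<Longrightarrow> 8 * gf T v \<le> exp (K * (1 + v powr p))"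
    and small: "(\<integral>x. hfun c\<^sub>0 K p (C\<^sub>g * W T x) \<partial>P) \<le> ln 2"
begin

text \<open>The loss per unit of time, so that the orbit integral over a window of length
  \<open>T\<close> is an average of losses.\<close>

definition rate where "rate x = hfun c\<^sub>0 K p (C\<^sub>g * W T x) / T"

lemma rate_admissible: "admissible rate"
  unfolding rate_def[abs_def] by (rule hfun_admissible[OF K p C\<^sub>g_nonneg C\<^sub>g1 _ W_int]) (use T in simp)

lemma rate_expectation: "(\<integral>x. rate x \<partial>P) * T \<le> ln 2"
  unfolding rate_def[abs_def] using small T by simp

lemmas I_rate = I_nn[OF rate_admissible] I_mono[OF rate_admissible] I_add[OF rate_admissible]

text \<open>At every time u of the window, \<open>W T\<close> measures the noise over an interval
  that contains the window. Hence the loss of the window is at most the average of the losses at its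
  times u, and consecutive windows add up to one orbit integral, without any ergodicity of the shift
  by T.\<close>

lemma window_noise:
  assumes x: "x \<in> space P"
  shows "\<exists>w\<ge>0. hol \<nu> w 0 T (wiener_shift s x) \<and> hfun c\<^sub>0 K p (C\<^sub>g * w) \<le> I rate s (s + T) x"
proof -
  define w where "w = enn2real (holder_seminorm \<nu> {0..T} (wiener_shift s x))"
  have w0: "0 \<le> w" by (simp add: w_def)
  have "holder_seminorm \<nu> {0..T} (wiener_shift s x) = ennreal w"
    using seminorm_finite[OF \<theta>_space[OF x], of 0 T s] by (simp add: w_def)
  then have "holder_seminorm \<nu> {0..T} (wiener_shift s x) \<le> ennreal w" by simp
  then have hw: "hol \<nu> w 0 T (wiener_shift s x)" by (subst (asm) holder_seminorm_le_iff[OF w0])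
  have wW: "w \<le> W T (wiener_shift u x)" if u: "s \<le> u" "u \<le> s + T" for u
  proof -
    have "hol \<nu> (W T (wiener_shift u x)) (s + 0) (s + T) x"
      by (rule hol_subset[OF hol_W[OF x]]) (use u in auto)
    then show ?thesis
      unfolding w_def by (intro enn2real_leI W_nonneg) (simp add: seminorm_shift holder_seminorm_le_iff[OF W_nonneg])
  qed
  let ?h = "hfun c\<^sub>0 K p (C\<^sub>g * w)"
  have "?h = (\<integral>u. indicator {s..s + T} u * (?h / T) \<partial>lborel)" using T by simp
  also have "\<dots> \<le> I rate s (s + T) x"
    unfolding I_def
  proof (rule integral_mono[OF _ I_integrable[OF rate_admissible x]])
    show "integrable lborel (\<lambda>u. indicator {s..s + T} u * (?h / T))"
      by (rule integrable_mult_left, rule integrable_real_indicator) (auto simp: emeasure_lborel_Icc_eq)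
    fix u :: real
    have "?h \<le> hfun c\<^sub>0 K p (C\<^sub>g * W T (wiener_shift u x))" if "s \<le> u" "u \<le> s + T"
      using wW[OF that] w0 C\<^sub>g_nonneg by (intro hfun_mono K p mult_left_mono) auto
    then show "indicator {s..s + T} u * (?h / T) \<le> indicator {s..s + T} u * rate (wiener_shift u x)"
      using T by (auto simp: indicator_def rate_def divide_right_mono)
  qed
  finally show ?thesis using w0 hw by blast
qed

lemma noisy_bound:
  assumes "0 \<le> w" "c\<^sub>0 < C\<^sub>g * w"
  shows "8 * gf T (C\<^sub>g * w) \<le> exp (hfun c\<^sub>0 K p (C\<^sub>g * w))"
  using noisy[of "C\<^sub>g * w"] assms C\<^sub>g_nonneg by (simp add: hfun_def)

text \<open>The logarithm of the Lipschitz bound over a quiet window that is cut short, where no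
  contraction is available.\<close>

definition K0 where "K0 = ln (2 * gf T 1)"

lemma exp_K0: "exp K0 = 2 * gf T 1" and K0_nonneg: "0 \<le> K0"
proof -
  have "1 \<le> gf T 1" by (simp add: gf_def)
  then show "exp K0 = 2 * gf T 1" "0 \<le> K0" by (simp_all add: K0_def)
qed

lemma gf_window:
  assumes x: "x \<in> space P" and w: "0 \<le> w" "hfun c\<^sub>0 K p (C\<^sub>g * w) \<le> I rate s (s + T) x"
  shows "2 * gf T (C\<^sub>g * w) \<le> exp (K0 + I rate s (s + T) x)"
proof (cases "C\<^sub>g * w \<le> c\<^sub>0")
  case True
  have "2 * gf T (C\<^sub>g * w) \<le> 2 * gf T 1"
    using True w c0 T C\<^sub>g_nonneg by (intro mult_left_mono gf_mono) auto
  also have "\<dots> \<le> exp (K0 + I rate s (s + T) x)" unfolding exp_K0[symmetric] using I_rate(1)[OF x] by simp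
  finally show ?thesis .
next
  case False
  then have "8 * gf T (C\<^sub>g * w) \<le> exp (hfun c\<^sub>0 K p (C\<^sub>g * w))" using noisy_bound w by simp
  also have "\<dots> \<le> exp (K0 + I rate s (s + T) x)" using w K0_nonneg by simp
  finally show ?thesis using gf_nonneg[of T "C\<^sub>g * w"] by linarith
qed

text \<open>On a quiet window the factor 1/4 only becomes larger when the loss is added; on a noisy
  one the loss is large enough to pay for the credit ln 4 as well. So quiet and noisy windows obey
  the same inequality.\<close>

lemma window_contracts:
  assumes x: "x \<in> space P" and \<eta>: "\<eta>1 \<in> S" "\<eta>2 \<in> S"
  shows "dS (\<phi> T (wiener_shift s x) \<eta>1) (\<phi> T (wiener_shift s x) \<eta>2) \<le> exp (I rate s (s + T) x - ln 4) * dS \<eta>1 \<eta>2"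
proof -
  obtain w where w: "0 \<le> w" "hol \<nu> w 0 T (wiener_shift s x)" "hfun c\<^sub>0 K p (C\<^sub>g * w) \<le> I rate s (s + T) x"
    using window_noise[OF x] by blast
  note x' = space_lhol[OF \<theta>_space[OF x, of s]]
  have d: "0 \<le> dS \<eta>1 \<eta>2" by (simp add: holder_dist_def)
  have e4: "exp (I rate s (s + T) x - ln 4) = exp (I rate s (s + T) x) / 4" by (simp add: exp_diff)
  show ?thesis
  proof (cases "C\<^sub>g * w \<le> c\<^sub>0")
    case True
    have "dS (\<phi> T (wiener_shift s x) \<eta>1) (\<phi> T (wiener_shift s x) \<eta>2) \<le> 1 / 4 * dS \<eta>1 \<eta>2"
      by (rule quiet[OF x' w(2,1) True \<eta>])
    also have "\<dots> \<le> exp (I rate s (s + T) x - ln 4) * dS \<eta>1 \<eta>2"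
      unfolding e4 using I_rate(1)[OF x] d by (intro mult_right_mono) auto
    finally show ?thesis .
  next
    case False
    have "dS (\<phi> T (wiener_shift s x) \<eta>1) (\<phi> T (wiener_shift s x) \<eta>2) \<le> 2 * (gf T (C\<^sub>g * w) * dS \<eta>1 \<eta>2)"
      by (rule \<phi>_lipschitz[OF x' w(2,1) \<eta>]) (use T in auto)
    also have "\<dots> = 2 * gf T (C\<^sub>g * w) * dS \<eta>1 \<eta>2" by simp
    also have "\<dots> \<le> exp (I rate s (s + T) x - ln 4) * dS \<eta>1 \<eta>2"
    proof (rule mult_right_mono[OF _ d])
      have "8 * gf T (C\<^sub>g * w) \<le> exp (hfun c\<^sub>0 K p (C\<^sub>g * w))" using noisy_bound w False by simp
      also have "\<dots> \<le> exp (I rate s (s + T) x)" using w by simp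
      finally show "2 * gf T (C\<^sub>g * w) \<le> exp (I rate s (s + T) x - ln 4)" unfolding e4 by simp
    qed
    finally show ?thesis .
  qed
qed

lemma window_lipschitz:
  assumes x: "x \<in> space P" and \<eta>: "\<eta>1 \<in> S" "\<eta>2 \<in> S" and t: "0 \<le> t" "t \<le> T"
  shows "dS (\<phi> t (wiener_shift s x) \<eta>1) (\<phi> t (wiener_shift s x) \<eta>2) \<le> exp (K0 + I rate s (s + T) x) * dS \<eta>1 \<eta>2"
proof -
  obtain w where w: "0 \<le> w" "hol \<nu> w 0 T (wiener_shift s x)" "hfun c\<^sub>0 K p (C\<^sub>g * w) \<le> I rate s (s + T) x"
    using window_noise[OF x] by blast
  have "dS (\<phi> t (wiener_shift s x) \<eta>1) (\<phi> t (wiener_shift s x) \<eta>2) \<le> 2 * (gf T (C\<^sub>g * w) * dS \<eta>1 \<eta>2)"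
    by (rule \<phi>_lipschitz[OF space_lhol[OF \<theta>_space[OF x]] w(2,1) \<eta> t])
  also have "\<dots> = 2 * gf T (C\<^sub>g * w) * dS \<eta>1 \<eta>2" by simp
  also have "\<dots> \<le> exp (K0 + I rate s (s + T) x) * dS \<eta>1 \<eta>2"
    by (rule mult_right_mono[OF gf_window[OF x w(1,3)]]) (simp add: holder_dist_def)
  finally show ?thesis .
qed

lemma window_growth:
  assumes x: "x \<in> space P" and t: "0 \<le> t" "t \<le> T"
  shows "dS (\<phi> t (wiener_shift s x) (cst 0)) (cst 0) \<le> exp (K0 + I rate s (s + T) x) * (2 * norm (f (cst 0)))"
proof -
  interpret Metric_space "holder_space \<alpha> {-r..0} :: (real \<Rightarrow> real^'d) set" dS by (rule Metric_space_holder)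
  obtain w where w: "0 \<le> w" "hol \<nu> w 0 T (wiener_shift s x)" "hfun c\<^sub>0 K p (C\<^sub>g * w) \<le> I rate s (s + T) x"
    using window_noise[OF x] by blast
  have "dS (\<phi> t (wiener_shift s x) (cst 0)) (cst 0) \<le> 2 * (gf T (C\<^sub>g * w) * (dS (cst 0) (cst 0) + 2 * norm (f (cst 0))))"
    by (rule \<phi>_growth[OF space_lhol[OF \<theta>_space[OF x]] w(2,1) cst_S t])
  also have "\<dots> = 2 * gf T (C\<^sub>g * w) * (2 * norm (f (cst 0)))" using S_holder[OF cst_S] by simp
  also have "\<dots> \<le> exp (K0 + I rate s (s + T) x) * (2 * norm (f (cst 0)))"
    by (rule mult_right_mono[OF gf_window[OF x w(1,3)]]) simp
  finally show ?thesis .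
qed

text \<open>Full windows come first; the remainder of length \<open>t\<close> contributes
  \<open>K0\<close> and is charged with the loss of a full window, which extends the orbit integral
  by \<open>T\<close>.\<close>

lemma windows_contract:
  assumes x: "x \<in> space P" and t: "0 \<le> t" "t \<le> T"
  shows "\<eta>1 \<in> S \<Longrightarrow> \<eta>2 \<in> S \<Longrightarrow>
    dS (\<phi> (real n * T + t) (wiener_shift s x) \<eta>1) (\<phi> (real n * T + t) (wiener_shift s x) \<eta>2)
      \<le> exp (K0 + I rate s (s + real n * T + T) x - real n * ln 4) * dS \<eta>1 \<eta>2"
proof (induction n arbitrary: s \<eta>1 \<eta>2)
  case 0
  then show ?case using window_lipschitz[OF x 0 t] by simp
next
  case (Suc n)
  let ?x = "wiener_shift s x" and ?l = "real n * T + t"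
  note x' = space_lhol[OF \<theta>_space[OF x, of s]]
  have T0: "0 \<le> T" using T by simp
  \<comment> \<open>The first window is split off by the cocycle property, so that the induction
    hypothesis applies from the later time T + s on.\<close>
  have split: "\<phi> (real (Suc n) * T + t) ?x \<eta> = \<phi> ?l (wiener_shift (T + s) x) (\<phi> T ?x \<eta>)" if "\<eta> \<in> S" for \<eta>
    using \<phi>_cocycle[OF x' that T0, of ?l] T0 t \<theta>_add[OF x] by (simp add: algebra_simps)
  have "dS (\<phi> (real (Suc n) * T + t) ?x \<eta>1) (\<phi> (real (Suc n) * T + t) ?x \<eta>2)
    \<le> exp (K0 + I rate (T + s) (T + s + real n * T + T) x - real n * ln 4) * dS (\<phi> T ?x \<eta>1) (\<phi> T ?x \<eta>2)"
    unfolding split[OF Suc.prems(1)] split[OF Suc.prems(2)]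
    by (rule Suc.IH[OF \<phi>_S[OF x' Suc.prems(1) T0] \<phi>_S[OF x' Suc.prems(2) T0]])
  also have "\<dots> \<le> exp (K0 + I rate (T + s) (T + s + real n * T + T) x - real n * ln 4) * (exp (I rate s (s + T) x - ln 4) * dS \<eta>1 \<eta>2)"
    by (rule mult_left_mono[OF window_contracts[OF x Suc.prems]]) simp
  also have "\<dots> = exp (K0 + (I rate s (s + T) x + I rate (T + s) (T + s + real n * T + T) x) - real (Suc n) * ln 4) * dS \<eta>1 \<eta>2"
    by (simp add: algebra_simps flip: exp_add)
  also have "I rate s (s + T) x + I rate (T + s) (T + s + real n * T + T) x = I rate s (s + real (Suc n) * T + T) x"
    using I_rate(3)[OF x, of s "s + T" "s + real (Suc n) * T + T"] T0 by (simp add: algebra_simps)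
  finally show ?case .
qed

definition \<Gamma> where "\<Gamma> = {x \<in> space P. regular rate x}"

lemma flow_contraction:
  assumes x: "x \<in> \<Gamma>" and e: "0 < e"
  shows "\<exists>C\<ge>0. \<forall>s t \<eta> \<eta>'. s \<le> t \<longrightarrow> \<eta> \<in> S \<longrightarrow> \<eta>' \<in> S \<longrightarrow>
       dS (\<phi> (t - s) (wiener_shift s x) \<eta>) (\<phi> (t - s) (wiener_shift s x) \<eta>')
         \<le> C * exp (- (ln 2 / T) * (t - s) + e * (\<bar>s\<bar> + \<bar>t\<bar>)) * dS \<eta> \<eta>'"
proof -
  have xs: "x \<in> space P" and reg: "regular rate x" using x by (auto simp: \<Gamma>_def)
  obtain C where C: "0 \<le> C" "\<And>s t. s \<le> t \<Longrightarrow> I rate s t x \<le> (\<integral>x. rate x \<partial>P) * (t - s) + e * (\<bar>s\<bar> + \<bar>t\<bar>) + C"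
    using regularD[OF reg e] by blast
  let ?C = "exp (K0 + 2 * ln 2 + e * T + C)"
  have "dS (\<phi> (t - s) (wiener_shift s x) \<eta>) (\<phi> (t - s) (wiener_shift s x) \<eta>')
         \<le> ?C * exp (- (ln 2 / T) * (t - s) + e * (\<bar>s\<bar> + \<bar>t\<bar>)) * dS \<eta> \<eta>'"
    if st: "s \<le> t" and \<eta>: "\<eta> \<in> S" "\<eta>' \<in> S" for s t \<eta> \<eta>'
  proof -
    define n where "n = nat \<lfloor>(t - s) / T\<rfloor>"
    have T0: "0 < T" using T by simp
    have "0 \<le> (t - s) / T" using st T0 by simp
    then have "real n \<le> (t - s) / T" "(t - s) / T < real n + 1" unfolding n_def by linarith+
    then have n: "real n * T \<le> t - s" "t - s < (real n + 1) * T"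
      using T0 by (simp_all add: pos_le_divide_eq pos_divide_less_eq)
    let ?q = "t - s - real n * T"
    have q: "0 \<le> ?q" "?q \<le> T" using n by (auto simp: algebra_simps)
    have "dS (\<phi> (t - s) (wiener_shift s x) \<eta>) (\<phi> (t - s) (wiener_shift s x) \<eta>')
      \<le> exp (K0 + I rate s (s + real n * T + T) x - real n * ln 4) * dS \<eta> \<eta>'"
      using windows_contract[OF xs q \<eta>, of n s] by simp
    also have "\<dots> \<le> exp (K0 + 2 * ln 2 + e * T + C + (- (ln 2 / T) * (t - s) + e * (\<bar>s\<bar> + \<bar>t\<bar>))) * dS \<eta> \<eta>'"
    proof (rule mult_right_mono)
      have "I rate s (s + real n * T + T) x
        \<le> (\<integral>x. rate x \<partial>P) * (s + real n * T + T - s) + e * (\<bar>s\<bar> + \<bar>s + real n * T + T\<bar>) + C"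
        using T0 by (intro C(2)) simp
      \<comment> \<open>Up to the error terms, n + 1 windows lose at most ln 2 each, against a gain
        of 2 ln 2 for each of the n full ones; the net rate is ln 2 per time T.\<close>
      also have "(\<integral>x. rate x \<partial>P) * (s + real n * T + T - s) = (real n + 1) * ((\<integral>x. rate x \<partial>P) * T)" by (simp add: algebra_simps)
      also have "\<dots> \<le> (real n + 1) * ln 2" by (intro mult_left_mono rate_expectation) simp
      also have "e * (\<bar>s\<bar> + \<bar>s + real n * T + T\<bar>) \<le> e * (\<bar>s\<bar> + (\<bar>t\<bar> + T))"
        using e q T0 by (intro mult_left_mono) auto
      finally have I: "I rate s (s + real n * T + T) x \<le> (real n + 1) * ln 2 + e * (\<bar>s\<bar> + (\<bar>t\<bar> + T)) + C" by simp
      have l4: "ln (4 :: real) = 2 * ln 2" using ln_realpow[of 2 2] by simp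
      have "(t - s) / T \<le> real n + 1" using n T0 by (simp add: pos_divide_le_eq)
      then have "ln 2 * ((t - s) / T) \<le> ln 2 * (real n + 1)" by (intro mult_left_mono) auto
      then show "exp (K0 + I rate s (s + real n * T + T) x - real n * ln 4)
        \<le> exp (K0 + 2 * ln 2 + e * T + C + (- (ln 2 / T) * (t - s) + e * (\<bar>s\<bar> + \<bar>t\<bar>)))"
        using I by (simp add: l4 algebra_simps)
    qed (simp add: holder_dist_def)
    also have "\<dots> = ?C * exp (- (ln 2 / T) * (t - s) + e * (\<bar>s\<bar> + \<bar>t\<bar>)) * dS \<eta> \<eta>'"
      by (simp only: exp_add)
    finally show ?thesis .
  qed
  moreover have "0 \<le> ?C" by simp
  ultimately show ?thesis by blast
qed

lemma flow_growth:
  assumes x: "x \<in> \<Gamma>" and e: "0 < e"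
  shows "\<exists>C\<ge>0. \<forall>s t. s \<le> t \<longrightarrow> t \<le> s + 1 \<longrightarrow>
       dS (\<phi> (t - s) (wiener_shift s x) (cst 0)) (cst 0) \<le> C * exp (e * \<bar>s\<bar>)"
proof -
  have xs: "x \<in> space P" and reg: "regular rate x" using x by (auto simp: \<Gamma>_def)
  \<comment> \<open>Half of e, because both end points of the window lie close to s and each
    contributes once.\<close>
  have "0 < e / 2" using e by simp
  then obtain C where C: "0 \<le> C" "\<And>s t. s \<le> t \<Longrightarrow> I rate s t x \<le> (\<integral>x. rate x \<partial>P) * (t - s) + e / 2 * (\<bar>s\<bar> + \<bar>t\<bar>) + C"
    using regularD[OF reg] by blast
  let ?C = "exp (K0 + ln 2 + e / 2 * T + C) * (2 * norm (f (cst 0)))"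
  have "dS (\<phi> (t - s) (wiener_shift s x) (cst 0)) (cst 0) \<le> ?C * exp (e * \<bar>s\<bar>)"
    if st: "s \<le> t" "t \<le> s + 1" for s t
  proof -
    have "dS (\<phi> (t - s) (wiener_shift s x) (cst 0)) (cst 0) \<le> exp (K0 + I rate s (s + T) x) * (2 * norm (f (cst 0)))"
      by (rule window_growth[OF xs]) (use st T in auto)
    also have "\<dots> \<le> exp (K0 + ln 2 + e / 2 * T + C + e * \<bar>s\<bar>) * (2 * norm (f (cst 0)))"
    proof (rule mult_right_mono)
      have "I rate s (s + T) x \<le> (\<integral>x. rate x \<partial>P) * (s + T - s) + e / 2 * (\<bar>s\<bar> + \<bar>s + T\<bar>) + C"
        using T by (intro C(2)) simp
      also have "(\<integral>x. rate x \<partial>P) * (s + T - s) \<le> ln 2" using rate_expectation by simp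
      also have "e / 2 * (\<bar>s\<bar> + \<bar>s + T\<bar>) \<le> e / 2 * (\<bar>s\<bar> + (\<bar>s\<bar> + T))"
        using e T by (intro mult_left_mono) auto
      finally show "exp (K0 + I rate s (s + T) x) \<le> exp (K0 + ln 2 + e / 2 * T + C + e * \<bar>s\<bar>)"
        by (simp add: algebra_simps)
    qed simp
    also have "\<dots> = ?C * exp (e * \<bar>s\<bar>)" by (simp add: exp_add)
    finally show ?thesis .
  qed
  moreover have "0 \<le> ?C" by simp
  ultimately show ?thesis by blast
qed

text \<open>The state space is by definition a closure inside the complete space of all
  \<alpha>-Hoelder paths.\<close>

lemma state_mcomplete: "Metric_space.mcomplete S dS"
proof -
  interpret Metric_space "holder_space \<alpha> {-r..0} :: (real \<Rightarrow> real^'d) set" dS by (rule Metric_space_holder)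
  interpret Submetric "holder_space \<alpha> {-r..0} :: (real \<Rightarrow> real^'d) set" dS S
    by unfold_locales (use S_holder in blast)
  show ?thesis
    by (rule closedin_mcomplete_imp_mcomplete[OF _ mcomplete_holder])
       (simp add: little_holder_space_def holder_topology_def)
qed

sublocale young_attractor P r \<nu> \<alpha> \<beta> A f g C\<^sub>f C\<^sub>g \<Gamma> "ln 2 / T"
proof (intro young_attractor.intro contracting_cocycle.intro young_attractor_axioms.intro contracting_cocycle_axioms.intro)
  show "Metric_space S dS"
    by (rule Metric_space.subspace[OF Metric_space_holder]) (use S_holder in blast)
  show "Metric_space.mcomplete S dS" by (rule state_mcomplete)
  show "cst 0 \<in> S" by (rule cst_S)
  show "0 < ln 2 / T" using T by simp
  show "\<And>x t. x \<in> \<Gamma> \<Longrightarrow> wiener_shift t x \<in> \<Gamma>"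
    using regular_shift[OF rate_admissible] \<theta>_space by (auto simp: \<Gamma>_def)
  show "\<And>x s t. x \<in> \<Gamma> \<Longrightarrow> wiener_shift s (wiener_shift t x) = wiener_shift (s + t) x"
    using \<theta>_add by (auto simp: \<Gamma>_def)
  show "\<And>x. x \<in> \<Gamma> \<Longrightarrow> wiener_shift 0 x = x" using \<theta>_0 by (auto simp: \<Gamma>_def)
  show "\<And>x \<eta> t. x \<in> \<Gamma> \<Longrightarrow> \<eta> \<in> S \<Longrightarrow> 0 \<le> t \<Longrightarrow> \<phi> t x \<eta> \<in> S"
    using \<phi>_S space_lhol by (auto simp: \<Gamma>_def)
  show "\<And>x \<eta>. x \<in> \<Gamma> \<Longrightarrow> \<eta> \<in> S \<Longrightarrow> \<phi> 0 x \<eta> = \<eta>" using \<phi>_0 space_lhol by (auto simp: \<Gamma>_def)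
  show "\<And>x \<eta> s t. x \<in> \<Gamma> \<Longrightarrow> \<eta> \<in> S \<Longrightarrow> 0 \<le> s \<Longrightarrow> 0 \<le> t \<Longrightarrow> \<phi> (s + t) x \<eta> = \<phi> t (wiener_shift s x) (\<phi> s x \<eta>)"
    using \<phi>_cocycle space_lhol by (auto simp: \<Gamma>_def)
  show "\<Gamma> \<in> sets P" unfolding \<Gamma>_def by (rule regular_meas[OF rate_admissible])
  show "AE x in P. x \<in> \<Gamma>"
    using regular_AE[OF rate_admissible] by (auto simp: \<Gamma>_def elim: AE_mp)
qed (fact young_noise_axioms flow_contraction flow_growth)+

end

theorem theorem4p8:
  fixes r \<nu> \<beta>\<^sub>0 \<beta> C\<^sub>A lam C\<^sub>f :: real
    and P :: "(real \<Rightarrow> real^'m) measure"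
    and A :: "real^'d^'d"
    and f :: "(real \<Rightarrow> real^'d) \<Rightarrow> real^'d"
  assumes "0 < r" and "1/2 < \<nu>" and "\<nu> \<le> 1"
    and "1 - \<nu> < \<beta>\<^sub>0" and "\<beta>\<^sub>0 < \<nu>" and "\<beta>\<^sub>0 < \<beta>" and "\<beta> < \<nu>"
    and "prob_space P"
    and "sets P = sets (borel_of_topology (noise_topology \<nu>))"
    and "invariant_measure P wiener_shift"
    and "ergodic_flow P wiener_shift"
    and "(\<integral>\<^sup>+ x. ennreal (enn2real (holder_seminorm \<nu> {-r..r} x) powr (1 / (\<nu> - \<beta>))) \<partial>P) < \<infinity>"
    and "\<And>c. mat_eigenvalue A c \<Longrightarrow> Re c < 0"
    and "0 < C\<^sub>A" and "0 < lam"
    and "\<And>a b. 0 < a \<Longrightarrow> a < b \<Longrightarrow>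
           sup_norm {a..b} (\<lambda>t. mat_op (mat_exp (t *\<^sub>R A))) \<le> ennreal (C\<^sub>A * exp (- lam * a))"
    and "\<And>a b \<alpha>. 0 < a \<Longrightarrow> a < b \<Longrightarrow> 0 < \<alpha> \<Longrightarrow> \<alpha> \<le> 1 \<Longrightarrow>
           holder_seminorm \<alpha> {a..b} (\<lambda>t. mat_op (mat_exp (t *\<^sub>R A)))
             \<le> ennreal (norm (mat_op A) * C\<^sub>A * exp (- lam * a) * (b - a) powr (1 - \<alpha>))"
    and "\<And>\<xi> \<zeta>. \<xi> \<in> cont_paths {-r..0} \<Longrightarrow> \<zeta> \<in> cont_paths {-r..0} \<Longrightarrow>
           norm (f \<xi> - f \<zeta>) \<le> C\<^sub>f * enn2real (sup_norm {-r..0} (\<lambda>s. \<xi> s - \<zeta> s))"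
    and "C\<^sub>A * C\<^sub>f < lam * exp (- lam * r)"
  shows "\<exists>\<epsilon>>0. \<forall>(g :: (real \<Rightarrow> real^'d) \<Rightarrow> real^'m^'d) C\<^sub>g.
           linear_with_bound r g C\<^sub>g \<and> C\<^sub>g < \<epsilon> \<longrightarrow>
           (\<exists>\<A> \<in> tempered_universe P wiener_shift r \<beta>\<^sub>0.
              random_pullback_attractor P wiener_shift (state_topology r \<beta>\<^sub>0)
                (holder_dist \<beta>\<^sub>0 {-r..0}) (delay_rds r \<beta>\<^sub>0 \<beta> A f g)
                (tempered_universe P wiener_shift r \<beta>\<^sub>0) \<A> \<and>
              (\<forall>x\<in>space P. \<A> `` {x} \<subseteq> holder_space \<beta> {-r..0}) \<and>
              (AE x in P. \<exists>\<eta>. \<A> `` {x} = {\<eta>}) \<and>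
              random_forward_attractor P wiener_shift (state_topology r \<beta>\<^sub>0)
                (holder_dist \<beta>\<^sub>0 {-r..0}) (delay_rds r \<beta>\<^sub>0 \<beta> A f g)
                (tempered_universe P wiener_shift r \<beta>\<^sub>0) \<A>)"
proof -
  let ?p = "1 / (\<nu> - \<beta>)"
  have \<nu>: "0 < \<nu>" using assms(2) by simp
  have p: "0 < ?p" using assms(7) by simp
  interpret noise_space P \<nu>
    by (intro noise_space.intro noise_space_axioms.intro assms(8-11,3) \<nu>)
  have op0: "mat_op 0 = (0 :: (real^'m) \<Rightarrow>\<^sub>L (real^'d))"
    by (rule blinfun_eqI) simp
  \<comment> \<open>The zero coefficient satisfies the assumptions of the locale; this yields
    \<open>0 \<le> C\<^sub>f\<close> before any g is given.\<close>
  have "linear_with_bound r (\<lambda>_. 0 :: real^'m^'d) 0"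
    by (simp add: linear_with_bound_def op0)
  then have "young_delay r \<nu> \<beta>\<^sub>0 \<beta> f (\<lambda>_. 0 :: real^'m^'d) C\<^sub>f 0"
    by (intro young_delay.intro assms)
  then have Cf: "0 \<le> C\<^sub>f" by (rule young_delay.C\<^sub>f_nonneg)
  have expA: "norm (mat_op (mat_exp (t *\<^sub>R A))) \<le> C\<^sub>A * exp (- lam * t)" if "0 < t" for t
  proof -
    have "sup_norm {t..t + 1} (\<lambda>t. mat_op (mat_exp (t *\<^sub>R A))) \<le> ennreal (C\<^sub>A * exp (- lam * t))"
      by (rule assms(16)) (use that in auto)
    then show ?thesis using assms(14) by (subst (asm) sup_norm_le_iff) auto
  qed
  \<comment> \<open>Both constants are fixed before g and are valid for all g at once.\<close>
  obtain T c\<^sub>0 where T: "2 * r \<le> T" "1 \<le> T" and c0: "0 < c\<^sub>0" "c\<^sub>0 \<le> 1" and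
    quiet: "\<And>(g :: (real \<Rightarrow> real^'d) \<Rightarrow> real^'m^'d) C\<^sub>g x w \<eta>1 \<eta>2.
       young_delay r \<nu> \<beta>\<^sub>0 \<beta> f g C\<^sub>f C\<^sub>g \<Longrightarrow> young_delay.lhol \<nu> x \<Longrightarrow> hol \<nu> w 0 T x \<Longrightarrow> 0 \<le> w \<Longrightarrow> C\<^sub>g * w \<le> c\<^sub>0 \<Longrightarrow>
       \<eta>1 \<in> little_holder_space \<beta>\<^sub>0 {-r..0} \<Longrightarrow> \<eta>2 \<in> little_holder_space \<beta>\<^sub>0 {-r..0} \<Longrightarrow>
       holder_dist \<beta>\<^sub>0 {-r..0} (delay_rds r \<beta>\<^sub>0 \<beta> A f g T x \<eta>1) (delay_rds r \<beta>\<^sub>0 \<beta> A f g T x \<eta>2)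
         \<le> 1 / 4 * holder_dist \<beta>\<^sub>0 {-r..0} \<eta>1 \<eta>2"
    using contraction_window_exists[OF assms(1,3,4,6,7,14,15) Cf expA assms(19)] by blast
  have "integrable P (\<lambda>x. W r x powr ?p)"
  proof (rule integrableI_bounded)
    have "W r \<in> borel_measurable P" by (rule W_meas)
    then show "(\<lambda>x. W r x powr ?p) \<in> borel_measurable P" by measurable
    show "(\<integral>\<^sup>+ x. ennreal (norm (W r x powr ?p)) \<partial>P) < \<infinity>" using assms(12) by (simp add: W_def)
  qed
  then have W_int: "integrable P (\<lambda>x. W T x powr ?p)" by (rule W_powr_integrable[OF assms(1) p])
  \<comment> \<open>As \<open>\<beta>\<^sub>0 < \<beta>\<close>, the power of the noise that counts
    the steps does not exceed the one with a finite mean.\<close>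
  have "1 / (\<nu> - \<beta>\<^sub>0) \<le> ?p" using assms(6,7) by (intro divide_left_mono mult_pos_pos) auto
  moreover have "0 \<le> 1 + young_const (\<beta>\<^sub>0 + \<nu>)" using young_const_nonneg[of "\<beta>\<^sub>0 + \<nu>"] assms(4) by simp
  ultimately obtain K where K: "0 \<le> K" "\<And>v. 0 \<le> v \<Longrightarrow>
      8 * 2 ^ gsteps (\<nu> - \<beta>\<^sub>0) T (norm (mat_op A) + C\<^sub>f + v * (1 + young_const (\<beta>\<^sub>0 + \<nu>))) \<le> exp (K * (1 + v powr ?p))"
    using gsteps_exp_bound[of "\<nu> - \<beta>\<^sub>0" ?p T "norm (mat_op A) + C\<^sub>f" "1 + young_const (\<beta>\<^sub>0 + \<nu>)"] assms(5) T(2) Cf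
    by auto
  \<comment> \<open>\<epsilon> brings the mean loss of a window below ln 2; it is determined by
    \<open>T\<close>, \<open>c\<^sub>0\<close>, \<open>K\<close> and the law of the noise.\<close>
  obtain \<epsilon> where \<epsilon>: "0 < \<epsilon>" "\<epsilon> \<le> 1"
    "\<And>c. 0 \<le> c \<Longrightarrow> c \<le> \<epsilon> \<Longrightarrow> (\<integral>x. hfun c\<^sub>0 K ?p (c * W T x) \<partial>P) < ln 2"
    using hfun_small[OF K(1) p c0(1) _ W_int, of "ln 2"] by auto
  show ?thesis
  proof (intro exI[of _ \<epsilon>] conjI allI impI \<epsilon>(1))
    fix g :: "(real \<Rightarrow> real^'d) \<Rightarrow> real^'m^'d" and C\<^sub>g
    assume g: "linear_with_bound r g C\<^sub>g \<and> C\<^sub>g < \<epsilon>"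
    then have "linear_with_bound r g C\<^sub>g" by simp
    then have yd: "young_delay r \<nu> \<beta>\<^sub>0 \<beta> f g C\<^sub>f C\<^sub>g"
      by (intro young_delay.intro assms)
    interpret young_delay r \<nu> \<beta>\<^sub>0 \<beta> A f g C\<^sub>f C\<^sub>g by (rule yd)
    interpret young_windows P r \<nu> \<beta>\<^sub>0 \<beta> A f g C\<^sub>f C\<^sub>g T c\<^sub>0 K ?p
    proof (intro young_windows.intro young_noise.intro young_windows_axioms.intro)
      show "noise_space P \<nu>" by (rule noise_space_axioms)
      show "(\<integral>x. hfun c\<^sub>0 K ?p (C\<^sub>g * W T x) \<partial>P) \<le> ln 2"
        using \<epsilon>(3)[OF C\<^sub>g_nonneg] g by simp
      show "C\<^sub>g \<le> 1" using g \<epsilon>(2) by simp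
      show "8 * gf T v \<le> exp (K * (1 + v powr ?p))" if "0 \<le> v" for v
        unfolding gf_def by (rule K(2)[OF that])
    qed (fact yd T(2) c0(2) K(1) p W_int quiet[OF yd])+
    show "\<exists>\<A> \<in> tempered_universe P wiener_shift r \<beta>\<^sub>0.
              random_pullback_attractor P wiener_shift (state_topology r \<beta>\<^sub>0)
                (holder_dist \<beta>\<^sub>0 {-r..0}) (delay_rds r \<beta>\<^sub>0 \<beta> A f g)
                (tempered_universe P wiener_shift r \<beta>\<^sub>0) \<A> \<and>
              (\<forall>x\<in>space P. \<A> `` {x} \<subseteq> holder_space \<beta> {-r..0}) \<and>
              (AE x in P. \<exists>\<eta>. \<A> `` {x} = {\<eta>}) \<and>
              random_forward_attractor P wiener_shift (state_topology r \<beta>\<^sub>0)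
                (holder_dist \<beta>\<^sub>0 {-r..0}) (delay_rds r \<beta>\<^sub>0 \<beta> A f g)
                (tempered_universe P wiener_shift r \<beta>\<^sub>0) \<A>"
      by (rule graph_attractor)
  qed
qed

end
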